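(* Let $A$ be a unital $\mathrm{C}^*$-algebra. Let $H$ be a subgroup of $\mathrm{G}_A$ normalized by $(\mathrm{G}_A,\mathrm{G}_A)$. Suppose that $[H,A]$ generates $A$ as a closed two-sided ideal. Then $(\mathrm{G}_A,\mathrm{G}_A)\subseteq H$. Moreover, in this case there exists an additive subgroup $L$ of $A$ with $[A,A]\subseteq L\subseteq A$ such that $$H=\Big\{e^{b_1}\cdots e^{b_n}\;\Big|\; n\in\mathbb{N},\ b_1,\dots,b_n\in A,\ \sum_{i=1}^n b_i\in L\Big\}.$$
   Context: $\mathrm{G}_A$ denotes the connected component of the identity (in the norm topology) of the group of invertible elements of the unital $\mathrm{C}^*$-algebra $A$. Write $[x,y]=xy-yx$ and $(x,y)=xyx^{-1}y^{-1}$ (for invertible $x,y$). For sets, $[X,Y]$ is the linear span of $\{[x,y]: x\in X,y\in Y\}$ (no closure taken) and $(X,Y)$ is the subgroup generated by $\{(x,y): x\in X,y\in Y\}$ (no closure taken). The subgroup $H$ is not assumed to be closed. "$H$ is normalized by $K$" means $kHk^{-1}=H$ for all $k\in K$. *)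

theory Defs
  imports "HOL-Analysis.Analysis" "HOL-Algebra.Generated_Groups"
begin

text \<open>
  Unital complex C*-algebras. The superclasses provide a complete, real normed algebra with
  \<open>1 \<noteq> 0\<close> and \<open>norm 1 = 1\<close>; the second is automatic in a nonzero unital C*-algebra.
\<close>

class unital_cstar_algebra = real_normed_algebra_1 + banach +
  fixes scaleC :: "complex \<Rightarrow> 'a \<Rightarrow> 'a"
    and star :: "'a \<Rightarrow> 'a"
  assumes scaleC_add_right: "scaleC c (x + y) = scaleC c x + scaleC c y"
    and scaleC_add_left: "scaleC (c + d) x = scaleC c x + scaleC d x"
    and scaleC_scaleC: "scaleC c (scaleC d x) = scaleC (c * d) x"
    and scaleC_of_real: "scaleC (complex_of_real r) x = scaleR r x"
    and mult_scaleC_left: "scaleC c x * y = scaleC c (x * y)"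
    and mult_scaleC_right: "x * scaleC c y = scaleC c (x * y)"
    and norm_scaleC: "norm (scaleC c x) = cmod c * norm x"
    and star_star: "star (star x) = x"
    and star_add: "star (x + y) = star x + star y"
    and star_scaleC: "star (scaleC c x) = scaleC (cnj c) (star x)"
    and star_mult: "star (x * y) = star y * star x"
    and cstar_identity: "norm (star x * x) = (norm x)\<^sup>2"

instantiation complex :: unital_cstar_algebra
begin

definition scaleC_complex :: "complex \<Rightarrow> complex \<Rightarrow> complex"
  where "scaleC_complex = (*)"

definition star_complex :: "complex \<Rightarrow> complex"
  where "star_complex = cnj"

instance
  by standard
    (simp_all add: scaleC_complex_def star_complex_def algebra_simps norm_mult
      power2_eq_square scaleR_conv_of_real)

end

global_interpretation cvs:
  vector_space "scaleC :: complex \<Rightarrow> 'a::unital_cstar_algebra \<Rightarrow> 'a"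
  defines cspan = cvs.span
    and csubspace = cvs.subspace
proof
  fix x :: 'a
  show "scaleC 1 x = x"
    using scaleC_of_real[of 1 x] by simp
qed (simp_all add: scaleC_add_right scaleC_add_left scaleC_scaleC)

definition closed_two_sided_ideal :: "'a::unital_cstar_algebra set \<Rightarrow> bool"
  where "closed_two_sided_ideal I \<longleftrightarrow>
    closed I \<and> csubspace I \<and> (\<forall>x\<in>I. \<forall>a. a * x \<in> I \<and> x * a \<in> I)"

definition commutator_span ::
    "'a::unital_cstar_algebra set \<Rightarrow> 'a set \<Rightarrow> 'a set"
  where "commutator_span X Y = cspan {x * y - y * x | x y. x \<in> X \<and> y \<in> Y}"

definition unit_group :: "'a::unital_cstar_algebra monoid"
  where "unit_group = units_of \<lparr>carrier = UNIV, mult = (*), one = 1\<rparr>"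

text \<open>\<open>G\<^sub>A\<close>; the commutator subgroup \<open>(G\<^sub>A, G\<^sub>A)\<close> is then \<open>derived unit_group identity_component\<close>.\<close>

definition identity_component :: "'a::unital_cstar_algebra set"
  where "identity_component = connected_component_set (carrier unit_group) 1"

definition normalized_by :: "'a::unital_cstar_algebra set \<Rightarrow> 'a set \<Rightarrow> bool"
  where "normalized_by H K \<longleftrightarrow>
    (\<forall>k\<in>K. (\<lambda>h. k * h * inv\<^bsub>unit_group\<^esub> k) ` H = H)"

definition add_subgroup :: "'a::ab_group_add set \<Rightarrow> bool"
  where "add_subgroup L \<longleftrightarrow>
    0 \<in> L \<and> (\<forall>x\<in>L. \<forall>y\<in>L. x + y \<in> L) \<and> (\<forall>x\<in>L. - x \<in> L)"

end

theory Submission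
  imports Defs
begin

text \<open>
The group \<open>(G\<^sub>A, G\<^sub>A)\<close> enters through one family of elements. For \<open>b\<close> of small norm
\<open>D x b = (1 + x * b) * iv (1 + b * x)\<close> is a product of commutators of elements near \<open>1\<close>; hence \<open>H\<close> is
invariant under conjugation by \<open>D s b\<close>, and \<open>H\<close> contains the commutators \<open>(D s b, h)\<close> with \<open>h \<in> H\<close>.
The problem is to pass from commutators with elements of \<open>H\<close> to all commutators without ever taking a
closure, because \<open>H\<close> need not be closed.

Up to errors of second order \<open>D x b\<close> is additive in \<open>x\<close> and in \<open>b\<close>, and exactly
\<open>D (x * y) b = D x (y * b) * D y (b * x)\<close>. So \<open>D\<close> behaves like a universal differential form \<open>dx\<close>
evaluated at \<open>b\<close>. Let \<open>X\<close> consist of the \<open>x\<close> such that \<open>D x b\<close> agrees, up to an error of arbitrarily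
small relative size, with a product of elements \<open>(D s\<^sub>i u\<^sub>i, h\<^sub>i)\<close> where the \<open>u\<^sub>i\<close> are of the size of \<open>b\<close>.
The product rule makes \<open>X\<close> an algebra. It is stable under brackets with commutators (\<open>X_bracket\<close>), it
contains the group commutators of \<open>H\<close> (\<open>X_commutator\<close>), and for \<open>t = w * x - x * w\<close> with \<open>w, x \<in> X\<close> it
contains all multiples \<open>a * (t * b * t * g * t * p * t * b' * t) * a'\<close> (\<open>X_word\<close>).

If these words, formed from group commutators \<open>w, x\<close> of \<open>H\<close>, did not generate the algebra as an ideal, they
would lie in a maximal ideal \<open>M\<close>. As \<open>M\<close> is prime, \<open>t \<in> M\<close>, that is, the group commutators of \<open>H\<close> commute
with each other modulo \<open>M\<close>. Arguments on derivations of prime rings, in the manner of Herstein, then show that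
all of \<open>H\<close> is central modulo \<open>M\<close> (\<open>subgroup_central\<close>), so that \<open>[H, A] \<subseteq> M\<close>, a contradiction. Therefore
\<open>1\<close> is a finite sum of such words (\<open>unit_is_sum_of_words\<close>), and every element is reachable.

To remove the errors they have to be measured in a finer way than by the norm. Only finitely many
elements occur in the expression for \<open>1\<close>; they and any finite set of further elements are taken as the letters of
a gauge that measures an element by its expansions into words. For a word \<open>x\<^sub>1 \<cdots> x\<^sub>n\<close> the product rule
expresses \<open>D (x\<^sub>1 \<cdots> x\<^sub>n) b\<close> by the factors \<open>D x\<^sub>i u\<^sub>i\<close> of single letters, and this turns every
product of commutators of small total weight into a product of one factor for each letter, up to an error
of a fraction of the weight (\<open>W_rep\<close>). Replacing the letters by elements \<open>(D s\<^sub>i u\<^sub>i, h\<^sub>i)\<close> and correcting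
the error again and again is a Newton iteration. The arguments \<open>u\<^sub>i\<close> converge while the number of factors stays fixed,
and so the limit is a finite product of elements of \<open>H\<close>
(\<open>convergent_products_in_subgroup\<close>): small products of small commutators, and also convergent infinite ones,
lie in \<open>H\<close>.

For fixed \<open>q\<close> and \<open>k\<close> this gives \<open>(1 + t q, k) \<in> H\<close> for small \<open>t\<close>; connectedness of segments and then of
\<open>G\<^sub>A\<close> extends it to \<open>(g, k) \<in> H\<close> for all \<open>g \<in> G\<^sub>A\<close>. The dyadic Trotter product exhibits
\<open>exp (- b) * exp (- a) * exp (a + b)\<close>, for small \<open>a\<close> and \<open>b\<close>, as a convergent infinite product of small commutators,
and therefore \<open>a \<mapsto> exp a\<close> is additive modulo \<open>H\<close>. So \<open>L = {c. exp c \<in> H}\<close> is a subgroup that decides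
which products of exponentials belong to \<open>H\<close>. It contains every \<open>[a, b]\<close>: after rescaling, \<open>[a, b] = [u, c]\<close> with
\<open>u\<close> near \<open>1\<close>, and \<open>exp (u * c) * exp (- (c * u))\<close> is the commutator \<open>(u, exp (c * u))\<close>.
\<close>

section \<open>Inverses and the elements \<open>D x b\<close>\<close>

definition unit :: "'a::ring_1 \<Rightarrow> bool" where
  "unit x \<longleftrightarrow> (\<exists>y. x * y = 1 \<and> y * x = 1)"

definition iv :: "'a::ring_1 \<Rightarrow> 'a" where
  "iv x = (SOME y. x * y = 1 \<and> y * x = 1)"

lemma iv_right: "unit x \<Longrightarrow> x * iv x = 1"
  unfolding unit_def iv_def by (metis (mono_tags, lifting) someI_ex)
lemma iv_left: "unit x \<Longrightarrow> iv x * x = 1"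
  unfolding unit_def iv_def by (metis (mono_tags, lifting) someI_ex)
lemma iv_right': "unit x \<Longrightarrow> x * (iv x * y) = y"
  by (metis iv_right mult.assoc mult_1)
lemma iv_left': "unit x \<Longrightarrow> iv x * (x * y) = y"
  by (metis iv_left mult.assoc mult_1)
lemmas iv_simps = iv_right iv_left iv_right' iv_left'

lemma unitI: "x * y = 1 \<Longrightarrow> y * x = 1 \<Longrightarrow> unit x"
  unfolding unit_def by blast
lemma iv_unique: "x * y = 1 \<Longrightarrow> y * x = 1 \<Longrightarrow> iv x = y"
  by (metis iv_left unitI mult.assoc mult_1 mult.right_neutral)
lemma unit_iv: "unit x \<Longrightarrow> unit (iv x)" by (meson iv_left iv_right unitI)
lemma iv_iv: "unit x \<Longrightarrow> iv (iv x) = x" by (simp add: iv_left iv_right iv_unique)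
lemma unit_one: "unit 1" by (simp add: unitI)
lemma iv_one: "iv 1 = 1" by (simp add: iv_unique)
lemma unit_mult: "unit x \<Longrightarrow> unit y \<Longrightarrow> unit (x * y)"
  by (rule unitI[of _ "iv y * iv x"]) (simp_all add: mult.assoc iv_simps)
lemma iv_mult: "unit x \<Longrightarrow> unit y \<Longrightarrow> iv (x * y) = iv y * iv x"
  by (rule iv_unique) (simp_all add: mult.assoc iv_simps)

text \<open>The inverse is \<open>1 - b * iv (1 + x * b) * x\<close>, the usual proof that \<open>x * b\<close> and \<open>b * x\<close> have the same
  spectrum away from \<open>0\<close>.\<close>
lemma unit_swap: fixes x b :: "'a::ring_1" assumes "unit (1 + x * b)" shows "unit (1 + b * x)"
proof (rule unitI[of _ "1 - b * iv (1 + x*b) * x"])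
  let ?i = "iv (1 + x*b)"
  have 1: "?i + x * b * ?i = 1" using iv_right[OF assms] by (simp add: algebra_simps)
  have 2: "?i + ?i * x * b = 1" using iv_left[OF assms] by (simp add: algebra_simps)
  have "(1 + b * x) * (1 - b * ?i * x) = 1 + b * x - b * (?i + x * b * ?i) * x"
    by (simp add: algebra_simps)
  then show "(1 + b * x) * (1 - b * ?i * x) = 1" by (simp add: 1)
  have "(1 - b * ?i * x) * (1 + b * x) = 1 + b * x - b * (?i + ?i * x * b) * x"
    by (simp add: algebra_simps)
  then show "(1 - b * ?i * x) * (1 + b * x) = 1" by (simp add: 2)
qed

text \<open>By \<open>D_unit_left\<close> and \<open>K_eq_D\<close> this is a group commutator as soon as \<open>x\<close> is a unit; to first order
  it is \<open>1 + (x * b - b * x)\<close>.\<close>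
definition D :: "'a::ring_1 \<Rightarrow> 'a \<Rightarrow> 'a" where "D x b = (1 + x * b) * iv (1 + b * x)"

text \<open>The group commutator of \<open>1 + p\<close> and \<open>1 + q\<close>, parametrized so that the sizes of \<open>p\<close> and \<open>q\<close> measure
  how close it is to \<open>1\<close>.\<close>
definition K :: "'a::ring_1 \<Rightarrow> 'a \<Rightarrow> 'a" where
  "K p q = (1 + p) * (1 + q) * iv (1 + p) * iv (1 + q)"

lemma unit_D: "unit (1 + x * b) \<Longrightarrow> unit (D x b)"
  by (simp add: D_def unit_mult unit_iv unit_swap)
lemma unit_K: "unit (1 + p) \<Longrightarrow> unit (1 + q) \<Longrightarrow> unit (K p q)"
  by (simp add: K_def unit_mult unit_iv)
lemma iv_K: "unit (1 + p) \<Longrightarrow> unit (1 + q) \<Longrightarrow> iv (K p q) = K q p"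
  by (simp add: K_def iv_mult unit_mult unit_iv iv_iv mult.assoc)
lemma iv_D: "unit (1 + x * b) \<Longrightarrow> iv (D x b) = D b x"
  by (simp add: D_def iv_mult unit_mult unit_iv iv_iv unit_swap)

text \<open>The Leibniz rule for \<open>D\<close>: the factors \<open>1 + y * b * x\<close> cancel.\<close>
lemma D_mult:
  assumes "unit (1 + x * y * b)"
  shows "D (x * y) b = D x (y * b) * D y (b * x)"
proof -
  have "unit (1 + y * b * x)" using assms unit_swap[of x "y*b"] by (simp add: mult.assoc)
  then show ?thesis by (simp add: D_def mult.assoc iv_simps)
qed

lemma D_unit_left:
  assumes u: "unit u" and ub: "unit (1 + u * b)"
  shows "D u b = K (u * b) (iv u - 1)"
proof -
  have "1 + b * u = iv u * (1 + u * b) * u"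
    using u by (simp add: distrib_left distrib_right mult.assoc iv_simps)
  then have "iv (1 + b * u) = iv u * iv (1 + u * b) * u"
    using u ub by (simp add: iv_mult unit_mult unit_iv iv_iv mult.assoc)
  then show ?thesis using u by (simp add: D_def K_def iv_iv mult.assoc)
qed

lemma conj_one_plus: "unit h \<Longrightarrow> 1 + h * x * iv h = h * (1 + x) * iv h"
  by (simp add: distrib_left distrib_right iv_simps)

lemma K_eq_D:
  assumes p: "unit (1 + p)" and q: "unit (1 + q)"
  shows "K p q = D (1 + p) (q * iv (1 + p))"
proof -
  have "1 + (1 + p) * (q * iv (1 + p)) = (1 + p) * (1 + q) * iv (1 + p)"
    using conj_one_plus[OF p, of q] by (simp add: mult.assoc)
  moreover have "1 + (q * iv (1 + p)) * (1 + p) = 1 + q"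
    using p by (simp add: mult.assoc iv_simps)
  ultimately show ?thesis by (simp add: D_def K_def)
qed

text \<open>Replacing \<open>y\<close> by the unit \<open>1 + y\<close> costs one further commutator. Read backwards it writes \<open>D y\<close> as
  a product of two commutators even if \<open>y\<close> is not invertible.\<close>
lemma D_one_plus:
  fixes y b :: "'a::ring_1"
  assumes b: "unit (1 + b)" and yb: "unit (1 + y * (b * iv (1 + b)))"
  shows "D (1 + y) b = D y (b * iv (1 + b)) * K (b * iv (1 + b) * y) b"
proof -
  let ?B = "b * iv (1 + b)"
  have comm: "iv (1 + b) * b = ?B"
  proof -
    have "(1 + b) * b = b * (1 + b)" by (simp add: algebra_simps)
    then have "iv (1 + b) * ((1 + b) * b) * iv (1 + b) = iv (1 + b) * (b * (1 + b)) * iv (1 + b)" by simp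
    then show ?thesis using b by (simp add: mult.assoc iv_simps)
  qed
  have By: "unit (1 + ?B * y)" using yb by (rule unit_swap)
  have e1: "1 + (1 + y) * b = (1 + y * ?B) * (1 + b)"
  proof -
    have "(1 + y * ?B) * (1 + b) = 1 + b + y * (b * (iv (1 + b) * (1 + b)))"
      by (simp only: distrib_right mult_1 mult.assoc)
    then show ?thesis unfolding iv_left[OF b] by (simp add: algebra_simps)
  qed
  have e2: "1 + b * (1 + y) = (1 + b) * (1 + ?B * y)"
  proof -
    have "(1 + b) * (1 + ?B * y) = 1 + b + (1 + b) * (iv (1 + b) * b) * y" by (simp add: comm distrib_left mult.assoc)
    also have "\<dots> = 1 + b + b * y" using b by (simp add: iv_simps mult.assoc)
    finally show ?thesis by (simp add: distrib_left add.assoc)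
  qed
  show ?thesis unfolding D_def e1 e2 K_def
    using b By by (simp add: iv_mult mult.assoc iv_simps)
qed

text \<open>Additivity of \<open>D\<close> in its first argument, with the exact error: the inner argument changes to second order
  and one commutator of second order appears.\<close>
lemma D_add:
  fixes x y b :: "'a::ring_1"
  assumes xb: "unit (1 + x * b)" and yb: "unit (1 + y * (b * iv (1 + x * b)))"
  shows "D (x + y) b = D y (b * iv (1 + x * b)) * K (b * iv (1 + x * b) * y) (x * b) * D x b"
proof -
  let ?B = "b * iv (1 + x * b)"
  have bx: "unit (1 + b * x)" using xb by (rule unit_swap)
  have comm: "iv (1 + b * x) * b = ?B"
  proof -
    have "(1 + b * x) * b = b * (1 + x * b)" by (simp add: algebra_simps)
    then have "iv (1 + b * x) * ((1 + b * x) * b) * iv (1 + x * b) = iv (1 + b * x) * (b * (1 + x * b)) * iv (1 + x * b)" by simp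
    then show ?thesis using xb bx by (simp add: mult.assoc iv_simps)
  qed
  have By: "unit (1 + ?B * y)" using yb by (rule unit_swap)
  have e1: "1 + (x + y) * b = (1 + y * ?B) * (1 + x * b)"
  proof -
    have "(1 + y * ?B) * (1 + x * b) = 1 + x * b + y * (b * (iv (1 + x * b) * (1 + x * b)))"
      by (simp only: distrib_right mult_1 mult.assoc)
    then show ?thesis unfolding iv_left[OF xb] by (simp add: algebra_simps)
  qed
  have e2: "1 + b * (x + y) = (1 + b * x) * (1 + ?B * y)"
  proof -
    have "(1 + b * x) * (1 + ?B * y) = 1 + b * x + (1 + b * x) * (iv (1 + b * x) * b) * y"
      by (simp only: comm distrib_left mult_1_right mult.assoc)
    also have "\<dots> = 1 + b * x + b * y" using bx by (simp add: iv_simps mult.assoc)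
    finally show ?thesis by (simp add: algebra_simps)
  qed
  show ?thesis unfolding D_def e1 e2 K_def
    using xb bx By by (simp add: iv_mult mult.assoc iv_simps)
qed

lemma D_conj:
  assumes h: "unit h" and xb: "unit (1 + x * b)"
  shows "h * D x b * iv h = D (h * x * iv h) (h * b * iv h)"
proof -
  have 1: "1 + h * x * iv h * (h * b * iv h) = h * (1 + x * b) * iv h"
    using h by (simp add: distrib_left distrib_right iv_simps mult.assoc)
  have 2: "1 + h * b * iv h * (h * x * iv h) = h * (1 + b * x) * iv h"
    using h by (simp add: distrib_left distrib_right iv_simps mult.assoc)
  show ?thesis unfolding D_def 1 2
    using assms unit_swap[OF xb] by (simp add: iv_mult unit_mult unit_iv iv_iv mult.assoc iv_simps)
qed

lemma D_one: "unit (1 + b) \<Longrightarrow> D 1 b = 1" by (simp add: D_def iv_simps)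
lemma D_zero_left: "D 0 b = 1" by (simp add: D_def iv_one)
lemma D_zero_right: "D x 0 = 1" by (simp add: D_def iv_one)

text \<open>Conjugating both arguments of \<open>D\<close> is conjugating the value; by this identity it also amounts to multiplication by values of
  \<open>D h\<close>. Comparing the two expresses \<open>(h, D x b)\<close> through \<open>D h\<close>.\<close>
lemma D_conj_eq:
  assumes h: "unit h" and xb: "unit (1 + x * b)"
  shows "D (h * x * iv h) (h * b * iv h) = D h (x * b * iv h) * D x b * iv (D h (b * x * iv h))"
proof -
  have u1: "unit (1 + h * x * iv h * (h * b * iv h))"
    using conj_one_plus[OF h, of "x * b"] h xb by (simp add: mult.assoc iv_simps unit_mult unit_iv)
  have u2: "unit (1 + h * (b * x * iv h))"
    using conj_one_plus[OF h, of "b * x"] h unit_swap[OF xb] by (simp add: mult.assoc iv_simps unit_mult unit_iv)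
  have a1: "D (h * (x * iv h)) (h * b * iv h) = D h (x * iv h * (h * b * iv h)) * D (x * iv h) (h * b * iv h * h)"
    by (rule D_mult) (use u1 in \<open>simp add: mult.assoc\<close>)
  have a2: "D (x * iv h) (h * b) = D x (iv h * (h * b)) * D (iv h) (h * b * x)"
    by (rule D_mult) (use h xb in \<open>simp add: mult.assoc iv_simps\<close>)
  have a3: "D (iv h) (h * b * x) = iv (D h (b * x * iv h))"
    unfolding iv_D[OF u2] using h by (simp add: D_def mult.assoc iv_simps)
  show ?thesis using a1 a2 a3 h by (simp add: mult.assoc iv_simps)
qed

section \<open>Gauges and products of small commutators\<close>

text \<open>The bound on the entries of elementary commutators. Together with \<open>rho\<close> it is chosen far smaller than necessary, so that all
  estimates below reduce to crude linear arithmetic.\<close>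
definition kap :: real where "kap = 1/1000"

text \<open>The bound on products of sizes \<open>r * s\<close> under which \<open>D x b\<close> with \<open>x \<in> G r\<close> and \<open>b \<in> G s\<close> is controlled.\<close>
definition rho :: real where "rho = 1/20000000"

text \<open>\<open>G r\<close> plays the role of the ball of radius \<open>r\<close> of a Banach algebra norm that may be infinite on some elements. The
  norm balls are one instance; the word gauges below are the instances for which the reduction to letters works.\<close>
locale gauge =
  fixes G :: "real \<Rightarrow> 'a::{real_normed_algebra_1,banach} set"
  assumes G_norm: "x \<in> G r \<Longrightarrow> norm x \<le> r"
    and G_mono: "x \<in> G r \<Longrightarrow> r \<le> s \<Longrightarrow> x \<in> G s"
    and G_zero: "0 \<in> G 0"
    and G_one: "1 \<in> G 1"
    and G_add: "x \<in> G r \<Longrightarrow> y \<in> G s \<Longrightarrow> x + y \<in> G (r + s)"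
    and G_scale: "x \<in> G r \<Longrightarrow> c *\<^sub>R x \<in> G (\<bar>c\<bar> * r)"
    and G_mult: "x \<in> G r \<Longrightarrow> y \<in> G s \<Longrightarrow> x * y \<in> G (r * s)"
    and G_inv: "x \<in> G r \<Longrightarrow> r < 1 \<Longrightarrow>
      \<exists>y\<in>G (r / (1 - r)). (1 + x) * (1 + y) = 1 \<and> (1 + y) * (1 + x) = 1"
begin

lemma G_nonneg: "x \<in> G r \<Longrightarrow> 0 \<le> r"
  using G_norm norm_ge_zero order_trans by blast
lemma G_minus: "x \<in> G r \<Longrightarrow> - x \<in> G r"
  using G_scale[of x r "-1"] by simp
lemma G_diff: "x \<in> G r \<Longrightarrow> y \<in> G s \<Longrightarrow> x - y \<in> G (r + s)"
  using G_add[OF _ G_minus] by force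
lemma G_0: "x \<in> G 0 \<Longrightarrow> x = 0" using G_norm by force
lemma G_zero': "0 \<le> r \<Longrightarrow> 0 \<in> G r" using G_mono[OF G_zero] by blast

lemma unit1: "x \<in> G r \<Longrightarrow> r < 1 \<Longrightarrow> unit (1 + x)"
  using G_inv unitI by metis
lemma iv1_G: "x \<in> G r \<Longrightarrow> r < 1 \<Longrightarrow> iv (1 + x) - 1 \<in> G (r / (1 - r))"
  using G_inv iv_unique by (metis add_diff_cancel_left')
lemma iv1_G': assumes "x \<in> G r" "r < 1" shows "iv (1 + x) \<in> G (1 / (1 - r))"
proof -
  have "1 + (iv (1 + x) - 1) \<in> G (1 + r / (1 - r))" using G_add[OF G_one iv1_G[OF assms]] .
  moreover have "1 + r / (1 - r) = 1 / (1 - r)" using assms by (simp add: field_simps)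
  ultimately show ?thesis by simp
qed
lemma iv1_G2: assumes "x \<in> G r" "r \<le> 1/2" shows "iv (1 + x) - 1 \<in> G (2 * r)"
proof -
  have r: "0 \<le> r" "r < 1" using assms G_nonneg[OF assms(1)] by auto
  have "r / (1 - r) \<le> 2 * r" using r mult_left_mono[OF assms(2) r(1)] by (simp add: divide_le_eq) (simp add: algebra_simps)
  then show ?thesis using iv1_G[OF assms(1) r(2)] G_mono by blast
qed
lemma iv1_G2': assumes "x \<in> G r" "r \<le> 1/2" shows "iv (1 + x) \<in> G 2"
proof -
  have "r < 1" using assms by auto
  moreover have "1 / (1 - r) \<le> 2" using assms(2) by (simp add: divide_le_eq)
  ultimately show ?thesis using iv1_G'[OF assms(1)] G_mono by blast
qed

text \<open>\<open>W e g\<close> says that \<open>g\<close> is a finite product of commutators \<open>K P Q\<close> whose total weight, the sum of the products of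
  the sizes of \<open>P\<close> and \<open>Q\<close>, is at most \<open>e\<close>. Weights add under multiplication, and the distance of \<open>g\<close> from \<open>1\<close> is
  bounded by the weight, but conversely nearness to \<open>1\<close> gives no weight at all.\<close>
inductive W :: "real \<Rightarrow> 'a \<Rightarrow> bool" where
  W_one: "0 \<le> e \<Longrightarrow> W e 1"
| W_step: "W e g \<Longrightarrow> P \<in> G p \<Longrightarrow> Q \<in> G q \<Longrightarrow> p \<le> kap \<Longrightarrow> q \<le> kap \<Longrightarrow> W (e + p * q) (g * K P Q)"

lemma W_nonneg: "W e g \<Longrightarrow> 0 \<le> e"
  by (induction rule: W.induct) (auto simp: G_nonneg)

lemma W_mono: "W e g \<Longrightarrow> e \<le> e' \<Longrightarrow> W e' g"
proof (induction arbitrary: e' rule: W.induct)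
  case (W_one e) then show ?case by (simp add: W.W_one)
next
  case (W_step e g P p Q q)
  have "W (e' - p * q) g" using W_step by simp
  from W.W_step[OF this W_step.hyps(2-5)] show ?case by simp
qed

lemma W_mult: "W d h \<Longrightarrow> W e g \<Longrightarrow> W (e + d) (g * h)"
proof (induction rule: W.induct)
  case (W_one d) then show ?case using W_mono by simp
next
  case (W_step d h P p Q q)
  from W.W_step[OF W_step.IH[OF W_step.prems] W_step.hyps(2-5)] show ?case by (simp add: mult.assoc add.assoc)
qed

lemma W_K: "P \<in> G p \<Longrightarrow> Q \<in> G q \<Longrightarrow> p \<le> kap \<Longrightarrow> q \<le> kap \<Longrightarrow> W (p * q) (K P Q)"
  using W_step[OF W_one[of 0]] by simp

lemma unit1_kap: "P \<in> G p \<Longrightarrow> p \<le> kap \<Longrightarrow> unit (1 + P)" by (rule unit1) (auto simp: kap_def)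

lemma W_unit: "W e g \<Longrightarrow> unit g"
  by (induction rule: W.induct) (auto simp: unit_one unit_mult unit_K unit1_kap)

lemma W_iv: "W e g \<Longrightarrow> W e (iv g)"
proof (induction rule: W.induct)
  case (W_one e) then show ?case by (simp add: iv_one W.W_one)
next
  case (W_step e g P p Q q)
  have "iv (g * K P Q) = K Q P * iv g" using W_step
    by (simp add: iv_mult W_unit unit_K unit1_kap iv_K)
  moreover have "W (q * p + e) (K Q P * iv g)"
    using W_mult[OF W_step.IH W_K[OF W_step.hyps(3,2,5,4)]] .
  ultimately show ?case by (simp add: algebra_simps)
qed

lemma K_minus_one_G:
  assumes "P \<in> G p" "Q \<in> G q" "p \<le> kap" "q \<le> kap"
  shows "K P Q - 1 \<in> G (3 * (p * q))"
proof -
  have u: "unit (1 + P)" "unit (1 + Q)" using assms unit1_kap by auto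
  have pq: "0 \<le> p" "0 \<le> q" using assms G_nonneg by auto
  have "K P Q - 1 = (P * Q - Q * P) * iv (1 + P) * iv (1 + Q)"
  proof -
    have "(P * Q - Q * P) = (1 + P) * (1 + Q) - (1 + Q) * (1 + P)" by (simp add: algebra_simps)
    also have "\<dots> * iv (1 + P) * iv (1 + Q) = K P Q - 1"
      using u by (simp add: K_def left_diff_distrib mult.assoc iv_simps)
    finally show ?thesis by simp
  qed
  also have "\<dots> \<in> G ((p * q + q * p) * (1 / (1 - p)) * (1 / (1 - q)))"
    using assms by (intro G_mult G_diff iv1_G') (auto simp: kap_def)
  finally have 1: "K P Q - 1 \<in> G ((p * q + q * p) * (1 / (1 - p)) * (1 / (1 - q)))" .
  have a: "1 / (1 - p) \<le> 11/10" "1 / (1 - q) \<le> 11/10" using assms pq by (auto simp: kap_def divide_le_eq)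
  have "(1 / (1 - p)) * (1 / (1 - q)) \<le> (11/10) * (11/10)"
    using a assms by (intro mult_mono) (auto simp: kap_def)
  then have "2 * (p * q) * ((1 / (1 - p)) * (1 / (1 - q))) \<le> 2 * (p * q) * (3/2)"
    using pq by (intro mult_left_mono) auto
  then show ?thesis using 1 by (elim G_mono) (simp add: mult.assoc)
qed

text \<open>The stronger bound \<open>3 * e / (1 - 3 * e)\<close> is what survives the induction over the factors.\<close>
lemma W_G_aux: "W e g \<Longrightarrow> 3 * e < 1 \<Longrightarrow> g - 1 \<in> G (3 * e / (1 - 3 * e))"
proof (induction rule: W.induct)
  case (W_one e) then show ?case using G_zero'[of "3 * e / (1 - 3 * e)"] by simp
next
  case (W_step e g P p Q q)
  have pq: "0 \<le> p * q" using W_step.hyps G_nonneg by auto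
  have e: "0 \<le> e" "3 * e < 1" using W_step W_nonneg pq by auto
  let ?u = "3 * e / (1 - 3 * e)" and ?v = "3 * (p * q)"
  have g: "g - 1 \<in> G ?u" using W_step e by simp
  have k: "K P Q - 1 \<in> G ?v" using K_minus_one_G W_step.hyps by blast
  have eq: "g * K P Q - 1 = (g - 1) + (K P Q - 1) + (g - 1) * (K P Q - 1)" by (simp add: algebra_simps)
  have mem: "(g - 1) + (K P Q - 1) + (g - 1) * (K P Q - 1) \<in> G (?u + ?v + ?u * ?v)" by (intro G_add G_mult g k)
  have le: "?u + ?v + ?u * ?v \<le> 3 * (e + p * q) / (1 - 3 * (e + p * q))"
  proof -
    let ?d = "1 - 3 * e"
    have d: "0 < ?d" "0 < ?d - ?v" using e W_step.prems by (auto simp: algebra_simps)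
    have 1: "1 + (?u + ?v + ?u * ?v) = (1 + ?v) / ?d"
    proof -
      have "1 + ?u = 1 / ?d" using d by (simp add: divide_simps)
      moreover have "1 + (u + v + u * v) = (1 + u) * (1 + v)" for u v :: real by (simp add: algebra_simps)
      ultimately show ?thesis by (metis mult.commute times_divide_eq_right mult.right_neutral)
    qed
    have 2: "1 + 3 * (e + p * q) / (1 - 3 * (e + p * q)) = 1 / (?d - ?v)"
    proof -
      have "1 - 3 * (e + p * q) = ?d - ?v" by (simp add: algebra_simps)
      then show ?thesis using d by (simp add: field_simps)
    qed
    have "(1 + ?v) * (?d - ?v) \<le> ?d"
    proof -
      have "(1 + ?v) * (?d - ?v) = ?d - (?v * (3 * e) + ?v * ?v)" by (simp add: algebra_simps)
      moreover have "0 \<le> ?v * (3 * e)" "0 \<le> ?v * ?v" using pq e zero_le_square[of ?v] by auto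
      ultimately show ?thesis by linarith
    qed
    moreover have "(1 + v) * (dd - v) \<le> dd \<Longrightarrow> 0 < dd \<Longrightarrow> 0 < dd - v \<Longrightarrow> (1 + v) / dd \<le> 1 / (dd - v)" for v dd :: real
      by (simp add: pos_divide_le_eq pos_le_divide_eq)
    ultimately have "(1 + ?v) / ?d \<le> 1 / (?d - ?v)" using d by blast
    then have "1 + (?u + ?v + ?u * ?v) \<le> 1 + 3 * (e + p * q) / (1 - 3 * (e + p * q))" unfolding 1 2 .
    then show ?thesis by (simp only: add_le_cancel_left)
  qed
  show ?case unfolding eq by (rule G_mono[OF mem le])
qed

lemma W_G: assumes "W e g" "12 * e \<le> 1" shows "g - 1 \<in> G (4 * e)"
proof -
  have e: "0 \<le> e" using W_nonneg assms by auto
  have "3 * e / (1 - 3 * e) \<le> 4 * e" using e assms(2) mult_left_mono[OF assms(2) e] by (simp add: divide_le_eq) (simp add: algebra_simps)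
  then show ?thesis using W_G_aux[OF assms(1)] assms(2) e G_mono by force
qed

text \<open>The commutator of \<open>1 + P\<close> with \<open>g\<close> is the single elementary commutator \<open>K P (g - 1)\<close>, whatever the number of factors of \<open>g\<close>.\<close>
lemma W_comm_one:
  assumes "P \<in> G p" "p \<le> kap" "W e g" "4 * e \<le> kap"
  shows "W (4 * p * e) ((1 + P) * g * iv (1 + P) * iv g)"
proof -
  have "g - 1 \<in> G (4 * e)" using assms W_G by (auto simp: kap_def)
  from W_K[OF assms(1) this assms(2,4)] show ?thesis by (simp add: K_def algebra_simps)
qed

text \<open>Conjugation adds only a commutator of lower order, so it preserves weights up to a factor.\<close>
lemma W_conj:
  assumes "P \<in> G p" "p \<le> kap" "W e g" "4 * e \<le> kap"
  shows "W (2 * e) ((1 + P) * g * iv (1 + P))"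
proof -
  have e: "0 \<le> e" using W_nonneg assms by auto
  have "(1 + P) * g * iv (1 + P) = ((1 + P) * g * iv (1 + P) * iv g) * g"
    using W_unit[OF assms(3)] by (simp add: mult.assoc iv_simps)
  then have "W (4 * p * e + e) ((1 + P) * g * iv (1 + P))"
    using W_mult[OF assms(3) W_comm_one[OF assms]] by simp
  moreover have "4 * p * e + e \<le> 2 * e"
    using e assms(2) mult_right_mono[of "4*p" 1 e] by (simp add: kap_def)
  ultimately show ?thesis using W_mono by blast
qed

lemma W_conj':
  assumes "s - 1 \<in> G p" "2 * p \<le> kap" "W e g" "4 * e \<le> kap"
  shows "W (2 * e) (iv s * g * s)"
proof -
  have p: "p \<le> 1/2" "0 \<le> p" using assms G_nonneg by (auto simp: kap_def)
  have s: "unit s" using unit1[OF assms(1)] p by simp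
  have "iv s - 1 \<in> G (2 * p)" using iv1_G2[OF assms(1)] p by simp
  from W_conj[OF this assms(2,3,4)] show ?thesis using s by (simp add: iv_iv)
qed

lemma W_comm:
  assumes "W e g" "W d h" "4 * e \<le> kap" "4 * d \<le> kap"
  shows "W (16 * e * d) (g * h * iv g * iv h)"
  using W_comm_one[of "g - 1" "4 * e" d h] assms W_G[of e g] by (simp add: kap_def mult.assoc)

text \<open>Congruence of group elements up to a right factor of weight \<open>e\<close>.\<close>
definition near :: "real \<Rightarrow> 'a \<Rightarrow> 'a \<Rightarrow> bool" where
  "near e g h \<longleftrightarrow> (\<exists>w. W e w \<and> g = h * w)"

lemma near_refl: "0 \<le> e \<Longrightarrow> near e g g" unfolding near_def using W_one by force
lemma near_sym: "near e g h \<Longrightarrow> near e h g"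
  unfolding near_def using W_iv W_unit by (metis iv_right mult.assoc mult.right_neutral)
lemma near_trans: "near e g h \<Longrightarrow> near d h k \<Longrightarrow> near (e + d) g k"
  unfolding near_def using W_mult by (metis add.commute mult.assoc)
lemma near_mono: "near e g h \<Longrightarrow> e \<le> e' \<Longrightarrow> near e' g h" unfolding near_def using W_mono by blast
lemma near_left: "near e g h \<Longrightarrow> near e (s * g) (s * h)" unfolding near_def by (metis mult.assoc)
lemma near_right:
  assumes "near e g h" "s - 1 \<in> G p" "2 * p \<le> kap" "4 * e \<le> kap"
  shows "near (2 * e) (g * s) (h * s)"
proof -
  obtain w where w: "W e w" "g = h * w" using assms(1) near_def by auto
  have s: "unit s" using unit1[OF assms(2)] assms(3) by (simp add: kap_def)
  have "W (2 * e) (iv s * w * s)" using W_conj'[OF assms(2,3) w(1) assms(4)] .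
  moreover have "g * s = h * s * (iv s * w * s)" using w s by (simp add: mult.assoc iv_simps)
  ultimately show ?thesis unfolding near_def by blast
qed
lemma near_right_W:
  assumes "near e g h" "W d s" "8 * d \<le> kap" "4 * e \<le> kap"
  shows "near (2 * e) (g * s) (h * s)"
  using near_right[OF assms(1) W_G[OF assms(2)] _ assms(4)] assms(3) by (simp add: kap_def)
lemma near_W: "W e w \<Longrightarrow> near e (g * w) g" unfolding near_def by blast
lemma W_near: "W d h \<Longrightarrow> near e g h \<Longrightarrow> W (d + e) g" unfolding near_def using W_mult by blast
lemma near_commute:
  assumes "W e g" "W d h" "4 * e \<le> kap" "4 * d \<le> kap"
  shows "near (16 * e * d) (g * h) (h * g)"
proof -
  have u: "unit g" "unit h" using assms W_unit by auto
  have "W (16 * e * d) (iv g * iv h * iv (iv g) * iv (iv h))"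
    using W_comm[OF W_iv[OF assms(1)] W_iv[OF assms(2)] assms(3,4)] .
  then have "W (16 * e * d) (iv g * iv h * g * h)" using u by (simp add: iv_iv)
  moreover have "g * h = h * g * (iv g * iv h * g * h)" using u by (simp add: mult.assoc iv_simps)
  ultimately show ?thesis unfolding near_def by blast
qed
lemma near_iv:
  assumes "near e g h" "W d g" "W d' h" "8 * d \<le> kap" "8 * d' \<le> kap" "4 * e \<le> kap"
  shows "near (2 * e) (iv g) (iv h)"
proof -
  obtain w where w: "W e w" "g = h * w" using assms(1) near_def by auto
  have u: "unit h" "unit w" "unit g" using w assms W_unit by auto
  have "W (2 * e) (iv (iv h) * iv w * iv h)"
    by (rule W_conj'[OF W_G[OF W_iv[OF assms(3)]] _ W_iv[OF w(1)] assms(6)])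
       (use assms in \<open>auto simp: kap_def\<close>)
  moreover have "iv g = iv h * (iv (iv h) * iv w * iv h)"
    using w u by (simp add: iv_mult mult.assoc iv_simps unit_iv)
  ultimately show ?thesis unfolding near_def by blast
qed

end

section \<open>Additivity of \<open>D\<close> up to second order\<close>

lemma D_scale: "D (c *\<^sub>R x) b = D x (c *\<^sub>R (b::'a::real_normed_algebra_1))"
  by (simp add: D_def)

lemma rho_pos: "0 < rho" by (simp add: rho_def)

context gauge begin

text \<open>By \<open>D_one_plus\<close> with \<open>b\<close> chosen such that \<open>b * iv (1 + b) = B\<close>, the element \<open>D y B\<close> is the quotient of two elementary commutators.\<close>
lemma D_W_small:
  assumes y: "y \<in> G p" and B: "B \<in> G q" and p: "p \<le> kap / 4" and q: "q \<le> kap / 4"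
  shows "W (5 * (p * q)) (D y B)"
proof -
  have pos: "0 \<le> p" "0 \<le> q" using y B G_nonneg by auto
  define b where "b = B * iv (1 + - B)"
  have nB: "- B \<in> G q" using B G_minus by blast
  have uB: "unit (1 + - B)" using unit1[OF nB] q by (simp add: kap_def)
  have iB: "iv (1 + - B) \<in> G 2" using iv1_G2'[OF nB] q by (simp add: kap_def)
  have b: "b \<in> G (q * 2)" unfolding b_def by (intro G_mult B iB)
  have b1: "1 + b = iv (1 + - B)"
  proof -
    have "(1 + - B) * iv (1 + - B) = 1" using uB iv_right by blast
    then show ?thesis by (simp add: b_def algebra_simps)
  qed
  have ivb: "iv (1 + b) = 1 + - B" unfolding b1 using uB by (simp add: iv_iv)
  have bB: "b * iv (1 + b) = B"
  proof -
    have "b * iv (1 + b) = b * (1 + - B)" using ivb by (rule arg_cong)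
    also have "\<dots> = B * (iv (1 + - B) * (1 + - B))" unfolding b_def by (simp only: mult.assoc)
    also have "\<dots> = B" unfolding iv_left[OF uB] by simp
    finally show ?thesis .
  qed
  have ub: "unit (1 + b)" unfolding b1 using uB unit_iv by blast
  have pq: "p * q \<le> (kap/4) * (kap/4)" using p q pos by (intro mult_mono) auto
  have uyB: "unit (1 + y * (b * iv (1 + b)))" unfolding bB
    by (rule unit1[OF G_mult[OF y B]]) (use pq in \<open>auto simp: kap_def\<close>)
  have uy: "unit (1 + y)" using unit1[OF y] p by (simp add: kap_def)
  have y1: "1 + y \<in> G (1 + p)" by (intro G_add G_one y)
  have yb: "(1 + y) * b \<in> G ((1 + p) * (q * 2))" by (intro G_mult y1 b)
  have s1: "(1 + p) * (q * 2) \<le> kap"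
  proof -
    have "(1 + p) * (q * 2) \<le> 2 * (kap / 4 * 2)" using p q pos by (intro mult_mono) (auto simp: kap_def)
    then show ?thesis by simp
  qed
  have iy: "iv (1 + y) - 1 \<in> G (2 * p)" using iv1_G2[OF y] p by (simp add: kap_def)
  have uyb: "unit (1 + (1 + y) * b)" using unit1[OF yb] s1 by (simp add: kap_def)
  have By: "B * y \<in> G (q * p)" by (intro G_mult B y)
  have qp: "q * p \<le> kap" using pq by (auto simp: kap_def mult.commute)
  have uBy: "unit (1 + B * y)" using unit1[OF By] qp by (simp add: kap_def)
  have e1: "D (1 + y) b = D y B * K (B * y) b" using D_one_plus[OF ub uyB] by (simp add: bB)
  have e2: "D (1 + y) b = K ((1 + y) * b) (iv (1 + y) - 1)" by (rule D_unit_left[OF uy uyb])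
  have "D y B = K ((1 + y) * b) (iv (1 + y) - 1) * K b (B * y)"
  proof -
    have "D y B * K (B * y) b * K b (B * y) = D y B"
      using iv_K[OF uBy ub] iv_right[OF unit_K[OF uBy ub]] by (simp add: mult.assoc)
    then show ?thesis using e1 e2 by metis
  qed
  moreover have "W ((1 + p) * (q * 2) * (2 * p)) (K ((1 + y) * b) (iv (1 + y) - 1))"
    using W_K[OF yb iy s1] p by (simp add: kap_def)
  moreover have "W (q * 2 * (q * p)) (K b (B * y))"
    using W_K[OF b By _ qp] q pos by (simp add: kap_def)
  ultimately have "W ((1 + p) * (q * 2) * (2 * p) + q * 2 * (q * p)) (D y B)"
    using W_mult by metis
  moreover have "(1 + p) * (q * 2) * (2 * p) + q * 2 * (q * p) \<le> 5 * (p * q)"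
  proof -
    have "(1 + p) * (q * 2) * (2 * p) + q * 2 * (q * p) = (p * q) * (4 * (1 + p) + 2 * q)" by (simp add: algebra_simps)
    also have "\<dots> \<le> (p * q) * 5" using p q pos by (intro mult_left_mono) (auto simp: kap_def)
    finally show ?thesis by simp
  qed
  ultimately show ?thesis using W_mono by blast
qed

text \<open>Only the product of the two sizes matters, since scalars can be moved from one argument of \<open>D\<close> to the other.\<close>
lemma D_W:
  assumes x: "x \<in> G r" and b: "b \<in> G s" and rs: "r * s \<le> rho"
  shows "W (5 * (r * s)) (D x b)"
proof -
  have pos: "0 \<le> r" "0 \<le> s" using x b G_nonneg by auto
  consider "r = 0" | "s = 0" | "r > 0" "s > 0" using pos by linarith
  then show ?thesis
  proof cases
    case 1 then have "x = 0" using G_0 x by blast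
    then show ?thesis using 1 W_one[of 0] by (simp add: D_zero_left)
  next
    case 2 then have "b = 0" using G_0 b by blast
    then show ?thesis using 2 W_one[of 0] by (simp add: D_zero_right)
  next
    case 3
    define t where "t = sqrt (s / r)"
    have t: "t > 0" using 3 by (simp add: t_def)
    have tr: "t * r = sqrt (r * s)" using 3 by (simp add: t_def real_sqrt_divide real_sqrt_mult field_simps)
    have st: "inverse t * s = sqrt (r * s)" using 3 by (simp add: t_def real_sqrt_divide real_sqrt_mult field_simps)
    have "sqrt (r * s) \<le> sqrt (kap\<^sup>2 / 16)" using rs by (intro real_sqrt_le_mono) (simp add: kap_def rho_def power2_eq_square)
    also have "sqrt (kap\<^sup>2 / 16) = kap / 4" by (simp add: real_sqrt_divide kap_def)
    finally have le: "sqrt (r * s) \<le> kap / 4" .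
    have 1: "t *\<^sub>R x \<in> G (sqrt (r * s))" using G_scale[OF x, of t] t tr by simp
    have 2: "inverse t *\<^sub>R b \<in> G (sqrt (r * s))" using G_scale[OF b, of "inverse t"] t st by (simp add: abs_mult)
    have "D x b = D (t *\<^sub>R x) (inverse t *\<^sub>R b)" using t by (simp add: D_scale)
    then show ?thesis using D_W_small[OF 1 2 le le] 3 by simp
  qed
qed

lemma rho_kap: "x \<le> rho \<Longrightarrow> 400 * x \<le> kap" by (simp add: rho_def kap_def)

text \<open>The correction of the inner argument in \<open>D_add\<close> is of second order, hence invisible up to second order.\<close>
lemma D_pert:
  assumes x: "x \<in> G r" and y: "y \<in> G p" and b: "b \<in> G s" and a: "r * s \<le> rho / 8" and c: "p * s \<le> rho / 8"
  shows "near (21 * (r * s) * (p * s)) (D y b) (D y (b * iv (1 + x * b)))"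
proof -
  have pos: "0 \<le> r" "0 \<le> s" "0 \<le> p" using x y b G_nonneg by auto
  let ?a = "r * s" and ?c = "p * s"
  have ac: "0 \<le> ?a" "0 \<le> ?c" using pos by auto
  have xb: "x * b \<in> G ?a" by (intro G_mult x b)
  have uxb: "unit (1 + x * b)" using unit1[OF xb] a by (simp add: rho_def)
  have ixb: "iv (1 + x * b) \<in> G 2" using iv1_G2'[OF xb] a by (simp add: rho_def)
  define b' where "b' = b * iv (1 + x * b)"
  have b': "b' \<in> G (s * 2)" unfolding b'_def by (intro G_mult b ixb)
  define d where "d = b' * (x * b)"
  have d: "d \<in> G (s * 2 * ?a)" unfolding d_def by (intro G_mult b' xb)
  have bd: "b' + d = b"
  proof -
    have "b' + d = b * (iv (1 + x * b) * (1 + x * b))" by (simp add: d_def b'_def distrib_left mult.assoc)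
    then show ?thesis using uxb by (simp add: iv_left)
  qed
  have b'y: "b' * y \<in> G (s * 2 * p)" by (intro G_mult b' y)
  have ub'y: "unit (1 + b' * y)" using unit1[OF b'y] c by (simp add: rho_def mult.commute)
  define z where "z = y * iv (1 + b' * y)"
  have z: "z \<in> G (p * 2)" unfolding z_def
    by (intro G_mult y iv1_G2'[OF b'y]) (use c in \<open>simp add: rho_def mult.commute\<close>)
  have acle: "?a * ?c \<le> rho / 8 * 1" using a c ac by (intro mult_mono) (auto simp: rho_def)
  have dz: "d * z \<in> G (s * 2 * ?a * (p * 2))" by (intro G_mult d z)
  have e: "s * 2 * ?a * (p * 2) = 4 * (?a * ?c)" by simp
  have udz: "unit (1 + d * (y * iv (1 + b' * y)))"
    using unit1[OF dz] acle unfolding e z_def[symmetric] by (simp add: rho_def)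
  have by': "b * y \<in> G (s * p)" by (intro G_mult b y)
  have uby: "unit (1 + b * y)" using unit1[OF by'] c by (simp add: rho_def mult.commute)
  have zd: "z * d \<in> G (p * 2 * (s * 2 * ?a))" by (intro G_mult d z)
  have main: "D b y = D d z * K (z * d) (b' * y) * D b' y"
    using D_add[OF ub'y udz] by (simp add: bd z_def)
  have w1: "W (5 * (s * 2 * ?a * (p * 2))) (D d z)"
    by (rule D_W[OF d z], unfold e) (use acle ac rho_pos in linarith)
  have w2: "W (p * 2 * (s * 2 * ?a) * (s * 2 * p)) (K (z * d) (b' * y))"
    by (rule W_K[OF zd b'y]) (use acle c rho_kap[of "?a * ?c"] in \<open>auto simp: rho_def kap_def mult.assoc mult.left_commute mult.commute\<close>)
  have w: "W (p * 2 * (s * 2 * ?a) * (s * 2 * p) + 5 * (s * 2 * ?a * (p * 2))) (D d z * K (z * d) (b' * y))"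
    using W_mult[OF w2 w1] by (simp add: add.commute)
  have "p * 2 * (s * 2 * ?a) * (s * 2 * p) + 5 * (s * 2 * ?a * (p * 2)) = (?a * ?c) * (8 * ?c + 20)" by (simp add: algebra_simps)
  also have "\<dots> \<le> (?a * ?c) * 21" using ac c by (intro mult_left_mono) (auto simp: rho_def)
  finally have w': "W (21 * ?a * ?c) (D d z * K (z * d) (b' * y))" using W_mono[OF w] by (simp add: mult.assoc mult.commute mult.left_commute)
  let ?Z = "D d z * K (z * d) (b' * y)"
  have ud: "unit (D b' y)" using unit_D[OF ub'y] .
  have "D y b = iv (D b y)" using iv_D[OF uby] by simp
  also have "\<dots> = iv (D b' y) * iv ?Z" unfolding main using iv_mult[OF W_unit[OF w'] ud] by simp
  also have "iv (D b' y) = D y b'" using iv_D[OF ub'y] .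
  finally have "D y b = D y b' * iv ?Z" .
  then show ?thesis unfolding b'_def[symmetric] near_def using W_iv[OF w'] by blast
qed

lemma D_add_left:
  assumes x: "x \<in> G r" and y: "y \<in> G p" and b: "b \<in> G s" and a: "r * s \<le> rho / 8" and c: "p * s \<le> rho / 8"
  shows "near (500 * (r * s) * (p * s)) (D (x + y) b) (D x b * D y b)"
proof -
  have pos: "0 \<le> r" "0 \<le> s" "0 \<le> p" using x y b G_nonneg by auto
  let ?a = "r * s" and ?c = "p * s"
  have ac: "0 \<le> ?a" "0 \<le> ?c" "0 \<le> ?a * ?c" using pos by auto
  have acle: "?a * ?c \<le> rho / 8 * 1" using a c ac by (intro mult_mono) (auto simp: rho_def)
  have xb: "x * b \<in> G ?a" by (intro G_mult x b)
  have uxb: "unit (1 + x * b)" using unit1[OF xb] a by (simp add: rho_def)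
  have ixb: "iv (1 + x * b) \<in> G 2" using iv1_G2'[OF xb] a by (simp add: rho_def)
  define b' where "b' = b * iv (1 + x * b)"
  have b': "b' \<in> G (s * 2)" unfolding b'_def by (intro G_mult b ixb)
  have b'y: "b' * y \<in> G (s * 2 * p)" by (intro G_mult b' y)
  have yb': "y * b' \<in> G (p * (s * 2))" by (intro G_mult b' y)
  have uyb': "unit (1 + y * (b * iv (1 + x * b)))"
    using unit1[OF yb'] c unfolding b'_def by (simp add: rho_def)
  have main: "D (x + y) b = D y b' * K (b' * y) (x * b) * D x b" using D_add[OF uxb uyb'] by (simp add: b'_def)
  have wk: "W (s * 2 * p * (r * s)) (K (b' * y) (x * b))"
    by (rule W_K[OF b'y xb]) (use a c in \<open>auto simp: rho_def kap_def mult.commute\<close>)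
  have 1: "near (2 * (?a * ?c)) (D y b' * K (b' * y) (x * b)) (D y b')"
    using near_W[OF wk] by (simp add: mult.assoc mult.commute mult.left_commute)
  have 2: "near (21 * ?a * ?c) (D y b') (D y b)" using near_sym[OF D_pert[OF x y b a c]] by (simp add: b'_def)
  have 3: "near (23 * (?a * ?c)) (D y b' * K (b' * y) (x * b)) (D y b)"
    using near_trans[OF 1 2] by (simp add: algebra_simps)
  have wx: "W (5 * ?a) (D x b)" by (rule D_W[OF x b]) (use a in \<open>simp add: rho_def\<close>)
  have wy: "W (5 * ?c) (D y b)" by (rule D_W[OF y b]) (use c in \<open>simp add: rho_def\<close>)
  have 4: "near (2 * (23 * (?a * ?c))) (D (x + y) b) (D y b * D x b)"
    unfolding main by (rule near_right_W[OF 3 wx]) (use a acle in \<open>simp_all add: rho_def kap_def\<close>)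
  have 5: "near (16 * (5 * ?c) * (5 * ?a)) (D y b * D x b) (D x b * D y b)"
    by (rule near_commute[OF wy wx]) (use a c in \<open>simp_all add: rho_def kap_def\<close>)
  have "near (2 * (23 * (?a * ?c)) + 16 * (5 * ?c) * (5 * ?a)) (D (x + y) b) (D x b * D y b)"
    by (rule near_trans[OF 4 5])
  then show ?thesis by (rule near_mono) (use ac in \<open>simp add: algebra_simps\<close>)
qed

lemma D_add_right:
  assumes x: "x \<in> G r" and b: "b \<in> G s" and b': "b' \<in> G s'" and a: "r * s \<le> rho / 8" and c: "r * s' \<le> rho / 8"
  shows "near (1500 * (r * s) * (r * s')) (D x (b + b')) (D x b * D x b')"
proof -
  have pos: "0 \<le> r" "0 \<le> s" "0 \<le> s'" using x b b' G_nonneg by auto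
  let ?a = "r * s" and ?c = "r * s'"
  have ac: "0 \<le> ?a" "0 \<le> ?c" "0 \<le> ?a * ?c" using pos by auto
  have acle: "?a * ?c \<le> ?a * (rho/8)" "?a * (rho / 8) \<le> rho / 8 * (rho / 8)"
    using mult_left_mono[OF c ac(1)] mult_right_mono[OF a, of "rho / 8"] by (simp_all add: rho_def)
  have acle2: "?a * ?c \<le> rho * rho / 64" using acle by linarith
  have 1: "near (500 * (s * r) * (s' * r)) (D (b + b') x) (D b x * D b' x)"
    by (rule D_add_left[OF b b' x]) (use a c in \<open>simp_all add: mult.commute\<close>)
  have wb: "W (5 * (s * r)) (D b x)" by (rule D_W[OF b x]) (use a in \<open>simp add: rho_def mult.commute\<close>)
  have wb': "W (5 * (s' * r)) (D b' x)" by (rule D_W[OF b' x]) (use c in \<open>simp add: rho_def mult.commute\<close>)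
  have bb': "b + b' \<in> G (s + s')" by (intro G_add b b')
  have wbb: "W (5 * ((s + s') * r)) (D (b + b') x)"
    by (rule D_W[OF bb' x]) (use a c in \<open>simp add: rho_def algebra_simps\<close>)
  have 2: "near (2 * (500 * (s * r) * (s' * r))) (iv (D (b + b') x)) (iv (D b x * D b' x))"
    by (rule near_iv[OF 1 wbb W_mult[OF wb' wb]]) (use a c acle2 in \<open>simp_all add: rho_def kap_def algebra_simps\<close>)
  have u: "unit (1 + b * x)" by (rule unit1[OF G_mult[OF b x]]) (use a in \<open>simp add: rho_def mult.commute\<close>)
  have u': "unit (1 + b' * x)" by (rule unit1[OF G_mult[OF b' x]]) (use c in \<open>simp add: rho_def mult.commute\<close>)
  have ub: "unit (1 + (b + b') * x)" by (rule unit1[OF G_mult[OF bb' x]]) (use a c in \<open>simp add: rho_def algebra_simps\<close>)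
  have 3: "near (1000 * (?a * ?c)) (D x (b + b')) (D x b' * D x b)"
    using 2 by (simp add: iv_D[OF ub] iv_mult[OF unit_D[OF u] unit_D[OF u']] iv_D[OF u] iv_D[OF u'] mult.assoc mult.commute mult.left_commute)
  have wx: "W (5 * ?a) (D x b)" by (rule D_W[OF x b]) (use a in \<open>simp add: rho_def\<close>)
  have wx': "W (5 * ?c) (D x b')" by (rule D_W[OF x b']) (use c in \<open>simp add: rho_def\<close>)
  have 5: "near (16 * (5 * ?c) * (5 * ?a)) (D x b' * D x b) (D x b * D x b')"
    by (rule near_commute[OF wx' wx]) (use a c in \<open>simp_all add: rho_def kap_def\<close>)
  show ?thesis using near_trans[OF 3 5] by (rule near_mono) (use ac in \<open>simp add: algebra_simps\<close>)
qed

lemma D_neg: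
  assumes x: "x \<in> G r" and b: "b \<in> G s" and a: "r * s \<le> rho / 8"
  shows "near (1500 * (r * s) * (r * s)) (iv (D x b)) (D x (- b))"
proof -
  have u: "unit (1 + x * b)" by (rule unit1[OF G_mult[OF x b]]) (use a in \<open>simp add: rho_def\<close>)
  have "near (1500 * (r * s) * (r * s)) (D x (b + - b)) (D x b * D x (- b))"
    by (rule D_add_right[OF x b G_minus[OF b] a a])
  from near_left[OF this, of "iv (D x b)"] show ?thesis
    by (simp add: D_zero_right iv_left'[OF unit_D[OF u]])
qed

end

section \<open>Word gauges\<close>

text \<open>The geometric series, stated with an unconditional sum so that it can be estimated in any word gauge.\<close>
lemma neumann:
  fixes x :: "'a::{real_normed_algebra_1,banach}"
  assumes x: "norm x \<le> r" and r: "r < 1"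
  obtains y where "((\<lambda>n. (- x) ^ Suc n) has_sum y) UNIV" "(1 + x) * (1 + y) = 1" "(1 + y) * (1 + x) = 1" "norm y \<le> r / (1 - r)"
proof -
  have r0: "0 \<le> r" using x norm_ge_zero order_trans by blast
  have x1: "norm (- x) < 1" using x r by simp
  define s where "s = (\<Sum>n. (- x) ^ n)"
  have sm: "summable (\<lambda>n. (- x) ^ n)" using complete_algebra_summable_geometric[OF x1] .
  have s: "(\<lambda>n. (- x) ^ n) sums s" unfolding s_def using sm by (rule summable_sums)
  have nb: "norm ((- x) ^ Suc n) \<le> r ^ Suc n" for n
    by (rule order_trans[OF norm_power_ineq]) (use x r0 in \<open>auto intro!: power_mono simp del: power_Suc\<close>)
  have gs: "(\<lambda>n. r ^ Suc n) sums (r / (1 - r))"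
    using sums_mult[OF geometric_sums[of r], of r] r r0 by simp
  have ns: "summable (\<lambda>n. norm ((- x) ^ Suc n))"
    by (rule summable_comparison_test'[OF sums_summable[OF gs], of 0]) (use nb in \<open>simp\<close>)
  have tail: "(\<lambda>n. (- x) ^ Suc n) sums (s - 1)" using s sums_Suc_iff[of "\<lambda>n. (- x) ^ n" "s - 1"] by simp
  have hs: "((\<lambda>n. (- x) ^ Suc n) has_sum (s - 1)) UNIV"
    by (rule norm_summable_imp_has_sum[OF ns tail])
  have "(\<lambda>n. (- x) * (- x) ^ n) sums ((- x) * s)" using s by (rule sums_mult)
  then have 1: "s - 1 = - x * s" using tail sums_unique2 by (metis (no_types, lifting) power_Suc sums_cong)
  have "(\<lambda>n. (- x) ^ n * (- x)) sums (s * (- x))" using s by (rule sums_mult2)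
  then have 2: "s - 1 = s * (- x)" using tail sums_unique2 by (metis (no_types, lifting) power_Suc2 sums_cong)
  have "norm (s - 1) \<le> r / (1 - r)"
  proof -
    have "norm (s - 1) = norm (\<Sum>n. (- x) ^ Suc n)" using tail sums_unique by metis
    also have "\<dots> \<le> (\<Sum>n. r ^ Suc n)"
      by (rule norm_suminf_le[OF _ sums_summable[OF gs]]) (use nb in auto)
    finally show ?thesis using gs sums_unique by metis
  qed
  moreover have "(1 + x) * (1 + (s - 1)) = 1" using 1 by (simp add: algebra_simps)
  moreover have "(1 + (s - 1)) * (1 + x) = 1" using 2 by (simp add: algebra_simps)
  ultimately show ?thesis using that hs by blast
qed

definition norm_gauge :: "real \<Rightarrow> 'a::{real_normed_algebra_1,banach} set" where "norm_gauge r = {x. norm x \<le> r}"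

lemma gauge_norm_balls: "gauge (norm_gauge :: real \<Rightarrow> 'a::{real_normed_algebra_1,banach} set)"
proof
  fix x y :: 'a and r s c :: real
  show "x \<in> norm_gauge r \<Longrightarrow> y \<in> norm_gauge s \<Longrightarrow> x + y \<in> norm_gauge (r + s)" unfolding norm_gauge_def using norm_triangle_mono by blast
  show "x \<in> norm_gauge r \<Longrightarrow> y \<in> norm_gauge s \<Longrightarrow> x * y \<in> norm_gauge (r * s)" unfolding norm_gauge_def
    by (auto intro!: order_trans[OF norm_mult_ineq] mult_mono intro: order_trans[OF norm_ge_zero])
  show "x \<in> norm_gauge r \<Longrightarrow> r < 1 \<Longrightarrow> \<exists>y\<in>norm_gauge (r / (1 - r)). (1 + x) * (1 + y) = 1 \<and> (1 + y) * (1 + x) = 1"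
    unfolding norm_gauge_def using neumann[of x r] by (metis mem_Collect_eq)
qed (auto simp: norm_gauge_def intro: mult_left_mono)

text \<open>Polynomials in the letters \<open>S\<close>; a word of length \<open>n\<close> counts \<open>n + 1\<close>. This weight is submultiplicative, and it pays for
  the reduction to letters: splitting a word of length \<open>n\<close> by the Leibniz rule produces \<open>n\<close> terms.\<close>
inductive Poly :: "'a::real_normed_algebra_1 set \<Rightarrow> real \<Rightarrow> 'a \<Rightarrow> bool" for S where
  Poly_zero: "0 \<le> r \<Longrightarrow> Poly S r 0"
| Poly_step: "Poly S r x \<Longrightarrow> set w \<subseteq> S \<Longrightarrow> Poly S (r + \<bar>c\<bar> * (real (length w) + 1)) (x + c *\<^sub>R prod_list w)"

lemma Poly_nonneg: "Poly S r x \<Longrightarrow> 0 \<le> r" by (induction rule: Poly.induct) auto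

lemma Poly_mono: "Poly S r x \<Longrightarrow> r \<le> s \<Longrightarrow> Poly S s x"
proof (induction arbitrary: s rule: Poly.induct)
  case (Poly_zero r) then show ?case by (simp add: Poly.Poly_zero)
next
  case (Poly_step r x w c)
  have "Poly S (s - \<bar>c\<bar> * (real (length w) + 1)) x" using Poly_step by simp
  from Poly.Poly_step[OF this Poly_step.hyps(2), of c] show ?case by simp
qed

lemma Poly_add: "Poly S s y \<Longrightarrow> Poly S r x \<Longrightarrow> Poly S (r + s) (x + y)"
proof (induction rule: Poly.induct)
  case (Poly_zero s) then show ?case by (auto intro: Poly_mono)
next
  case (Poly_step s y w c)
  from Poly.Poly_step[OF Poly_step.IH[OF Poly_step.prems] Poly_step.hyps(2), of c]
  show ?case by (simp add: add.assoc)
qed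

lemma Poly_scale: "Poly S r x \<Longrightarrow> Poly S (\<bar>d\<bar> * r) (d *\<^sub>R x)"
proof (induction rule: Poly.induct)
  case (Poly_zero s) then show ?case by (auto intro!: Poly.Poly_zero mult_nonneg_nonneg)
next
  case (Poly_step s y w c)
  from Poly.Poly_step[OF Poly_step.IH Poly_step.hyps(2), of "d * c"]
  show ?case by (simp add: algebra_simps abs_mult)
qed

lemma Poly_word: "set w \<subseteq> S \<Longrightarrow> Poly S (real (length w) + 1) (prod_list w)"
  using Poly_step[OF Poly_zero[of 0], of w S 1] by simp

lemma Poly_mult_word: "Poly S r x \<Longrightarrow> set v \<subseteq> S \<Longrightarrow> Poly S (r * (real (length v) + 1)) (x * prod_list v)"
proof (induction rule: Poly.induct)
  case (Poly_zero s) then show ?case by (auto intro!: Poly.Poly_zero mult_nonneg_nonneg)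
next
  case (Poly_step s y w c)
  have w: "set (w @ v) \<subseteq> S" using Poly_step by simp
  have "Poly S (s * (real (length v) + 1) + \<bar>c\<bar> * (real (length (w @ v)) + 1)) (y * prod_list v + c *\<^sub>R prod_list (w @ v))"
    by (rule Poly.Poly_step[OF Poly_step.IH[OF Poly_step.prems] w])
  then have "Poly S (s * (real (length v) + 1) + \<bar>c\<bar> * (real (length (w @ v)) + 1)) ((y + c *\<^sub>R prod_list w) * prod_list v)"
    by (simp add: distrib_right)
  moreover have "\<bar>c\<bar> * (real (length (w @ v)) + 1) \<le> \<bar>c\<bar> * ((real (length w) + 1) * (real (length v) + 1))"
    by (intro mult_left_mono) (auto simp: algebra_simps)
  ultimately show ?case by (elim Poly_mono) (simp add: algebra_simps)
qed

lemma Poly_mult: "Poly S s y \<Longrightarrow> Poly S r x \<Longrightarrow> Poly S (r * s) (x * y)"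
proof (induction rule: Poly.induct)
  case (Poly_zero s) then show ?case using Poly_nonneg[OF Poly_zero(2)] by (auto intro!: Poly.Poly_zero mult_nonneg_nonneg)
next
  case (Poly_step s y w c)
  have "Poly S (\<bar>c\<bar> * (r * (real (length w) + 1))) (c *\<^sub>R (x * prod_list w))"
    by (intro Poly_scale Poly_mult_word Poly_step)
  from Poly_add[OF this Poly_step.IH[OF Poly_step.prems]]
  show ?case by (simp add: algebra_simps)
qed

lemma norm_word: "\<forall>s\<in>S. norm s \<le> 1 \<Longrightarrow> set w \<subseteq> S \<Longrightarrow> norm (prod_list w :: 'a::real_normed_algebra_1) \<le> 1"
proof (induction w)
  case (Cons a w)
  have "norm (a * prod_list w) \<le> norm a * norm (prod_list w)" by (rule norm_mult_ineq)
  also have "\<dots> \<le> 1 * 1" using Cons by (intro mult_mono) auto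
  finally show ?case by simp
qed simp

lemma Poly_norm: "Poly S r x \<Longrightarrow> \<forall>s\<in>S. norm s \<le> 1 \<Longrightarrow> norm x \<le> r"
proof (induction rule: Poly.induct)
  case (Poly_step s y w c)
  have "norm (c *\<^sub>R prod_list w) \<le> \<bar>c\<bar> * 1" using norm_word[OF Poly_step.prems Poly_step.hyps(2)]
    by (simp add: mult_left_le)
  also have "\<dots> \<le> \<bar>c\<bar> * (real (length w) + 1)" by (intro mult_left_mono) auto
  finally show ?case using Poly_step by (meson norm_triangle_mono)
qed simp

text \<open>The completion of polynomials in the letters with respect to their weight: absolutely convergent series of polynomials.\<close>
definition WG :: "'a::{real_normed_algebra_1,banach} set \<Rightarrow> real \<Rightarrow> 'a set" where
  "WG S r = {x. \<exists>P rs. (\<forall>k::nat. Poly S (rs k) (P k)) \<and> rs summable_on UNIV \<and> infsum rs UNIV \<le> r \<and> (P has_sum x) UNIV}"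

lemma has_sum_diff': "(f has_sum a) A \<Longrightarrow> (g has_sum b) A \<Longrightarrow> ((\<lambda>k. f k - g k) has_sum (a - b :: 'b::real_normed_vector)) A"
  using has_sum_add[of f A a "\<lambda>k. - g k" "- b"] by (simp add: has_sum_uminus)

lemma has_sum_single: "((\<lambda>k::nat. if k = 0 then x else 0) has_sum x) UNIV"
  by (rule has_sum_finite_neutralI[of "{0}"]) auto

lemma Poly_WG: "Poly S r x \<Longrightarrow> x \<in> WG S r"
  unfolding WG_def
  using has_sum_single[of x] has_sum_single[of r]
  by (intro CollectI exI[of _ "\<lambda>k. if k = 0 then x else 0"] exI[of _ "\<lambda>k. if k = 0 then r else 0"])
     (auto simp: Poly_zero infsumI summable_on_def)

lemma WG_mono: "x \<in> WG S r \<Longrightarrow> r \<le> s \<Longrightarrow> x \<in> WG S s" unfolding WG_def by force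

lemma WG_norm: assumes "\<forall>s\<in>S. norm s \<le> 1" "x \<in> WG S r" shows "norm x \<le> r"
proof -
  obtain P rs where P: "\<And>k::nat. Poly S (rs k) (P k)" "rs summable_on UNIV" "infsum rs UNIV \<le> r" "(P has_sum x) UNIV"
    using assms(2) unfolding WG_def by auto
  have "norm x \<le> infsum rs UNIV"
    by (rule norm_infsum_le[OF P(4) has_sum_infsum[OF P(2)]]) (use Poly_norm[OF P(1) assms(1)] in auto)
  then show ?thesis using P(3) by simp
qed

lemma WG_add: assumes "x \<in> WG S r" "y \<in> WG S s" shows "x + y \<in> WG S (r + s)"
proof -
  obtain P rs where P: "\<And>k::nat. Poly S (rs k) (P k)" "rs summable_on UNIV" "infsum rs UNIV \<le> r" "(P has_sum x) UNIV"
    using assms(1) unfolding WG_def by auto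
  obtain Q qs where Q: "\<And>k::nat. Poly S (qs k) (Q k)" "qs summable_on UNIV" "infsum qs UNIV \<le> s" "(Q has_sum y) UNIV"
    using assms(2) unfolding WG_def by auto
  show ?thesis unfolding WG_def
    by (intro CollectI exI[of _ "\<lambda>k. P k + Q k"] exI[of _ "\<lambda>k. rs k + qs k"] conjI allI
        Poly_add P Q summable_on_add has_sum_add)
       (use P Q in \<open>simp add: infsum_add\<close>)
qed

text \<open>Maps that are bounded on polynomials act on the completion.\<close>
lemma WG_bl:
  assumes f: "bounded_linear f" and b: "\<And>r x. Poly S r x \<Longrightarrow> Poly S (c * r) (f x)" and c: "0 \<le> c"
    and x: "x \<in> WG S r"
  shows "f x \<in> WG S (c * r)"
proof -
  obtain P rs where P: "\<And>k::nat. Poly S (rs k) (P k)" "rs summable_on UNIV" "infsum rs UNIV \<le> r" "(P has_sum x) UNIV"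
    using x unfolding WG_def by auto
  have "infsum (\<lambda>k. c * rs k) UNIV \<le> c * r"
    using P(2,3) c by (simp add: infsum_cmult_right mult_left_mono)
  then show ?thesis unfolding WG_def
    by (intro CollectI exI[of _ "\<lambda>k. f (P k)"] exI[of _ "\<lambda>k. c * rs k"] conjI allI
        b P summable_on_cmult_right has_sum_bounded_linear[OF f])
qed

text \<open>Completeness of the word gauge: a series of series is rearranged into one series.\<close>
lemma WG_infsum:
  fixes X :: "nat \<Rightarrow> 'a::{real_normed_algebra_1,banach}"
  assumes S: "\<forall>s\<in>S. norm s \<le> 1" and X: "\<And>n. X n \<in> WG S (t n)" and t: "t summable_on UNIV"
    and x: "(X has_sum x) UNIV"
  shows "x \<in> WG S (infsum t UNIV)"
proof -
  have "\<forall>n. \<exists>P rs. (\<forall>k::nat. Poly S (rs k) (P k)) \<and> rs summable_on UNIV \<and> infsum rs UNIV \<le> t n \<and> (P has_sum X n) UNIV"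
    using X unfolding WG_def by auto
  then obtain P rs where P: "\<And>n k::nat. Poly S (rs n k) (P n k)" "\<And>n. rs n summable_on UNIV"
      "\<And>n. infsum (rs n) UNIV \<le> t n" "\<And>n. (P n has_sum X n) UNIV" by metis
  have rs0: "0 \<le> rs n k" for n k using P(1) Poly_nonneg by blast
  define g where "g = (\<lambda>(n, k). rs n k)"
  define f where "f = (\<lambda>(n, k). P n k)"
  have ninf: "0 \<le> infsum (rs n) UNIV" for n by (intro infsum_nonneg rs0)
  have gabs: "(\<lambda>p. norm (g p)) summable_on (Sigma UNIV (\<lambda>_. UNIV))"
  proof (rule Infinite_Sum.abs_summable_on_Sigma_iff[THEN iffD2], intro conjI ballI)
    fix n show "(\<lambda>k. norm (g (n, k))) summable_on UNIV" using P(2) rs0 by (simp add: g_def)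
    show "(\<lambda>n. norm (infsum (\<lambda>k. norm (g (n, k))) UNIV)) summable_on UNIV"
      by (rule summable_on_comparison_test[OF t]) (use P(3) rs0 ninf in \<open>auto simp: g_def\<close>)
  qed
  have gs: "g summable_on UNIV" using gabs rs0 by (simp add: g_def case_prod_unfold)
  have fabs: "(\<lambda>p. norm (f p)) summable_on UNIV"
    by (rule Infinite_Sum.abs_summable_on_comparison_test'[OF gs])
       (use Poly_norm[OF P(1) S] in \<open>auto simp: g_def f_def split_beta\<close>)
  have fs: "f summable_on UNIV" using fabs by (rule abs_summable_summable)
  have "infsum f UNIV = infsum (\<lambda>n. infsum (\<lambda>k. f (n, k)) UNIV) UNIV"
    using infsum_Sigma_banach[of f UNIV "\<lambda>_. UNIV"] fs by simp
  also have "\<dots> = infsum X UNIV"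
  proof -
    have "infsum (P n) UNIV = X n" for n using P(4) by (rule infsumI)
    then show ?thesis by (simp add: f_def)
  qed
  also have "\<dots> = x" using x by (rule infsumI)
  finally have fx: "infsum f UNIV = x" .
  have "infsum g UNIV = infsum (\<lambda>n. infsum (\<lambda>k. g (n, k)) UNIV) UNIV"
    using infsum_Sigma_banach[of g UNIV "\<lambda>_. UNIV"] gs by simp
  also have "\<dots> \<le> infsum t UNIV"
    by (rule infsum_mono[OF summable_on_comparison_test[OF t] t]) (use P(3) ninf in \<open>auto simp: g_def\<close>)
  finally have gt: "infsum g UNIV \<le> infsum t UNIV" .
  have bij: "bij_betw prod_decode UNIV (UNIV :: (nat \<times> nat) set)" by (rule bij_prod_decode)
  show ?thesis unfolding WG_def
  proof (intro CollectI exI[of _ "\<lambda>m. f (prod_decode m)"] exI[of _ "\<lambda>m. g (prod_decode m)"] conjI allI)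
    fix m show "Poly S (g (prod_decode m)) (f (prod_decode m))" using P(1) by (simp add: f_def g_def split_beta)
    show "(\<lambda>m. g (prod_decode m)) summable_on UNIV" using summable_on_reindex_bij_betw[OF bij, of g] gs by simp
    show "infsum (\<lambda>m. g (prod_decode m)) UNIV \<le> infsum t UNIV" using infsum_reindex_bij_betw[OF bij, of g] gt by simp
    show "((\<lambda>m. f (prod_decode m)) has_sum x) UNIV"
      using has_sum_reindex_bij_betw[OF bij, of f x] fs fx has_sum_infsum by metis
  qed
qed

lemma WG_mult:
  assumes S: "\<forall>s\<in>S. norm s \<le> 1" and x: "x \<in> WG S r" and y: "y \<in> WG S s"
  shows "x * y \<in> WG S (r * s)"
proof -
  obtain P rs where P: "\<And>k::nat. Poly S (rs k) (P k)" "rs summable_on UNIV" "infsum rs UNIV \<le> r" "(P has_sum x) UNIV"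
    using x unfolding WG_def by auto
  have s0: "0 \<le> s" using WG_norm[OF S y] norm_ge_zero order_trans by blast
  have 1: "P k * y \<in> WG S (rs k * s)" for k
    by (rule WG_bl[OF bounded_linear_mult_right]) (use P(1)[of k] Poly_nonneg y in \<open>auto intro: Poly_mult\<close>)
  have 2: "(\<lambda>k. rs k * s) summable_on UNIV" using P(2) by (rule summable_on_cmult_left)
  have 3: "((\<lambda>k. P k * y) has_sum x * y) UNIV"
    by (rule has_sum_bounded_linear[OF bounded_linear_mult_left P(4)])
  have "x * y \<in> WG S (infsum (\<lambda>k. rs k * s) UNIV)" by (rule WG_infsum[OF S 1 2 3])
  then show ?thesis by (rule WG_mono) (use P(2,3) s0 in \<open>simp add: infsum_cmult_left mult_right_mono\<close>)
qed

text \<open>Word gauges are gauges; inversion is the Neumann series.\<close>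
lemma gauge_WG: assumes S: "\<forall>s\<in>S. norm s \<le> 1" shows "gauge (WG S)"
proof
  fix x y :: 'a and r s c :: real
  show "x \<in> WG S r \<Longrightarrow> norm x \<le> r" using WG_norm[OF S] .
  show "x \<in> WG S r \<Longrightarrow> r \<le> s \<Longrightarrow> x \<in> WG S s" by (rule WG_mono)
  show "0 \<in> WG S 0" by (intro Poly_WG Poly_zero) simp
  show one: "1 \<in> WG S 1" using Poly_WG[OF Poly_word[of "[]"]] by simp
  show "x \<in> WG S r \<Longrightarrow> y \<in> WG S s \<Longrightarrow> x + y \<in> WG S (r + s)" by (rule WG_add)
  show "x \<in> WG S r \<Longrightarrow> c *\<^sub>R x \<in> WG S (\<bar>c\<bar> * r)"
    by (rule WG_bl[OF bounded_linear_scaleR_right]) (auto intro: Poly_scale)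
  show "x \<in> WG S r \<Longrightarrow> y \<in> WG S s \<Longrightarrow> x * y \<in> WG S (r * s)" by (rule WG_mult[OF S])
  assume x: "x \<in> WG S r" and r: "r < 1"
  obtain y where y: "((\<lambda>n. (- x) ^ Suc n) has_sum y) UNIV" "(1 + x) * (1 + y) = 1" "(1 + y) * (1 + x) = 1"
    using neumann[OF WG_norm[OF S x] r] by blast
  have r0: "0 \<le> r" using WG_norm[OF S x] norm_ge_zero order_trans by blast
  have mx: "- x \<in> WG S r" using WG_bl[OF bounded_linear_scaleR_right[of "-1"] _ _ x, of 1] Poly_scale[of S _ _ "-1"] by simp
  have pw: "(- x) ^ n \<in> WG S (r ^ n)" for n
    by (induction n) (auto simp only: power_0 power_Suc intro: one WG_mult[OF S mx])
  have gs: "((\<lambda>n. r ^ Suc n) has_sum (r / (1 - r))) UNIV"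
  proof (rule norm_summable_imp_has_sum)
    show "(\<lambda>n. r ^ Suc n) sums (r / (1 - r))" using sums_mult[OF geometric_sums[of r], of r] r r0 by simp
    then show "summable (\<lambda>n. norm (r ^ Suc n))" using r0 sums_summable by fastforce
  qed
  have "y \<in> WG S (infsum (\<lambda>n. r ^ Suc n) UNIV)"
    by (rule WG_infsum[OF S pw has_sum_imp_summable[OF gs] y(1)])
  then show "\<exists>y\<in>WG S (r / (1 - r)). (1 + x) * (1 + y) = 1 \<and> (1 + y) * (1 + x) = 1"
    using y infsumI[OF gs] by metis
qed

text \<open>Elements of the gauge are approximated, in the gauge, by polynomials.\<close>
lemma WG_split:
  assumes x: "x \<in> WG S r" and e: "0 < e"
  obtains p q where "x = p + q" "Poly S r p" "q \<in> WG S e"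
proof -
  obtain P rs where P: "\<And>k::nat. Poly S (rs k) (P k)" "rs summable_on UNIV" "infsum rs UNIV \<le> r" "(P has_sum x) UNIV"
    using x unfolding WG_def by auto
  have rs0: "0 \<le> rs k" for k using P(1) Poly_nonneg by blast
  have "(\<lambda>n. \<Sum>k<n. rs k) \<longlonglongrightarrow> infsum rs UNIV"
    using has_sum_imp_sums[OF has_sum_infsum[OF P(2)]] by (simp add: sums_def)
  then obtain n where n: "\<bar>(\<Sum>k<n. rs k) - infsum rs UNIV\<bar> < e" using e unfolding LIMSEQ_def dist_real_def by blast
  have poly: "Poly S (\<Sum>k<m. rs k) (\<Sum>k<m. P k)" for m
    by (induction m) (auto intro: Poly_zero Poly_add P)
  have le: "(\<Sum>k<n. rs k) \<le> infsum rs UNIV"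
    by (rule finite_sum_le_infsum[OF P(2)]) (auto intro: rs0)
  have t1: "((\<lambda>k. if k < n then P k else 0) has_sum (\<Sum>k<n. P k)) UNIV"
    by (rule has_sum_finite_neutralI[of "{..<n}"]) auto
  have t2: "((\<lambda>k. if k < n then rs k else 0) has_sum (\<Sum>k<n. rs k)) UNIV"
    by (rule has_sum_finite_neutralI[of "{..<n}"]) auto
  have h1: "((\<lambda>k. P k - (if k < n then P k else 0)) has_sum (x - (\<Sum>k<n. P k))) UNIV"
    by (intro has_sum_diff' P t1)
  have h2: "((\<lambda>k. rs k - (if k < n then rs k else 0)) has_sum (infsum rs UNIV - (\<Sum>k<n. rs k))) UNIV"
    by (intro has_sum_diff' has_sum_infsum P t2)
  have "x - (\<Sum>k<n. P k) \<in> WG S e" unfolding WG_def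
    by (intro CollectI exI[of _ "\<lambda>k. P k - (if k < n then P k else 0)"] exI[of _ "\<lambda>k. rs k - (if k < n then rs k else 0)"] conjI allI h1 has_sum_imp_summable[OF h2])
       (use P infsumI[OF h2] n in \<open>auto intro: Poly_zero\<close>)
  moreover have "Poly S r (\<Sum>k<n. P k)" using Poly_mono[OF poly] le P(3) by simp
  ultimately show ?thesis using that by force
qed

section \<open>Products of almost additive maps\<close>

text \<open>The product \<open>f\<^sub>0 (u 0) * f\<^sub>1 (u 1) * \<cdots>\<close>. The number of factors is fixed by the list of maps, and only the
  arguments vary.\<close>
primrec germ_prod :: "('a \<Rightarrow> 'a::monoid_mult) list \<Rightarrow> (nat \<Rightarrow> 'a) \<Rightarrow> 'a" where
  "germ_prod [] u = 1"
| "germ_prod (f # fs) u = f (u 0) * germ_prod fs (\<lambda>i. u (Suc i))"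

context gauge begin

text \<open>\<open>f\<close> is a homomorphism from small elements to the group up to weights of second order, and it takes elements of
  size \<open>s\<close> to weight of order \<open>s\<close>.\<close>
definition almost_additive :: "real \<Rightarrow> real \<Rightarrow> ('a \<Rightarrow> 'a) \<Rightarrow> bool" where
  "almost_additive C s0 f \<longleftrightarrow> f 0 = 1 \<and> (\<forall>s b. s \<le> s0 \<longrightarrow> b \<in> G s \<longrightarrow> W (C * s) (f b)) \<and>
    (\<forall>s s' b b'. s \<le> s0 \<longrightarrow> s' \<le> s0 \<longrightarrow> b \<in> G s \<longrightarrow> b' \<in> G s' \<longrightarrow> near (C * s * s') (f (b + b')) (f b * f b'))"

text \<open>The same for products of several maps, as a function of all arguments at once.\<close>
definition almost_additive_list :: "real \<Rightarrow> real \<Rightarrow> ('a \<Rightarrow> 'a) list \<Rightarrow> bool" where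
  "almost_additive_list C s0 fs \<longleftrightarrow> (\<forall>s u. s \<le> s0 \<longrightarrow> (\<forall>i. u i \<in> G s) \<longrightarrow> W (C * s) (germ_prod fs u)) \<and>
    (\<forall>s s' u v. s \<le> s0 \<longrightarrow> s' \<le> s0 \<longrightarrow> (\<forall>i. u i \<in> G s) \<longrightarrow> (\<forall>i. v i \<in> G s') \<longrightarrow>
       near (C * s * s') (germ_prod fs (\<lambda>i. u i + v i)) (germ_prod fs u * germ_prod fs v))"

lemma almost_additive_list_W: "almost_additive_list C s0 fs \<Longrightarrow> s \<le> s0 \<Longrightarrow> \<forall>i. u i \<in> G s \<Longrightarrow> W (C * s) (germ_prod fs u)"
  unfolding almost_additive_list_def by simp
lemma almost_additive_list_near: "almost_additive_list C s0 fs \<Longrightarrow> s \<le> s0 \<Longrightarrow> s' \<le> s0 \<Longrightarrow> \<forall>i. u i \<in> G s \<Longrightarrow> \<forall>i. v i \<in> G s' \<Longrightarrow>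
  near (C * s * s') (germ_prod fs (\<lambda>i. u i + v i)) (germ_prod fs u * germ_prod fs v)"
  unfolding almost_additive_list_def by simp

lemma kap_pos: "0 < kap" by (simp add: kap_def)

text \<open>Reordering the factors produces only errors of second order, since elements of weights \<open>e\<close> and \<open>d\<close> commute up to
  weight of order \<open>e * d\<close>.\<close>
lemma almost_additive_list_exists:
  assumes "\<forall>f\<in>set fs. \<exists>C s0. 0 < C \<and> 0 < s0 \<and> almost_additive C s0 f"
  shows "\<exists>C s0. 0 < C \<and> 0 < s0 \<and> almost_additive_list C s0 fs"
  using assms
proof (induction fs)
  case Nil
  have "almost_additive_list 1 1 []" unfolding almost_additive_list_def
  proof (intro conjI allI impI)
    fix s :: real and u :: "nat \<Rightarrow> 'a" assume u: "\<forall>i. u i \<in> G s"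
    then have s: "0 \<le> s" using G_nonneg by blast
    then show "W (1 * s) (germ_prod [] u)" by (simp add: W_one)
    fix s' :: real and v :: "nat \<Rightarrow> 'a" assume "\<forall>i. v i \<in> G s'"
    then have "0 \<le> s'" using G_nonneg by blast
    then have "0 \<le> s * s'" using s by simp
    then show "near (1 * s * s') (germ_prod [] (\<lambda>i. u i + v i)) (germ_prod [] u * germ_prod [] v)" using near_refl[of "s * s'"] by simp
  qed
  then show ?case by (intro exI[of _ "1::real"] conjI) simp_all
next
  case (Cons f fs)
  obtain A a where A: "0 < A" "0 < a" "almost_additive A a f" using Cons.prems by auto
  obtain B b where B: "0 < B" "0 < b" "almost_additive_list B b fs" using Cons by auto
  define C where "C = A + B + 2 * A + B + 32 * A * B"
  define s0 where "s0 = min (min a b) (min 1 (kap / (16 * (1 + A) * (1 + B))))"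
  have C: "0 < C" using A B by (simp add: C_def add_pos_pos)
  have s0: "0 < s0" using A B kap_pos by (simp add: s0_def)
  have small: "8 * (A * s) \<le> kap" "8 * (B * s) \<le> kap" "s \<le> 1" "s \<le> a" "s \<le> b" "16 * (B * s) \<le> kap" if s: "0 \<le> s" "s \<le> s0" for s
  proof -
    have "s * (16 * (1 + A) * (1 + B)) \<le> kap" using s A B by (simp add: s0_def pos_le_divide_eq)
    moreover have "16 * (A * s) \<le> s * (16 * (1 + A) * (1 + B))" "16 * (B * s) \<le> s * (16 * (1 + A) * (1 + B))"
      using s A B by (simp_all add: algebra_simps)
    moreover have "0 \<le> A * s" "0 \<le> B * s" using s A B by auto
    ultimately show "8 * (A * s) \<le> kap" "8 * (B * s) \<le> kap" "16 * (B * s) \<le> kap" by linarith+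
    show "s \<le> 1" "s \<le> a" "s \<le> b" using s by (auto simp: s0_def)
  qed
  have "almost_additive_list C s0 (f # fs)" unfolding almost_additive_list_def
  proof (intro conjI allI impI)
    fix s :: real and u :: "nat \<Rightarrow> 'a" assume s: "s \<le> s0" and u: "\<forall>i. u i \<in> G s"
    have p: "0 \<le> s" using u G_nonneg by blast
    have w1: "W (A * s) (f (u 0))" using A(3) small[OF p s] u unfolding almost_additive_def by blast
    have w2: "W (B * s) (germ_prod fs (\<lambda>i. u (Suc i)))" by (rule almost_additive_list_W[OF B(3) small(5)[OF p s]]) (use u in blast)
    have "W (A * s + B * s) (germ_prod (f # fs) u)" using W_mult[OF w2 w1] by simp
    moreover have "A * s + B * s \<le> C * s" using A B p by (simp add: C_def algebra_simps)
    ultimately show "W (C * s) (germ_prod (f # fs) u)" using W_mono by blast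
  next
    fix s s' :: real and u v :: "nat \<Rightarrow> 'a" assume s: "s \<le> s0" and s': "s' \<le> s0" and u: "\<forall>i. u i \<in> G s" and v: "\<forall>i. v i \<in> G s'"
    have p: "0 \<le> s" and p': "0 \<le> s'" using u v G_nonneg by blast+
    note sm = small[OF p s] and sm' = small[OF p' s']
    let ?u = "\<lambda>i. u (Suc i)" and ?v = "\<lambda>i. v (Suc i)"
    have w1: "W (A * s) (f (u 0))" using A(3) sm u unfolding almost_additive_def by blast
    have w1': "W (A * s') (f (v 0))" using A(3) sm' v unfolding almost_additive_def by blast
    have u': "\<forall>i. ?u i \<in> G s" and v': "\<forall>i. ?v i \<in> G s'" using u v by auto
    have w2: "W (B * s) (germ_prod fs ?u)" by (rule almost_additive_list_W[OF B(3) sm(5) u'])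
    have w2': "W (B * s') (germ_prod fs ?v)" by (rule almost_additive_list_W[OF B(3) sm'(5) v'])
    have f1: "near (A * s * s') (f (u 0 + v 0)) (f (u 0) * f (v 0))" using A(3) sm(4) sm'(4) u v unfolding almost_additive_def by blast
    have f2: "near (B * s * s') (germ_prod fs (\<lambda>i. ?u i + ?v i)) (germ_prod fs ?u * germ_prod fs ?v)" by (rule almost_additive_list_near[OF B(3) sm(5) sm'(5) u' v'])
    have nn: "0 \<le> A * s" "0 \<le> B * s" using A B p by auto
    have ss: "A * s * s' \<le> A * s" "B * s * s' \<le> B * s" using sm'(3) nn by (auto intro: mult_left_le)
    have e1: "4 * (A * s * s') \<le> kap" using ss(1) nn(1) sm(1) by linarith
    have w3: "W (B * s + B * s') (germ_prod fs ?u * germ_prod fs ?v)" using W_mult[OF w2' w2] .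
    have 1: "near (2 * (A * s * s')) (f (u 0 + v 0) * (germ_prod fs ?u * germ_prod fs ?v)) (f (u 0) * f (v 0) * (germ_prod fs ?u * germ_prod fs ?v))"
      by (rule near_right[OF f1 W_G[OF w3] _ e1]) (use sm(6) sm'(6) in \<open>auto simp: kap_def\<close>)
    have 0: "near (B * s * s') (f (u 0 + v 0) * germ_prod fs (\<lambda>i. ?u i + ?v i)) (f (u 0 + v 0) * (germ_prod fs ?u * germ_prod fs ?v))"
      by (rule near_left[OF f2])
    have 2: "near (16 * (A * s') * (B * s)) (f (v 0) * germ_prod fs ?u) (germ_prod fs ?u * f (v 0))"
      by (rule near_commute[OF w1' w2]) (use sm sm' kap_pos in auto)
    have e3: "4 * (16 * (A * s') * (B * s)) \<le> kap"
    proof -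
      have "(8 * (A * s')) * (8 * (B * s)) \<le> kap * kap" using sm sm' A B p p' by (intro mult_mono) (auto simp: kap_def)
      then show ?thesis by (simp add: kap_def)
    qed
    have 3: "near (2 * (16 * (A * s') * (B * s))) (f (v 0) * germ_prod fs ?u * germ_prod fs ?v) (germ_prod fs ?u * f (v 0) * germ_prod fs ?v)"
      by (rule near_right_W[OF 2 w2' _ e3]) (use sm' in auto)
    have 4: "near (2 * (16 * (A * s') * (B * s))) (f (u 0) * f (v 0) * (germ_prod fs ?u * germ_prod fs ?v)) (f (u 0) * germ_prod fs ?u * (f (v 0) * germ_prod fs ?v))"
      using near_left[OF 3, of "f (u 0)"] by (simp add: mult.assoc)
    have "near (B * s * s' + 2 * (A * s * s') + 2 * (16 * (A * s') * (B * s))) (germ_prod (f # fs) (\<lambda>i. u i + v i)) (germ_prod (f # fs) u * germ_prod (f # fs) v)"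
      using near_trans[OF near_trans[OF 0 1] 4] by simp
    moreover have "B * s * s' + 2 * (A * s * s') + 2 * (16 * (A * s') * (B * s)) \<le> C * s * s'"
      using A B p p' by (simp add: C_def algebra_simps)
    ultimately show "near (C * s * s') (germ_prod (f # fs) (\<lambda>i. u i + v i)) (germ_prod (f # fs) u * germ_prod (f # fs) v)" using near_mono by blast
  qed
  then show ?case using C s0 by blast
qed

lemma almost_additive_list_mono: "almost_additive_list C s0 fs \<Longrightarrow> s1 \<le> s0 \<Longrightarrow> almost_additive_list C s1 fs" unfolding almost_additive_list_def by (meson order_trans)

text \<open>\<open>g\<close> is represented by the maps \<open>fs\<close> at arguments of size \<open>e\<close>, with an error of weight \<open>d\<close>.\<close>
definition rep :: "('a \<Rightarrow> 'a) list \<Rightarrow> real \<Rightarrow> real \<Rightarrow> 'a \<Rightarrow> bool" where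
  "rep fs e d g \<longleftrightarrow> (\<exists>u. (\<forall>i. u i \<in> G e) \<and> near d g (germ_prod fs u))"

lemma rep_mono: "rep fs e d g \<Longrightarrow> e \<le> e' \<Longrightarrow> d \<le> d' \<Longrightarrow> rep fs e' d' g"
  unfolding rep_def using G_mono near_mono by meson
lemma rep_near: "rep fs e d g \<Longrightarrow> near d' h g \<Longrightarrow> rep fs e (d' + d) h"
  unfolding rep_def using near_trans by meson

lemma germ_prod_zero: "\<forall>f\<in>set fs. f 0 = 1 \<Longrightarrow> germ_prod fs (\<lambda>i. 0) = 1" by (induction fs) auto

lemma rep_one: "\<forall>f\<in>set fs. f 0 = 1 \<Longrightarrow> rep fs 0 0 1"
  unfolding rep_def by (intro exI[of _ "\<lambda>i. 0"]) (simp add: G_zero germ_prod_zero near_refl)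

text \<open>Arguments add up, errors add up, and a second-order error appears. Thus arbitrarily many small factors are gathered into a product with one factor for each map.\<close>
lemma rep_mult:
  assumes fs: "almost_additive_list C s0 fs" and C: "0 < C" and s0: "C * s0 \<le> kap / 32"
    and g: "rep fs e d g" and h: "rep fs e' d' h"
    and e: "e \<le> s0" "e' \<le> s0" and d: "d \<le> kap / 32" "d' \<le> kap / 32"
  shows "rep fs (e + e') (2 * d + d' + C * e * e') (g * h)"
proof -
  obtain u where u: "\<And>i. u i \<in> G e" "near d g (germ_prod fs u)" using g unfolding rep_def by auto
  obtain v where v: "\<And>i. v i \<in> G e'" "near d' h (germ_prod fs v)" using h unfolding rep_def by auto
  have wv: "W (C * e') (germ_prod fs v)" by (rule almost_additive_list_W[OF fs e(2)]) (use v in blast)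
  have wh: "W (C * e' + d') h" by (rule W_near[OF wv v(2)])
  have "C * e' \<le> C * s0" using C e by simp
  then have "8 * (C * e' + d') \<le> kap" using s0 d kap_pos by simp
  then have 1: "near (2 * d) (g * h) (germ_prod fs u * h)"
    by (rule near_right_W[OF u(2) wh]) (use d kap_pos in simp)
  have 2: "near d' (germ_prod fs u * h) (germ_prod fs u * germ_prod fs v)" by (rule near_left[OF v(2)])
  have 3: "near (C * e * e') (germ_prod fs u * germ_prod fs v) (germ_prod fs (\<lambda>i. u i + v i))"
    by (rule near_sym, rule almost_additive_list_near[OF fs e]) (use u v in auto)
  show ?thesis unfolding rep_def
    by (intro exI[of _ "\<lambda>i. u i + v i"]) (use near_trans[OF near_trans[OF 1 2] 3] G_add u v in auto)
qed

lemma germ_prod_single: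
  assumes "\<forall>f\<in>set fs. f 0 = 1" "k < length fs"
  shows "germ_prod fs (\<lambda>i. if i = k then b else 0) = (fs ! k) b"
  using assms
proof (induction fs arbitrary: k)
  case (Cons f fs)
  show ?case
  proof (cases k)
    case 0 then show ?thesis using Cons.prems germ_prod_zero[of fs] by simp
  next
    case (Suc k')
    have "(\<lambda>i. if Suc i = k then b else 0) = (\<lambda>i. if i = k' then b else 0)" using Suc by auto
    then show ?thesis using Suc Cons by simp
  qed
qed simp

lemma rep_single:
  assumes "\<forall>f\<in>set fs. f 0 = 1" "f \<in> set fs" "b \<in> G s"
  shows "rep fs s 0 (f b)"
proof -
  obtain k where k: "k < length fs" "fs ! k = f" using assms(2) by (auto simp: in_set_conv_nth)
  show ?thesis unfolding rep_def
    by (intro exI[of _ "\<lambda>i. if i = k then b else 0"])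
       (use germ_prod_single[OF assms(1) k(1)] k assms(3) G_nonneg[OF assms(3)] G_zero' near_refl in auto)
qed

lemma almost_additive_D: assumes x: "x \<in> G r" and r: "0 < r" shows "almost_additive (1500 * (r + 1) * (r + 1)) (rho / (8 * r)) (D x)"
proof -
  have rs: "r * s \<le> rho / 8" if "s \<le> rho / (8 * r)" for s
    using mult_left_mono[OF that, of r] r by simp
  show ?thesis unfolding almost_additive_def
  proof (intro conjI allI impI)
    fix s b assume s: "s \<le> rho / (8 * r)" and b: "b \<in> G s"
    have p: "0 \<le> s" using b G_nonneg by blast
    have "W (5 * (r * s)) (D x b)" by (rule D_W[OF x b]) (use rs[OF s] in \<open>simp add: rho_def\<close>)
    moreover have "5 * r \<le> 1500 * (r + 1) * (r + 1)"
    proof -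
      have "1500 * (r + 1) * (r + 1) = 1500 * (r * r) + 3000 * r + 1500" by (simp add: algebra_simps)
      moreover have "0 \<le> r * r" by simp
      ultimately show ?thesis using r by linarith
    qed
    from mult_right_mono[OF this p] have "5 * (r * s) \<le> 1500 * (r + 1) * (r + 1) * s" by (simp only: mult.assoc)
    ultimately show "W (1500 * (r + 1) * (r + 1) * s) (D x b)" using W_mono by blast
  next
    fix s s' b b' assume s: "s \<le> rho / (8 * r)" "s' \<le> rho / (8 * r)" and b: "b \<in> G s" "b' \<in> G s'"
    have p: "0 \<le> s" "0 \<le> s'" using b G_nonneg by auto
    have "near (1500 * (r * s) * (r * s')) (D x (b + b')) (D x b * D x b')" by (rule D_add_right[OF x b rs[OF s(1)] rs[OF s(2)]])
    moreover have "1500 * (r * s) * (r * s') \<le> 1500 * (r + 1) * (r + 1) * s * s'"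
    proof -
      have "1500 * (r * r) * (s * s') \<le> 1500 * ((r + 1) * (r + 1)) * (s * s')"
        using p r by (intro mult_right_mono) (auto simp: algebra_simps)
      then show ?thesis by (simp add: algebra_simps)
    qed
    ultimately show "near (1500 * (r + 1) * (r + 1) * s * s') (D x (b + b')) (D x b * D x b')" using near_mono by blast
  qed (simp add: D_zero_right)
qed

lemma almost_additive_D_ex: assumes "x \<in> G r" shows "\<exists>C s0. 0 < C \<and> 0 < s0 \<and> almost_additive C s0 (D x)"
proof -
  have r: "0 \<le> r" using assms G_nonneg by blast
  have "x \<in> G (r + 1)" using assms G_mono by force
  from almost_additive_D[OF this] show ?thesis using r
    by (intro exI[of _ "1500 * (r + 1 + 1) * (r + 1 + 1)"] exI[of _ "rho / (8 * (r + 1))"]) (auto simp: rho_def)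
qed

end

locale letter_gauge =
  fixes xs :: "'a::{real_normed_algebra_1,banach} list"
  assumes xs_norm: "\<forall>x\<in>set xs. norm x \<le> 1"
begin

sublocale gauge "WG (set xs)" by (rule gauge_WG[OF xs_norm])

abbreviation "LG \<equiv> WG (set xs)"
abbreviation "Ds \<equiv> map D xs"

lemma Ds0: "\<forall>f\<in>set Ds. f 0 = 1" by (simp add: D_zero_right)

lemma word_G: "set w \<subseteq> set xs \<Longrightarrow> prod_list w \<in> LG (real (length w) + 1)"
  using Poly_WG[OF Poly_word] .
lemma letter_G: "x \<in> set xs \<Longrightarrow> x \<in> LG 2" using word_G[of "[x]"] by simp

lemma almost_additive_list_Ds: "\<exists>C s0. 0 < C \<and> 0 < s0 \<and> C * s0 \<le> kap / 32 \<and> s0 \<le> 1 \<and> almost_additive_list C s0 Ds"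
proof -
  obtain C s0 where C: "0 < C" "0 < s0" "almost_additive_list C s0 Ds"
    using almost_additive_list_exists[of Ds] almost_additive_D_ex[OF letter_G] by auto
  let ?s = "min (min 1 s0) (kap / (32 * C))"
  have "C * ?s \<le> C * (kap / (32 * C))" using C by (intro mult_left_mono) auto
  then have "C * ?s \<le> kap / 32" using C by simp
  then show ?thesis using C almost_additive_list_mono[OF C(3), of ?s] kap_pos by (intro exI[of _ C] exI[of _ ?s]) auto
qed

end

section \<open>Reduction of \<open>D\<close> to single letters\<close>

context letter_gauge begin

text \<open>The Leibniz rule peels off the letters of \<open>w\<close> one by one. The cost is the number of letters of \<open>w\<close> times the total length of both
  words.\<close>
lemma word_rep:
  assumes C: "0 < C" "0 < s0" "C * s0 \<le> kap / 32" "s0 \<le> 1" "almost_additive_list C s0 Ds"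
  shows "set w \<subseteq> set xs \<Longrightarrow> set v \<subseteq> set xs \<Longrightarrow> \<bar>c\<bar> * (real (length w) + real (length v) + 1) \<le> 1/2 \<Longrightarrow>
    a = \<bar>c\<bar> * (real (length w) * (real (length w) + real (length v))) \<Longrightarrow> a \<le> s0 \<Longrightarrow> C * a * a \<le> kap / 32 \<Longrightarrow>
    rep Ds a (C * a * a) (D (prod_list w) (c *\<^sub>R prod_list v))"
proof (induction w arbitrary: v a)
  case Nil
  have "unit (1 + c *\<^sub>R prod_list v)"
    by (rule unit1[OF G_scale[OF word_G]]) (use Nil in auto)
  then show ?case using rep_one[OF Ds0] Nil by (simp add: D_one)
next
  case (Cons x w)
  let ?L = "real (length w) + 1 + real (length v)"
  define s where "s = \<bar>c\<bar> * ?L"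
  define a' where "a' = \<bar>c\<bar> * (real (length w) * ?L)"
  have a: "a = s + a'" using Cons.prems(4) by (simp add: s_def a'_def algebra_simps)
  have pos: "0 \<le> s" "0 \<le> a'" by (auto simp: s_def a'_def)
  have xs: "x \<in> set xs" "set w \<subseteq> set xs" "set (v @ [x]) \<subseteq> set xs" using Cons.prems by auto
  have sh: "\<bar>c\<bar> * (?L + 1) \<le> 1/2" using Cons.prems(3) by (simp add: algebra_simps)
  \<comment> \<open>The Leibniz rule moves the letter x to the end of the inner word; the total length stays the same.\<close>
  have wv: "c *\<^sub>R prod_list (w @ v) \<in> LG s"
    using G_scale[OF word_G[of "w @ v"], of c] Cons.prems by (simp add: s_def algebra_simps)
  have r1: "rep Ds s 0 (D x (c *\<^sub>R prod_list (w @ v)))"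
    by (rule rep_single[OF Ds0 _ wv]) (use xs in simp)
  have aa: "C * a' * a' \<le> C * a * a" using a pos C by (intro mult_mono) auto
  have r2: "rep Ds a' (C * a' * a') (D (prod_list w) (c *\<^sub>R prod_list (v @ [x])))"
    by (rule Cons.IH[OF xs(2,3)]) (use sh aa a pos Cons.prems in \<open>auto simp: a'_def algebra_simps\<close>)
  have u: "unit (1 + x * prod_list w * (c *\<^sub>R prod_list v))"
  proof -
    have "c *\<^sub>R prod_list (x # w @ v) \<in> LG (\<bar>c\<bar> * (?L + 1))"
      using G_scale[OF word_G[of "x # w @ v"], of c] Cons.prems by (simp add: algebra_simps)
    moreover have "\<bar>c\<bar> * (?L + 1) < 1" using sh by linarith
    ultimately have "unit (1 + c *\<^sub>R prod_list (x # w @ v))" by (rule unit1)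
    then show ?thesis by (simp add: mult.assoc)
  qed
  have "D (prod_list (x # w)) (c *\<^sub>R prod_list v) = D x (c *\<^sub>R prod_list (w @ v)) * D (prod_list w) (c *\<^sub>R prod_list (v @ [x]))"
    using D_mult[OF u] by (simp add: mult.assoc)
  moreover have "rep Ds (s + a') (2 * 0 + C * a' * a' + C * s * a') (D x (c *\<^sub>R prod_list (w @ v)) * D (prod_list w) (c *\<^sub>R prod_list (v @ [x])))"
    by (rule rep_mult[OF C(5,1,3) r1 r2]) (use a pos Cons.prems aa kap_pos in auto)
  moreover have "2 * 0 + C * a' * a' + C * s * a' \<le> C * a * a"
  proof -
    have "C * a * a = C * a' * a' + C * s * a' + (C * (s * a') + C * (s * s))" by (simp add: a algebra_simps)
    moreover have "0 \<le> C * (s * a') + C * (s * s)" using pos C by (intro add_nonneg_nonneg mult_nonneg_nonneg) auto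
    ultimately show ?thesis by linarith
  qed
  ultimately show ?case using rep_mono a by (metis order_refl)
qed

text \<open>The previous bound is quadratic in the length of \<open>w\<close>. As \<open>iv (D w v) = D v w\<close>, the shorter of the two words may be
  peeled off, and then the cost is bounded by the product of the weights of the two words.\<close>
lemma wordpair_rep:
  "\<exists>C \<rho>. 0 < C \<and> 0 < \<rho> \<and> (\<forall>w v c A. set w \<subseteq> set xs \<longrightarrow> set v \<subseteq> set xs \<longrightarrow>
     A = \<bar>c\<bar> * ((real (length w) + 1) * (real (length v) + 1)) \<longrightarrow> A \<le> \<rho> \<longrightarrow>
     rep Ds (2 * A) (C * A * A) (D (prod_list w) (c *\<^sub>R prod_list v)))"
proof -
  obtain C s0 where C: "0 < C" "0 < s0" "C * s0 \<le> kap / 32" "s0 \<le> 1" "almost_additive_list C s0 Ds" using almost_additive_list_Ds by blast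
  define \<rho> where "\<rho> = min (s0 / 2) (rho / 8)"
  have r: "0 < \<rho>" using C by (simp add: \<rho>_def rho_def)
  have key: "rep Ds (2 * A) (4 * C * A * A) (D (prod_list w) (c *\<^sub>R prod_list v))"
    if w: "set w \<subseteq> set xs" "set v \<subseteq> set xs" and A: "A = \<bar>c\<bar> * ((real (length w) + 1) * (real (length v) + 1))" "A \<le> \<rho>"
      and le: "length w \<le> length v" for w v c A
  proof -
    define a where "a = \<bar>c\<bar> * (real (length w) * (real (length w) + real (length v)))"
    have "real (length w) * (real (length w) + real (length v)) \<le> real (length w) * (2 * real (length v))"
      using le by (intro mult_left_mono) auto
    also have "\<dots> \<le> 2 * ((real (length w) + 1) * (real (length v) + 1))" by (simp add: algebra_simps)
    finally have "a \<le> \<bar>c\<bar> * (2 * ((real (length w) + 1) * (real (length v) + 1)))" unfolding a_def by (rule mult_left_mono) simp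
    then have a2: "a \<le> 2 * A" using A by simp
    have a0: "0 \<le> a" by (simp add: a_def)
    have sm: "2 * A \<le> s0" "A \<le> 1/2" using A(2) r by (auto simp: \<rho>_def rho_def)
    have "\<bar>c\<bar> * (real (length w) + real (length v) + 1) \<le> A" unfolding A(1) by (intro mult_left_mono) (auto simp: algebra_simps)
    then have sh: "\<bar>c\<bar> * (real (length w) + real (length v) + 1) \<le> 1/2" using sm by simp
    have ca: "C * a \<le> C * s0" using a2 sm C by simp
    have "C * a * a \<le> C * s0 * 1" using ca a2 sm C a0 by (intro mult_mono) auto
    then have cc: "C * a * a \<le> kap / 32" using C(3) by linarith
    have "rep Ds a (C * a * a) (D (prod_list w) (c *\<^sub>R prod_list v))"
      by (rule word_rep[OF C w sh a_def _ cc]) (use a2 sm in simp)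
    moreover have "C * a * a \<le> 4 * C * A * A"
    proof -
      have "a * a \<le> (2 * A) * (2 * A)" using a2 a0 by (intro mult_mono) auto
      then show ?thesis using mult_left_mono[of "a * a" "(2 * A) * (2 * A)" C] C by (simp add: mult_ac)
    qed
    ultimately show ?thesis using rep_mono a2 by blast
  qed
  have main: "rep Ds (2 * A) ((4 * C + 1500) * A * A) (D (prod_list w) (c *\<^sub>R prod_list v))"
    if w: "set w \<subseteq> set xs" "set v \<subseteq> set xs" and A: "A = \<bar>c\<bar> * ((real (length w) + 1) * (real (length v) + 1))" "A \<le> \<rho>" for w v c A
  proof (cases "length w \<le> length v")
    case True
    have "4 * C * A * A \<le> (4 * C + 1500) * A * A" by (simp add: distrib_right mult.assoc)
    then show ?thesis using key[OF w A True] rep_mono by blast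
  next
    case False
    have g: "prod_list v \<in> LG (real (length v) + 1)" "c *\<^sub>R prod_list w \<in> LG (\<bar>c\<bar> * (real (length w) + 1))"
      using word_G w G_scale by auto
    have e: "(real (length v) + 1) * (\<bar>c\<bar> * (real (length w) + 1)) = A" using A(1) by (simp add: mult_ac)
    have Ar: "A \<le> rho / 8" using A(2) by (simp add: \<rho>_def)
    have u: "unit (1 + prod_list v * (c *\<^sub>R prod_list w))"
      by (rule unit1[OF G_mult[OF g]]) (use e Ar in \<open>simp add: rho_def\<close>)
    have "D (prod_list w) (c *\<^sub>R prod_list v) = D (c *\<^sub>R prod_list w) (prod_list v)" by (simp add: D_scale)
    also have "\<dots> = iv (D (prod_list v) (c *\<^sub>R prod_list w))" using iv_D[OF u] by simp
    \<comment> \<open>The longer word is moved to the second argument by inversion.\<close>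
    finally have 1: "near (1500 * A * A) (D (prod_list w) (c *\<^sub>R prod_list v)) (D (prod_list v) ((- c) *\<^sub>R prod_list w))"
      using D_neg[OF g] e Ar by simp
    have "rep Ds (2 * A) (4 * C * A * A) (D (prod_list v) ((- c) *\<^sub>R prod_list w))"
      by (rule key) (use w A False in \<open>auto simp: mult_ac\<close>)
    from rep_near[OF this 1] show ?thesis by (simp add: distrib_right add.commute)
  qed
  show ?thesis
    by (intro exI[of _ "4 * C + 1500"] exI[of _ \<rho>]) (use main r C in auto)
qed

text \<open>Additivity in the second argument, one monomial at a time.\<close>
lemma polyR_rep:
  "\<exists>C \<rho>. 0 < C \<and> 0 < \<rho> \<and> (\<forall>w c q Q. set w \<subseteq> set xs \<longrightarrow> Poly (set xs) q Q \<longrightarrow>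
     \<bar>c\<bar> * (real (length w) + 1) * q \<le> \<rho> \<longrightarrow>
     rep Ds (2 * (\<bar>c\<bar> * (real (length w) + 1) * q)) (C * (\<bar>c\<bar> * (real (length w) + 1) * q)\<^sup>2) (D (c *\<^sub>R prod_list w) Q))"
proof -
  obtain C s0 where C: "0 < C" "0 < s0" "C * s0 \<le> kap / 32" "s0 \<le> 1" "almost_additive_list C s0 Ds" using almost_additive_list_Ds by blast
  obtain C1 \<rho>1 where C1: "0 < C1" "0 < \<rho>1" and wp: "\<And>w v c A. set w \<subseteq> set xs \<Longrightarrow> set v \<subseteq> set xs \<Longrightarrow>
     A = \<bar>c\<bar> * ((real (length w) + 1) * (real (length v) + 1)) \<Longrightarrow> A \<le> \<rho>1 \<Longrightarrow>
     rep Ds (2 * A) (C1 * A * A) (D (prod_list w) (c *\<^sub>R prod_list v))" using wordpair_rep by blast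
  define C2 where "C2 = 2 * C1 + 4 * C + 1500"
  define \<rho> where "\<rho> = min (min \<rho>1 (s0 / 2)) (min (rho / 8) (kap / (32 * (C1 + C2))))"
  have C2: "0 < C2" "0 < C1 + C2" using C C1 by (auto simp: C2_def)
  have r: "0 < \<rho>" using C C1 C2 kap_pos by (simp add: \<rho>_def rho_def)
  have sq: "C' * A\<^sup>2 \<le> kap / 32" if "0 \<le> A" "A \<le> \<rho>" "C' = C1 \<or> C' = C2" for A C'
  proof -
    have A1: "A \<le> 1" "A \<le> kap / (32 * (C1 + C2))" using that r by (auto simp: \<rho>_def rho_def)
    have "C' * A\<^sup>2 \<le> (C1 + C2) * A" using that A1 C1 C2 unfolding power2_eq_square
      by (intro mult_mono) (auto simp: mult_left_le)
    also have "\<dots> \<le> (C1 + C2) * (kap / (32 * (C1 + C2)))" using A1 C2 by (intro mult_left_mono) auto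
    also have "\<dots> = kap / 32"
    proof -
      have "x * (kap / (32 * x)) = kap / 32" if "0 < x" for x using that by simp
      then show ?thesis using C2 by blast
    qed
    finally show ?thesis .
  qed
  have main: "Poly (set xs) q Q \<Longrightarrow> k * q \<le> \<rho> \<Longrightarrow> rep Ds (2 * (k * q)) (C2 * (k * q)\<^sup>2) (D (c *\<^sub>R prod_list w) Q)"
    if w: "set w \<subseteq> set xs" and k: "k = \<bar>c\<bar> * (real (length w) + 1)" for w c q Q k
  proof (induction rule: Poly.induct)
    case (Poly_zero q)
    have "0 \<le> k * q" using k Poly_zero by simp
    then show ?case using rep_mono[OF rep_one[OF Ds0]] C2 by (simp add: D_zero_right)
  next
    case (Poly_step q Q v d)
    let ?q' = "\<bar>d\<bar> * (real (length v) + 1)"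
    have pos: "0 \<le> k" "0 \<le> q" "0 \<le> ?q'" using k Poly_nonneg[OF Poly_step(1)] by auto
    define A where "A = k * q"
    define A' where "A' = k * ?q'"
    have AA: "0 \<le> A" "0 \<le> A'" "k * (q + ?q') = A + A'" using pos by (auto simp: A_def A'_def distrib_left)
    have le: "A + A' \<le> \<rho>" using Poly_step.prems AA by simp
    have gw: "c *\<^sub>R prod_list w \<in> LG k" using G_scale[OF word_G[OF w], of c] k by simp
    have gQ: "Q \<in> LG q" using Poly_WG Poly_step by blast
    have gv: "d *\<^sub>R prod_list v \<in> LG ?q'" using G_scale[OF word_G] Poly_step by blast
    have 1: "rep Ds (2 * A') (C1 * A'\<^sup>2) (D (c *\<^sub>R prod_list w) (d *\<^sub>R prod_list v))"
      using wp[OF w Poly_step.hyps(2), of A' "c * d"] le AA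
      by (simp add: D_scale A'_def k abs_mult mult_ac power2_eq_square \<rho>_def)
    have 2: "rep Ds (2 * A) (C2 * A\<^sup>2) (D (c *\<^sub>R prod_list w) Q)"
      using Poly_step.IH le AA by (simp add: A_def)
    have 3: "rep Ds (2 * A' + 2 * A) (2 * (C1 * A'\<^sup>2) + C2 * A\<^sup>2 + C * (2 * A') * (2 * A)) (D (c *\<^sub>R prod_list w) (d *\<^sub>R prod_list v) * D (c *\<^sub>R prod_list w) Q)"
      by (rule rep_mult[OF C(5,1,3) 1 2]) (use le AA sq in \<open>auto simp: \<rho>_def\<close>)
    have 4: "near (1500 * A' * A) (D (c *\<^sub>R prod_list w) (Q + d *\<^sub>R prod_list v)) (D (c *\<^sub>R prod_list w) (d *\<^sub>R prod_list v) * D (c *\<^sub>R prod_list w) Q)"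
      using D_add_right[OF gw gv gQ] le AA by (simp add: A_def A'_def \<rho>_def add.commute)
    have 5: "rep Ds (2 * A' + 2 * A) (1500 * A' * A + (2 * (C1 * A'\<^sup>2) + C2 * A\<^sup>2 + C * (2 * A') * (2 * A))) (D (c *\<^sub>R prod_list w) (Q + d *\<^sub>R prod_list v))"
      by (rule rep_near[OF 3 4])
    have 6: "1500 * A' * A + (2 * (C1 * A'\<^sup>2) + C2 * A\<^sup>2 + C * (2 * A') * (2 * A)) \<le> C2 * (A + A')\<^sup>2"
    proof -
      have "C2 * (A + A')\<^sup>2 = C2 * A\<^sup>2 + C2 * A'\<^sup>2 + 2 * C2 * (A' * A)" by (simp add: power2_eq_square algebra_simps)
      moreover have "2 * C1 * A'\<^sup>2 \<le> C2 * A'\<^sup>2" using C C1 by (intro mult_right_mono) (auto simp: C2_def)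
      moreover have "(1500 + 4 * C) * (A' * A) \<le> 2 * C2 * (A' * A)" using C C1 AA by (intro mult_right_mono) (auto simp: C2_def)
      moreover have "(1500 + 4 * C) * (A' * A) = 1500 * A' * A + C * (2 * A') * (2 * A)" by (simp add: algebra_simps)
      ultimately show ?thesis by (simp only: mult.assoc)
    qed
    show ?case unfolding AA(3) by (rule rep_mono[OF 5 _ 6]) simp
  qed
  show ?thesis
    by (intro exI[of _ C2] exI[of _ \<rho>]) (use main r C2 in auto)
qed

text \<open>Additivity in the first argument, one monomial at a time.\<close>
lemma polyL_rep:
  "\<exists>C \<rho>. 0 < C \<and> 0 < \<rho> \<and> (\<forall>p P q Q. Poly (set xs) p P \<longrightarrow> Poly (set xs) q Q \<longrightarrow> p * q \<le> \<rho> \<longrightarrow>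
     rep Ds (2 * (p * q)) (C * (p * q)\<^sup>2) (D P Q))"
proof -
  obtain C s0 where C: "0 < C" "0 < s0" "C * s0 \<le> kap / 32" "s0 \<le> 1" "almost_additive_list C s0 Ds" using almost_additive_list_Ds by blast
  obtain C1 \<rho>1 where C1: "0 < C1" "0 < \<rho>1" and wp: "\<And>w c q Q. set w \<subseteq> set xs \<Longrightarrow> Poly (set xs) q Q \<Longrightarrow>
     \<bar>c\<bar> * (real (length w) + 1) * q \<le> \<rho>1 \<Longrightarrow>
     rep Ds (2 * (\<bar>c\<bar> * (real (length w) + 1) * q)) (C1 * (\<bar>c\<bar> * (real (length w) + 1) * q)\<^sup>2) (D (c *\<^sub>R prod_list w) Q)" using polyR_rep by blast
  define C2 where "C2 = 2 * C1 + 4 * C + 1500"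
  define \<rho> where "\<rho> = min (min \<rho>1 (s0 / 2)) (min (rho / 8) (kap / (32 * (C1 + C2))))"
  have C2: "0 < C2" "0 < C1 + C2" using C C1 by (auto simp: C2_def)
  have r: "0 < \<rho>" using C C1 C2 kap_pos by (simp add: \<rho>_def rho_def)
  have sq: "C' * A\<^sup>2 \<le> kap / 32" if "0 \<le> A" "A \<le> \<rho>" "C' = C1 \<or> C' = C2" for A C'
  proof -
    have A1: "A \<le> 1" "A \<le> kap / (32 * (C1 + C2))" using that r by (auto simp: \<rho>_def rho_def)
    have "C' * A\<^sup>2 \<le> (C1 + C2) * A" using that A1 C1 C2 unfolding power2_eq_square
      by (intro mult_mono) (auto simp: mult_left_le)
    also have "\<dots> \<le> (C1 + C2) * (kap / (32 * (C1 + C2)))" using A1 C2 by (intro mult_left_mono) auto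
    also have "\<dots> = kap / 32"
    proof -
      have "x * (kap / (32 * x)) = kap / 32" if "0 < x" for x using that by simp
      then show ?thesis using C2 by blast
    qed
    finally show ?thesis .
  qed
  have main: "Poly (set xs) p P \<Longrightarrow> p * q \<le> \<rho> \<Longrightarrow> rep Ds (2 * (p * q)) (C2 * (p * q)\<^sup>2) (D P Q)"
    if Q: "Poly (set xs) q Q" for p P q Q
  proof (induction rule: Poly.induct)
    case (Poly_zero p)
    have "0 \<le> p * q" using Poly_nonneg[OF Q] Poly_zero by simp
    then show ?case using rep_mono[OF rep_one[OF Ds0]] C2 by (simp add: D_zero_left)
  next
    case (Poly_step p P v d)
    let ?p' = "\<bar>d\<bar> * (real (length v) + 1)"
    have pos: "0 \<le> q" "0 \<le> p" "0 \<le> ?p'" using Poly_nonneg[OF Q] Poly_nonneg[OF Poly_step(1)] by auto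
    define A where "A = p * q"
    define A' where "A' = ?p' * q"
    have AA: "0 \<le> A" "0 \<le> A'" "(p + ?p') * q = A + A'" using pos by (auto simp: A_def A'_def distrib_right)
    have le: "A + A' \<le> \<rho>" using Poly_step.prems AA by simp
    have gP: "P \<in> LG p" using Poly_WG Poly_step by blast
    have gQ: "Q \<in> LG q" using Poly_WG Q by blast
    have gv: "d *\<^sub>R prod_list v \<in> LG ?p'" using G_scale[OF word_G] Poly_step by blast
    have 1: "rep Ds (2 * A') (C1 * A'\<^sup>2) (D (d *\<^sub>R prod_list v) Q)"
      using wp[OF Poly_step.hyps(2) Q, of d] le AA by (simp add: A'_def \<rho>_def)
    have 2: "rep Ds (2 * A) (C2 * A\<^sup>2) (D P Q)"
      using Poly_step.IH le AA by (simp add: A_def)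
    have 3: "rep Ds (2 * A' + 2 * A) (2 * (C1 * A'\<^sup>2) + C2 * A\<^sup>2 + C * (2 * A') * (2 * A)) (D (d *\<^sub>R prod_list v) Q * D P Q)"
      by (rule rep_mult[OF C(5,1,3) 1 2]) (use le AA sq in \<open>auto simp: \<rho>_def\<close>)
    have 4: "near (500 * A' * A) (D (P + d *\<^sub>R prod_list v) Q) (D (d *\<^sub>R prod_list v) Q * D P Q)"
      using D_add_left[OF gv gP gQ] le AA by (simp add: A_def A'_def \<rho>_def add.commute)
    have 5: "rep Ds (2 * A' + 2 * A) (500 * A' * A + (2 * (C1 * A'\<^sup>2) + C2 * A\<^sup>2 + C * (2 * A') * (2 * A))) (D (P + d *\<^sub>R prod_list v) Q)"
      by (rule rep_near[OF 3 4])
    have 6: "500 * A' * A + (2 * (C1 * A'\<^sup>2) + C2 * A\<^sup>2 + C * (2 * A') * (2 * A)) \<le> C2 * (A + A')\<^sup>2"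
    proof -
      have "C2 * (A + A')\<^sup>2 = C2 * A\<^sup>2 + C2 * A'\<^sup>2 + 2 * C2 * (A' * A)" by (simp add: power2_eq_square algebra_simps)
      moreover have "2 * C1 * A'\<^sup>2 \<le> C2 * A'\<^sup>2" using C C1 by (intro mult_right_mono) (auto simp: C2_def)
      moreover have "(500 + 4 * C) * (A' * A) \<le> 2 * C2 * (A' * A)" using C C1 AA by (intro mult_right_mono) (auto simp: C2_def)
      moreover have "(500 + 4 * C) * (A' * A) = 500 * A' * A + C * (2 * A') * (2 * A)" by (simp add: algebra_simps)
      ultimately show ?thesis by (simp only: mult.assoc)
    qed
    show ?case unfolding AA(3) by (rule rep_mono[OF 5 _ 6]) simp
  qed
  show ?thesis
    by (intro exI[of _ C2] exI[of _ \<rho>]) (use main r C2 in auto)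
qed

text \<open>By approximation the reduction to letters extends to the whole gauge at the price of an arbitrarily small additional error.\<close>
lemma D_rep:
  "\<exists>C \<rho>. 0 < C \<and> 0 < \<rho> \<and> (\<forall>p P q Q \<eta>. P \<in> LG p \<longrightarrow> Q \<in> LG q \<longrightarrow> p * q \<le> \<rho> \<longrightarrow> 0 < \<eta> \<longrightarrow>
     rep Ds (2 * (p * q)) (C * (p * q)\<^sup>2 + \<eta>) (D P Q))"
proof -
  obtain C \<rho>1 where C: "0 < C" "0 < \<rho>1" and pp: "\<And>p P q Q. Poly (set xs) p P \<Longrightarrow> Poly (set xs) q Q \<Longrightarrow> p * q \<le> \<rho>1 \<Longrightarrow>
     rep Ds (2 * (p * q)) (C * (p * q)\<^sup>2) (D P Q)" using polyL_rep by blast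
  define \<rho> where "\<rho> = min \<rho>1 (rho / 8)"
  have r: "0 < \<rho>" using C by (simp add: \<rho>_def rho_def)
  have "rep Ds (2 * (p * q)) (C * (p * q)\<^sup>2 + \<eta>) (D P Q)"
    if P: "P \<in> LG p" and Q: "Q \<in> LG q" and pq: "p * q \<le> \<rho>" and \<eta>: "0 < \<eta>" for p P q Q \<eta>
  proof -
    have pos: "0 \<le> p" "0 \<le> q" using P Q G_nonneg by auto
    have pq8: "p * q \<le> rho / 8" "p * q \<le> 1" "0 \<le> p * q" using pq pos by (auto simp: \<rho>_def rho_def)
    define e where "e = min (rho / 8) \<eta> / (10000 * (1 + p + q))"
    have e: "0 < e" using \<eta> pos by (simp add: e_def rho_def add_pos_nonneg)
    have e1: "e * (10000 * (1 + p + q)) = min (rho / 8) \<eta>" using pos by (simp add: e_def)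
    have ep: "e * q \<le> rho / 8" "p * e \<le> rho / 8" "10000 * (e * q) + 10000 * (p * e) \<le> \<eta>"
    proof -
      have "e * 10000 + 10000 * (p * e) + 10000 * (e * q) = min (rho / 8) \<eta>" using e1 by (simp add: algebra_simps)
      moreover have "min (rho / 8) \<eta> \<le> rho / 8" "min (rho / 8) \<eta> \<le> \<eta>" by auto
      moreover have "0 \<le> p * e" "0 \<le> e * q" using e pos by auto
      ultimately show "e * q \<le> rho / 8" "p * e \<le> rho / 8" "10000 * (e * q) + 10000 * (p * e) \<le> \<eta>" using e by linarith+
    qed
    obtain P1 P2 where P12: "P = P1 + P2" "Poly (set xs) p P1" "P2 \<in> LG e" using WG_split[OF P e] by blast
    obtain Q1 Q2 where Q12: "Q = Q1 + Q2" "Poly (set xs) q Q1" "Q2 \<in> LG e" using WG_split[OF Q e] by blast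
    have g: "P1 \<in> LG p" "Q1 \<in> LG q" using P12 Q12 Poly_WG by auto
    have 1: "near (500 * (p * q) * (e * q)) (D P Q) (D P1 Q * D P2 Q)"
      unfolding P12(1) by (rule D_add_left[OF g(1) P12(3) Q pq8(1) ep(1)])
    have 2: "near (5 * (e * q)) (D P1 Q * D P2 Q) (D P1 Q)" by (rule near_W[OF D_W[OF P12(3) Q]]) (use ep rho_pos in simp)
    have 3: "near (1500 * (p * q) * (p * e)) (D P1 Q) (D P1 Q1 * D P1 Q2)"
      unfolding Q12(1) by (rule D_add_right[OF g Q12(3) pq8(1) ep(2)])
    have 4: "near (5 * (p * e)) (D P1 Q1 * D P1 Q2) (D P1 Q1)" by (rule near_W[OF D_W[OF g(1) Q12(3)]]) (use ep rho_pos in simp)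
    have 5: "near (500 * (p * q) * (e * q) + 5 * (e * q) + 1500 * (p * q) * (p * e) + 5 * (p * e)) (D P Q) (D P1 Q1)"
      using near_trans[OF near_trans[OF near_trans[OF 1 2] 3] 4] .
    have "500 * (p * q) * (e * q) \<le> 500 * (e * q)" "1500 * (p * q) * (p * e) \<le> 1500 * (p * e)"
    proof -
      have "(p * q) * (500 * (e * q)) \<le> 1 * (500 * (e * q))" "(p * q) * (1500 * (p * e)) \<le> 1 * (1500 * (p * e))"
        using pq8(2) e pos by (intro mult_right_mono; simp)+
      then show "500 * (p * q) * (e * q) \<le> 500 * (e * q)" "1500 * (p * q) * (p * e) \<le> 1500 * (p * e)"
        by (simp_all only: mult.assoc mult.left_commute mult.commute mult_1_left)
    qed
    moreover have "0 \<le> e * q" "0 \<le> p * e" using e pos by auto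
    ultimately have "500 * (p * q) * (e * q) + 5 * (e * q) + 1500 * (p * q) * (p * e) + 5 * (p * e) \<le> \<eta>" using ep(3) by linarith
    then have 6: "near \<eta> (D P Q) (D P1 Q1)" using 5 near_mono by blast
    have "rep Ds (2 * (p * q)) (C * (p * q)\<^sup>2) (D P1 Q1)" by (rule pp[OF P12(2) Q12(2)]) (use pq in \<open>simp add: \<rho>_def\<close>)
    from rep_near[OF this 6] show ?thesis by (simp add: add.commute)
  qed
  then show ?thesis using C r by blast
qed

end

section \<open>Products of small commutators in terms of letters\<close>

context gauge begin

text \<open>Inversion amounts to a change of sign of the arguments.\<close>
lemma rep_iv:
  assumes fs: "almost_additive_list C s0 fs" "\<forall>f\<in>set fs. f 0 = 1" and C: "0 < C" and s0: "C * s0 \<le> kap / 32"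
    and g: "rep fs e d g" and e: "e \<le> s0" and d: "d \<le> kap / 32"
  shows "rep fs e (2 * d + C * e * e) (iv g)"
proof -
  obtain u where u: "\<forall>i. u i \<in> G e" "near d g (germ_prod fs u)" using g unfolding rep_def by auto
  let ?v = "\<lambda>i. - u i"
  have v: "\<forall>i. ?v i \<in> G e" using u G_minus by blast
  have wu: "W (C * e) (germ_prod fs u)" by (rule almost_additive_list_W[OF fs(1) e u(1)])
  have "near (C * e * e) (germ_prod fs (\<lambda>i. u i + ?v i)) (germ_prod fs u * germ_prod fs ?v)" by (rule almost_additive_list_near[OF fs(1) e e u(1) v])
  then have "near (C * e * e) 1 (germ_prod fs u * germ_prod fs ?v)" by (simp add: germ_prod_zero[OF fs(2)])
  from near_left[OF this, of "iv (germ_prod fs u)"] have 1: "near (C * e * e) (iv (germ_prod fs u)) (germ_prod fs ?v)"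
    using W_unit[OF wu] by (simp add: iv_left')
  have ce: "C * e \<le> kap / 32" using s0 e C mult_left_mono[OF e, of C] by linarith
  have wg: "W (C * e + d) g" by (rule W_near[OF wu u(2)])
  have 2: "near (2 * d) (iv g) (iv (germ_prod fs u))"
    by (rule near_iv[OF u(2) wg wu]) (use ce d kap_pos in auto)
  show ?thesis unfolding rep_def by (rule exI[of _ ?v], rule conjI[OF v near_trans[OF 2 1]])
qed

lemma almost_additive_zero: "almost_additive C s0 f \<Longrightarrow> f 0 = 1" unfolding almost_additive_def by blast

text \<open>Almost additivity with some constants.\<close>
definition additive_germ :: "('a \<Rightarrow> 'a) \<Rightarrow> bool" where "additive_germ f \<longleftrightarrow> (\<exists>C s0. 0 < C \<and> 0 < s0 \<and> almost_additive C s0 f)"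

lemma additive_germ_mult: assumes "additive_germ f" "additive_germ g" shows "additive_germ (\<lambda>b. f b * g b)"
proof -
  have "\<forall>f\<in>set [f, g]. \<exists>C s0. 0 < C \<and> 0 < s0 \<and> almost_additive C s0 f" using assms unfolding additive_germ_def by auto
  from almost_additive_list_exists[OF this] obtain C s0 where C: "0 < C" "0 < s0" "almost_additive_list C s0 [f, g]" by blast
  have "f 0 = 1" "g 0 = 1" using assms almost_additive_zero unfolding additive_germ_def by blast+
  then have "almost_additive C s0 (\<lambda>b. f b * g b)" unfolding almost_additive_def
    using almost_additive_list_W[OF C(3), of _ "\<lambda>_. b" for b] almost_additive_list_near[OF C(3), of _ _ "\<lambda>_. b" "\<lambda>_. b'" for b b'] by simp
  then show ?thesis using C unfolding additive_germ_def by blast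
qed

lemma additive_germ_iv: assumes "additive_germ f" shows "additive_germ (\<lambda>b. iv (f b))"
proof -
  obtain C0 s1 where C0: "0 < C0" "0 < s1" "almost_additive C0 s1 f" using assms unfolding additive_germ_def by auto
  define s0 where "s0 = min (min s1 1) (kap / (32 * C0))"
  have s0: "0 < s0" using C0 kap_pos by (simp add: s0_def)
  define C where "C = 34 * C0 + 32 * C0 * C0"
  have C: "0 < C" using C0 by (simp add: C_def add_pos_pos)
  have sm: "C0 * s \<le> kap / 32" "s \<le> s1" "s \<le> 1" if "s \<le> s0" for s
  proof -
    have "C0 * s \<le> C0 * (kap / (32 * C0))" using that C0 by (intro mult_left_mono) (auto simp: s0_def)
    then show "C0 * s \<le> kap / 32" using C0 by simp
    show "s \<le> s1" "s \<le> 1" using that by (auto simp: s0_def)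
  qed
  have "almost_additive C s0 (\<lambda>b. iv (f b))" unfolding almost_additive_def
  proof (intro conjI allI impI)
    show "iv (f 0) = 1" using almost_additive_zero[OF C0(3)] by (simp add: iv_one)
    fix s b assume s: "s \<le> s0" and b: "b \<in> G s"
    have p: "0 \<le> s" using b G_nonneg by blast
    have "W (C0 * s) (f b)" using C0(3) sm(2)[OF s] b unfolding almost_additive_def by blast
    then have "W (C0 * s) (iv (f b))" by (rule W_iv)
    moreover have "C0 * s \<le> C * s" using C0 p by (intro mult_right_mono) (auto simp: C_def)
    ultimately show "W (C * s) (iv (f b))" using W_mono by blast
  next
    fix s s' b b' assume s: "s \<le> s0" "s' \<le> s0" and b: "b \<in> G s" "b' \<in> G s'"
    have p: "0 \<le> s" "0 \<le> s'" using b G_nonneg by auto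
    have w: "W (C0 * s) (f b)" "W (C0 * s') (f b')" using C0(3) sm(2)[OF s(1)] sm(2)[OF s(2)] b unfolding almost_additive_def by blast+
    have f: "near (C0 * s * s') (f (b + b')) (f b * f b')" using C0(3) sm(2)[OF s(1)] sm(2)[OF s(2)] b unfolding almost_additive_def by blast
    have w2: "W (C0 * s + C0 * s') (f b * f b')" using W_mult[OF w(2,1)] .
    have cs: "C0 * s * s' \<le> kap / 32"
    proof -
      have "0 \<le> C0 * s" using C0 p by simp
      then have "C0 * s * s' \<le> C0 * s" using sm(3)[OF s(2)] by (intro mult_left_le) auto
      then show ?thesis using sm(1)[OF s(1)] by linarith
    qed
    have w3: "W (C0 * s + C0 * s' + C0 * s * s') (f (b + b'))" by (rule W_near[OF w2 f])
    have 1: "near (2 * (C0 * s * s')) (iv (f (b + b'))) (iv (f b * f b'))"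
    proof (rule near_iv[OF f w3 w2])
      note facts = sm(1)[OF s(1)] sm(1)[OF s(2)] cs kap_pos
      show "8 * (C0 * s + C0 * s' + C0 * s * s') \<le> kap" using facts by simp
      show "8 * (C0 * s + C0 * s') \<le> kap" using facts by simp
      show "4 * (C0 * s * s') \<le> kap" using facts by simp
    qed
    have 2: "iv (f b * f b') = iv (f b') * iv (f b)" using w W_unit iv_mult by blast
    have 3: "near (16 * (C0 * s') * (C0 * s)) (iv (f b') * iv (f b)) (iv (f b) * iv (f b'))"
      by (rule near_commute[OF W_iv[OF w(2)] W_iv[OF w(1)]]) (use sm(1)[OF s(1)] sm(1)[OF s(2)] kap_pos in auto)
    have "near (2 * (C0 * s * s') + 16 * (C0 * s') * (C0 * s)) (iv (f (b + b'))) (iv (f b) * iv (f b'))"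
      using near_trans[OF 1[unfolded 2] 3] .
    moreover have "2 * (C0 * s * s') + 16 * (C0 * s') * (C0 * s) \<le> C * s * s'"
    proof -
      have "2 * (C0 * s * s') + 16 * (C0 * s') * (C0 * s) = (2 * C0 + 16 * C0 * C0) * (s * s')" by (simp add: algebra_simps)
      also have "\<dots> \<le> C * (s * s')" using C0 p by (intro mult_right_mono) (auto simp: C_def)
      finally show ?thesis by (simp add: mult.assoc)
    qed
    ultimately show "near (C * s * s') (iv (f (b + b'))) (iv (f b) * iv (f b'))" using near_mono by blast
  qed
  then show ?thesis unfolding additive_germ_def using C s0 by blast
qed

text \<open>Additive maps that are linearly bounded with respect to the gauge.\<close>
definition lb :: "('a \<Rightarrow> 'a) \<Rightarrow> bool" where
  "lb l \<longleftrightarrow> (\<forall>b b'. l (b + b') = l b + l b') \<and> (\<exists>c>0. \<forall>s b. b \<in> G s \<longrightarrow> l b \<in> G (c * s))"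

lemma lb_zero: "lb l \<Longrightarrow> l 0 = 0" unfolding lb_def by (metis add_0 add_cancel_left_left)

lemma additive_germ_comp: assumes "additive_germ f" "lb l" shows "additive_germ (\<lambda>b. f (l b))"
proof -
  obtain C s0 where C: "0 < C" "0 < s0" "almost_additive C s0 f" using assms unfolding additive_germ_def by auto
  obtain c where c: "0 < c" "\<And>s b. b \<in> G s \<Longrightarrow> l b \<in> G (c * s)" "\<And>b b'. l (b + b') = l b + l b'"
    using assms(2) unfolding lb_def by blast
  have sm: "c * s \<le> s0" if "s \<le> s0 / c" for s using that c by (simp add: pos_le_divide_eq mult.commute)
  have "almost_additive (C * c + C * c * c) (s0 / c) (\<lambda>b. f (l b))" unfolding almost_additive_def
  proof (intro conjI allI impI)
    show "f (l 0) = 1" using almost_additive_zero[OF C(3)] lb_zero[OF assms(2)] by simp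
    fix s b assume s: "s \<le> s0 / c" and b: "b \<in> G s"
    have p: "0 \<le> s" using b G_nonneg by blast
    have "W (C * (c * s)) (f (l b))" using C(3) sm[OF s] c(2)[OF b] unfolding almost_additive_def by blast
    moreover have "C * (c * s) \<le> (C * c + C * c * c) * s" using C c p by (simp add: distrib_right)
    ultimately show "W ((C * c + C * c * c) * s) (f (l b))" using W_mono by blast
  next
    fix s s' b b' assume s: "s \<le> s0 / c" "s' \<le> s0 / c" and b: "b \<in> G s" "b' \<in> G s'"
    have p: "0 \<le> s" "0 \<le> s'" using b G_nonneg by auto
    have "near (C * (c * s) * (c * s')) (f (l b + l b')) (f (l b) * f (l b'))"
      using C(3) sm s c(2) b unfolding almost_additive_def by blast
    moreover have "C * (c * s) * (c * s') \<le> (C * c + C * c * c) * s * s'"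
    proof -
      have "C * (c * s) * (c * s') = (C * c * c) * (s * s')" by (simp add: algebra_simps)
      also have "\<dots> \<le> (C * c + C * c * c) * (s * s')" using C c p by (intro mult_right_mono) auto
      finally show ?thesis by (simp add: mult.assoc)
    qed
    ultimately show "near ((C * c + C * c * c) * s * s') (f (l (b + b'))) (f (l b) * f (l b'))"
      using near_mono c(3) by metis
  qed
  moreover have "0 < C * c + C * c * c" "0 < s0 / c" using C c by (auto simp: add_pos_pos)
  ultimately show ?thesis unfolding additive_germ_def by blast
qed

text \<open>The elements of finite gauge.\<close>
definition fin :: "'a \<Rightarrow> bool" where "fin x \<longleftrightarrow> (\<exists>r. x \<in> G r)"

lemma fin_add: "fin x \<Longrightarrow> fin y \<Longrightarrow> fin (x + y)" unfolding fin_def using G_add by blast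
lemma fin_diff: "fin x \<Longrightarrow> fin y \<Longrightarrow> fin (x - y)" unfolding fin_def using G_diff by blast
lemma fin_minus: "fin x \<Longrightarrow> fin (- x)" unfolding fin_def using G_minus by blast
lemma fin_mult: "fin x \<Longrightarrow> fin y \<Longrightarrow> fin (x * y)" unfolding fin_def using G_mult by blast
lemma fin_scale: "fin x \<Longrightarrow> fin (c *\<^sub>R x)" unfolding fin_def using G_scale by blast
lemma fin_one: "fin 1" unfolding fin_def using G_one by blast
lemma fin_zero: "fin 0" unfolding fin_def using G_zero by blast
lemma fin_W: assumes "W e g" "12 * e \<le> 1" shows "fin g" "fin (iv g)"
proof -
  have "fin (g - 1)" "fin (iv g - 1)" using W_G[OF assms] W_G[OF W_iv[OF assms(1)] assms(2)] unfolding fin_def by blast+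
  then have "fin (1 + (g - 1))" "fin (1 + (iv g - 1))" using fin_add[OF fin_one] by blast+
  then show "fin g" "fin (iv g)" by simp_all
qed
lemmas fin_intros = fin_add fin_diff fin_minus fin_mult fin_scale fin_one fin_zero
lemma fin_pos: assumes "fin x" obtains r where "0 < r" "x \<in> G r"
proof -
  obtain r where "x \<in> G r" using assms unfolding fin_def by blast
  then have "x \<in> G (r + 1)" "0 < r + 1" using G_mono G_nonneg by force+
  then show ?thesis using that by blast
qed

lemma lb_id: "lb (\<lambda>b. b)" unfolding lb_def by (auto intro!: exI[of _ 1])
lemma lb_add: assumes "lb l" "lb m" shows "lb (\<lambda>b. l b + m b)"
proof -
  obtain c where c: "0 < c" "\<And>s b. b \<in> G s \<Longrightarrow> l b \<in> G (c * s)" "\<And>b b'. l (b + b') = l b + l b'" using assms(1) unfolding lb_def by blast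
  obtain d where d: "0 < d" "\<And>s b. b \<in> G s \<Longrightarrow> m b \<in> G (d * s)" "\<And>b b'. m (b + b') = m b + m b'" using assms(2) unfolding lb_def by blast
  show ?thesis unfolding lb_def
  proof (intro conjI allI exI[of _ "c + d"] impI)
    fix s b assume "b \<in> G s"
    then show "l b + m b \<in> G ((c + d) * s)" unfolding distrib_right by (intro G_add c d)
  qed (use c d in auto)
qed
lemma lb_minus: assumes "lb l" shows "lb (\<lambda>b. - l b)"
proof -
  obtain c where c: "0 < c" "\<And>s b. b \<in> G s \<Longrightarrow> l b \<in> G (c * s)" "\<And>b b'. l (b + b') = l b + l b'" using assms unfolding lb_def by blast
  show ?thesis unfolding lb_def using c G_minus by (intro conjI exI[of _ c]) auto
qed
lemma lb_diff: "lb l \<Longrightarrow> lb m \<Longrightarrow> lb (\<lambda>b. l b - m b)"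
  using lb_add[OF _ lb_minus, of l m] by simp
lemma lb_mult_left: assumes "lb l" "fin x" shows "lb (\<lambda>b. x * l b)"
proof -
  obtain c where c: "0 < c" "\<And>s b. b \<in> G s \<Longrightarrow> l b \<in> G (c * s)" "\<And>b b'. l (b + b') = l b + l b'" using assms(1) unfolding lb_def by blast
  obtain r where r: "0 < r" "x \<in> G r" using fin_pos assms(2) by blast
  show ?thesis unfolding lb_def
  proof (intro conjI allI exI[of _ "r * c"] impI)
    fix s b assume "b \<in> G s"
    then show "x * l b \<in> G (r * c * s)" unfolding mult.assoc by (intro G_mult c r)
  qed (use c r in \<open>auto simp: distrib_left\<close>)
qed
lemma lb_mult_right: assumes "lb l" "fin x" shows "lb (\<lambda>b. l b * x)"
proof -
  obtain c where c: "0 < c" "\<And>s b. b \<in> G s \<Longrightarrow> l b \<in> G (c * s)" "\<And>b b'. l (b + b') = l b + l b'" using assms(1) unfolding lb_def by blast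
  obtain r where r: "0 < r" "x \<in> G r" using fin_pos assms(2) by blast
  show ?thesis unfolding lb_def
  proof (intro conjI allI exI[of _ "c * r"] impI)
    fix s b assume "b \<in> G s"
    then have "l b * x \<in> G (c * s * r)" by (intro G_mult c r)
    then show "l b * x \<in> G (c * r * s)" by (simp add: mult_ac)
  qed (use c r in \<open>auto simp: distrib_right\<close>)
qed
lemmas lb_intros = lb_id lb_add lb_diff lb_minus lb_mult_left lb_mult_right
lemma lb_scale: assumes "lb l" shows "lb (\<lambda>b. c *\<^sub>R l b)"
  using lb_mult_left[OF assms fin_scale[OF fin_one, of c]] by simp

lemma additive_germ_D: "fin x \<Longrightarrow> additive_germ (D x)" unfolding additive_germ_def fin_def using almost_additive_D_ex by blast

text \<open>Elementary commutators are values of \<open>D\<close>. The second form has a smaller error, quadratic in the size of \<open>Q\<close>.\<close>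
lemma K_D:
  assumes P: "P \<in> G p" and Q: "Q \<in> G q" and p: "p \<le> kap / 4" and q: "q \<le> kap / 4" and pq: "p * q \<le> rho / 100"
  shows "near (60 * (p * q) * (p + q)) (K P Q) (D P Q)" "near (8 * (p * q) * q) (K P Q) (D P (Q * iv (1 + P) * iv (1 + Q * iv (1 + P))))"
    "Q * iv (1 + P) * iv (1 + Q * iv (1 + P)) \<in> G (4 * q)"
proof -
  have pos: "0 \<le> p" "0 \<le> q" using P Q G_nonneg by auto
  have u: "unit (1 + P)" "unit (1 + Q)" using unit1_kap P Q p q kap_pos by force+
  define b where "b = Q * iv (1 + P)"
  have iP: "iv (1 + P) \<in> G 2" "iv (1 + P) - 1 \<in> G (2 * p)" using iv1_G2'[OF P] iv1_G2[OF P] p by (auto simp: kap_def)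
  have b: "b \<in> G (q * 2)" unfolding b_def by (intro G_mult Q iP)
  have ub: "unit (1 + b)" by (rule unit1_kap[OF b]) (use q kap_pos in simp)
  have ib: "iv (1 + b) \<in> G 2" "iv (1 + b) - 1 \<in> G (2 * (q * 2))" using iv1_G2'[OF b] iv1_G2[OF b] q by (auto simp: kap_def)
  define B where "B = b * iv (1 + b)"
  have B: "B \<in> G (q * 2 * 2)" unfolding B_def by (intro G_mult b ib)
  have PB: "P * B \<in> G (p * (q * 2 * 2))" "B * P \<in> G (q * 2 * 2 * p)" by (intro G_mult P B)+
  have uPB: "unit (1 + P * (b * iv (1 + b)))" using unit1[OF PB(1)] pq unfolding B_def by (simp add: rho_def)
  have K: "K P Q = D P B * K (B * P) b" using K_eq_D[OF u] D_one_plus[OF ub uPB] by (simp add: b_def B_def)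
  have w: "W (q * 2 * 2 * p * (q * 2)) (K (B * P) b)"
    by (rule W_K[OF PB(2) b]) (use pq q in \<open>auto simp: kap_def rho_def mult.commute\<close>)
  have 1: "near (8 * (p * q) * q) (K P Q) (D P B)" unfolding K using near_W[OF w] by (simp add: mult_ac)
  then show "near (8 * (p * q) * q) (K P Q) (D P (Q * iv (1 + P) * iv (1 + Q * iv (1 + P))))" by (simp add: B_def b_def)
  show "Q * iv (1 + P) * iv (1 + Q * iv (1 + P)) \<in> G (4 * q)" using B by (simp add: B_def b_def)
  define v where "v = (iv (1 + P) - 1) + (iv (1 + b) - 1) + (iv (1 + P) - 1) * (iv (1 + b) - 1)"
  have v: "v \<in> G (2 * p + 2 * (q * 2) + 2 * p * (2 * (q * 2)))" unfolding v_def by (intro G_add G_mult iP ib)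
  have "2 * p + 2 * (q * 2) + 2 * p * (2 * (q * 2)) \<le> 5 * (p + q)"
  proof -
    have "p * (8 * q) \<le> p * 1" using q pos by (intro mult_left_mono) (auto simp: kap_def)
    then show ?thesis using pos by simp
  qed
  then have v': "v \<in> G (5 * (p + q))" using v G_mono by blast
  have "v = iv (1 + P) * iv (1 + b) - 1" unfolding v_def by (simp add: algebra_simps)
  then have BQ: "B = Q + Q * v" unfolding B_def b_def by (simp add: right_diff_distrib mult.assoc)
  have Qv: "Q * v \<in> G (q * (5 * (p + q)))" by (intro G_mult Q v')
  have pq1: "p + q \<le> 1/100" "0 \<le> p * q" using p q pos by (auto simp: kap_def)
  have s2: "p * (q * (5 * (p + q))) \<le> (p * q) * 1"
  proof -
    have "(p * q) * (5 * (p + q)) \<le> (p * q) * 1" using pq1 by (intro mult_left_mono) auto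
    then show ?thesis by (simp add: mult.assoc)
  qed
  have 2: "near (1500 * (p * q) * (p * (q * (5 * (p + q))))) (D P B) (D P Q * D P (Q * v))"
    unfolding BQ by (rule D_add_right[OF P Q Qv]) (use pq s2 rho_pos in linarith)+
  have 3: "near (5 * (p * (q * (5 * (p + q))))) (D P Q * D P (Q * v)) (D P Q)"
    by (rule near_W[OF D_W[OF P Qv]]) (use pq s2 rho_pos in linarith)
  have "near (8 * (p * q) * q + 1500 * (p * q) * (p * (q * (5 * (p + q)))) + 5 * (p * (q * (5 * (p + q))))) (K P Q) (D P Q)"
    using near_trans[OF near_trans[OF 1 2] 3] .
  moreover have "8 * (p * q) * q + 1500 * (p * q) * (p * (q * (5 * (p + q)))) + 5 * (p * (q * (5 * (p + q)))) \<le> 60 * (p * q) * (p + q)"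
  proof -
    define X where "X = (p * q) * (p + q)"
    have X: "0 \<le> X" using pos by (simp add: X_def)
    have "8 * (p * q) * q \<le> 8 * X" using pos by (simp add: X_def distrib_left mult_ac)
    moreover have "p * (q * (5 * (p + q))) = 5 * X" by (simp add: X_def mult_ac)
    moreover have "1500 * (p * q) * (5 * X) \<le> 1 * X"
    proof -
      have "1500 * (p * q) * 5 \<le> 1" using pq by (simp add: rho_def)
      from mult_right_mono[OF this X] show ?thesis by (simp add: mult_ac)
    qed
    ultimately have "8 * (p * q) * q + 1500 * (p * q) * (p * (q * (5 * (p + q)))) + 5 * (p * (q * (5 * (p + q)))) \<le> 60 * X" using X by simp
    then show ?thesis by (simp add: X_def mult.assoc)
  qed
  ultimately show "near (60 * (p * q) * (p + q)) (K P Q) (D P Q)" using near_mono by blast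
qed

end

context letter_gauge begin

text \<open>The error is a small fraction of the weight \<open>p * q\<close>. As the product of the sizes is small, at least one of
  the entries is well below \<open>kap\<close>; inversion exchanges the two, so this may be assumed of the second.\<close>
lemma K_rep:
  "\<exists>\<rho>. 0 < \<rho> \<and> (\<forall>p P q Q. P \<in> LG p \<longrightarrow> Q \<in> LG q \<longrightarrow> p \<le> kap \<longrightarrow> q \<le> kap \<longrightarrow> p * q \<le> \<rho> \<longrightarrow>
     rep Ds (8 * (p * q)) (p * q / 90) (K P Q))"
proof -
  obtain C s0 where C: "0 < C" "0 < s0" "C * s0 \<le> kap / 32" "s0 \<le> 1" "almost_additive_list C s0 Ds" using almost_additive_list_Ds by blast
  obtain C1 \<rho>1 where C1: "0 < C1" "0 < \<rho>1" and dr: "\<And>p P q Q \<eta>. P \<in> LG p \<Longrightarrow> Q \<in> LG q \<Longrightarrow> p * q \<le> \<rho>1 \<Longrightarrow> 0 < \<eta> \<Longrightarrow>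
     rep Ds (2 * (p * q)) (C1 * (p * q)\<^sup>2 + \<eta>) (D P Q)" using D_rep by blast
  define \<rho> where "\<rho> = min (min (\<rho>1 / 4) (rho / 100)) (min (s0 / 8) (min (1 / (16000 * C1)) (1 / (64000 * C))))"
  have r: "0 < \<rho>" using C C1 by (simp add: \<rho>_def rho_def)
  have key: "rep Ds (8 * (p * q)) (p * q / 200) (K P Q)"
    if P: "P \<in> LG p" and Q: "Q \<in> LG q" and p: "p \<le> kap" and q: "q \<le> kap / 4" and pq: "p * q \<le> \<rho>" "0 < p * q" and p4: "p \<le> kap / 4 \<or> True" for p P q Q
  proof -
    have pos: "0 \<le> p" "0 \<le> q" using P Q G_nonneg by auto
    define b where "b = Q * iv (1 + P)"
    have iP: "iv (1 + P) \<in> LG 2" using iv1_G2'[OF P] p by (auto simp: kap_def)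
    have b: "b \<in> LG (q * 2)" unfolding b_def by (intro G_mult Q iP)
    have u: "unit (1 + P)" "unit (1 + Q)" using unit1_kap P Q p q kap_pos by force+
    have ub: "unit (1 + b)" by (rule unit1_kap[OF b]) (use q kap_pos in simp)
    define B where "B = b * iv (1 + b)"
    have B: "B \<in> LG (q * 2 * 2)" unfolding B_def by (intro G_mult b iv1_G2'[OF b]) (use q in \<open>simp add: kap_def\<close>)
    have PB: "P * B \<in> LG (p * (q * 2 * 2))" "B * P \<in> LG (q * 2 * 2 * p)" by (intro G_mult P B)+
    have pr: "p * q \<le> rho / 100" using pq by (simp add: \<rho>_def)
    have uPB: "unit (1 + P * (b * iv (1 + b)))" using unit1[OF PB(1)] pr unfolding B_def by (simp add: rho_def)
    have K: "K P Q = D P B * K (B * P) b" using K_eq_D[OF u] D_one_plus[OF ub uPB] by (simp add: b_def B_def)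
    have w: "W (q * 2 * 2 * p * (q * 2)) (K (B * P) b)"
      by (rule W_K[OF PB(2) b]) (use pr q in \<open>auto simp: kap_def rho_def mult.commute\<close>)
    have 1: "near (8 * (p * q) * q) (K P Q) (D P B)" unfolding K using near_W[OF w] by (simp add: mult_ac)
    have e: "p * (q * 2 * 2) = 4 * (p * q)" by simp
    have 2: "rep Ds (2 * (p * (q * 2 * 2))) (C1 * (p * (q * 2 * 2))\<^sup>2 + p * q / 1000) (D P B)"
      by (rule dr[OF P B]) (use pq in \<open>auto simp: \<rho>_def\<close>)
    have 3: "8 * (p * q) * q + (C1 * (p * (q * 2 * 2))\<^sup>2 + p * q / 1000) \<le> p * q / 200"
    proof -
      have "8 * (p * q) * q \<le> 8 * (p * q) * (kap / 4)" using q pq by (intro mult_left_mono) auto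
      moreover have "C1 * (p * (q * 2 * 2))\<^sup>2 \<le> p * q / 1000"
      proof -
        have "p * q \<le> 1 / (16000 * C1)" using pq by (simp add: \<rho>_def)
        then have "16 * C1 * (p * q) \<le> 1 / 1000" using C1 by (simp add: pos_le_divide_eq mult_ac)
        from mult_right_mono[OF this, of "p * q"] pq have "16 * C1 * (p * q) * (p * q) \<le> 1 / 1000 * (p * q)" by simp
        moreover have "C1 * (p * (q * 2 * 2))\<^sup>2 = 16 * C1 * (p * q) * (p * q)" by (simp add: power2_eq_square)
        ultimately show ?thesis by linarith
      qed
      ultimately show ?thesis using pq(2) by (simp add: kap_def)
    qed
    show ?thesis by (rule rep_mono[OF rep_near[OF 2 1] _ 3]) simp
  qed
  have "rep Ds (8 * (p * q)) (p * q / 90) (K P Q)"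
    if P: "P \<in> LG p" and Q: "Q \<in> LG q" and p: "p \<le> kap" and q: "q \<le> kap" and pq: "p * q \<le> \<rho>" for p P q Q
  proof -
    have pos: "0 \<le> p" "0 \<le> q" "0 \<le> p * q" using P Q G_nonneg by auto
    have u: "unit (1 + P)" "unit (1 + Q)" using unit1_kap P Q p q by auto
    have pr: "p * q \<le> rho" using pq rho_pos by (simp add: \<rho>_def)
    consider "p * q = 0" | "0 < p * q" "q \<le> kap / 4" | "0 < p * q" "kap / 4 < q" using pos by linarith
    then show ?thesis
    proof cases
      case 1
      then have "P = 0 \<or> Q = 0" using G_0 P Q by auto
      then have "K P Q = 1" using u by (auto simp: K_def iv_one iv_simps mult.assoc)
      then show ?thesis unfolding 1 using rep_one[OF Ds0] by simp
    next
      case 2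
      show ?thesis by (rule rep_mono[OF key[OF P Q p 2(2) pq 2(1)]]) (use 2 in auto)
    next
      case 3
      have "p * (kap / 4) \<le> rho" using pr 3 mult_left_mono[of "kap / 4" q p] pos by linarith
      then have p4: "p \<le> kap / 4" by (simp add: kap_def rho_def)
      have k: "rep Ds (8 * (q * p)) (q * p / 200) (K Q P)"
        by (rule key[OF Q P q p4]) (use pq 3 in \<open>auto simp: mult.commute\<close>)
      have e: "8 * (q * p) \<le> s0" using pq by (simp add: \<rho>_def mult.commute)
      have "rep Ds (8 * (q * p)) (2 * (q * p / 200) + C * (8 * (q * p)) * (8 * (q * p))) (iv (K Q P))"
        by (rule rep_iv[OF C(5) Ds0 C(1,3) k e]) (use pr in \<open>simp add: rho_def kap_def mult.commute\<close>)
      moreover have "iv (K Q P) = K P Q" using iv_K u by blast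
      moreover have "C * (8 * (q * p)) * (8 * (q * p)) \<le> q * p / 1000"
      proof -
        have "p * q \<le> 1 / (64000 * C)" using pq by (simp add: \<rho>_def)
        then have "64 * C * (q * p) \<le> 1 / 1000" using C by (simp add: pos_le_divide_eq mult_ac)
        from mult_right_mono[OF this, of "q * p"] 3 show ?thesis by (simp add: mult_ac)
      qed
      ultimately show ?thesis using 3 rep_mono[of Ds "8 * (q * p)" _ "K P Q" "8 * (p * q)" "p * q / 90"] by (simp add: mult.commute)
    qed
  qed
  then show ?thesis using r by blast
qed

text \<open>The reduction to letters for arbitrary products of small commutators. The induction runs over the inverses, since multiplying on the
  right by one more commutator means multiplying the inverse on the left.\<close>
lemma W_rep:
  "\<exists>\<rho>. 0 < \<rho> \<and> (\<forall>e g. W e g \<longrightarrow> e \<le> \<rho> \<longrightarrow> rep Ds (8 * e) (e / 20) g)"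
proof -
  obtain C s0 where C: "0 < C" "0 < s0" "C * s0 \<le> kap / 32" "s0 \<le> 1" "almost_additive_list C s0 Ds" using almost_additive_list_Ds by blast
  obtain \<rho>1 where r1: "0 < \<rho>1" and kr: "\<And>p P q Q. P \<in> LG p \<Longrightarrow> Q \<in> LG q \<Longrightarrow> p \<le> kap \<Longrightarrow> q \<le> kap \<Longrightarrow> p * q \<le> \<rho>1 \<Longrightarrow>
     rep Ds (8 * (p * q)) (p * q / 90) (K P Q)" using K_rep by blast
  define \<rho> where "\<rho> = min (min \<rho>1 (s0 / 8)) (min (1 / (64000 * C)) (kap / 32))"
  have r: "0 < \<rho>" using C r1 kap_pos by (simp add: \<rho>_def)
  have main: "W e g \<Longrightarrow> e \<le> \<rho> \<Longrightarrow> rep Ds (8 * e) (e / 20) (iv g)" for e g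
  proof (induction rule: W.induct)
    case (W_one e) then show ?case using rep_mono[OF rep_one[OF Ds0]] by (simp add: iv_one)
  next
    case (W_step e g P p Q q)
    have pos: "0 \<le> e" "0 \<le> p * q" using W_nonneg W_step.hyps G_nonneg by (auto intro: mult_nonneg_nonneg)
    have sm: "e \<le> \<rho>" "p * q \<le> \<rho>" "q * p \<le> \<rho>1" using W_step.prems pos by (auto simp: \<rho>_def mult.commute)
    have ivg: "iv (g * K P Q) = K Q P * iv g" using W_step.hyps
      by (simp add: iv_mult W_unit unit_K unit1_kap iv_K)
    have 1: "rep Ds (8 * (q * p)) (q * p / 90) (K Q P)" using kr W_step.hyps sm by blast
    have 2: "rep Ds (8 * e) (e / 20) (iv g)" using W_step.IH sm by blast
    have 3: "rep Ds (8 * (q * p) + 8 * e) (2 * (q * p / 90) + e / 20 + C * (8 * (q * p)) * (8 * e)) (K Q P * iv g)"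
      by (rule rep_mult[OF C(5,1,3) 1 2]) (use sm pos kap_pos in \<open>auto simp: \<rho>_def mult.commute\<close>)
    have "C * (8 * (q * p)) * (8 * e) \<le> p * q / 1000"
    proof -
      have "e \<le> 1 / (64000 * C)" using sm by (simp add: \<rho>_def)
      then have "64 * C * e \<le> 1 / 1000" using C by (simp add: pos_le_divide_eq mult_ac)
      from mult_right_mono[OF this pos(2)] show ?thesis by (simp add: mult_ac)
    qed
    then have 4: "2 * (q * p / 90) + e / 20 + C * (8 * (q * p)) * (8 * e) \<le> (e + p * q) / 20"
      using pos by (simp add: mult.commute)
    show ?case unfolding ivg by (rule rep_mono[OF 3 _ 4]) (simp add: mult.commute)
  qed
  have "rep Ds (8 * e) (e / 20) g" if "W e g" "e \<le> \<rho>" for e g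
    using main[OF W_iv[OF that(1)] that(2)] iv_iv[OF W_unit[OF that(1)]] by simp
  then show ?thesis using r by blast
qed

end

section \<open>Reachable germs\<close>

text \<open>The commutator \<open>(D s b, h)\<close>.\<close>
definition conj_germ :: "'a::ring_1 \<Rightarrow> 'a \<Rightarrow> 'a \<Rightarrow> 'a" where
  "conj_germ s h b = D s b * h * iv (D s b) * iv h"

lemma germ_prod_append: "germ_prod (fs @ gs) (\<lambda>i. if i < length fs then u i else v (i - length fs)) = germ_prod fs u * germ_prod gs v"
proof (induction fs arbitrary: u)
  case (Cons f fs)
  have "(\<lambda>i. if Suc i < length (f # fs) then u (Suc i) else v (Suc i - length (f # fs))) =
    (\<lambda>i. if i < length fs then u (Suc i) else v (i - length fs))" by auto
  then show ?case using Cons[of "\<lambda>i. u (Suc i)"] by (simp add: mult.assoc)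
qed simp

text \<open>Invariance under conjugation by commutators of elements near \<open>1\<close>, in the form in which it is used.\<close>
locale invariant_subgroup =
  fixes H :: "'a::{real_normed_algebra_1,banach} set"
  assumes H_unit: "h \<in> H \<Longrightarrow> unit h"
    and H_one: "1 \<in> H"
    and H_mult: "h \<in> H \<Longrightarrow> k \<in> H \<Longrightarrow> h * k \<in> H"
    and H_iv: "h \<in> H \<Longrightarrow> iv h \<in> H"
    and H_D: "h \<in> H \<Longrightarrow> norm s * norm b \<le> rho \<Longrightarrow> D s b * h * iv (D s b) \<in> H"

locale subgroup_gauge = gauge G + invariant_subgroup H
  for G :: "real \<Rightarrow> 'a::{real_normed_algebra_1,banach} set" and H :: "'a set"
begin

text \<open>The basic maps with values in \<open>H\<close>.\<close>
definition H_germ :: "('a \<Rightarrow> 'a) \<Rightarrow> bool" where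
  "H_germ f \<longleftrightarrow> (\<exists>s h. fin s \<and> h \<in> H \<and> fin h \<and> fin (iv h) \<and> f = conj_germ s h)"

lemma conj_germ_H: "h \<in> H \<Longrightarrow> norm s * norm b \<le> rho \<Longrightarrow> conj_germ s h b \<in> H"
  unfolding conj_germ_def by (intro H_mult H_D H_iv)

lemma lb_conj: "fin h \<Longrightarrow> fin (iv h) \<Longrightarrow> lb (\<lambda>b. h * b * iv h)"
  by (intro lb_intros)

text \<open>Maps that agree near zero are interchangeable.\<close>
lemma additive_germ_cong:
  assumes f: "additive_germ f" and s1: "0 < s1" and eq: "\<And>s b. s \<le> s1 \<Longrightarrow> b \<in> G s \<Longrightarrow> f b = g b"
  shows "additive_germ g"
proof -
  obtain C s0 where C: "0 < C" "0 < s0" "almost_additive C s0 f" using f unfolding additive_germ_def by auto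
  have "almost_additive C (min s0 (s1 / 2)) g" unfolding almost_additive_def
  proof (intro conjI allI impI)
    show "g 0 = 1" using eq[of 0 0] s1 G_zero almost_additive_zero[OF C(3)] by simp
    fix s b assume s: "s \<le> min s0 (s1 / 2)" and b: "b \<in> G s"
    have fb: "f b = g b" by (rule eq[of s]) (use s s1 b in auto)
    have "W (C * s) (f b)" using C(3) s b unfolding almost_additive_def by simp
    then show "W (C * s) (g b)" unfolding fb .
  next
    fix s s' b b' assume s: "s \<le> min s0 (s1 / 2)" "s' \<le> min s0 (s1 / 2)" and b: "b \<in> G s" "b' \<in> G s'"
    have "near (C * s * s') (f (b + b')) (f b * f b')" using C(3) s b unfolding almost_additive_def by auto
    moreover have "f (b + b') = g (b + b')" by (rule eq[OF _ G_add[OF b]]) (use s in auto)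
    moreover have "f b = g b" by (rule eq[OF _ b(1)]) (use s s1 in auto)
    moreover have "f b' = g b'" by (rule eq[OF _ b(2)]) (use s s1 in auto)
    ultimately show "near (C * s * s') (g (b + b')) (g b * g b')" by simp
  qed
  then show ?thesis unfolding additive_germ_def using C s1 by (intro exI[of _ C] exI[of _ "min s0 (s1 / 2)"]) auto
qed

lemma unit_small:
  assumes "fin s" obtains s1 where "0 < s1" "\<And>t b. t \<le> s1 \<Longrightarrow> b \<in> G t \<Longrightarrow> unit (1 + s * b)"
    "\<And>t b. t \<le> s1 \<Longrightarrow> b \<in> G t \<Longrightarrow> norm s * norm b \<le> rho"
proof -
  obtain r where r: "0 < r" "s \<in> G r" using fin_pos assms by blast
  have bound: "r * t \<le> rho" if "t \<le> rho / r" for t using that r by (simp add: pos_le_divide_eq mult.commute)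
  show ?thesis
  proof (rule that[of "rho / r"])
    show "0 < rho / r" using r rho_pos by simp
    fix t b assume t: "t \<le> rho / r" and b: "b \<in> G t"
    show "unit (1 + s * b)" by (rule unit1[OF G_mult[OF r(2) b]]) (use bound[OF t] in \<open>simp add: rho_def\<close>)
    have "norm s * norm b \<le> r * t" using G_norm r b G_nonneg[OF b] by (intro mult_mono) auto
    then show "norm s * norm b \<le> rho" using bound[OF t] by simp
  qed
qed

text \<open>Conjugation by \<open>h\<close> changes both arguments of \<open>D\<close>, so \<open>(D s b, h)\<close> is the product of the almost additive
  \<open>D s b\<close> with the inverse of \<open>D (h * s * iv h) (h * b * iv h)\<close>.\<close>
lemma H_germ_additive_germ: assumes "H_germ f" shows "additive_germ f"
proof -
  obtain s h where s: "fin s" "h \<in> H" "fin h" "fin (iv h)" "f = conj_germ s h" using assms unfolding H_germ_def by blast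
  have u: "unit h" using H_unit s by blast
  have 1: "additive_germ (\<lambda>b. D s b * iv (D (h * s * iv h) (h * b * iv h)))"
    by (intro additive_germ_mult additive_germ_iv additive_germ_comp[OF additive_germ_D lb_conj] additive_germ_D s fin_mult)
  obtain s1 where s1: "0 < s1" "\<And>t b. t \<le> s1 \<Longrightarrow> b \<in> G t \<Longrightarrow> unit (1 + s * b)"
    "\<And>t b. t \<le> s1 \<Longrightarrow> b \<in> G t \<Longrightarrow> norm s * norm b \<le> rho" using unit_small[OF s(1)] by metis
  show ?thesis
  proof (rule additive_germ_cong[OF 1 s1(1)])
    fix t b assume "t \<le> s1" "b \<in> G t"
    then have ub: "unit (1 + s * b)" using s1 by blast
    have "iv (D (h * s * iv h) (h * b * iv h)) = h * iv (D s b) * iv h"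
      unfolding D_conj[OF u ub, symmetric] using u unit_D[OF ub]
      by (simp add: iv_mult unit_mult unit_iv iv_iv mult.assoc)
    then show "D s b * iv (D (h * s * iv h) (h * b * iv h)) = f b" unfolding s(5) conj_germ_def by (simp add: mult.assoc)
  qed
qed

lemma H_germ_zero: "H_germ f \<Longrightarrow> f 0 = 1"
  using H_germ_additive_germ almost_additive_zero unfolding additive_germ_def by blast

lemma H_germ_almost_additive_list: assumes "\<forall>f\<in>set fs. H_germ f" shows "\<exists>C s0. 0 < C \<and> 0 < s0 \<and> C * s0 \<le> kap / 32 \<and> s0 \<le> 1 \<and> almost_additive_list C s0 fs"
proof -
  obtain C s0 where C: "0 < C" "0 < s0" "almost_additive_list C s0 fs"
    using almost_additive_list_exists[of fs] H_germ_additive_germ assms unfolding additive_germ_def by blast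
  let ?s = "min (min 1 s0) (kap / (32 * C))"
  have "C * ?s \<le> C * (kap / (32 * C))" using C by (intro mult_left_mono) auto
  then have "C * ?s \<le> kap / 32" using C by simp
  then show ?thesis using C almost_additive_list_mono[OF C(3), of ?s] kap_pos by (intro exI[of _ C] exI[of _ ?s]) auto
qed

text \<open>Weight at most linear in the size of the argument.\<close>
definition small :: "('a \<Rightarrow> 'a) \<Rightarrow> bool" where
  "small F \<longleftrightarrow> (\<exists>C s0. 0 < C \<and> 0 < s0 \<and> (\<forall>s b. s \<le> s0 \<longrightarrow> b \<in> G s \<longrightarrow> W (C * s) (F b)))"

text \<open>For every prescribed relative error \<open>\<eta>\<close> the map is represented by finitely many basic maps with values in \<open>H\<close>. The list of maps and the
  constant \<open>C\<close> may depend on \<open>\<eta>\<close>, and this is why limits of reachable maps remain reachable.\<close>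
definition reachable :: "('a \<Rightarrow> 'a) \<Rightarrow> bool" where
  "reachable F \<longleftrightarrow> (\<forall>\<eta>>0. \<exists>fs C s0. (\<forall>f\<in>set fs. H_germ f) \<and> 0 < C \<and> 0 < s0 \<and>
     (\<forall>s b. s \<le> s0 \<longrightarrow> b \<in> G s \<longrightarrow> rep fs (C * s) (\<eta> * s) (F b)))"

lemma reachD:
  assumes "reachable F" "0 < \<eta>"
  obtains fs C s0 where "\<forall>f\<in>set fs. H_germ f" "0 < C" "0 < s0"
    "\<And>s b. s \<le> s0 \<Longrightarrow> b \<in> G s \<Longrightarrow> rep fs (C * s) (\<eta> * s) (F b)"
  using assms unfolding reachable_def by blast

lemma small_additive_germ: "additive_germ F \<Longrightarrow> small F" unfolding additive_germ_def small_def almost_additive_def by blast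

lemma smallD:
  assumes "small F"
  obtains C s0 where "0 < C" "0 < s0" "\<And>s b. s \<le> s0 \<Longrightarrow> b \<in> G s \<Longrightarrow> W (C * s) (F b)"
    "\<And>s b. s \<le> s0 \<Longrightarrow> b \<in> G s \<Longrightarrow> C * s \<le> kap / 64"
proof -
  obtain C s0 where C: "0 < C" "0 < s0" "\<And>s b. s \<le> s0 \<Longrightarrow> b \<in> G s \<Longrightarrow> W (C * s) (F b)"
    using assms unfolding small_def by blast
  show ?thesis
  proof (rule that[of C "min s0 (kap / (64 * C))"])
    fix s b assume s: "s \<le> min s0 (kap / (64 * C))"
    have "C * s \<le> C * (kap / (64 * C))" using s C by (intro mult_left_mono) auto
    then show "C * s \<le> kap / 64" using C by simp
    assume "b \<in> G s" then show "W (C * s) (F b)" using C s by simp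
  qed (use C kap_pos in auto)
qed

lemma small_iv: assumes "small F" shows "small (\<lambda>b. iv (F b))"
  using assms W_iv unfolding small_def by blast
lemma reachable_comp: assumes "reachable F" "lb l" shows "reachable (\<lambda>b. F (l b))"
  unfolding reachable_def
proof (intro allI impI)
  fix \<eta> :: real assume e: "0 < \<eta>"
  obtain c where c: "0 < c" "\<And>s b. b \<in> G s \<Longrightarrow> l b \<in> G (c * s)" using assms(2) unfolding lb_def by blast
  obtain fs C s0 where C: "\<forall>f\<in>set fs. H_germ f" "0 < C" "0 < s0"
    "\<And>s b. s \<le> s0 \<Longrightarrow> b \<in> G s \<Longrightarrow> rep fs (C * s) (\<eta> / c * s) (F b)" using reachD[OF assms(1), of "\<eta> / c"] e c by (metis divide_pos_pos)
  have "rep fs (C * c * s) (\<eta> * s) (F (l b))" if "s \<le> s0 / c" "b \<in> G s" for s b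
    using C(4)[OF _ c(2)[OF that(2)]] that(1) c(1) by (simp add: pos_le_divide_eq mult_ac)
  then show "\<exists>fs C s0. (\<forall>f\<in>set fs. H_germ f) \<and> 0 < C \<and> 0 < s0 \<and> (\<forall>s b. s \<le> s0 \<longrightarrow> b \<in> G s \<longrightarrow> rep fs (C * s) (\<eta> * s) (F (l b)))"
    using C c by (intro exI[of _ fs] exI[of _ "C * c"] exI[of _ "s0 / c"]) auto
qed

text \<open>A map that is approximated by reachable maps to any relative accuracy is reachable.\<close>
lemma reachable_approx:
  assumes e: "\<And>\<eta>. 0 < \<eta> \<Longrightarrow> \<exists>F s0. reachable F \<and> 0 < s0 \<and> (\<forall>s b. s \<le> s0 \<longrightarrow> b \<in> G s \<longrightarrow> near (\<eta> * s) (F' b) (F b))"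
  shows "reachable F'"
  unfolding reachable_def
proof (intro allI impI)
  fix \<eta> :: real assume n: "0 < \<eta>"
  then have n2: "0 < \<eta> / 2" by simp
  obtain F s1 where s1: "reachable F" "0 < s1" "\<And>s b. s \<le> s1 \<Longrightarrow> b \<in> G s \<Longrightarrow> near (\<eta> / 2 * s) (F' b) (F b)" using e[OF n2] by blast
  obtain fs C s0 where C: "\<forall>f\<in>set fs. H_germ f" "0 < C" "0 < s0"
    "\<And>s b. s \<le> s0 \<Longrightarrow> b \<in> G s \<Longrightarrow> rep fs (C * s) (\<eta> / 2 * s) (F b)" using reachD[OF s1(1) n2] by metis
  have "rep fs (C * s) (\<eta> * s) (F' b)" if "s \<le> min s0 s1" "b \<in> G s" for s b
  proof -
    have 1: "rep fs (C * s) (\<eta> / 2 * s) (F b)" using C(4) that by simp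
    have 2: "near (\<eta> / 2 * s) (F' b) (F b)" using s1(3) that by simp
    show ?thesis by (rule rep_mono[OF rep_near[OF 1 2] order_refl]) simp
  qed
  then show "\<exists>fs C s0. (\<forall>f\<in>set fs. H_germ f) \<and> 0 < C \<and> 0 < s0 \<and> (\<forall>s b. s \<le> s0 \<longrightarrow> b \<in> G s \<longrightarrow> rep fs (C * s) (\<eta> * s) (F' b))"
    using C s1 by (intro exI[of _ fs] exI[of _ C] exI[of _ "min s0 s1"]) auto
qed

text \<open>Errors of lower order do not affect reachability.\<close>
lemma reachable_cong:
  assumes F: "reachable F" and e: "\<And>\<eta>. 0 < \<eta> \<Longrightarrow> \<exists>s0>0. \<forall>s b. s \<le> s0 \<longrightarrow> b \<in> G s \<longrightarrow> near (\<eta> * s) (F' b) (F b)"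
  shows "reachable F'"
  by (rule reachable_approx) (use F e in blast)

lemma reachable_cong2:
  assumes F: "reachable F" and c: "0 < s1" "\<And>s b. s \<le> s1 \<Longrightarrow> b \<in> G s \<Longrightarrow> near (c * s * s) (F' b) (F b)"
  shows "reachable F'"
proof (rule reachable_cong[OF F])
  fix \<eta> :: real assume n: "0 < \<eta>"
  have "near (\<eta> * s) (F' b) (F b)" if s: "s \<le> min s1 (\<eta> / (\<bar>c\<bar> + 1))" and b: "b \<in> G s" for s b
  proof -
    have p: "0 \<le> s" using b G_nonneg by blast
    have "s * (\<bar>c\<bar> + 1) \<le> \<eta>" using s by (simp add: pos_le_divide_eq)
    then have "c * s \<le> \<eta>" using p abs_ge_self[of c] mult_right_mono[of c "\<bar>c\<bar>" s] by (simp add: distrib_left mult.commute)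
    then have "c * s * s \<le> \<eta> * s" using p by (rule mult_right_mono)
    then show ?thesis using c(2)[of s b] s b near_mono by (meson min.boundedE)
  qed
  then show "\<exists>s0>0. \<forall>s b. s \<le> s0 \<longrightarrow> b \<in> G s \<longrightarrow> near (\<eta> * s) (F' b) (F b)"
    using c n by (intro exI[of _ "min s1 (\<eta> / (\<bar>c\<bar> + 1))"]) auto
qed

lemma reachable_eq:
  assumes F: "reachable F" and c: "0 < s1" "\<And>s b. s \<le> s1 \<Longrightarrow> b \<in> G s \<Longrightarrow> F' b = F b"
  shows "reachable F'"
  by (rule reachable_cong2[OF F c(1), of 0]) (use c near_refl[of 0] in auto)

lemma reachable_small: assumes "reachable F" shows "small F"
proof -
  obtain fs C s0 where C: "\<forall>f\<in>set fs. H_germ f" "0 < C" "0 < s0"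
    "\<And>s b. s \<le> s0 \<Longrightarrow> b \<in> G s \<Longrightarrow> rep fs (C * s) (1 * s) (F b)" using reachD[OF assms zero_less_one] by metis
  obtain D t0 where D: "0 < D" "0 < t0" "almost_additive_list D t0 fs" using H_germ_almost_additive_list[OF C(1)] by blast
  have "W ((D * C + 1) * s) (F b)" if s: "s \<le> min s0 (t0 / C)" and b: "b \<in> G s" for s b
  proof -
    obtain u where u: "\<forall>i. u i \<in> G (C * s)" "near (1 * s) (F b) (germ_prod fs u)" using C(4)[of s b] s b unfolding rep_def by auto
    have "C * s \<le> t0" using s C by (simp add: pos_le_divide_eq mult.commute)
    then have "W (D * (C * s)) (germ_prod fs u)" using almost_additive_list_W[OF D(3)] u by blast
    from W_near[OF this u(2)] show ?thesis by (simp add: distrib_right mult.assoc)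
  qed
  then show ?thesis unfolding small_def using C D by (intro exI[of _ "D * C + 1"] exI[of _ "min s0 (t0 / C)"]) (auto simp: add_pos_pos)
qed

lemma reachable_mult: assumes "reachable F" "reachable F'" shows "reachable (\<lambda>b. F b * F' b)"
  unfolding reachable_def
proof (intro allI impI)
  fix \<eta> :: real assume n: "0 < \<eta>"
  then have n3: "0 < \<eta> / 3" by simp
  obtain fs C s0 where C: "\<forall>f\<in>set fs. H_germ f" "0 < C" "0 < s0"
    "\<And>s b. s \<le> s0 \<Longrightarrow> b \<in> G s \<Longrightarrow> rep fs (C * s) (\<eta> / 3 * s) (F b)" using reachD[OF assms(1) n3] by metis
  obtain gs D t0 where D: "\<forall>f\<in>set gs. H_germ f" "0 < D" "0 < t0"
    "\<And>s b. s \<le> t0 \<Longrightarrow> b \<in> G s \<Longrightarrow> rep gs (D * s) (\<eta> / 3 * s) (F' b)" using reachD[OF assms(2) n3] by metis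
  obtain E r0 where E: "0 < E" "0 < r0" "\<And>s b. s \<le> r0 \<Longrightarrow> b \<in> G s \<Longrightarrow> W (E * s) (F' b)"
    "\<And>s b. s \<le> r0 \<Longrightarrow> b \<in> G s \<Longrightarrow> E * s \<le> kap / 64" using smallD[OF reachable_small[OF assms(2)]] by metis
  define m where "m = min (min s0 t0) (min r0 (kap / (4 * \<eta>)))"
  have "rep (fs @ gs) ((C + D) * s) (\<eta> * s) (F b * F' b)" if s: "s \<le> m" and b: "b \<in> G s" for s b
  proof -
    have p: "0 \<le> s" using b G_nonneg by blast
    have sm: "s \<le> s0" "s \<le> t0" "s \<le> r0" "s \<le> kap / (4 * \<eta>)" using s by (auto simp: m_def)
    have e4: "4 * (\<eta> / 3 * s) \<le> kap" using sm(4) n p kap_pos by (simp add: pos_le_divide_eq mult_ac)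
    obtain u where u: "\<forall>i. u i \<in> G (C * s)" "near (\<eta> / 3 * s) (F b) (germ_prod fs u)" using C(4)[OF sm(1) b] unfolding rep_def by auto
    obtain v where v: "\<forall>i. v i \<in> G (D * s)" "near (\<eta> / 3 * s) (F' b) (germ_prod gs v)" using D(4)[OF sm(2) b] unfolding rep_def by auto
    have 1: "near (2 * (\<eta> / 3 * s)) (F b * F' b) (germ_prod fs u * F' b)"
      by (rule near_right_W[OF u(2) E(3)[OF sm(3) b] _ e4]) (use E(4)[OF sm(3) b] kap_pos in linarith)
    have 2: "near (\<eta> / 3 * s) (germ_prod fs u * F' b) (germ_prod fs u * germ_prod gs v)" by (rule near_left[OF v(2)])
    let ?w = "\<lambda>i. if i < length fs then u i else v (i - length fs)"
    have w: "\<forall>i. ?w i \<in> G ((C + D) * s)"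
    proof
      fix i
      have "C * s \<le> (C + D) * s" "D * s \<le> (C + D) * s" using C D p by (auto intro: mult_right_mono)
      then show "?w i \<in> G ((C + D) * s)"
        using G_mono[OF u(1)[rule_format]] G_mono[OF v(1)[rule_format]] by (cases "i < length fs") simp_all
    qed
    have "near (2 * (\<eta> / 3 * s) + \<eta> / 3 * s) (F b * F' b) (germ_prod (fs @ gs) ?w)" unfolding germ_prod_append by (rule near_trans[OF 1 2])
    then have "near (\<eta> * s) (F b * F' b) (germ_prod (fs @ gs) ?w)" by (rule near_mono) simp
    then show ?thesis unfolding rep_def by (intro exI[of _ ?w] conjI w)
  qed
  then show "\<exists>fs C s0. (\<forall>f\<in>set fs. H_germ f) \<and> 0 < C \<and> 0 < s0 \<and> (\<forall>s b. s \<le> s0 \<longrightarrow> b \<in> G s \<longrightarrow> rep fs (C * s) (\<eta> * s) (F b * F' b))"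
    using C D E n kap_pos by (intro exI[of _ "fs @ gs"] exI[of _ "C + D"] exI[of _ m]) (auto simp: m_def)
qed

lemma reachable_iv: assumes "reachable F" shows "reachable (\<lambda>b. iv (F b))"
  unfolding reachable_def
proof (intro allI impI)
  fix \<eta> :: real assume n: "0 < \<eta>"
  then have n4: "0 < \<eta> / 4" by simp
  obtain fs C s0 where C: "\<forall>f\<in>set fs. H_germ f" "0 < C" "0 < s0"
    "\<And>s b. s \<le> s0 \<Longrightarrow> b \<in> G s \<Longrightarrow> rep fs (C * s) (\<eta> / 4 * s) (F b)" using reachD[OF assms(1) n4] by metis
  obtain D t0 where D: "0 < D" "0 < t0" "D * t0 \<le> kap / 32" "almost_additive_list D t0 fs" using H_germ_almost_additive_list[OF C(1)] by blast
  have z: "\<forall>f\<in>set fs. f 0 = 1" using C H_germ_zero by blast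
  define m where "m = min (min s0 (t0 / C)) (min (kap / (8 * \<eta>)) (\<eta> / (2 * D * C * C)))"
  have "rep fs (C * s) (\<eta> * s) (iv (F b))" if s: "s \<le> m" and b: "b \<in> G s" for s b
  proof -
    have p: "0 \<le> s" using b G_nonneg by blast
    have sm: "s \<le> s0" "C * s \<le> t0" "s * (8 * \<eta>) \<le> kap" "s * (2 * D * C * C) \<le> \<eta>"
      using s C D n by (auto simp: m_def pos_le_divide_eq mult.commute)
    have "rep fs (C * s) (2 * (\<eta> / 4 * s) + D * (C * s) * (C * s)) (iv (F b))"
      by (rule rep_iv[OF D(4) z D(1,3) C(4)[OF sm(1) b] sm(2)]) (use sm(3) in \<open>simp add: mult_ac\<close>)
    moreover have "D * (C * s) * (C * s) \<le> \<eta> / 2 * s"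
    proof -
      have "s * (2 * D * C * C) * s \<le> \<eta> * s" using sm(4) p by (rule mult_right_mono)
      then show ?thesis by (simp add: mult_ac)
    qed
    then have "2 * (\<eta> / 4 * s) + D * (C * s) * (C * s) \<le> \<eta> * s" by simp
    ultimately show ?thesis by (intro rep_mono[OF _ order_refl, of fs "C * s" _ "iv (F b)" "\<eta> * s"])
  qed
  then show "\<exists>fs C s0. (\<forall>f\<in>set fs. H_germ f) \<and> 0 < C \<and> 0 < s0 \<and> (\<forall>s b. s \<le> s0 \<longrightarrow> b \<in> G s \<longrightarrow> rep fs (C * s) (\<eta> * s) (iv (F b)))"
    using C D n kap_pos by (intro exI[of _ fs] exI[of _ C] exI[of _ m]) (auto simp: m_def)
qed

lemma reachable_H_germ: assumes "H_germ f" shows "reachable f"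
  unfolding reachable_def
proof (intro allI impI)
  fix \<eta> :: real assume n: "0 < \<eta>"
  have "rep [f] (1 * s) (\<eta> * s) (f b)" if "b \<in> G s" for s b
  proof (rule rep_mono[OF rep_single[of "[f]" f b s]])
    show "0 \<le> \<eta> * s" using n G_nonneg[OF that] by simp
  qed (use assms that H_germ_zero in auto)
  then show "\<exists>fs C s0. (\<forall>f\<in>set fs. H_germ f) \<and> 0 < C \<and> 0 < s0 \<and> (\<forall>s b. s \<le> s0 \<longrightarrow> b \<in> G s \<longrightarrow> rep fs (C * s) (\<eta> * s) (f b))"
    using assms by (intro exI[of _ "[f]"] exI[of _ 1]) auto
qed

text \<open>Small factors commute up to second order, hence can be reordered in a reachable product.\<close>
lemma reachable_commute:
  assumes a: "small A" and b: "small B" and c: "small C" and E: "small E" and R: "reachable (\<lambda>x. A x * B x * C x * E x)"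
  shows "reachable (\<lambda>x. A x * C x * B x * E x)"
proof -
  obtain cB sB where B: "0 < cB" "0 < sB" "\<And>s x. s \<le> sB \<Longrightarrow> x \<in> G s \<Longrightarrow> W (cB * s) (B x)"
    "\<And>s x. s \<le> sB \<Longrightarrow> x \<in> G s \<Longrightarrow> cB * s \<le> kap / 64" using smallD[OF b] by metis
  obtain cC sC where C: "0 < cC" "0 < sC" "\<And>s x. s \<le> sC \<Longrightarrow> x \<in> G s \<Longrightarrow> W (cC * s) (C x)"
    "\<And>s x. s \<le> sC \<Longrightarrow> x \<in> G s \<Longrightarrow> cC * s \<le> kap / 64" using smallD[OF c] by metis
  obtain cE sE where E: "0 < cE" "0 < sE" "\<And>s x. s \<le> sE \<Longrightarrow> x \<in> G s \<Longrightarrow> W (cE * s) (E x)"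
    "\<And>s x. s \<le> sE \<Longrightarrow> x \<in> G s \<Longrightarrow> cE * s \<le> kap / 64" using smallD[OF E] by metis
  show ?thesis
  proof (rule reachable_cong2[OF R, of "min sB (min sC sE)" "2 * (16 * cC * cB)"])
    fix s x assume s: "s \<le> min sB (min sC sE)" and x: "x \<in> G s"
    have sm: "s \<le> sB" "s \<le> sC" "s \<le> sE" using s by auto
    have p: "0 \<le> s" using x G_nonneg by blast
    have w: "cB * s \<le> kap / 64" "cC * s \<le> kap / 64" "cE * s \<le> kap / 64" using B C E sm x by blast+
    have 1: "near (16 * (cC * s) * (cB * s)) (C x * B x) (B x * C x)"
      by (rule near_commute[OF C(3)[OF sm(2) x] B(3)[OF sm(1) x]]) (use w kap_pos in linarith)+
    have "(cC * s) * (cB * s) \<le> kap / 64 * (kap / 64)" using w p B C kap_pos by (intro mult_mono) auto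
    then have e4: "4 * (16 * (cC * s) * (cB * s)) \<le> kap" by (simp add: kap_def)
    have "near (2 * (16 * (cC * s) * (cB * s))) (C x * B x * E x) (B x * C x * E x)"
      by (rule near_right_W[OF 1 E(3)[OF sm(3) x] _ e4]) (use w kap_pos in linarith)
    from near_left[OF this, of "A x"]
    show "near (2 * (16 * cC * cB) * s * s) (A x * C x * B x * E x) (A x * B x * C x * E x)"
      by (simp add: mult_ac)
  qed (use B C E in auto)
qed

lemma reachable_cancel_right:
  assumes "small A" "reachable (\<lambda>x. A x * B x)" "reachable B" shows "reachable A"
proof -
  have 1: "reachable (\<lambda>x. A x * B x * iv (B x))" by (intro reachable_mult reachable_iv assms)
  obtain cB sB where B: "0 < cB" "0 < sB" "\<And>s x. s \<le> sB \<Longrightarrow> x \<in> G s \<Longrightarrow> W (cB * s) (B x)"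
    using smallD[OF reachable_small[OF assms(3)]] by metis
  show ?thesis by (rule reachable_eq[OF 1 B(2)]) (use B(3) W_unit iv_right in \<open>metis mult.assoc mult.right_neutral\<close>)
qed

text \<open>Reachability of \<open>D x\<close> along a linear family of arguments; it plays the role of the statement that the form \<open>dx\<close> vanishes on the
  image of \<open>l\<close>.\<close>
definition reachable_D :: "'a \<Rightarrow> ('a \<Rightarrow> 'a) \<Rightarrow> bool" where "reachable_D x l \<longleftrightarrow> fin x \<and> lb l \<and> reachable (\<lambda>b. D x (l b))"

lemma small_D: "fin x \<Longrightarrow> lb l \<Longrightarrow> small (\<lambda>b. D x (l b))"
  by (rule small_additive_germ[OF additive_germ_comp[OF additive_germ_D]])

lemma reachable_D_comp: "reachable_D x l \<Longrightarrow> lb m \<Longrightarrow> reachable_D x (\<lambda>b. l (m b))"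
proof -
  assume a: "reachable_D x l" "lb m"
  have "lb (\<lambda>b. l (m b))"
  proof -
    obtain c where c: "0 < c" "\<And>s b. b \<in> G s \<Longrightarrow> l b \<in> G (c * s)" "\<And>b b'. l (b + b') = l b + l b'" using a unfolding reachable_D_def lb_def by blast
    obtain d where d: "0 < d" "\<And>s b. b \<in> G s \<Longrightarrow> m b \<in> G (d * s)" "\<And>b b'. m (b + b') = m b + m b'" using a unfolding lb_def by blast
    show ?thesis unfolding lb_def
      by (intro conjI exI[of _ "c * d"]) (use c d in \<open>auto simp: mult.assoc\<close>)
  qed
  then show ?thesis using a reachable_comp unfolding reachable_D_def by blast
qed

lemma reachable_D_add_arg: assumes "reachable_D x l" "reachable_D x m" shows "reachable_D x (\<lambda>b. l b + m b)"
proof -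
  have x: "fin x" "lb l" "lb m" using assms by (auto simp: reachable_D_def)
  have 1: "reachable (\<lambda>b. D x (l b) * D x (m b))" using assms reachable_mult unfolding reachable_D_def by blast
  obtain r where r: "0 < r" "x \<in> G r" using fin_pos x by blast
  obtain c where c: "0 < c" "\<And>s b. b \<in> G s \<Longrightarrow> l b \<in> G (c * s)" using x unfolding lb_def by blast
  obtain d where d: "0 < d" "\<And>s b. b \<in> G s \<Longrightarrow> m b \<in> G (d * s)" using x unfolding lb_def by blast
  have "reachable (\<lambda>b. D x (l b + m b))"
  proof (rule reachable_cong2[OF 1, of "min (rho / 8 / (r * c)) (rho / 8 / (r * d))" "1500 * r * c * r * d"])
    fix s b assume s: "s \<le> min (rho / 8 / (r * c)) (rho / 8 / (r * d))" and b: "b \<in> G s"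
    have "s \<le> rho / 8 / (r * c)" "s \<le> rho / 8 / (r * d)" using s by auto
    then have "s * (r * c) \<le> rho / 8" "s * (r * d) \<le> rho / 8" using r c d by (auto simp only: pos_le_divide_eq mult_pos_pos)
    then have "r * (c * s) \<le> rho / 8" "r * (d * s) \<le> rho / 8" by (simp_all add: mult_ac)
    from D_add_right[OF r(2) c(2)[OF b] d(2)[OF b] this]
    show "near (1500 * r * c * r * d * s * s) (D x (l b + m b)) (D x (l b) * D x (m b))" by (simp add: mult_ac)
  qed (use r c d rho_pos in auto)
  then show ?thesis using x lb_add unfolding reachable_D_def by blast
qed

lemma reachable_D_add: assumes "reachable_D x l" "reachable_D y l" shows "reachable_D (x + y) l"
proof -
  have x: "fin x" "fin y" "lb l" using assms by (auto simp: reachable_D_def)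
  have 1: "reachable (\<lambda>b. D x (l b) * D y (l b))" using assms reachable_mult unfolding reachable_D_def by blast
  obtain r where r: "0 < r" "x \<in> G r" using fin_pos x by blast
  obtain d where d: "0 < d" "y \<in> G d" using fin_pos x by blast
  obtain c where c: "0 < c" "\<And>s b. b \<in> G s \<Longrightarrow> l b \<in> G (c * s)" using x unfolding lb_def by blast
  have "reachable (\<lambda>b. D (x + y) (l b))"
  proof (rule reachable_cong2[OF 1, of "min (rho / 8 / (r * c)) (rho / 8 / (d * c))" "500 * r * c * d * c"])
    fix s b assume s: "s \<le> min (rho / 8 / (r * c)) (rho / 8 / (d * c))" and b: "b \<in> G s"
    have "s \<le> rho / 8 / (r * c)" "s \<le> rho / 8 / (d * c)" using s by auto
    then have "s * (r * c) \<le> rho / 8" "s * (d * c) \<le> rho / 8" using r c d by (auto simp only: pos_le_divide_eq mult_pos_pos)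
    then have "r * (c * s) \<le> rho / 8" "d * (c * s) \<le> rho / 8" by (simp_all add: mult_ac)
    from D_add_left[OF r(2) d(2) c(2)[OF b] this]
    show "near (500 * r * c * d * c * s * s) (D (x + y) (l b)) (D x (l b) * D y (l b))" by (simp add: mult_ac)
  qed (use r c d rho_pos in auto)
  then show ?thesis using x fin_add unfolding reachable_D_def by blast
qed

lemma reachable_D_minus: assumes "reachable_D x l" shows "reachable_D x (\<lambda>b. - l b)"
proof -
  have l: "lb l" using assms by (simp add: reachable_D_def)
  have "l b + l (- b) = 0" for b using lb_zero[OF l] l unfolding lb_def by (metis add.right_inverse)
  then have "l (- b) = - l b" for b by (metis add.inverse_unique)
  then show ?thesis using reachable_D_comp[OF assms lb_minus[OF lb_id]] by simp
qed
lemma reachable_D_diff_arg: "reachable_D x l \<Longrightarrow> reachable_D x m \<Longrightarrow> reachable_D x (\<lambda>b. l b - m b)" using reachable_D_add_arg[OF _ reachable_D_minus, of x l m] by simp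
end

section \<open>The algebra of reachable elements\<close>

lemma D_minus_one:
  assumes "unit (1 + b * x)" shows "D x b - 1 = (x * b - b * x) * iv (1 + b * x)"
proof -
  have "(x * b - b * x) * iv (1 + b * x) = (1 + x * b) * iv (1 + b * x) - (1 + b * x) * iv (1 + b * x)"
    unfolding left_diff_distrib[symmetric] by simp
  then show ?thesis using assms by (simp add: D_def iv_right)
qed

context subgroup_gauge begin

lemma unit_small_lb:
  assumes "fin x" "lb l" obtains s1 where "0 < s1" "\<And>t b. t \<le> s1 \<Longrightarrow> b \<in> G t \<Longrightarrow> unit (1 + x * l b)"
proof -
  obtain s1 where s1: "0 < s1" "\<And>t b. t \<le> s1 \<Longrightarrow> b \<in> G t \<Longrightarrow> unit (1 + x * b)" using unit_small[OF assms(1)] by metis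
  obtain c where c: "0 < c" "\<And>s b. b \<in> G s \<Longrightarrow> l b \<in> G (c * s)" using assms(2) unfolding lb_def by blast
  show ?thesis
  proof (rule that[of "s1 / c"])
    fix t b assume "t \<le> s1 / c" "b \<in> G t"
    then show "unit (1 + x * l b)" using s1(2)[OF _ c(2)] c(1) by (simp add: pos_le_divide_eq mult.commute)
  qed (use s1 c in simp)
qed

text \<open>The Leibniz rule for reachable elements.\<close>
lemma reachable_D_prod: assumes "reachable_D x (\<lambda>b. y * l b)" "reachable_D y (\<lambda>b. l b * x)" "lb l" shows "reachable_D (x * y) l"
proof -
  have f: "fin x" "fin y" using assms by (auto simp: reachable_D_def)
  obtain s1 where s1: "0 < s1" "\<And>t b. t \<le> s1 \<Longrightarrow> b \<in> G t \<Longrightarrow> unit (1 + x * y * l b)"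
    using unit_small_lb[OF fin_mult[OF f] assms(3)] by metis
  have "reachable (\<lambda>b. D x (y * l b) * D y (l b * x))" using assms reachable_mult unfolding reachable_D_def by blast
  then have "reachable (\<lambda>b. D (x * y) (l b))" by (rule reachable_eq[OF _ s1(1)]) (rule D_mult[OF s1(2)])
  then show ?thesis using f assms fin_mult unfolding reachable_D_def by blast
qed

lemma reachable_D_prod_left: assumes "reachable_D (x * y) l" "reachable_D y (\<lambda>b. l b * x)" "fin x" "lb l" shows "reachable_D x (\<lambda>b. y * l b)"
proof -
  have f: "fin x" "fin y" using assms by (auto simp: reachable_D_def)
  have l: "lb (\<lambda>b. y * l b)" by (rule lb_mult_left[OF assms(4) f(2)])
  obtain s1 where s1: "0 < s1" "\<And>t b. t \<le> s1 \<Longrightarrow> b \<in> G t \<Longrightarrow> unit (1 + x * y * l b)"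
    using unit_small_lb[OF fin_mult[OF f] assms(4)] by metis
  have "reachable (\<lambda>b. D (x * y) (l b))" using assms unfolding reachable_D_def by blast
  then have "reachable (\<lambda>b. D x (y * l b) * D y (l b * x))" by (rule reachable_eq[OF _ s1(1)]) (rule D_mult[OF s1(2), symmetric])
  then have "reachable (\<lambda>b. D x (y * l b))" by (rule reachable_cancel_right[OF small_D[OF f(1) l]]) (use assms in \<open>simp add: reachable_D_def\<close>)
  then show ?thesis using f l unfolding reachable_D_def by blast
qed

text \<open>The elements at which \<open>D\<close> is reachable for all arguments. The aim is to show that \<open>X\<close> contains every element of finite gauge.\<close>
definition X :: "'a set" where "X = {x. reachable_D x (\<lambda>b. b)}"

lemma X_fin: "x \<in> X \<Longrightarrow> fin x" by (simp add: X_def reachable_D_def)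
lemma X_reachable_D: "x \<in> X \<Longrightarrow> lb l \<Longrightarrow> reachable_D x l" using reachable_D_comp[of x "\<lambda>b. b" l] by (simp add: X_def)
lemma X_add: "x \<in> X \<Longrightarrow> y \<in> X \<Longrightarrow> x + y \<in> X" unfolding X_def using reachable_D_add by simp
lemma X_scale: assumes "x \<in> X" shows "c *\<^sub>R x \<in> X"
proof -
  have "reachable_D x (\<lambda>b. c *\<^sub>R b)" by (rule X_reachable_D[OF assms lb_scale[OF lb_id]])
  moreover have "(\<lambda>b. D (c *\<^sub>R x) b) = (\<lambda>b. D x (c *\<^sub>R b))" by (simp add: D_scale)
  ultimately show ?thesis using X_fin[OF assms] fin_scale lb_id unfolding X_def reachable_D_def by auto
qed
lemma X_minus: "x \<in> X \<Longrightarrow> - x \<in> X" using X_scale[of x "-1"] by simp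
lemma X_diff: "x \<in> X \<Longrightarrow> y \<in> X \<Longrightarrow> x - y \<in> X" using X_add[OF _ X_minus, of x y] by simp
lemma X_mult: "x \<in> X \<Longrightarrow> y \<in> X \<Longrightarrow> x * y \<in> X"
  using reachable_D_prod[OF X_reachable_D[of x, OF _ lb_mult_left[OF lb_id X_fin]] X_reachable_D[of y, OF _ lb_mult_right[OF lb_id X_fin]] lb_id]
  unfolding X_def by blast

text \<open>Closedness in the gauge: \<open>D (x - x')\<close> has small weight relative to its argument.\<close>
lemma X_closed:
  assumes x: "fin x" and a: "\<And>d. 0 < d \<Longrightarrow> \<exists>x'\<in>X. x - x' \<in> G d"
  shows "x \<in> X"
proof -
  obtain r where r: "0 < r" "x \<in> G r" using fin_pos x by blast
  have "reachable (\<lambda>b. D x b)"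
  proof (rule reachable_approx)
    fix \<eta> :: real assume n: "0 < \<eta>"
    define d where "d = min 1 (\<eta> / 20)"
    have d: "0 < d" "d \<le> 1" "20 * d \<le> \<eta>" using n by (auto simp: d_def)
    obtain x' where x': "x' \<in> X" "x - x' \<in> G d" using a[OF d(1)] by blast
    have xr: "x' \<in> G (r + d)" using G_diff[OF r(2) x'(2)] by simp
    define m where "m = rho / 8 / (r + 1)"
    have m: "0 < m" using r rho_pos by (simp add: m_def)
    have "near (\<eta> * s) (D x b) (D x' b)" if s: "s \<le> m" and b: "b \<in> G s" for s b
    proof -
      have p: "0 \<le> s" using b G_nonneg by blast
      have "0 < r + 1" using r by simp
      then have "s * (r + 1) \<le> rho / 8" using s unfolding m_def by (simp only: pos_le_divide_eq)
      moreover have "(r + d) * s \<le> (r + 1) * s" "d * s \<le> (r + 1) * s" using d r p by (auto intro!: mult_right_mono)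
      ultimately have le: "(r + d) * s \<le> rho / 8" "d * s \<le> rho / 8" by (auto simp: mult.commute)
      have 1: "near (500 * ((r + d) * s) * (d * s)) (D (x' + (x - x')) b) (D x' b * D (x - x') b)"
        by (rule D_add_left[OF xr x'(2) b le])
      have 2: "near (5 * (d * s)) (D x' b * D (x - x') b) (D x' b)" by (rule near_W[OF D_W[OF x'(2) b]]) (use le rho_pos in simp)
      have "500 * ((r + d) * s) \<le> 1" using le by (simp add: rho_def)
      then have "500 * ((r + d) * s) * (d * s) \<le> 1 * (d * s)" using d p by (intro mult_right_mono) auto
      moreover have "0 \<le> d * s" using d p by simp
      ultimately have "500 * ((r + d) * s) * (d * s) + 5 * (d * s) \<le> 20 * (d * s)" by linarith
      also have "\<dots> = 20 * d * s" by simp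
      also have "\<dots> \<le> \<eta> * s" using d(3) p by (rule mult_right_mono)
      finally show ?thesis using near_trans[OF 1 2] near_mono by simp
    qed
    then show "\<exists>F s0. reachable F \<and> 0 < s0 \<and> (\<forall>s b. s \<le> s0 \<longrightarrow> b \<in> G s \<longrightarrow> near (\<eta> * s) (D x b) (F b))"
      using x'(1) m unfolding X_def reachable_D_def by blast
  qed
  then show ?thesis using x lb_id by (simp add: X_def reachable_D_def)
qed

lemma germ_prod_H:
  assumes "\<forall>f\<in>set fs. H_germ f" obtains s1 where "0 < s1" "\<And>u s. s \<le> s1 \<Longrightarrow> \<forall>i. u i \<in> G s \<Longrightarrow> germ_prod fs u \<in> H"
proof -
  have "\<exists>s1>0. \<forall>u s. s \<le> s1 \<longrightarrow> (\<forall>i. u i \<in> G s) \<longrightarrow> germ_prod fs u \<in> H" using assms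
  proof (induction fs)
    case Nil show ?case by (intro exI[of _ 1]) (simp add: H_one)
  next
    case (Cons f fs)
    obtain s1 where s1: "0 < s1" "\<And>u s. s \<le> s1 \<Longrightarrow> (\<forall>i. u i \<in> G s) \<Longrightarrow> germ_prod fs u \<in> H" using Cons by auto
    obtain s h where s: "fin s" "h \<in> H" "f = conj_germ s h" using Cons.prems unfolding H_germ_def by auto
    obtain s2 where s2: "0 < s2" "\<And>t b. t \<le> s2 \<Longrightarrow> b \<in> G t \<Longrightarrow> norm s * norm b \<le> rho" using unit_small[OF s(1)] by metis
    have "germ_prod (f # fs) u \<in> H" if t: "t \<le> min s1 s2" and u: "\<forall>i. u i \<in> G t" for u t
    proof -
      have "f (u 0) \<in> H" unfolding s(3) by (rule conj_germ_H[OF s(2) s2(2)[of t]]) (use t u in auto)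
      moreover have "germ_prod fs (\<lambda>i. u (Suc i)) \<in> H" by (rule s1(2)[of t]) (use t u in auto)
      ultimately show ?thesis using H_mult by simp
    qed
    then show ?case using s1 s2 by (intro exI[of _ "min s1 s2"]) auto
  qed
  then show ?thesis using that by blast
qed

text \<open>A unit that normalizes \<open>H\<close> carries basic maps to basic maps.\<close>
lemma germ_prod_conj:
  assumes "\<forall>f\<in>set fs. H_germ f" and n: "unit n" "fin n" "fin (iv n)" "\<And>h. h \<in> H \<Longrightarrow> n * h * iv n \<in> H"
  shows "\<exists>fs' s1. (\<forall>f\<in>set fs'. H_germ f) \<and> 0 < s1 \<and> (\<forall>u s. s \<le> s1 \<longrightarrow> (\<forall>i. u i \<in> G s) \<longrightarrow> n * germ_prod fs u * iv n = germ_prod fs' (\<lambda>i. n * u i * iv n))"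
  using assms(1)
proof (induction fs)
  case Nil show ?case by (intro exI[of _ "[]"] exI[of _ 1]) (simp add: iv_right n)
next
  case (Cons f fs)
  obtain gs s1 where s1: "\<forall>f\<in>set gs. H_germ f" "0 < s1" "\<And>u s. s \<le> s1 \<Longrightarrow> (\<forall>i. u i \<in> G s) \<Longrightarrow> n * germ_prod fs u * iv n = germ_prod gs (\<lambda>i. n * u i * iv n)"
    using Cons by auto
  obtain s h where s: "fin s" "h \<in> H" "fin h" "fin (iv h)" "f = conj_germ s h" using Cons.prems unfolding H_germ_def by auto
  obtain s2 where s2: "0 < s2" "\<And>t b. t \<le> s2 \<Longrightarrow> b \<in> G t \<Longrightarrow> unit (1 + s * b)" using unit_small[OF s(1)] by metis
  let ?g = "conj_germ (n * s * iv n) (n * h * iv n)"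
  have uh: "unit h" using s H_unit by blast
  have ih: "iv (n * h * iv n) = n * iv h * iv n" using uh n by (simp add: iv_mult unit_mult unit_iv iv_iv mult.assoc)
  have g: "H_germ ?g" unfolding H_germ_def
    by (intro exI[of _ "n * s * iv n"] exI[of _ "n * h * iv n"]) (use s n ih in \<open>auto intro!: fin_mult\<close>)
  have "n * germ_prod (f # fs) u * iv n = germ_prod (?g # gs) (\<lambda>i. n * u i * iv n)" if t: "t \<le> min s1 s2" and u: "\<forall>i. u i \<in> G t" for u t
  proof -
    have ub: "unit (1 + s * u 0)" by (rule s2(2)[of t]) (use t u in auto)
    have uD: "unit (D s (u 0))" using unit_D[OF ub] .
    have f0: "n * f (u 0) * iv n = ?g (n * u 0 * iv n)"
      unfolding s(5) conj_germ_def D_conj[OF n(1) ub, symmetric] ih using uD n uh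
      by (simp add: iv_mult unit_mult unit_iv iv_iv mult.assoc iv_simps)
    have "n * germ_prod fs (\<lambda>i. u (Suc i)) * iv n = germ_prod gs (\<lambda>i. n * u (Suc i) * iv n)" by (rule s1(3)[of t]) (use t u in auto)
    moreover have "n * (a * b) * iv n = (n * a * iv n) * (n * b * iv n)" for a b using n(1) by (simp add: mult.assoc iv_simps)
    ultimately show ?thesis using f0 by simp
  qed
  then show ?case using s1 s2 g by (intro exI[of _ "?g # gs"] exI[of _ "min s1 s2"]) auto
qed

lemma X_conj:
  assumes x: "x \<in> X" and n: "n - 1 \<in> G q" "2 * q \<le> kap" "\<And>h. h \<in> H \<Longrightarrow> n * h * iv n \<in> H"
  shows "n * x * iv n \<in> X"
proof -
  have q: "0 \<le> q" "q \<le> 1/2" using n G_nonneg by (auto simp: kap_def)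
  have un: "unit n" using unit1[OF n(1)] q by simp
  have ng: "n \<in> G 2" using G_mono[OF G_add[OF G_one n(1)], of 2] q by simp
  have ing: "iv n \<in> G 2" using iv1_G2'[OF n(1) q(2)] by simp
  have fn: "fin n" "fin (iv n)" using ng ing by (auto simp: fin_def)
  have fx: "fin x" using x X_fin by blast
  obtain s1 where s1: "0 < s1" "\<And>t b. t \<le> s1 \<Longrightarrow> b \<in> G t \<Longrightarrow> unit (1 + x * b)" using unit_small[OF fx] by metis
  have "reachable (\<lambda>b. D (n * x * iv n) b)" unfolding reachable_def
  proof (intro allI impI)
    fix \<eta> :: real assume e: "0 < \<eta>"
    then have e8: "0 < \<eta> / 8" by simp
    have "reachable (\<lambda>b. D x b)" using x by (simp add: X_def reachable_D_def)
    from reachD[OF this e8] obtain fs C s0 where C: "\<forall>f\<in>set fs. H_germ f" "0 < C" "0 < s0"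
      "\<And>s b. s \<le> s0 \<Longrightarrow> b \<in> G s \<Longrightarrow> rep fs (C * s) (\<eta> / 8 * s) (D x b)" by metis
    obtain fs' s2 where s2: "\<forall>f\<in>set fs'. H_germ f" "0 < s2"
      "\<And>u s. s \<le> s2 \<Longrightarrow> \<forall>i. u i \<in> G s \<Longrightarrow> n * germ_prod fs u * iv n = germ_prod fs' (\<lambda>i. n * u i * iv n)"
      using germ_prod_conj[OF C(1) un fn n(3)] by metis
    define m where "m = min (min (s0 / 4) (s1 / 4)) (min (s2 / (4 * C)) (kap / (4 * \<eta>)))"
    have "rep fs' (16 * C * s) (\<eta> * s) (D (n * x * iv n) b)" if s: "s \<le> m" and b: "b \<in> G s" for s b
    proof -
      have p: "0 \<le> s" using b G_nonneg by blast
      have sm: "4 * s \<le> s0" "4 * s \<le> s1" "C * (4 * s) \<le> s2" "s * (4 * \<eta>) \<le> kap"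
        using s C e by (auto simp: m_def pos_le_divide_eq mult_ac)
      let ?b = "iv n * b * n"
      have b': "?b \<in> G (4 * s)" using G_mult[OF G_mult[OF ing b] ng] by (simp add: mult_ac)
      obtain u where u: "\<forall>i. u i \<in> G (C * (4 * s))" "near (\<eta> / 8 * (4 * s)) (D x ?b) (germ_prod fs u)"
        using C(4)[OF sm(1) b'] unfolding rep_def by blast
      obtain w where w: "W (\<eta> / 2 * s) w" "D x ?b = germ_prod fs u * w" using u(2) unfolding near_def by auto
      have "W (2 * (\<eta> / 2 * s)) (n * w * iv n)"
        using W_conj[of "n - 1" q "\<eta> / 2 * s" w] n(1,2) w(1) sm(4) q e p by (simp add: mult_ac)
      then have w2: "W (\<eta> * s) (n * w * iv n)" by simp
      have "D (n * x * iv n) b = n * D x ?b * iv n"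
        using D_conj[OF un s1(2)[OF sm(2) b']] un by (simp add: mult.assoc iv_simps)
      also have "\<dots> = (n * germ_prod fs u * iv n) * (n * w * iv n)" unfolding w(2) using un by (simp add: mult.assoc iv_simps)
      also have "n * germ_prod fs u * iv n = germ_prod fs' (\<lambda>i. n * u i * iv n)" by (rule s2(3)[OF sm(3) u(1)])
      finally have "near (\<eta> * s) (D (n * x * iv n) b) (germ_prod fs' (\<lambda>i. n * u i * iv n))" using w2 unfolding near_def by blast
      moreover have "\<forall>i. n * u i * iv n \<in> G (16 * C * s)"
      proof
        fix i have "n * u i * iv n \<in> G (2 * (C * (4 * s)) * 2)" by (intro G_mult ng ing u(1)[rule_format])
        then show "n * u i * iv n \<in> G (16 * C * s)" by (simp add: mult_ac)
      qed
      ultimately show ?thesis unfolding rep_def by (intro exI[of _ "\<lambda>i. n * u i * iv n"] conjI)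
    qed
    then show "\<exists>fs C s0. (\<forall>f\<in>set fs. H_germ f) \<and> 0 < C \<and> 0 < s0 \<and> (\<forall>s b. s \<le> s0 \<longrightarrow> b \<in> G s \<longrightarrow> rep fs (C * s) (\<eta> * s) (D (n * x * iv n) b))"
      using C s1 s2 e kap_pos by (intro exI[of _ fs'] exI[of _ "16 * C"] exI[of _ m]) (auto simp: m_def)
  qed
  then show ?thesis using fx fn lb_id by (simp add: X_def reachable_D_def fin_mult)
qed

lemma fin_bound: assumes "finite A" "\<forall>x\<in>A. fin x" obtains R where "1 \<le> R" "\<forall>x\<in>A. x \<in> G R"
proof -
  have "\<exists>R\<ge>1. \<forall>x\<in>A. x \<in> G R" using assms
  proof (induction A)
    case empty show ?case by (intro exI[of _ 1]) simp
  next
    case (insert a A)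
    obtain R where R: "1 \<le> R" "\<forall>x\<in>A. x \<in> G R" using insert by auto
    obtain r where r: "a \<in> G r" using insert.prems unfolding fin_def by auto
    show ?case using R r G_mono by (intro exI[of _ "max R r"]) (auto intro: G_mono)
  qed
  then show ?thesis using that by blast
qed

text \<open>Conjugation by the elements \<open>n = D p (t *\<^sub>R q)\<close> preserves \<open>X\<close>. As \<open>n\<close> is \<open>1 + t *\<^sub>R (p * q - q * p)\<close> to first order, the difference quotients of
  this conjugation lie in \<open>X\<close> and converge to the bracket.\<close>
lemma X_bracket:
  assumes x: "x \<in> X" and p: "fin p" and q: "fin q"
  shows "(p * q - q * p) * x - x * (p * q - q * p) \<in> X"
proof -
  have fx: "fin x" using x X_fin by blast
  obtain R where R: "1 \<le> R" "\<forall>z\<in>{x, p, q}. z \<in> G R" using fin_bound[of "{x, p, q}"] fx p q by auto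
  then have g: "x \<in> G R" "p \<in> G R" "q \<in> G R" by auto
  let ?c = "p * q - q * p"
  have c: "?c \<in> G (2 * (R * R))" using G_diff[OF G_mult[OF g(2,3)] G_mult[OF g(3,2)]] by simp
  have pw: "1 \<le> R * R" "R * R \<le> R^5" using R(1) by (simp_all add: mult_le_one one_le_power power2_eq_square[symmetric] power_increasing)
  show ?thesis
  proof (rule X_closed)
    show "fin (?c * x - x * ?c)" by (intro fin_intros fx p q)
    fix d :: real assume d: "0 < d"
    define t where "t = min d rho / (1000 * R^5)"
    have R5: "0 < R^5" using R by simp
    have t: "0 < t" "t * (1000 * R^5) \<le> d" "t * (1000 * R^5) \<le> rho" using d R5 rho_pos by (auto simp: t_def)
    have tR: "t * (R * R) \<le> t * R^5" using pw t by (intro mult_left_mono) auto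
    have trho: "1000 * (t * (R * R)) \<le> rho" using tR t(3) by simp
    have tq: "t *\<^sub>R q \<in> G (t * R)" using G_scale[OF g(3), of t] t by simp
    have qp: "(t *\<^sub>R q) * p \<in> G (t * R * R)" by (intro G_mult tq g)
    have half: "t * R * R \<le> 1/2" using trho t pw by (simp add: rho_def)
    define n where "n = D p (t *\<^sub>R q)"
    have u: "unit (1 + (t *\<^sub>R q) * p)" using unit1[OF qp] half by simp
    define v where "v = iv (1 + (t *\<^sub>R q) * p) - 1"
    have v: "v \<in> G (2 * (t * R * R))" unfolding v_def by (rule iv1_G2[OF qp half])
    have n1: "n - 1 = t *\<^sub>R (?c * (1 + v))"
      unfolding n_def D_minus_one[OF u] v_def by (simp add: scaleR_diff_right left_diff_distrib)
    have "1 + v \<in> G (1 + 1)" by (intro G_add G_one G_mono[OF v]) (use half in simp)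
    then have "1 + v \<in> G 2" by simp
    then have cv: "?c * (1 + v) \<in> G (2 * (R * R) * 2)" by (rule G_mult[OF c])
    then have ng: "n - 1 \<in> G (4 * (t * (R * R)))" unfolding n1 using G_scale[OF cv, of t] t by (simp add: mult_ac)
    have nk: "2 * (4 * (t * (R * R))) \<le> kap" using trho by (simp add: rho_def kap_def)
    have un: "unit n" using unit1[OF ng] nk by (simp add: kap_def)
    have nH: "n * h * iv n \<in> H" if "h \<in> H" for h unfolding n_def
    proof (rule H_D[OF that])
      have "norm p * norm (t *\<^sub>R q) \<le> R * (t * R)" using G_norm[OF g(2)] G_norm[OF tq] t R by (intro mult_mono) auto
      also have "R * (t * R) = t * (R * R)" by simp
      finally show "norm p * norm (t *\<^sub>R q) \<le> rho" using trho t(1) pw(1) rho_pos by linarith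
    qed
    have xn: "n * x * iv n \<in> X" by (rule X_conj[OF x ng nk nH])
    define v' where "v' = iv n - 1"
    have v': "v' \<in> G (2 * (4 * (t * (R * R))))" unfolding v'_def using iv1_G2[OF ng] nk by (simp add: kap_def)
    define x' where "x' = inverse t *\<^sub>R (n * x * iv n - x)"
    have x': "x' \<in> X" unfolding x'_def by (intro X_scale X_diff xn x)
    have "n * x * iv n - x = ((n - 1) * x - x * (n - 1)) * iv n"
      using un by (simp add: algebra_simps iv_simps)
    then have "x' = (?c * (1 + v) * x - x * (?c * (1 + v))) * (1 + v')"
      unfolding x'_def n1 v'_def using t(1) by (simp add: scaleR_diff_right[symmetric])
    then have diff: "(?c * x - x * ?c) - x' = - ((?c * v * x - x * (?c * v)) + (?c * (1 + v) * x - x * (?c * (1 + v))) * v')"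
      by (simp add: algebra_simps)
    have mem: "\<dots> \<in> G ((2 * (R * R) * (2 * (t * R * R)) * R + R * (2 * (R * R) * (2 * (t * R * R)))) + (2 * (R * R) * 2 * R + R * (2 * (R * R) * 2)) * (2 * (4 * (t * (R * R)))))"
      by (intro G_minus G_add G_diff G_mult c v g v' cv)
    have fin_eq: "(2 * (R * R) * (2 * (t * R * R)) * R + R * (2 * (R * R) * (2 * (t * R * R)))) + (2 * (R * R) * 2 * R + R * (2 * (R * R) * 2)) * (2 * (4 * (t * (R * R)))) = 72 * (t * R^5)"
      by (simp add: algebra_simps eval_nat_numeral)
    have le: "72 * (t * R^5) \<le> d"
    proof -
      have "0 \<le> t * R^5" "t * (1000 * R^5) = 1000 * (t * R^5)" using t R5 by simp_all
      then show ?thesis using t(2) by linarith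
    qed
    have "(?c * x - x * ?c) - x' \<in> G d" unfolding diff by (rule G_mono[OF mem[unfolded fin_eq] le])
    then show "\<exists>x'\<in>X. ?c * x - x * ?c - x' \<in> G d" using x' by blast
  qed
qed

end

section \<open>Brackets of reachable elements\<close>

context subgroup_gauge begin

text \<open>Since \<open>w\<close> is reachable, \<open>D w (\<tau> *\<^sub>R p)\<close> is an element \<open>k\<close> of \<open>H\<close> up to an error that is small compared with \<open>\<tau>\<close>. The basic
  map \<open>(D s b', k)\<close> has values in \<open>H\<close>, and to first order in \<open>b'\<close> and \<open>\<tau>\<close> it is the commutator of
  \<open>1 + (s * b' - b' * s)\<close> and \<open>1 + \<tau> *\<^sub>R (w * p - p * w)\<close>, that is, the inverse of \<open>D (w * p - p * w) (s * b - b * s)\<close> for \<open>b' = inverse \<tau> *\<^sub>R b\<close>. All errors are small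
  relative to \<open>b\<close> when \<open>\<tau>\<close> is small.\<close>
lemma reachable_D_bracket_bracket:
  assumes w: "w \<in> X" and p: "fin p" and s: "fin s"
  shows "reachable_D (w * p - p * w) (\<lambda>b. s * b - b * s)"
proof -
  have fw: "fin w" using w X_fin by blast
  obtain R where R: "1 \<le> R" "\<forall>z\<in>{w, p, s}. z \<in> G R" using fin_bound[of "{w, p, s}"] fw p s by auto
  then have g: "w \<in> G R" "p \<in> G R" "s \<in> G R" by auto
  let ?y = "w * p - p * w" and ?z = "\<lambda>b. s * b - b * s"
  have lz: "lb ?z" by (intro lb_intros s)
  have fy: "fin ?y" by (intro fin_intros fw p)
  have y: "?y \<in> G (2 * (R * R))" using G_diff[OF G_mult[OF g(1,2)] G_mult[OF g(2,1)]] by simp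
  have zg: "?z b \<in> G (2 * (R * e))" if "b \<in> G e" for b e
    using G_diff[OF G_mult[OF g(3) that] G_mult[OF that g(3)]] by (simp add: mult.commute)
  have R0: "0 < R" using R by simp
  define A where "A = R^5"
  have A: "1 \<le> A" "R \<le> A" "R * R \<le> A" "R * R * R \<le> A" "R * R * R * R \<le> A"
    using R(1) power_increasing[of 1 5 R] power_increasing[of 2 5 R] power_increasing[of 3 5 R] power_increasing[of 4 5 R] one_le_power[of R 5]
    by (simp_all add: A_def eval_nat_numeral mult.assoc)
  have "reachable (\<lambda>b. D ?y (?z b))"
  proof (rule reachable_approx)
    fix \<eta> :: real assume n: "0 < \<eta>"
    define \<eta>1 where "\<eta>1 = min \<eta> kap / (10000 * A)"
    have n1: "0 < \<eta>1" "\<eta>1 * (10000 * A) \<le> \<eta>" "\<eta>1 * (10000 * A) \<le> kap" using n A kap_pos by (auto simp: \<eta>1_def)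
    have "reachable (\<lambda>b. D w b)" using w by (simp add: X_def reachable_D_def)
    from reachD[OF this n1(1)] obtain fs C s0 where C: "\<forall>f\<in>set fs. H_germ f" "0 < C" "0 < s0"
      "\<And>s b. s \<le> s0 \<Longrightarrow> b \<in> G s \<Longrightarrow> rep fs (C * s) (\<eta>1 * s) (D w b)" by metis
    obtain s1 where s1: "0 < s1" "\<And>u s. s \<le> s1 \<Longrightarrow> \<forall>i. u i \<in> G s \<Longrightarrow> germ_prod fs u \<in> H" using germ_prod_H[OF C(1)] by metis
    define \<tau> where "\<tau> = min (min 1 (min (s0 / R) (s1 / (C * R)))) (min \<eta> rho / (100000 * A))"
    have t0: "0 < \<tau>" using R0 C s1 n A rho_pos by (simp add: \<tau>_def)
    have t: "\<tau> \<le> 1" "\<tau> * R \<le> s0" "C * (\<tau> * R) \<le> s1" "\<tau> * (100000 * A) \<le> \<eta>" "\<tau> * (100000 * A) \<le> rho"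
    proof -
      have "\<tau> \<le> s0 / R" "\<tau> \<le> s1 / (C * R)" "\<tau> \<le> min \<eta> rho / (100000 * A)" by (auto simp: \<tau>_def)
      then have "\<tau> * R \<le> s0" "\<tau> * (C * R) \<le> s1" "\<tau> * (100000 * A) \<le> min \<eta> rho"
        using R0 C A by (auto simp only: pos_le_divide_eq mult_pos_pos zero_less_numeral less_le_trans[OF zero_less_one A(1)])
      then show "\<tau> * R \<le> s0" "C * (\<tau> * R) \<le> s1" "\<tau> * (100000 * A) \<le> \<eta>" "\<tau> * (100000 * A) \<le> rho" by (auto simp: mult_ac)
    qed (simp add: \<tau>_def)
    have tA: "0 \<le> \<tau> * A" "100000 * (\<tau> * A) \<le> \<eta>" "100000 * (\<tau> * A) \<le> rho" using t t0 A by (auto simp: mult_ac)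
    have tRR: "\<tau> * (R * R) \<le> \<tau> * A" "\<tau> * R \<le> \<tau> * A" using A t0 by (auto intro: mult_left_mono)
    have tp: "\<tau> *\<^sub>R p \<in> G (\<tau> * R)" using G_scale[OF g(2), of \<tau>] t0 by simp
    define E where "E = D w (\<tau> *\<^sub>R p)"
    obtain u where u: "\<forall>i. u i \<in> G (C * (\<tau> * R))" "near (\<eta>1 * (\<tau> * R)) E (germ_prod fs u)"
      using C(4)[OF t(2) tp] unfolding rep_def E_def by blast
    define k where "k = germ_prod fs u"
    obtain r where r: "W (\<eta>1 * (\<tau> * R)) r" "E = k * r" using u(2) unfolding near_def k_def by auto
    have kH: "k \<in> H" unfolding k_def by (rule s1(2)[OF t(3) u(1)])
    have uk: "unit k" using H_unit kH by blast
    have EW: "W (5 * (R * (\<tau> * R))) E" unfolding E_def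
      by (rule D_W[OF g(1) tp]) (use tRR tA rho_pos in \<open>simp add: mult_ac\<close>)
    have RtR: "R * (\<tau> * R) = \<tau> * (R * R)" by simp
    have Esm: "5 * (R * (\<tau> * R)) \<le> kap / 1000" using tRR(1) tA(1,3) rho_pos unfolding RtR by (simp add: rho_def kap_def)
    have rsm: "\<eta>1 * (\<tau> * R) \<le> kap / 1000"
    proof -
      have "\<tau> * R \<le> 1" using tRR(2) tA(3) by (simp add: rho_def)
      then have "\<eta>1 * (\<tau> * R) \<le> \<eta>1 * 1" using n1 by (intro mult_left_mono) auto
      also have "\<dots> * 10000 \<le> \<eta>1 * (10000 * A)" using A(1) n1 by simp
      finally show ?thesis using n1(3) kap_pos by linarith
    qed
    have ur: "unit r" and uE: "unit E" using W_unit r EW by auto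
    have kE: "k = E * iv r" using r(2) ur by (simp add: mult.assoc iv_right)
    have kW: "W (\<eta>1 * (\<tau> * R) + 5 * (R * (\<tau> * R))) k" unfolding kE using W_mult[OF W_iv[OF r(1)] EW] by (simp add: add.commute)
    have fk: "fin k" "fin (iv k)" by (rule fin_W[OF kW]; use Esm rsm in \<open>simp add: kap_def\<close>)+
    have Hgk: "H_germ (conj_germ s k)" unfolding H_germ_def using s kH fk by blast
    let ?F = "\<lambda>b. iv (conj_germ s k (inverse \<tau> *\<^sub>R b))"
    have rF: "reachable ?F" by (rule reachable_iv[OF reachable_comp[OF reachable_H_germ[OF Hgk] lb_scale[OF lb_id]]])
    define \<sigma>0 where "\<sigma>0 = \<tau> * min \<eta> rho / (100000 * A)"
    have S0: "0 < \<sigma>0" using t0 n A rho_pos by (simp add: \<sigma>0_def)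
    have "near (\<eta> * \<sigma>) (D ?y (?z b)) (?F b)" if sg: "\<sigma> \<le> \<sigma>0" and b: "b \<in> G \<sigma>" for \<sigma> b
    proof -
      have p0: "0 \<le> \<sigma>" using b G_nonneg by blast
      define b' where "b' = inverse \<tau> *\<^sub>R b"
      define \<sigma>' where "\<sigma>' = \<sigma> / \<tau>"
      have b': "b' \<in> G \<sigma>'" using G_scale[OF b, of "inverse \<tau>"] t0 by (simp add: b'_def \<sigma>'_def divide_inverse mult.commute)
      have ts: "\<tau> * \<sigma>' = \<sigma>" "0 \<le> \<sigma>'" using t0 p0 by (auto simp: \<sigma>'_def)
      have "\<sigma>' \<le> \<sigma>0 / \<tau>" unfolding \<sigma>'_def using sg t0 by (simp add: divide_right_mono)
      also have "\<sigma>0 / \<tau> = min \<eta> rho / (100000 * A)" using t0 by (simp add: \<sigma>0_def)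
      finally have "\<sigma>' * (100000 * A) \<le> min \<eta> rho" using A(1) by (simp add: pos_le_divide_eq)
      then have sA: "0 \<le> \<sigma>' * A" "100000 * (\<sigma>' * A) \<le> \<eta>" "100000 * (\<sigma>' * A) \<le> rho" using ts A by (auto simp: mult_ac)
      have sR: "\<sigma>' * R \<le> \<sigma>' * A" "\<sigma>' * (R * R) \<le> \<sigma>' * A" using A ts by (auto intro: mult_left_mono)
      define m where "m = D s b'"
      have mW: "W (5 * (R * \<sigma>')) m" unfolding m_def
        by (rule D_W[OF g(3) b']) (use sR sA rho_pos in \<open>simp add: mult_ac\<close>)
      have msm: "5 * (R * \<sigma>') \<le> kap / 1000" using sR(1) sA(1,3) rho_pos by (simp add: rho_def kap_def mult_ac)
      have um: "unit m" using W_unit mW by blast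
      have F: "?F b = k * m * iv k * iv m"
        unfolding conj_germ_def b'_def[symmetric] m_def[symmetric] using um uk by (simp add: iv_mult unit_mult unit_iv iv_iv mult.assoc)
      \<comment> \<open>The element k of H is replaced by E = k * r; the factor r only contributes a commutator of r and m.\<close>
      define om where "om = iv r * m * iv (iv r) * iv m"
      have omW: "W (16 * (\<eta>1 * (\<tau> * R)) * (5 * (R * \<sigma>'))) om" unfolding om_def
        by (rule W_comm[OF W_iv[OF r(1)] mW]) (use rsm msm kap_pos in auto)
      define T where "T = m * E * iv m"
      define T2 where "T2 = m * E * iv m * iv E"
      have W2: "W (16 * (5 * (R * \<sigma>')) * (5 * (R * (\<tau> * R)))) T2" unfolding T2_def
        by (rule W_comm[OF mW EW]) (use Esm msm kap_pos in auto)
      have TW: "W (5 * (R * (\<tau> * R)) + 16 * (5 * (R * \<sigma>')) * (5 * (R * (\<tau> * R)))) T"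
        using W_mult[OF EW W2] uE by (simp add: T2_def T_def mult.assoc iv_left add.commute)
      have Tsm: "5 * (R * (\<tau> * R)) + 16 * (5 * (R * \<sigma>')) * (5 * (R * (\<tau> * R))) \<le> kap / 100"
      proof -
        have "(5 * (R * \<sigma>')) * (5 * (R * (\<tau> * R))) \<le> kap / 1000 * (kap / 1000)"
          using msm Esm ts t0 R0 kap_pos by (intro mult_mono) auto
        then have "16 * ((5 * (R * \<sigma>')) * (5 * (R * (\<tau> * R)))) \<le> kap / 1000" by (simp add: kap_def)
        then show ?thesis using Esm kap_pos by (simp only: mult.assoc)
      qed
      have uT: "unit T" using W_unit TW by blast
      have omsm: "16 * (\<eta>1 * (\<tau> * R)) * (5 * (R * \<sigma>')) \<le> kap / 1000"
      proof -
        have "(\<eta>1 * (\<tau> * R)) * (5 * (R * \<sigma>')) \<le> kap / 1000 * (kap / 1000)"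
          using msm rsm ts t0 R0 n1 kap_pos by (intro mult_mono) auto
        then show ?thesis by (simp add: kap_def)
      qed
      have conj: "W (2 * (16 * (\<eta>1 * (\<tau> * R)) * (5 * (R * \<sigma>')))) (T * om * iv T)"
      proof -
        have "W (2 * (16 * (\<eta>1 * (\<tau> * R)) * (5 * (R * \<sigma>')))) (iv (iv T) * om * iv T)"
          by (rule W_conj'[OF W_G[OF W_iv[OF TW]] _ omW]) (use Tsm omsm kap_pos in \<open>auto simp: kap_def\<close>)
        then show ?thesis using uT by (simp add: iv_iv)
      qed
      have "k * m * iv k * iv m = E * m * iv E * iv m * (T * om * iv T)"
        unfolding kE om_def T_def using uE ur um
        by (simp add: iv_mult unit_mult unit_iv iv_iv mult.assoc iv_simps)
      then have "near (2 * (16 * (\<eta>1 * (\<tau> * R)) * (5 * (R * \<sigma>')))) (?F b) (E * m * iv E * iv m)"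
        unfolding F using near_W[OF conj, of "E * m * iv E * iv m"] by simp
      moreover have "2 * (16 * (\<eta>1 * (\<tau> * R)) * (5 * (R * \<sigma>'))) = 160 * (\<eta>1 * (R * R)) * (\<tau> * \<sigma>')" by simp
      ultimately have 1: "near (160 * (\<eta>1 * (R * R)) * \<sigma>) (?F b) (E * m * iv E * iv m)" by (simp only: ts)
      \<comment> \<open>It remains to expand the commutator of E and m to first order in both entries.\<close>
      define P where "P = E - 1"
      define Q where "Q = m - 1"
      have KPQ: "E * m * iv E * iv m = K P Q" by (simp add: K_def P_def Q_def)
      define v where "v = iv (1 + (\<tau> *\<^sub>R p) * w) - 1"
      have pw: "(\<tau> *\<^sub>R p) * w \<in> G (\<tau> * R * R)" by (intro G_mult tp g)
      define \<alpha> where "\<alpha> = \<tau> * (R * R)"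
      define \<beta> where "\<beta> = R * \<sigma>'"
      have al: "0 \<le> \<alpha>" "\<alpha> \<le> \<tau> * A" "100000 * \<alpha> \<le> rho"
      proof -
        show "0 \<le> \<alpha>" using t0 R0 by (simp add: \<alpha>_def)
        show "\<alpha> \<le> \<tau> * A" using tRR(1) by (simp only: \<alpha>_def)
        then show "100000 * \<alpha> \<le> rho" using tA(3) by linarith
      qed
      have be: "0 \<le> \<beta>" "\<beta> \<le> \<sigma>' * A" "100000 * \<beta> \<le> rho"
      proof -
        show "0 \<le> \<beta>" using ts R0 by (simp add: \<beta>_def)
        show "\<beta> \<le> \<sigma>' * A" using sR(1) by (simp only: \<beta>_def mult.commute)
        then show "100000 * \<beta> \<le> rho" using sA(3) by linarith
      qed
      have ab: "0 \<le> \<alpha> * \<beta>" "\<alpha> * \<beta> \<le> \<alpha>" "\<alpha> * \<beta> \<le> \<beta>" "\<alpha> * \<alpha> \<le> \<alpha>" "\<beta> * \<beta> \<le> \<beta>"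
        using al be mult_left_le[of \<beta> \<alpha>] mult_left_le[of \<alpha> \<beta>] mult_left_le[of \<alpha> \<alpha>] mult_left_le[of \<beta> \<beta>]
        by (auto simp: rho_def mult.commute)
      have ab2: "4 * (\<alpha> * \<alpha>) \<le> \<alpha>" "4 * (\<beta> * \<beta>) \<le> \<beta>"
        using mult_left_mono[of "4 * \<alpha>" 1 \<alpha>] mult_left_mono[of "4 * \<beta>" 1 \<beta>] al be by (auto simp: rho_def)
      have pwa: "(\<tau> *\<^sub>R p) * w \<in> G \<alpha>" using pw by (simp add: \<alpha>_def mult.assoc)
      have v: "v \<in> G (2 * \<alpha>)" unfolding v_def by (rule iv1_G2[OF pwa]) (use al in \<open>simp add: rho_def\<close>)
      have upw: "unit (1 + (\<tau> *\<^sub>R p) * w)" by (rule unit1[OF pwa]) (use al in \<open>simp add: rho_def\<close>)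
      have P: "P = \<tau> *\<^sub>R ?y + \<tau> *\<^sub>R (?y * v)"
        unfolding P_def E_def D_minus_one[OF upw] v_def
        by (simp add: right_diff_distrib scaleR_diff_right)
          (simp add: left_diff_distrib scaleR_diff_right)
      have P1: "\<tau> *\<^sub>R ?y \<in> G (2 * \<alpha>)" using G_scale[OF y, of \<tau>] t0 by (simp add: \<alpha>_def mult_ac)
      have P2: "\<tau> *\<^sub>R (?y * v) \<in> G (2 * \<alpha> * (2 * \<alpha>))" using G_mult[OF P1 v] by simp
      have Pg: "P \<in> G (4 * \<alpha>)" unfolding P by (rule G_mono[OF G_add[OF P1 P2]]) (use al ab2 in simp)
      define v' where "v' = iv (1 + b' * s) - 1"
      have bs: "b' * s \<in> G \<beta>" using G_mult[OF b' g(3)] by (simp add: \<beta>_def mult.commute)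
      have v': "v' \<in> G (2 * \<beta>)" unfolding v'_def by (rule iv1_G2[OF bs]) (use be in \<open>simp add: rho_def\<close>)
      have ubs: "unit (1 + b' * s)" by (rule unit1[OF bs]) (use be in \<open>simp add: rho_def\<close>)
      have Q: "Q = ?z b' + ?z b' * v'"
        unfolding Q_def m_def D_minus_one[OF ubs] v'_def by (simp add: right_diff_distrib)
      have Q1: "?z b' \<in> G (2 * \<beta>)" using zg[OF b'] by (simp add: \<beta>_def)
      have Q2: "?z b' * v' \<in> G (2 * \<beta> * (2 * \<beta>))" by (rule G_mult[OF Q1 v'])
      have Qg: "Q \<in> G (4 * \<beta>)" unfolding Q by (rule G_mono[OF G_add[OF Q1 Q2]]) (use be ab2 in simp)
      have small1: "\<alpha> * \<beta> * 64000 \<le> 1" "16 * (\<alpha> * \<beta>) \<le> rho / 100" using ab al be by (auto simp: rho_def)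
      have 2: "near (60 * (4 * \<alpha> * (4 * \<beta>)) * (4 * \<alpha> + 4 * \<beta>)) (K P Q) (D P Q)"
        by (rule K_D(1)[OF Pg Qg]) (use al be small1 in \<open>auto simp: rho_def kap_def\<close>)
      have aab: "\<alpha> * \<alpha> * \<beta> \<le> \<alpha> * \<beta>" "\<alpha> * \<beta> * \<beta> \<le> \<alpha> * \<beta>"
        using mult_right_mono[OF ab(4) be(1)] mult_left_mono[OF ab(5) al(1)] by (auto simp: mult.assoc)
      have 3: "near (500 * (2 * \<alpha> * (4 * \<beta>)) * (2 * \<alpha> * (2 * \<alpha>) * (4 * \<beta>))) (D P Q) (D (\<tau> *\<^sub>R ?y) Q * D (\<tau> *\<^sub>R (?y * v)) Q)"
        unfolding P by (rule D_add_left[OF P1 P2 Qg]) (use small1 aab rho_pos in \<open>auto simp: mult_ac\<close>)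
      have 4: "near (5 * (2 * \<alpha> * (2 * \<alpha>) * (4 * \<beta>))) (D (\<tau> *\<^sub>R ?y) Q * D (\<tau> *\<^sub>R (?y * v)) Q) (D (\<tau> *\<^sub>R ?y) Q)"
        by (rule near_W[OF D_W[OF P2 Qg]]) (use small1 aab rho_pos in \<open>auto simp: mult_ac\<close>)
      have 5: "near (1500 * (2 * \<alpha> * (2 * \<beta>)) * (2 * \<alpha> * (2 * \<beta> * (2 * \<beta>)))) (D (\<tau> *\<^sub>R ?y) Q) (D (\<tau> *\<^sub>R ?y) (?z b') * D (\<tau> *\<^sub>R ?y) (?z b' * v'))"
        unfolding Q by (rule D_add_right[OF P1 Q1 Q2]) (use small1 aab rho_pos in \<open>auto simp: mult_ac\<close>)
      have 6: "near (5 * (2 * \<alpha> * (2 * \<beta> * (2 * \<beta>)))) (D (\<tau> *\<^sub>R ?y) (?z b') * D (\<tau> *\<^sub>R ?y) (?z b' * v')) (D (\<tau> *\<^sub>R ?y) (?z b'))"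
        by (rule near_W[OF D_W[OF P1 Q2]]) (use small1 aab rho_pos in \<open>auto simp: mult_ac\<close>)
      have 7: "D (\<tau> *\<^sub>R ?y) (?z b') = D ?y (?z b)"
        unfolding D_scale b'_def using t0 by (simp add: scaleR_diff_right)
      note chain = near_trans[OF near_trans[OF near_trans[OF near_trans[OF near_trans[OF 1[unfolded KPQ] 2] 3] 4] 5] 6, unfolded 7]
      have "160 * (\<eta>1 * (R * R)) * \<sigma> + 60 * (4 * \<alpha> * (4 * \<beta>)) * (4 * \<alpha> + 4 * \<beta>) + 500 * (2 * \<alpha> * (4 * \<beta>)) * (2 * \<alpha> * (2 * \<alpha>) * (4 * \<beta>)) +
          5 * (2 * \<alpha> * (2 * \<alpha>) * (4 * \<beta>)) + 1500 * (2 * \<alpha> * (2 * \<beta>)) * (2 * \<alpha> * (2 * \<beta> * (2 * \<beta>))) + 5 * (2 * \<alpha> * (2 * \<beta> * (2 * \<beta>))) \<le> \<eta> * \<sigma>"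
      proof -
        define U where "U = \<alpha> * \<beta> * \<alpha>"
        define V where "V = \<alpha> * \<beta> * \<beta>"
        have UV: "0 \<le> U" "0 \<le> V" using al be ab by (auto simp: U_def V_def)
        have "\<alpha> * \<beta> * 64000 * U \<le> 1 * U" "\<alpha> * \<beta> * 64000 * V \<le> 1 * V" using small1(1) UV by (intro mult_right_mono; simp)+
        then have s1: "\<alpha> * \<beta> * U * 64000 \<le> U" "\<alpha> * \<beta> * V * 64000 \<le> V" by (simp_all add: mult_ac)
        have s2: "60 * (4 * \<alpha> * (4 * \<beta>)) * (4 * \<alpha> + 4 * \<beta>) = 3840 * U + 3840 * V" by (simp add: U_def V_def algebra_simps)
        have s3: "500 * (2 * \<alpha> * (4 * \<beta>)) * (2 * \<alpha> * (2 * \<alpha>) * (4 * \<beta>)) = \<alpha> * \<beta> * U * 64000" by (simp add: U_def)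
        have s4: "5 * (2 * \<alpha> * (2 * \<alpha>) * (4 * \<beta>)) = 80 * U" by (simp add: U_def)
        have s5: "1500 * (2 * \<alpha> * (2 * \<beta>)) * (2 * \<alpha> * (2 * \<beta> * (2 * \<beta>))) = \<alpha> * \<beta> * V * 48000" by (simp add: V_def)
        have s6: "5 * (2 * \<alpha> * (2 * \<beta> * (2 * \<beta>))) = 40 * V" by (simp add: V_def)
        have s7: "\<alpha> * \<beta> * V * 48000 \<le> V" using s1(2) mult_nonneg_nonneg[OF ab(1) UV(2)] by linarith
        have "\<alpha> * \<beta> = R * R * R * (\<tau> * \<sigma>')" by (simp add: \<alpha>_def \<beta>_def)
        then have abr: "\<alpha> * \<beta> = R * R * R * \<sigma>" by (simp only: ts(1))
        have U: "U = \<tau> * A * \<sigma>" unfolding U_def unfolding abr unfolding \<alpha>_def A_def by (simp add: eval_nat_numeral)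
        have V: "V \<le> \<sigma>' * A * \<sigma>"
        proof -
          have "V = (R * R * R * R) * (\<sigma>' * \<sigma>)" unfolding V_def unfolding abr unfolding \<beta>_def by simp
          also have "\<dots> \<le> A * (\<sigma>' * \<sigma>)" using A(5) ts p0 by (intro mult_right_mono) auto
          finally show ?thesis by (simp add: mult_ac)
        qed
        have "100000 * U \<le> \<eta> * \<sigma>" using mult_right_mono[OF tA(2) p0] by (simp add: U mult_ac)
        moreover have "100000 * V \<le> \<eta> * \<sigma>" using mult_right_mono[OF sA(2) p0] V by (simp add: mult_ac)
        moreover have "10000 * ((\<eta>1 * (R * R)) * \<sigma>) \<le> \<eta> * \<sigma>"
        proof -
          have "10000 * (\<eta>1 * (R * R)) \<le> 10000 * (\<eta>1 * A)" using A(3) n1(1) by simp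
          then have "10000 * (\<eta>1 * (R * R)) \<le> \<eta>" using n1(2) by (simp add: mult_ac)
          from mult_right_mono[OF this p0] show ?thesis by (simp add: mult_ac)
        qed
        moreover have "0 \<le> \<eta> * \<sigma>" using n p0 by simp
        ultimately show ?thesis unfolding s2 s3 s4 s5 s6 using s1(1) s7 UV by (simp only: mult.assoc)
      qed
      from near_mono[OF chain this] show ?thesis by (rule near_sym)
    qed
    then show "\<exists>F s0. reachable F \<and> 0 < s0 \<and> (\<forall>\<sigma> b. \<sigma> \<le> s0 \<longrightarrow> b \<in> G \<sigma> \<longrightarrow> near (\<eta> * \<sigma>) (D ?y (?z b)) (F b))"
      using rF S0 by blast
  qed
  then show ?thesis unfolding reachable_D_def using fy lz by blast
qed

end

section \<open>Ideals of reachable elements\<close>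

context subgroup_gauge begin

text \<open>Quotients of values of \<open>D x\<close> are values at differences, up to second order.\<close>
lemma reachable_D_diff_iff:
  assumes x: "fin x" and l: "lb l" and m: "lb m"
  shows "reachable (\<lambda>b. D x (l b) * iv (D x (m b))) \<longleftrightarrow> reachable_D x (\<lambda>b. l b - m b)"
proof -
  obtain r where r: "0 < r" "x \<in> G r" using fin_pos x by blast
  obtain c where c: "0 < c" "\<And>s b. b \<in> G s \<Longrightarrow> l b \<in> G (c * s)" using l unfolding lb_def by blast
  obtain d where d: "0 < d" "\<And>s b. b \<in> G s \<Longrightarrow> m b \<in> G (d * s)" using m unfolding lb_def by blast
  define s0 where "s0 = min (rho / 8 / (r * c)) (rho / 8 / (r * d))"
  have s0: "0 < s0" using r c d rho_pos by (simp add: s0_def)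
  have 1: "near ((1500 * (r * c) * (r * d) + 1500 * (r * d) * (r * d)) * s * s) (D x (l b - m b)) (D x (l b) * iv (D x (m b)))"
    if s: "s \<le> s0" and b: "b \<in> G s" for s b
  proof -
    have "s \<le> rho / 8 / (r * c)" "s \<le> rho / 8 / (r * d)" using s by (auto simp: s0_def)
    then have "s * (r * c) \<le> rho / 8" "s * (r * d) \<le> rho / 8" using r c d by (auto simp only: pos_le_divide_eq mult_pos_pos)
    then have le: "r * (c * s) \<le> rho / 8" "r * (d * s) \<le> rho / 8" by (simp_all add: mult_ac)
    have "near (1500 * (r * (c * s)) * (r * (d * s))) (D x (l b + - m b)) (D x (l b) * D x (- m b))"
      by (rule D_add_right[OF r(2) c(2)[OF b] G_minus[OF d(2)[OF b]] le])
    moreover have "near (1500 * (r * (d * s)) * (r * (d * s))) (D x (l b) * D x (- m b)) (D x (l b) * iv (D x (m b)))"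
      by (rule near_left[OF near_sym[OF D_neg[OF r(2) d(2)[OF b] le(2)]]])
    ultimately have "near (1500 * (r * (c * s)) * (r * (d * s)) + 1500 * (r * (d * s)) * (r * (d * s))) (D x (l b + - m b)) (D x (l b) * iv (D x (m b)))"
      by (rule near_trans)
    then show ?thesis by (simp add: algebra_simps)
  qed
  show ?thesis
  proof
    assume "reachable (\<lambda>b. D x (l b) * iv (D x (m b)))"
    from reachable_cong2[OF this s0 1] show "reachable_D x (\<lambda>b. l b - m b)" unfolding reachable_D_def using x lb_diff[OF l m] by blast
  next
    assume "reachable_D x (\<lambda>b. l b - m b)"
    then have "reachable (\<lambda>b. D x (l b - m b))" by (simp add: reachable_D_def)
    from reachable_cong2[OF this s0 near_sym[OF 1]] show "reachable (\<lambda>b. D x (l b) * iv (D x (m b)))" .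
  qed
qed

text \<open>\<open>D_conj_eq\<close> rewrites the basic map \<open>(D x b, h)\<close> in terms of \<open>D h\<close>.\<close>
lemma reachable_D_H_bracket:
  assumes h: "h \<in> H" "fin h" "fin (iv h)" and x: "fin x"
  shows "reachable_D h (\<lambda>b. x * b * iv h - b * x * iv h)"
proof -
  have u: "unit h" using H_unit h by blast
  have l: "lb (\<lambda>b. x * b * iv h)" "lb (\<lambda>b. b * x * iv h)" by (intro lb_intros h x)+
  obtain s1 where s1: "0 < s1" "\<And>t b. t \<le> s1 \<Longrightarrow> b \<in> G t \<Longrightarrow> unit (1 + x * b)" using unit_small[OF x] by metis
  obtain s2 where s2: "0 < s2" "\<And>t b. t \<le> s2 \<Longrightarrow> b \<in> G t \<Longrightarrow> unit (1 + h * (x * b * iv h))" using unit_small_lb[OF h(2) l(1)] by metis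
  obtain s3 where s3: "0 < s3" "\<And>t b. t \<le> s3 \<Longrightarrow> b \<in> G t \<Longrightarrow> unit (1 + h * (b * x * iv h))" using unit_small_lb[OF h(2) l(2)] by metis
  let ?A1 = "\<lambda>b. D h (x * b * iv h)" and ?A2 = "\<lambda>b. D h (b * x * iv h)"
  have "H_germ (conj_germ x h)" unfolding H_germ_def using assms by blast
  then have r: "reachable (conj_germ x h)" by (rule reachable_H_germ)
  have "reachable (\<lambda>b. D x b * ?A2 b * iv (D x b) * iv (?A1 b))"
  proof (rule reachable_eq[OF r, of "min s1 (min s2 s3)"])
    fix t b assume t: "t \<le> min s1 (min s2 s3)" and b: "b \<in> G t"
    have ub: "unit (1 + x * b)" by (rule s1(2)[of t]) (use t b in auto)
    have uA1: "unit (?A1 b)" by (rule unit_D, rule s2(2)[of t]) (use t b in auto)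
    have uA2: "unit (?A2 b)" by (rule unit_D, rule s3(2)[of t]) (use t b in auto)
    have uD: "unit (D x b)" using unit_D[OF ub] .
    have "h * iv (D x b) * iv h = iv (h * D x b * iv h)" using u uD by (simp add: iv_mult unit_mult unit_iv iv_iv mult.assoc)
    also have "\<dots> = iv (?A1 b * D x b * iv (?A2 b))" unfolding D_conj[OF u ub] D_conj_eq[OF u ub] ..
    also have "\<dots> = ?A2 b * iv (D x b) * iv (?A1 b)" using uA1 uA2 uD by (simp add: iv_mult unit_mult unit_iv iv_iv mult.assoc)
    finally show "D x b * ?A2 b * iv (D x b) * iv (?A1 b) = conj_germ x h b" by (simp add: conj_germ_def mult.assoc)
  qed (use s1 s2 s3 in auto)
  then have 2: "reachable (\<lambda>b. D x b * iv (D x b) * ?A2 b * iv (?A1 b))"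
    by (rule reachable_commute[rotated -1]) (intro small_iv small_D[OF h(2) l(1)] small_D[OF h(2) l(2)] small_D[OF x lb_id])+
  have "reachable (\<lambda>b. ?A1 b * iv (?A2 b))"
  proof (rule reachable_eq[OF reachable_iv[OF 2], of "min s1 (min s2 s3)"])
    fix t b assume t: "t \<le> min s1 (min s2 s3)" and b: "b \<in> G t"
    have ub: "unit (1 + x * b)" by (rule s1(2)[of t]) (use t b in auto)
    have uA1: "unit (?A1 b)" by (rule unit_D, rule s2(2)[of t]) (use t b in auto)
    have uA2: "unit (?A2 b)" by (rule unit_D, rule s3(2)[of t]) (use t b in auto)
    show "?A1 b * iv (?A2 b) = iv (D x b * iv (D x b) * ?A2 b * iv (?A1 b))"
      using uA1 uA2 unit_D[OF ub] by (simp add: iv_right iv_mult unit_iv iv_iv)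
  qed (use s1 s2 s3 in auto)
  then show ?thesis using reachable_D_diff_iff[OF h(2) l] by simp
qed

text \<open>Modulo reachable factors, \<open>D h\<close> does not distinguish \<open>x * b * iv h\<close> from \<open>b * x * iv h\<close>. By the Leibniz rule \<open>D (h * k)\<close> and \<open>D (k * h)\<close> then
  agree modulo reachable factors, up to the matching change of the argument. As \<open>h * k = c * (k * h)\<close> for the commutator
  \<open>c\<close>, their quotient is a value of \<open>D c\<close>.\<close>
lemma X_commutator:
  assumes h: "h \<in> H" "fin h" "fin (iv h)" and k: "k \<in> H" "fin k" "fin (iv k)"
  shows "h * k * iv h * iv k \<in> X"
proof -
  have u: "unit h" "unit k" using H_unit h k by auto
  define c where "c = h * k * iv h * iv k"
  have fc: "fin c" unfolding c_def by (intro fin_mult h k)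
  have uc: "unit c" unfolding c_def using u by (intro unit_mult unit_iv)
  have ivc: "iv c = k * h * iv k * iv h" unfolding c_def using u by (simp add: iv_mult unit_mult unit_iv iv_iv mult.assoc)
  have fic: "fin (iv c)" unfolding ivc by (intro fin_mult h k)
  define X1 where "X1 = (\<lambda>b. D h (k * b * iv k * iv h))"
  define X2 where "X2 = (\<lambda>b. D k (b * iv k))"
  define Y1 where "Y1 = (\<lambda>b. D h (b * iv h))"
  define Y2 where "Y2 = (\<lambda>b. D k (h * b * iv h * iv k))"
  have l: "lb (\<lambda>b. k * b * iv k * iv h)" "lb (\<lambda>b. b * iv k)" "lb (\<lambda>b. b * iv h)" "lb (\<lambda>b. h * b * iv h * iv k)"
    by (intro lb_intros h k)+
  have "reachable_D h (\<lambda>b. k * (b * iv k) * iv h - (b * iv k) * k * iv h)"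
    by (rule reachable_D_comp[OF reachable_D_H_bracket[OF h k(2)] l(2)])
  then have "reachable_D h (\<lambda>b. k * b * iv k * iv h - b * iv h)" using u by (simp add: mult.assoc iv_left')
  then have r1: "reachable (\<lambda>b. X1 b * iv (Y1 b))" unfolding X1_def Y1_def using reachable_D_diff_iff[OF h(2) l(1,3)] by simp
  have "reachable_D k (\<lambda>b. - (h * (b * iv h) * iv k - (b * iv h) * h * iv k))"
    by (rule reachable_D_minus[OF reachable_D_comp[OF reachable_D_H_bracket[OF k h(2)] l(3)]])
  then have "reachable_D k (\<lambda>b. b * iv k - h * b * iv h * iv k)" using u by (simp add: mult.assoc iv_left')
  then have r2: "reachable (\<lambda>b. X2 b * iv (Y2 b))" unfolding X2_def Y2_def using reachable_D_diff_iff[OF k(2) l(2,4)] by simp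
  have sm: "small X1" "small X2" "small Y1" "small Y2"
    unfolding X1_def X2_def Y1_def Y2_def by (intro small_D l h k)+
  have "reachable (\<lambda>b. X1 b * iv (Y1 b) * (X2 b * iv (Y2 b)))" by (rule reachable_mult[OF r1 r2])
  then have "reachable (\<lambda>b. X1 b * iv (Y1 b) * X2 b * iv (Y2 b))" by (simp add: mult.assoc)
  then have r3: "reachable (\<lambda>b. X1 b * X2 b * iv (Y1 b) * iv (Y2 b))"
    by (rule reachable_commute[rotated -1]) (intro small_iv sm)+
  have lc: "lb (\<lambda>b. (k * h) * b * (iv h * iv k) * iv c)" by (intro lb_intros h k fin_mult fic)
  have lm: "lb (\<lambda>b. b * iv k * iv h)" "lb (\<lambda>b. b * iv h * iv k)" by (intro lb_intros h k)+
  obtain s1 where s1: "0 < s1" "\<And>t b. t \<le> s1 \<Longrightarrow> b \<in> G t \<Longrightarrow> unit (1 + h * k * (b * iv k * iv h))" using unit_small_lb[OF fin_mult[OF h(2) k(2)] lm(1)] by metis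
  obtain s2 where s2: "0 < s2" "\<And>t b. t \<le> s2 \<Longrightarrow> b \<in> G t \<Longrightarrow> unit (1 + k * h * (b * iv h * iv k))" using unit_small_lb[OF fin_mult[OF k(2) h(2)] lm(2)] by metis
  obtain s3 where s3: "0 < s3" "\<And>t b. t \<le> s3 \<Longrightarrow> b \<in> G t \<Longrightarrow> unit (1 + h * (b * iv h))" using unit_small_lb[OF h(2) l(3)] by metis
  obtain s4 where s4: "0 < s4" "\<And>t b. t \<le> s4 \<Longrightarrow> b \<in> G t \<Longrightarrow> unit (1 + k * (h * b * iv h * iv k))" using unit_small_lb[OF k(2) l(4)] by metis
  \<comment> \<open>By the Leibniz rule for this product, D c is the quotient of D (h * k) and D (k * h).\<close>
  have chk: "c * (k * h) = h * k" unfolding c_def using u by (simp add: mult.assoc iv_simps)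
  have "reachable (\<lambda>b. D c ((k * h) * b * (iv h * iv k) * iv c))"
  proof (rule reachable_eq[OF r3, of "min (min s1 s2) (min s3 s4)"])
    fix t b assume t: "t \<le> min (min s1 s2) (min s3 s4)" and b: "b \<in> G t"
    have e1: "unit (1 + h * k * (b * iv k * iv h))" by (rule s1(2)[of t]) (use t b in auto)
    have e2: "unit (1 + k * h * (b * iv h * iv k))" by (rule s2(2)[of t]) (use t b in auto)
    have uY1: "unit (Y1 b)" unfolding Y1_def by (rule unit_D, rule s3(2)[of t]) (use t b in auto)
    have uY2: "unit (Y2 b)" unfolding Y2_def by (rule unit_D, rule s4(2)[of t]) (use t b in auto)
    have d1: "D (h * k) (b * iv k * iv h) = X1 b * X2 b"
      using D_mult[OF e1] u by (simp add: X1_def X2_def mult.assoc iv_left)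
    have d2: "D (k * h) (b * iv h * iv k) = Y2 b * Y1 b"
      using D_mult[OF e2] u by (simp add: Y1_def Y2_def mult.assoc iv_left)
    have arg: "b * (iv h * iv k) * iv c = b * iv k * iv h" unfolding ivc using u by (simp add: mult.assoc iv_simps)
    have e3: "unit (1 + c * (k * h) * (b * (iv h * iv k) * iv c))" unfolding chk arg by (rule e1)
    have "D (c * (k * h)) (b * (iv h * iv k) * iv c) = D c ((k * h) * b * (iv h * iv k) * iv c) * D (k * h) (b * iv h * iv k)"
      using D_mult[OF e3] uc by (simp add: mult.assoc iv_left)
    then have "X1 b * X2 b = D c ((k * h) * b * (iv h * iv k) * iv c) * (Y2 b * Y1 b)"
      unfolding chk arg d1 d2 .
    then show "D c ((k * h) * b * (iv h * iv k) * iv c) = X1 b * X2 b * iv (Y1 b) * iv (Y2 b)"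
      using uY1 uY2 by (simp add: mult.assoc iv_simps)
  qed (use s1 s2 s3 s4 in auto)
  then have "reachable_D c (\<lambda>b. (k * h) * b * (iv h * iv k) * iv c)" unfolding reachable_D_def using fc lc by blast
  moreover have "lb (\<lambda>b. iv h * iv k * (b * c) * (k * h))" by (intro lb_intros fin_mult fc h k)
  ultimately have "reachable_D c (\<lambda>b. (k * h) * (iv h * iv k * (b * c) * (k * h)) * (iv h * iv k) * iv c)"
    by (rule reachable_D_comp)
  then have "reachable_D c (\<lambda>b. b)" using u uc by (simp add: mult.assoc iv_simps)
  then show ?thesis unfolding X_def c_def by simp
qed

text \<open>Apply the previous fact to \<open>p * w\<close> in place of \<open>p\<close>: as \<open>[w, p * w] = [w, p] * w\<close>, the Leibniz rule removes the factor
  \<open>w\<close>, and \<open>w * [t, b] - [t, w * b] = [w, t] * b\<close>.\<close>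
lemma reachable_D_bracket_left:
  assumes w: "w \<in> X" and p: "fin p" and t: "fin t"
  shows "reachable_D (w * p - p * w) (\<lambda>b. (w * t - t * w) * b)"
proof -
  have fw: "fin w" using w X_fin by blast
  let ?y = "w * p - p * w"
  have fy: "fin ?y" by (intro fin_intros fw p)
  have lt: "lb (\<lambda>b. t * b - b * t)" by (intro lb_intros t)
  have "reachable_D (w * (p * w) - (p * w) * w) (\<lambda>b. t * b - b * t)" by (rule reachable_D_bracket_bracket[OF w fin_mult[OF p fw] t])
  then have 1: "reachable_D (?y * w) (\<lambda>b. t * b - b * t)" by (simp add: left_diff_distrib mult.assoc)
  have 2: "reachable_D ?y (\<lambda>b. w * (t * b - b * t))"
    by (rule reachable_D_prod_left[OF 1 X_reachable_D[OF w lb_mult_right[OF lt fy]] fy lt])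
  have 3: "reachable_D ?y (\<lambda>b. - (t * (w * b) - (w * b) * t))"
    by (rule reachable_D_minus[OF reachable_D_comp[OF reachable_D_bracket_bracket[OF w p t] lb_mult_left[OF lb_id fw]]])
  have "(\<lambda>b. - (t * (w * b) - (w * b) * t) + w * (t * b - b * t)) = (\<lambda>b. (w * t - t * w) * b)"
    by (simp add: algebra_simps)
  with reachable_D_add_arg[OF 3 2] show ?thesis by simp
qed

text \<open>The two conditions of the Leibniz rule for the product of the brackets are \<open>reachable_D_bracket_left\<close> and its mirror image, which follows
  by subtracting \<open>reachable_D_bracket_bracket\<close>.\<close>
lemma X_bracket_mult:
  assumes w: "w \<in> X" and p: "fin p" and q: "fin q"
  shows "(w * p - p * w) * (w * q - q * w) \<in> X"
proof -
  have fw: "fin w" using w X_fin by blast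
  let ?y = "w * p - p * w" and ?y' = "w * q - q * w"
  have fy: "fin ?y" by (intro fin_intros fw p)
  have 1: "reachable_D ?y (\<lambda>b. ?y' * b)" by (rule reachable_D_bracket_left[OF w p q])
  have "reachable_D ?y' (\<lambda>b. ?y * b - (?y * b - b * ?y))"
    by (rule reachable_D_diff_arg[OF reachable_D_bracket_left[OF w q p] reachable_D_bracket_bracket[OF w q fy]])
  then have 2: "reachable_D ?y' (\<lambda>b. b * ?y)" by simp
  show ?thesis unfolding X_def using reachable_D_prod[OF 1 2 lb_id] by simp
qed

text \<open>Inserting coefficients into products \<open>[w, p] * [w, q]\<close> by the derivation rule for \<open>[w, -]\<close> yields first \<open>c * t * d * t\<close> and
  \<open>t * d * t * c\<close> in \<open>X\<close>, with a coefficient on one side only. Multiplying \<open>a * t * b * t\<close> by a commutator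
  from the right, which \<open>X_bracket\<close> allows, and comparing with a product of both kinds of words leaves a word with coefficients on both sides.\<close>
lemma X_word:
  assumes w: "w \<in> X" and x: "x \<in> X" and t: "t = w * x - x * w"
    and f: "fin a" "fin b" "fin g" "fin p" "fin b'" "fin a'"
  shows "a * (t * b * t * g * t * p * t * b' * t) * a' \<in> X"
proof -
  have fwx: "fin w" "fin x" using w x X_fin by auto
  have ft: "fin t" unfolding t by (intro fin_intros fwx)
  have B: "(w * c - c * w) * d * t \<in> X" if "fin c" "fin d" for c d
  proof -
    have "(w * c - c * w) * (w * (d * x) - (d * x) * w) - (w * c - c * w) * (w * d - d * w) * x \<in> X"
      by (intro X_diff X_mult X_bracket_mult w x that fin_mult fwx)
    moreover have "(w * c - c * w) * (w * (d * x) - (d * x) * w) - (w * c - c * w) * (w * d - d * w) * x = (w * c - c * w) * d * t"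
      unfolding t by (simp add: algebra_simps)
    ultimately show ?thesis by simp
  qed
  have B': "t * d * (w * c - c * w) \<in> X" if "fin c" "fin d" for c d
  proof -
    have "(w * (x * d) - (x * d) * w) * (w * c - c * w) - x * ((w * d - d * w) * (w * c - c * w)) \<in> X"
      by (intro X_diff X_mult X_bracket_mult w x that fin_mult fwx)
    moreover have "(w * (x * d) - (x * d) * w) * (w * c - c * w) - x * ((w * d - d * w) * (w * c - c * w)) = t * d * (w * c - c * w)"
      unfolding t by (simp add: algebra_simps)
    ultimately show ?thesis by simp
  qed
  have L: "c * t * d * t \<in> X" if "fin c" "fin d" for c d
  proof -
    have "(w * (c * x) - (c * x) * w) * d * t - (w * c - c * w) * (x * d) * t \<in> X"
      by (intro X_diff B that fin_mult fwx)
    moreover have "(w * (c * x) - (c * x) * w) * d * t - (w * c - c * w) * (x * d) * t = c * t * d * t"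
      unfolding t by (simp add: algebra_simps)
    ultimately show ?thesis by simp
  qed
  have R: "t * d * t * c \<in> X" if "fin c" "fin d" for c d
  proof -
    have "t * d * (w * (x * c) - (x * c) * w) - t * (d * x) * (w * c - c * w) \<in> X"
      by (intro X_diff B' that fin_mult fwx)
    moreover have "t * d * (w * (x * c) - (x * c) * w) - t * (d * x) * (w * c - c * w) = t * d * t * c"
      unfolding t by (simp add: algebra_simps)
    ultimately show ?thesis by simp
  qed
  \<comment> \<open>This commutator is the one by which a * t * b * t is multiplied from the right.\<close>
  let ?c = "p * (g * t) - (g * t) * p"
  have "?c * (a * t * b * t) - (a * t * b * t) * ?c \<in> X"
    by (rule X_bracket[OF L[OF f(1,2)] f(4) fin_mult[OF f(3) ft]])
  moreover have "?c * a * t * b * t \<in> X" by (intro L fin_intros f ft)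
  ultimately have "?c * a * t * b * t - (?c * (a * t * b * t) - (a * t * b * t) * ?c) \<in> X" by (rule X_diff[rotated])
  then have c1: "(a * t * b * t) * ?c \<in> X" by (simp add: mult.assoc)
  have c2: "(a * t * (b * t * p * g) * t) * (t * b' * t * a') \<in> X" by (intro X_mult L R fin_mult f ft)
  have "(a * t * (b * t * p * g) * t) * (t * b' * t * a') - (a * t * b * t) * ?c * (t * b' * t * a') \<in> X"
    by (intro X_diff c2 X_mult[OF c1] R f)
  moreover have "(a * t * (b * t * p * g) * t) * (t * b' * t * a') - (a * t * b * t) * ?c * (t * b' * t * a') = a * (t * b * t * g * t * p * t * b' * t) * a'"
    by (simp add: left_diff_distrib right_diff_distrib mult.assoc)
  ultimately show ?thesis by simp
qed

end

section \<open>Newton iteration\<close>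

lemma norm_iv: fixes x :: "'a::{real_normed_algebra_1,banach}"
  assumes "norm x \<le> 1/2" shows "unit (1 + x)" "norm (iv (1 + x)) \<le> 2"
proof -
  obtain y where y: "(1 + x) * (1 + y) = 1" "(1 + y) * (1 + x) = 1" "norm y \<le> (1/2) / (1 - 1/2)"
    using neumann[OF assms] by auto
  show "unit (1 + x)" using y unitI by blast
  have "iv (1 + x) = 1 + y" using y iv_unique by blast
  then show "norm (iv (1 + x)) \<le> 2" using y(3) norm_triangle_ineq[of 1 y] by simp
qed

text \<open>Continuity of inversion near \<open>1\<close>.\<close>
lemma tendsto_iv: fixes x :: "nat \<Rightarrow> 'a::{real_normed_algebra_1,banach}"
  assumes "\<And>n. norm (x n) \<le> 1/2" "x \<longlonglongrightarrow> l" shows "(\<lambda>n. iv (1 + x n)) \<longlonglongrightarrow> iv (1 + l)"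
proof -
  have l: "norm l \<le> 1/2" using assms by (intro Lim_bounded[of "\<lambda>n. norm (x n)"] tendsto_norm) auto
  have "norm (iv (1 + x n) - iv (1 + l)) \<le> 4 * norm (x n - l)" for n
  proof -
    have "iv (1 + x n) - iv (1 + l) = iv (1 + x n) * ((1 + l) - (1 + x n)) * iv (1 + l)"
      using norm_iv[OF assms(1)[of n]] norm_iv[OF l] by (simp only: right_diff_distrib left_diff_distrib iv_left mult.assoc iv_right mult_1_left mult_1_right)
    also have "norm \<dots> \<le> norm (iv (1 + x n)) * norm ((1 + l) - (1 + x n)) * norm (iv (1 + l))"
      by (meson norm_mult_ineq mult_right_mono norm_ge_zero order_trans)
    also have "\<dots> \<le> 2 * norm (x n - l) * 2"
      using norm_iv[OF assms(1)[of n]] norm_iv[OF l] by (intro mult_mono) (auto simp: norm_minus_commute)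
    finally show ?thesis by simp
  qed
  then have "(\<lambda>n. iv (1 + x n) - iv (1 + l)) \<longlonglongrightarrow> 0"
    by (rule Lim_null_comparison[OF always_eventually, rule_format])
      (use tendsto_mult_right_zero[OF tendsto_norm_zero[OF LIM_zero[OF assms(2)]], of 4] in \<open>simp\<close>)
  then show ?thesis by (rule LIM_zero_cancel)
qed

context subgroup_gauge begin

text \<open>With the list of basic maps fixed, convergence of the arguments suffices for convergence of the product, and the limit is again a
  value of the same product. In this way limits are found inside \<open>H\<close> itself.\<close>
lemma germ_prod_limit:
  assumes "\<forall>f\<in>set fs. H_germ f"
  shows "\<exists>s1>0. \<forall>b c. (\<forall>n i. norm (b n i) \<le> s1) \<longrightarrow> (\<forall>i. (\<lambda>n. b n i) \<longlonglongrightarrow> c i) \<longrightarrow>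
    (\<lambda>n::nat. germ_prod fs (b n)) \<longlonglongrightarrow> germ_prod fs c \<and> germ_prod fs c \<in> H"
  using assms
proof (induction fs)
  case Nil show ?case by (intro exI[of _ 1]) (simp add: H_one)
next
  case (Cons f fs)
  obtain s1 where s1: "0 < s1" "\<And>b c. (\<forall>n i. norm (b n i) \<le> s1) \<Longrightarrow> (\<forall>i. (\<lambda>n. b n i) \<longlonglongrightarrow> c i) \<Longrightarrow>
    (\<lambda>n::nat. germ_prod fs (b n)) \<longlonglongrightarrow> germ_prod fs c \<and> germ_prod fs c \<in> H" using Cons by auto
  obtain s h where s: "h \<in> H" "f = conj_germ s h" using Cons.prems unfolding H_germ_def by auto
  define s2 where "s2 = rho / (norm s + 1)"
  have s2: "0 < s2" using rho_pos by (simp add: s2_def add_nonneg_pos)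
  have le: "norm s * r \<le> rho" "r * norm s \<le> rho" if "r \<le> s2" "0 \<le> r" for r
  proof -
    have "r * (norm s + 1) \<le> rho" using that by (simp add: s2_def pos_le_divide_eq add_nonneg_pos)
    then show "norm s * r \<le> rho" "r * norm s \<le> rho" using that by (auto simp: algebra_simps)
  qed
  have "(\<lambda>n. germ_prod (f # fs) (b n)) \<longlonglongrightarrow> germ_prod (f # fs) c \<and> germ_prod (f # fs) c \<in> H"
    if nb: "\<forall>n i. norm (b n i) \<le> min s1 s2" and lim: "\<forall>i. (\<lambda>n. b n i) \<longlonglongrightarrow> c i" for b :: "nat \<Rightarrow> nat \<Rightarrow> 'a" and c
  proof -
    have tl: "(\<lambda>n. germ_prod fs (\<lambda>i. b n (Suc i))) \<longlonglongrightarrow> germ_prod fs (\<lambda>i. c (Suc i)) \<and> germ_prod fs (\<lambda>i. c (Suc i)) \<in> H"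
      by (rule s1(2)) (use nb lim in auto)
    have n0: "norm (b n 0) \<le> s2" for n using nb by auto
    have c0: "norm (c 0) \<le> s2" using n0 lim by (intro Lim_bounded[of "\<lambda>n. norm (b n 0)"] tendsto_norm) auto
    have h1: "norm (x * s) \<le> 1/2" "norm (s * x) \<le> 1/2" if "norm x \<le> s2" for x
      using le[OF that] norm_mult_ineq[of x s] norm_mult_ineq[of s x] norm_ge_zero[of x] unfolding rho_def by linarith+
    have l0: "(\<lambda>n. b n 0) \<longlonglongrightarrow> c 0" using lim by blast
    have D1: "(\<lambda>n. D s (b n 0)) \<longlonglongrightarrow> D s (c 0)" unfolding D_def
      by (intro tendsto_intros tendsto_iv h1 n0 l0)
    have D2: "(\<lambda>n. D (b n 0) s) \<longlonglongrightarrow> D (c 0) s" unfolding D_def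
      by (intro tendsto_intros tendsto_iv h1 n0 l0)
    have ivD: "iv (D s x) = D x s" if "norm x \<le> s2" for x by (rule iv_D[OF norm_iv(1)[OF h1(2)[OF that]]])
    have "(\<lambda>n. D s (b n 0) * h * D (b n 0) s * iv h) \<longlonglongrightarrow> D s (c 0) * h * D (c 0) s * iv h"
      by (intro tendsto_intros D1 D2)
    then have "(\<lambda>n. f (b n 0)) \<longlonglongrightarrow> f (c 0)" unfolding s(2) conj_germ_def using ivD n0 c0 by simp
    moreover have "f (c 0) \<in> H" unfolding s(2) by (rule conj_germ_H[OF s(1) le(1)[OF c0]]) simp
    ultimately show ?thesis using tl by (auto intro!: H_mult tendsto_mult)
  qed
  then show ?case using s1(1) s2 by (intro exI[of _ "min s1 s2"]) auto
qed

text \<open>If all letters are reachable, the product of all letter maps is represented by basic maps with values in \<open>H\<close>.\<close>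
lemma germ_prod_D_rep:
  assumes "set ys \<subseteq> X" "0 < \<eta>"
  shows "\<exists>fs C s0. (\<forall>f\<in>set fs. H_germ f) \<and> 0 < C \<and> 0 < s0 \<and>
    (\<forall>s u. s \<le> s0 \<longrightarrow> (\<forall>i. u i \<in> G s) \<longrightarrow> rep fs (C * s) (\<eta> * s) (germ_prod (map D ys) u))"
  using assms
proof (induction ys arbitrary: \<eta>)
  case Nil
  have "rep [] (1 * s) (\<eta> * s) (germ_prod (map D []) u)" if "\<forall>i. u i \<in> G s" for s and u :: "nat \<Rightarrow> 'a"
  proof -
    have "0 \<le> s" using that G_nonneg by blast
    then show ?thesis using rep_mono[OF rep_one[of "[]"], of "1 * s" "\<eta> * s"] Nil by simp
  qed
  then show ?case by (intro exI[of _ "[]"] exI[of _ "1::real"]) auto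
next
  case (Cons y ys)
  have n3: "0 < \<eta> / 3" using Cons by simp
  have "reachable (\<lambda>b. D y b)" using Cons.prems by (simp add: X_def reachable_D_def)
  from reachD[OF this n3] obtain fs C s0 where C: "\<forall>f\<in>set fs. H_germ f" "0 < C" "0 < s0"
    "\<And>s b. s \<le> s0 \<Longrightarrow> b \<in> G s \<Longrightarrow> rep fs (C * s) (\<eta> / 3 * s) (D y b)" by metis
  have sub: "set ys \<subseteq> X" using Cons.prems by simp
  obtain gs B t0 where B: "\<forall>f\<in>set gs. H_germ f" "0 < B" "0 < t0"
    "\<And>s u. s \<le> t0 \<Longrightarrow> (\<forall>i. u i \<in> G s) \<Longrightarrow> rep gs (B * s) (\<eta> / 3 * s) (germ_prod (map D ys) u)" using Cons.IH[OF sub n3] by blast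
  have "\<forall>f\<in>set (map D ys). \<exists>C s0. 0 < C \<and> 0 < s0 \<and> almost_additive C s0 f"
    using sub X_fin additive_germ_D unfolding additive_germ_def by auto
  from almost_additive_list_exists[OF this] obtain E r0 where E: "0 < E" "0 < r0" "almost_additive_list E r0 (map D ys)" by blast
  define m where "m = min (min s0 t0) (min (min r0 (kap / (64 * E))) (kap / (4 * \<eta>)))"
  have "rep (fs @ gs) ((C + B) * s) (\<eta> * s) (germ_prod (map D (y # ys)) u)" if s: "s \<le> m" and u0: "\<forall>i. u i \<in> G s" for s u
  proof -
    have p: "0 \<le> s" using u0 G_nonneg by blast
    have sm: "s \<le> s0" "s \<le> t0" "s \<le> r0" "s \<le> kap / (64 * E)" "s \<le> kap / (4 * \<eta>)" using s by (auto simp: m_def)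
    have e4: "4 * (\<eta> / 3 * s) \<le> kap" using sm(5) Cons.prems(2) p kap_pos by (simp add: pos_le_divide_eq mult_ac)
    have e5: "8 * (E * s) \<le> kap" using sm(4) E kap_pos p by (simp add: pos_le_divide_eq mult_ac)
    have ut: "\<forall>i. u (Suc i) \<in> G s" using u0 by blast
    have W: "W (E * s) (germ_prod (map D ys) (\<lambda>i. u (Suc i)))" by (rule almost_additive_list_W[OF E(3) sm(3) ut])
    obtain a where a: "\<forall>i. a i \<in> G (C * s)" "near (\<eta> / 3 * s) (D y (u 0)) (germ_prod fs a)" using C(4)[OF sm(1) u0[rule_format]] unfolding rep_def by auto
    obtain v where v: "\<forall>i. v i \<in> G (B * s)" "near (\<eta> / 3 * s) (germ_prod (map D ys) (\<lambda>i. u (Suc i))) (germ_prod gs v)" using B(4)[OF sm(2) ut] unfolding rep_def by auto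
    have 1: "near (2 * (\<eta> / 3 * s)) (D y (u 0) * germ_prod (map D ys) (\<lambda>i. u (Suc i))) (germ_prod fs a * germ_prod (map D ys) (\<lambda>i. u (Suc i)))"
      by (rule near_right_W[OF a(2) W e5 e4])
    have 2: "near (\<eta> / 3 * s) (germ_prod fs a * germ_prod (map D ys) (\<lambda>i. u (Suc i))) (germ_prod fs a * germ_prod gs v)" by (rule near_left[OF v(2)])
    let ?w = "\<lambda>i. if i < length fs then a i else v (i - length fs)"
    have w: "\<forall>i. ?w i \<in> G ((C + B) * s)"
    proof
      fix i
      have "C * s \<le> (C + B) * s" "B * s \<le> (C + B) * s" using C B p by (auto intro: mult_right_mono)
      then show "?w i \<in> G ((C + B) * s)"
        using G_mono[OF a(1)[rule_format]] G_mono[OF v(1)[rule_format]] by (cases "i < length fs") simp_all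
    qed
    have "near (2 * (\<eta> / 3 * s) + \<eta> / 3 * s) (germ_prod (map D (y # ys)) u) (germ_prod (fs @ gs) ?w)" unfolding germ_prod_append using near_trans[OF 1 2] by simp
    then have "near (\<eta> * s) (germ_prod (map D (y # ys)) u) (germ_prod (fs @ gs) ?w)" by (rule near_mono) simp
    then show ?thesis unfolding rep_def by (intro exI[of _ ?w] conjI w)
  qed
  then show ?case
    using C B E Cons.prems(2) kap_pos by (intro exI[of _ "fs @ gs"] exI[of _ "C + B"] exI[of _ m]) (auto simp: m_def)
qed

end

locale letter_subgroup = letter_gauge xs + subgroup_gauge "WG (set xs)" H
  for xs :: "'a::{real_normed_algebra_1,banach} list" and H :: "'a set"
begin

text \<open>Products of small commutators are values of a fixed product of basic maps with values in \<open>H\<close>, with an error of at most a quarter of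
  the weight.\<close>
lemma W_rep_H:
  assumes X: "set xs \<subseteq> X"
  shows "\<exists>fs C \<rho>. (\<forall>f\<in>set fs. H_germ f) \<and> 0 < C \<and> 0 < \<rho> \<and> (\<forall>e g. W e g \<longrightarrow> e \<le> \<rho> \<longrightarrow> rep fs (C * e) (e / 4) g)"
proof -
  obtain \<rho>1 where r1: "0 < \<rho>1" "\<And>e g. W e g \<Longrightarrow> e \<le> \<rho>1 \<Longrightarrow> rep Ds (8 * e) (e / 20) g" using W_rep by blast
  obtain fs C s0 where C: "\<forall>f\<in>set fs. H_germ f" "0 < C" "0 < s0"
    "\<And>s u. s \<le> s0 \<Longrightarrow> (\<forall>i. u i \<in> LG s) \<Longrightarrow> rep fs (C * s) (1/100 * s) (germ_prod Ds u)" using germ_prod_D_rep[OF X, of "1/100"] by auto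
  have "rep fs (C * 8 * e) (e / 4) g" if w: "W e g" and e: "e \<le> min \<rho>1 (s0 / 8)" for e g
  proof -
    have p: "0 \<le> e" using w W_nonneg by blast
    obtain u where u: "\<forall>i. u i \<in> LG (8 * e)" "near (e / 20) g (germ_prod Ds u)" using r1(2)[OF w] e unfolding rep_def by auto
    have "rep fs (C * (8 * e)) (1/100 * (8 * e)) (germ_prod Ds u)" by (rule C(4)[OF _ u(1)]) (use e in auto)
    from rep_near[OF this u(2)] show ?thesis by (rule rep_mono) (use p in auto)
  qed
  then show ?thesis using C r1 by (intro exI[of _ fs] exI[of _ "C * 8"] exI[of _ "min \<rho>1 (s0 / 8)"]) auto
qed

text \<open>Newton iteration. At stage \<open>n\<close> the partial product \<open>g n\<close> equals a value of the fixed product of basic maps up to weight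
  \<open>2 * \<epsilon> / 2^n\<close>. The next factor of weight \<open>\<epsilon> / 2^n\<close> and the old error are represented together by basic maps; their arguments are added
  to the current ones, and the new error is at most \<open>2 * \<epsilon> / 2^(n + 1)\<close>. The arguments form a geometrically convergent sequence.\<close>
theorem convergent_products_in_subgroup:
  assumes X: "set xs \<subseteq> X"
  shows "\<exists>\<epsilon>>0. \<forall>g l. g 0 = 1 \<longrightarrow> (\<forall>n. unit (g n)) \<longrightarrow> (\<forall>n::nat. W (\<epsilon> / 2^n) (iv (g n) * g (Suc n))) \<longrightarrow> g \<longlonglongrightarrow> l \<longrightarrow> l \<in> H"
proof -
  obtain fs C \<rho> where C: "\<forall>f\<in>set fs. H_germ f" "0 < C" "0 < \<rho>" "\<And>e g. W e g \<Longrightarrow> e \<le> \<rho> \<Longrightarrow> rep fs (C * e) (e / 4) g"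
    using W_rep_H[OF X] by blast
  obtain B s0 where B: "0 < B" "0 < s0" "B * s0 \<le> kap / 32" "s0 \<le> 1" "almost_additive_list B s0 fs" using H_germ_almost_additive_list[OF C(1)] by blast
  obtain s1 where s1: "0 < s1" "\<And>b c. (\<forall>n i. norm (b n i) \<le> s1) \<Longrightarrow> (\<forall>i. (\<lambda>n. b n i) \<longlonglongrightarrow> c i) \<Longrightarrow>
    (\<lambda>n::nat. germ_prod fs (b n)) \<longlonglongrightarrow> germ_prod fs c \<and> germ_prod fs c \<in> H" using germ_prod_limit[OF C(1)] by blast
  define \<epsilon> where "\<epsilon> = min (min (\<rho> / 3) (s0 / (6 * C))) (min (s1 / (6 * C)) (min (1 / (72 * B * C * C)) (kap / 100)))"
  have e0: "0 < \<epsilon>" using C B s1 kap_pos by (simp add: \<epsilon>_def)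
  have em: "3 * \<epsilon> \<le> \<rho>" "6 * C * \<epsilon> \<le> s0" "6 * C * \<epsilon> \<le> s1" "72 * B * C * C * \<epsilon> \<le> 1" "100 * \<epsilon> \<le> kap"
  proof -
    have "\<epsilon> \<le> \<rho> / 3" "\<epsilon> \<le> s0 / (6 * C)" "\<epsilon> \<le> s1 / (6 * C)" "\<epsilon> \<le> 1 / (72 * B * C * C)" "\<epsilon> \<le> kap / 100" by (auto simp: \<epsilon>_def)
    then show "3 * \<epsilon> \<le> \<rho>" "6 * C * \<epsilon> \<le> s0" "6 * C * \<epsilon> \<le> s1" "72 * B * C * C * \<epsilon> \<le> 1" "100 * \<epsilon> \<le> kap"
      using B C by (simp_all add: pos_le_divide_eq mult_ac)
  qed
  have "l \<in> H" if g0: "g 0 = 1" and ug: "\<And>n. unit (g n)" and Wg: "\<And>n::nat. W (\<epsilon> / 2^n) (iv (g n) * g (Suc n))" and gl: "g \<longlonglongrightarrow> l" for g l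
  proof -
    define S where "S = (\<lambda>n b. (\<forall>i. b i \<in> LG (6 * C * \<epsilon> * (1 - 1 / 2^n))) \<and> W (2 * \<epsilon> / 2^n) (iv (germ_prod fs b) * g n))"
    define T where "T = (\<lambda>n (b :: nat \<Rightarrow> 'a) b'. \<forall>i. b' i - b i \<in> LG (3 * C * \<epsilon> / 2^n))"
    have start: "\<exists>b. S 0 b"
    proof -
      have "germ_prod fs (\<lambda>i. 0) = 1" by (rule germ_prod_zero) (use C H_germ_zero in blast)
      then show ?thesis unfolding S_def using e0 G_zero g0 by (intro exI[of _ "\<lambda>i. 0"]) (auto simp: iv_one W_one)
    qed
    have step: "\<exists>b'. S (Suc n) b' \<and> T n b b'" if Sb: "S n b" for n b
    proof -
      define e where "e = 3 * \<epsilon> / 2^n"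
      have pw: "(1::real) \<le> 2^n" by simp
      have e: "0 < e" "e \<le> 3 * \<epsilon>" using e0 pw by (auto simp: e_def divide_le_eq mult_left_le)
      have b: "\<forall>i. b i \<in> LG (6 * C * \<epsilon> * (1 - 1 / 2^n))" and sW: "W (2 * \<epsilon> / 2^n) (iv (germ_prod fs b) * g n)" using Sb by (auto simp: S_def)
      have ble: "6 * C * \<epsilon> * (1 - 1 / 2^n) \<le> 6 * C * \<epsilon>" using C e0 by (simp add: mult_left_le)
      have bs0: "6 * C * \<epsilon> * (1 - 1 / 2^n) \<le> s0" using ble em by linarith
      have ub: "unit (germ_prod fs b)" using W_unit[OF almost_additive_list_W[OF B(5) bs0 b]] .
      have "W (2 * \<epsilon> / 2^n + \<epsilon> / 2^n) (iv (germ_prod fs b) * g n * (iv (g n) * g (Suc n)))" using W_mult[OF Wg sW] .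
      then have W1: "W e (iv (germ_prod fs b) * g (Suc n))" using ug[of n] by (simp add: mult.assoc iv_right' e_def add_divide_distrib[symmetric])
      \<comment> \<open>The old error and the new factor together are represented by the basic maps at the arguments d.\<close>
      obtain d where d: "\<forall>i. d i \<in> LG (C * e)" "near (e / 4) (iv (germ_prod fs b) * g (Suc n)) (germ_prod fs d)"
        using C(4)[OF W1] e em unfolding rep_def by auto
      have Ce: "C * e \<le> 3 * C * \<epsilon>" using e C by simp
      have ds0: "C * e \<le> s0"
      proof -
        have "0 \<le> C * \<epsilon>" using C e0 by simp
        moreover have "3 * C * \<epsilon> = 3 * (C * \<epsilon>)" "6 * C * \<epsilon> = 6 * (C * \<epsilon>)" by simp_all
        ultimately show ?thesis using Ce em(2) by linarith
      qed
      let ?b = "\<lambda>i. b i + d i"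
      have c1: "near (B * (6 * C * \<epsilon> * (1 - 1 / 2^n)) * (C * e)) (germ_prod fs b * germ_prod fs d) (germ_prod fs ?b)"
        by (rule near_sym[OF almost_additive_list_near[OF B(5) bs0 ds0 b d(1)]])
      have c2: "near (e / 4) (g (Suc n)) (germ_prod fs b * germ_prod fs d)" using near_left[OF d(2), of "germ_prod fs b"] ub by (simp add: iv_right')
      have c3: "near (e / 4 + B * (6 * C * \<epsilon> * (1 - 1 / 2^n)) * (C * e)) (g (Suc n)) (germ_prod fs ?b)" by (rule near_trans[OF c2 c1])
      have "B * (6 * C * \<epsilon> * (1 - 1 / 2^n)) * (C * e) \<le> B * (6 * C * \<epsilon>) * (C * e)"
        using ble B C e by (intro mult_right_mono mult_left_mono) auto
      also have "\<dots> = (72 * B * C * C * \<epsilon>) * (e / 12)" by simp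
      also have "\<dots> \<le> 1 * (e / 12)" using em(4) e by (intro mult_right_mono) auto
      finally have "e / 4 + B * (6 * C * \<epsilon> * (1 - 1 / 2^n)) * (C * e) \<le> e / 3" by simp
      from near_mono[OF c3 this] have c4: "near (2 * \<epsilon> / 2^Suc n) (g (Suc n)) (germ_prod fs ?b)" by (simp add: e_def)
      have bg: "?b i \<in> LG (6 * C * \<epsilon> * (1 - 1 / 2^Suc n))" for i
      proof -
        have "?b i \<in> LG (6 * C * \<epsilon> * (1 - 1 / 2^n) + C * e)" using G_add b d by blast
        moreover have "6 * C * \<epsilon> * (1 - 1 / 2^n) + C * e = 6 * C * \<epsilon> * (1 - 1 / 2^Suc n)" by (simp add: e_def field_simps)
        ultimately show ?thesis by simp
      qed
      have "6 * C * \<epsilon> * (1 - 1 / 2^Suc n) \<le> 6 * C * \<epsilon>" using C e0 by (simp add: mult_left_le)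
      then have bs0': "6 * C * \<epsilon> * (1 - 1 / 2^Suc n) \<le> s0" using em by linarith
      have ub': "unit (germ_prod fs ?b)" by (rule W_unit[OF almost_additive_list_W[OF B(5) bs0' allI[OF bg]]])
      have "W (2 * \<epsilon> / 2^Suc n) (iv (germ_prod fs ?b) * g (Suc n))" using c4 ub' unfolding near_def by (auto simp: iv_left')
      then have "S (Suc n) ?b" unfolding S_def using bg by blast
      moreover have "T n b ?b" unfolding T_def using d by (simp add: e_def mult_ac)
      ultimately show ?thesis by blast
    qed
    obtain b where b: "\<And>n. S n (b n)" "\<And>n. T n (b n) (b (Suc n))"
      using dependent_nat_choice[of S T] start step by blast
    have bG: "b n i \<in> LG (6 * C * \<epsilon>)" for n i
    proof -
      have "6 * C * \<epsilon> * (1 - 1 / 2^n) \<le> 6 * C * \<epsilon>" using C e0 by (simp add: mult_left_le)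
      then show ?thesis using b(1)[of n] G_mono unfolding S_def by blast
    qed
    have bn: "norm (b n i) \<le> s1" for n i using G_norm[OF bG[of n i]] em by linarith
    have conv: "\<exists>c. (\<lambda>n. b n i) \<longlonglongrightarrow> c" for i
    proof -
      have dn: "norm (b (Suc n) i - b n i) \<le> 3 * C * \<epsilon> * (1/2)^n" for n
      proof -
        have "b (Suc n) i - b n i \<in> LG (3 * C * \<epsilon> / 2^n)" using b(2)[of n] by (simp add: T_def)
        moreover have "3 * C * \<epsilon> / 2^n = 3 * C * \<epsilon> * (1/2)^n" by (simp add: power_divide)
        ultimately show ?thesis using G_norm by metis
      qed
      have "summable (\<lambda>n. b (Suc n) i - b n i)"
        by (rule summable_comparison_test'[OF summable_mult[OF summable_geometric[of "1/2::real"]], of 0 _ "3 * C * \<epsilon>"]) (use dn in auto)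
      then have "convergent (\<lambda>n. \<Sum>k<n. b (Suc k) i - b k i)" by (simp add: summable_iff_convergent)
      moreover have "(\<lambda>n. \<Sum>k<n. b (Suc k) i - b k i) = (\<lambda>n. b n i - b 0 i)"
        using sum_lessThan_telescope[of "\<lambda>k. b k i"] by auto
      ultimately have "convergent (\<lambda>n. b n i - b 0 i)" by metis
      then have "convergent (\<lambda>n. (b n i - b 0 i) + b 0 i)" by (intro convergent_add convergent_const)
      then show ?thesis by (simp add: convergent_def)
    qed
    then obtain c where c: "\<And>i. (\<lambda>n. b n i) \<longlonglongrightarrow> c i" by metis
    have lim: "(\<lambda>n. germ_prod fs (b n)) \<longlonglongrightarrow> germ_prod fs c \<and> germ_prod fs c \<in> H" using s1(2)[of b c] bn c by blast
    define s where "s = (\<lambda>n. iv (germ_prod fs (b n)) * g n)"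
    have s1': "norm (s n - 1) \<le> 8 * \<epsilon> * (1/2)^n" for n
    proof -
      have w: "W (2 * \<epsilon> / 2^n) (s n)" using b(1)[of n] by (simp add: S_def s_def)
      have "2 * \<epsilon> / 2^n \<le> 2 * \<epsilon>" using e0 by (simp add: divide_le_eq mult_left_le)
      then have "12 * (2 * \<epsilon> / 2^n) \<le> 1" using em(5) unfolding kap_def by linarith
      from G_norm[OF W_G[OF w this]] have "norm (s n - 1) \<le> 4 * (2 * \<epsilon> / 2^n)" .
      also have "4 * (2 * \<epsilon> / 2^n) = 8 * \<epsilon> * (1/2)^n" by (simp add: power_divide)
      finally show ?thesis .
    qed
    have "(\<lambda>n. 8 * \<epsilon> * (1/2)^n) \<longlonglongrightarrow> 8 * \<epsilon> * 0" by (intro tendsto_intros LIMSEQ_power_zero) simp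
    then have "(\<lambda>n. s n - 1) \<longlonglongrightarrow> 0" by (intro Lim_null_comparison[OF always_eventually[OF allI[OF s1']]]) simp
    then have sl: "s \<longlonglongrightarrow> 1" by (rule LIM_zero_cancel)
    have gs: "g n = germ_prod fs (b n) * s n" for n
    proof -
      have b0: "6 * C * \<epsilon> \<le> s0" using em by simp
      have "unit (germ_prod fs (b n))" by (rule W_unit[OF almost_additive_list_W[OF B(5) b0 allI[OF bG]]])
      then show ?thesis by (simp add: s_def iv_right')
    qed
    have "(\<lambda>n. germ_prod fs (b n) * s n) \<longlonglongrightarrow> germ_prod fs c * 1" by (intro tendsto_mult sl) (use lim in blast)
    moreover have "(\<lambda>n. germ_prod fs (b n) * s n) = g" by (rule ext) (rule gs[symmetric])
    ultimately have "g \<longlonglongrightarrow> germ_prod fs c" by simp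
    then have "l = germ_prod fs c" using gl LIMSEQ_unique by blast
    then show ?thesis using lim by simp
  qed
  then show ?thesis using e0 by blast
qed

end

section \<open>Derivations modulo maximal ideals\<close>

definition two_sided_ideal :: "'a::ring_1 set \<Rightarrow> bool" where
  "two_sided_ideal I \<longleftrightarrow> 0 \<in> I \<and> (\<forall>x\<in>I. \<forall>y\<in>I. x + y \<in> I) \<and> (\<forall>x\<in>I. \<forall>a. a * x \<in> I \<and> x * a \<in> I)"

text \<open>Maximality among all two-sided ideals, closed or not; closedness follows.\<close>
definition is_maximal_ideal :: "'a::ring_1 set \<Rightarrow> bool" where
  "is_maximal_ideal M \<longleftrightarrow> two_sided_ideal M \<and> 1 \<notin> M \<and> (\<forall>J. two_sided_ideal J \<longrightarrow> 1 \<notin> J \<longrightarrow> M \<subseteq> J \<longrightarrow> J = M)"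

lemma exists_maximal_ideal:
  assumes I: "two_sided_ideal I" "1 \<notin> I" shows "\<exists>M. is_maximal_ideal M \<and> I \<subseteq> M"
proof -
  let ?A = "{J. two_sided_ideal J \<and> 1 \<notin> J \<and> I \<subseteq> J}"
  have "\<exists>M\<in>?A. \<forall>X\<in>?A. M \<subseteq> X \<longrightarrow> X = M"
  proof (rule subset_Zorn_nonempty)
    show "?A \<noteq> {}" using I by blast
    fix C assume C: "C \<noteq> {}" "subset.chain ?A C"
    have id: "two_sided_ideal J" "1 \<notin> J" "I \<subseteq> J" if "J \<in> C" for J using C that unfolding subset.chain_def by auto
    have ch: "J \<subseteq> K \<or> K \<subseteq> J" if "J \<in> C" "K \<in> C" for J K using C that unfolding subset.chain_def by blast
    have "two_sided_ideal (\<Union>C)" unfolding two_sided_ideal_def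
    proof (intro conjI ballI allI)
      show "0 \<in> \<Union>C" using C id unfolding two_sided_ideal_def by blast
      fix x assume x: "x \<in> \<Union>C"
      then obtain J where J: "J \<in> C" "x \<in> J" by blast
      show "a * x \<in> \<Union>C" "x * a \<in> \<Union>C" for a using J id(1)[OF J(1)] unfolding two_sided_ideal_def by blast+
      fix y assume "y \<in> \<Union>C"
      then obtain K where K: "K \<in> C" "y \<in> K" by blast
      show "x + y \<in> \<Union>C" using ch[OF J(1) K(1)]
      proof
        assume "J \<subseteq> K" then have "x + y \<in> K" using J K id(1)[OF K(1)] unfolding two_sided_ideal_def by blast
        then show ?thesis using K by blast
      next
        assume "K \<subseteq> J" then have "x + y \<in> J" using J K id(1)[OF J(1)] unfolding two_sided_ideal_def by blast
        then show ?thesis using J by blast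
      qed
    qed
    then show "\<Union>C \<in> ?A" using C id by blast
  qed
  then obtain M where M: "M \<in> ?A" "\<forall>X\<in>?A. M \<subseteq> X \<longrightarrow> X = M" by (rule bexE)
  have "is_maximal_ideal M" unfolding is_maximal_ideal_def
  proof (intro conjI allI impI)
    fix J assume J: "two_sided_ideal J" "1 \<notin> J" "M \<subseteq> J"
    then have "J \<in> ?A" using M(1) by auto
    then show "J = M" using M(2) J(3) by simp
  qed (use M(1) in auto)
  then show ?thesis using M(1) by auto
qed

locale maximal_ideal =
  fixes M :: "'a::{real_normed_algebra_1,banach} set"
  assumes M: "is_maximal_ideal M"
begin

lemma MI: "two_sided_ideal M" using M unfolding is_maximal_ideal_def by simp
lemma M_max: "two_sided_ideal J \<Longrightarrow> 1 \<notin> J \<Longrightarrow> M \<subseteq> J \<Longrightarrow> J = M" using M unfolding is_maximal_ideal_def by simp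
lemma M_zero: "0 \<in> M" using MI unfolding two_sided_ideal_def by blast
lemma M_add: "x \<in> M \<Longrightarrow> y \<in> M \<Longrightarrow> x + y \<in> M" using MI unfolding two_sided_ideal_def by blast
lemma M_left: "x \<in> M \<Longrightarrow> a * x \<in> M" using MI unfolding two_sided_ideal_def by blast
lemma M_right: "x \<in> M \<Longrightarrow> x * a \<in> M" using MI unfolding two_sided_ideal_def by blast
lemma M_one: "1 \<notin> M" using M unfolding is_maximal_ideal_def by simp
lemma M_minus: "x \<in> M \<Longrightarrow> - x \<in> M" using M_left[of x "- 1"] by simp
lemma M_diff: "x \<in> M \<Longrightarrow> y \<in> M \<Longrightarrow> x - y \<in> M" using M_add[OF _ M_minus, of x y] by simp
lemma M_scale: "x \<in> M \<Longrightarrow> c *\<^sub>R x \<in> M" using M_left[of x "c *\<^sub>R 1"] by simp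
lemma M_half: assumes "x + x \<in> M" shows "x \<in> M"
proof -
  have "(1/2) *\<^sub>R (x + x) = x" by (simp add: scaleR_add_right flip: scaleR_left_distrib)
  then show ?thesis using M_scale[OF assms, of "1/2"] by simp
qed

text \<open>The elements \<open>z\<close> with \<open>z * s * y \<in> M\<close> for all \<open>s\<close> form an ideal containing \<open>M\<close>.\<close>
lemma M_prime: assumes "\<And>s. x * s * y \<in> M" shows "x \<in> M \<or> y \<in> M"
proof -
  let ?J = "{z. \<forall>s. z * s * y \<in> M}"
  have J: "two_sided_ideal ?J" unfolding two_sided_ideal_def
  proof (intro conjI ballI allI)
    show "0 \<in> ?J" using M_zero by simp
    fix z assume z: "z \<in> ?J"
    show "z' \<in> ?J \<Longrightarrow> z + z' \<in> ?J" for z' using z by (simp add: distrib_right M_add)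
    show "a * z \<in> ?J" for a using z M_left by (simp add: mult.assoc)
    show "z * a \<in> ?J" for a
    proof -
      have "z * (a * s) * y \<in> M" for s using z by blast
      then show ?thesis by (simp add: mult.assoc)
    qed
  qed
  have MJ: "M \<subseteq> ?J" using M_right by auto
  show ?thesis
  proof (cases "1 \<in> ?J")
    case True then have "1 * 1 * y \<in> M" by blast
    then show ?thesis by simp
  next
    case False
    then have "?J = M" by (rule M_max[OF J _ MJ])
    then show ?thesis using assms by blast
  qed
qed

text \<open>The closure is an ideal, and it is proper because elements near \<open>1\<close> are invertible.\<close>
lemma M_closed: "closed M"
proof -
  have "two_sided_ideal (closure M)" unfolding two_sided_ideal_def
  proof (intro conjI ballI allI)
    show "0 \<in> closure M" using M_zero closure_subset by blast
    fix x assume x: "x \<in> closure M"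
    then obtain f where f: "\<And>n. f n \<in> M" "f \<longlonglongrightarrow> x" unfolding closure_sequential by blast
    show "a * x \<in> closure M" for a unfolding closure_sequential
      by (rule exI[of _ "\<lambda>n. a * f n"]) (intro conjI allI M_left f tendsto_mult tendsto_const)
    show "x * a \<in> closure M" for a unfolding closure_sequential
      by (rule exI[of _ "\<lambda>n. f n * a"]) (intro conjI allI M_right f tendsto_mult tendsto_const)
    fix y assume "y \<in> closure M"
    then obtain g where g: "\<And>n. g n \<in> M" "g \<longlonglongrightarrow> y" unfolding closure_sequential by blast
    show "x + y \<in> closure M" unfolding closure_sequential
      by (rule exI[of _ "\<lambda>n. f n + g n"]) (intro conjI allI M_add f g tendsto_add)
  qed
  moreover have "1 \<notin> closure M"
  proof
    assume "1 \<in> closure M"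
    then obtain m where m: "m \<in> M" "dist m 1 < 1/2" unfolding closure_approachable by (metis zero_less_divide_1_iff zero_less_numeral)
    have "norm (m - 1) \<le> 1/2" using m(2) by (simp add: dist_norm)
    then have "unit (1 + (m - 1))" by (rule norm_iv)
    then have "m * iv m = 1" by (simp add: iv_right)
    then show False using M_right[OF m(1), of "iv m"] M_one by simp
  qed
  ultimately have "closure M = M" by (rule M_max[OF _ _ closure_subset])
  then show ?thesis by (metis closed_closure)
qed

text \<open>Let \<open>d\<close> be the derivation \<open>[v, -]\<close> with \<open>d \<circ> d = 0\<close> modulo the prime ideal. Expanding \<open>d (d (x * y))\<close> gives \<open>d x * d y = 0\<close>, and inserting a factor gives \<open>d x * s * d y = 0\<close>.\<close>
lemma ad_square_zero:
  assumes "\<And>x. v * (v * x - x * v) - (v * x - x * v) * v \<in> M"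
  shows "v * x - x * v \<in> M"
proof -
  let ?d = "\<lambda>x. v * x - x * v"
  have 1: "?d x * ?d y \<in> M" for x y
  proof (rule M_half)
    have "?d x * ?d y + ?d x * ?d y = ?d (?d (x * y)) - ?d (?d x) * y - x * ?d (?d y)" by (simp add: algebra_simps)
    then show "?d x * ?d y + ?d x * ?d y \<in> M" using assms by (simp only: M_diff M_left M_right)
  qed
  have 2: "?d x * s * ?d y \<in> M" for s y
  proof -
    have "?d x * s * ?d y = ?d x * ?d (s * y) - ?d x * ?d s * y" by (simp add: algebra_simps)
    then show ?thesis using 1 by (simp only: M_diff M_left M_right)
  qed
  show ?thesis using M_prime[OF 2[of _ x]] by blast
qed

text \<open>A derivation \<open>d = [v, -]\<close> with \<open>d\<^sup>3 = 0\<close> that satisfies \<open>d\<^sup>2 = 0\<close> on commutators vanishes modulo the prime ideal. Expanding \<open>d\<^sup>3 (x * y)\<close>, and \<open>d\<^sup>2\<close> of the commutator of \<open>x\<close> and \<open>v * y\<close>,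
  gives two linear relations between \<open>d\<^sup>2 x * d y\<close> and \<open>d x * d\<^sup>2 y\<close>, and hence \<open>d\<^sup>2 x * d y = 0\<close>.\<close>
lemma ad_square_zero_on_commutators:
  assumes c: "\<And>x y. v * (v * (x * y - y * x) - (x * y - y * x) * v) - (v * (x * y - y * x) - (x * y - y * x) * v) * v \<in> M"
    and t: "\<And>x. v * (v * (v * x - x * v) - (v * x - x * v) * v) - (v * (v * x - x * v) - (v * x - x * v) * v) * v \<in> M"
  shows "v * x - x * v \<in> M"
proof -
  define d where "d = (\<lambda>x. v * x - x * v)"
  have prod: "d (x * y) = d x * y + x * d y" for x y by (simp add: d_def algebra_simps)
  have add: "d (x + y) = d x + d y" "d (x - y) = d x - d y" for x y by (simp_all add: d_def algebra_simps)
  have dv: "d v = 0" by (simp add: d_def)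
  have c': "d (d (x * y - y * x)) \<in> M" for x y using c[of x y] by (simp add: d_def)
  have t': "d (d (d x)) \<in> M" for x using t[of x] by (simp add: d_def)
  have 1: "d (d x) * d y + d x * d (d y) \<in> M" for x y
  proof -
    let ?A = "d (d x) * d y" and ?B = "d x * d (d y)"
    have "(?A + ?B) + (?A + ?B) + (?A + ?B) = d (d (d (x * y))) - d (d (d x)) * y - x * d (d (d y))"
      by (simp add: prod add algebra_simps)
    also have "\<dots> \<in> M" by (intro M_diff M_left M_right t')
    finally have "(?A + ?B) + (?A + ?B) + (?A + ?B) \<in> M" .
    then have "(1/3) *\<^sub>R ((?A + ?B) + (?A + ?B) + (?A + ?B)) \<in> M" by (rule M_scale)
    moreover have "(1/3) *\<^sub>R (z + z + z) = z" for z :: 'a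
      by (simp add: scaleR_add_right scaleR_left_distrib[symmetric])
    ultimately show ?thesis by metis
  qed
  have 2: "d (d x) * d y \<in> M" for x y
  proof -
    let ?A = "d (d x) * d y" and ?B = "d x * d (d y)"
    \<comment> \<open>This uses [x, v * y] = v * [x, y] - d x * y.\<close>
    have "?A + ?A + ?B = v * d (d (x * y - y * x)) - d (d (x * (v * y) - (v * y) * x)) - d (d (d x)) * y"
      by (simp add: prod add dv) (simp add: d_def algebra_simps)
    also have "\<dots> \<in> M" by (intro M_diff M_left M_right t' c')
    finally have "?A + ?A + ?B - (?A + ?B) \<in> M" using 1 M_diff by blast
    then show ?thesis by simp
  qed
  have 3: "d (d x) * s * d y \<in> M" for x s y
  proof -
    have "d (d x) * s * d y = d (d x) * d (s * y) - d (d x) * d s * y" by (simp add: prod algebra_simps)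
    then show ?thesis using 2 by (simp only: M_diff M_left M_right)
  qed
  show ?thesis
  proof (cases "\<forall>x. d (d x) \<in> M")
    case True then show ?thesis using ad_square_zero[of v x] by (simp add: d_def)
  next
    case False then show ?thesis using M_prime[OF 3] unfolding d_def by blast
  qed
qed

text \<open>A set that is commutative modulo \<open>M\<close> and stable under brackets with commutators is central modulo \<open>M\<close>, as in Herstein's theory of
  Lie ideals of prime rings. The brackets \<open>[b, [p, q]]\<close> are central by the previous lemma. Hence for
  \<open>d = [b, -]\<close> both \<open>d\<^sup>2 a\<close> and \<open>b * d\<^sup>2 a = [b, [b, b * a]]\<close> are central, and so \<open>d x * d\<^sup>2 a = 0\<close>.\<close>
lemma commutative_invariant_central:
  assumes BB: "\<And>a b. a \<in> B \<Longrightarrow> b \<in> B \<Longrightarrow> a * b - b * a \<in> M"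
    and BU: "\<And>b p q. b \<in> B \<Longrightarrow> b * (p * q - q * p) - (p * q - q * p) * b \<in> B"
    and b: "b \<in> B"
  shows "b * x - x * b \<in> M"
proof -
  have v: "v * x - x * v \<in> M" if v: "v = b * (p * q - q * p) - (p * q - q * p) * b" for v p q x
  proof (rule ad_square_zero_on_commutators)
    have vB: "v \<in> B" using BU[OF b] v by simp
    show 1: "v * (v * (x * y - y * x) - (x * y - y * x) * v) - (v * (x * y - y * x) - (x * y - y * x) * v) * v \<in> M" for x y
      by (rule BB[OF vB BU[OF vB]])
    show "v * (v * (v * x - x * v) - (v * x - x * v) * v) - (v * (v * x - x * v) - (v * x - x * v) * v) * v \<in> M" for x
      by (rule 1)
  qed
  define d where "d = (\<lambda>x. b * x - x * b)"
  have c1: "d (d a) * x - x * d (d a) \<in> M" for a x using v[of "d (d a)" b a x] by (simp add: d_def)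
  have c2: "b * d (d a) * x - x * (b * d (d a)) \<in> M" for a x
    using v[of "b * d (d a)" b "b * a" x] by (simp add: d_def algebra_simps)
  have 1: "d x * d (d a) \<in> M" for x a
  proof -
    have "d x * d (d a) = (b * d (d a) * x - x * (b * d (d a))) - b * (d (d a) * x - x * d (d a)) +
      (d x * d (d a) - (b * d (d a) * x - x * (b * d (d a))) + b * (d (d a) * x - x * d (d a)))" by simp
    moreover have "d x * d (d a) - (b * d (d a) * x - x * (b * d (d a))) + b * (d (d a) * x - x * d (d a)) = 0"
      by (simp add: d_def algebra_simps)
    ultimately have "d x * d (d a) = (b * d (d a) * x - x * (b * d (d a))) - b * (d (d a) * x - x * d (d a))" by simp
    then show ?thesis using c1 c2 by (simp only: M_diff M_left)
  qed
  have 2: "d x * s * d (d a) \<in> M" for x s a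
  proof -
    have "d x * s * d (d a) = d (x * s) * d (d a) - x * (d s * d (d a))" by (simp add: d_def algebra_simps)
    then show ?thesis using 1 by (simp only: M_diff M_left)
  qed
  show ?thesis
  proof (cases "\<forall>a. d (d a) \<in> M")
    case True then show ?thesis using ad_square_zero[of b x] by (simp add: d_def)
  next
    case False then show ?thesis using M_prime[OF 2] unfolding d_def by blast
  qed
qed

text \<open>Put \<open>d = [h, -]\<close>. The hypothesis says that \<open>Z c = d\<^sup>2 c * iv h * iv h\<close> is central for all commutators \<open>c\<close>. Since \<open>Z (d (h * a)) = h * Z (d a)\<close>, also \<open>h\<close> times
  a central element is central, so \<open>h\<close> is central or \<open>d\<^sup>3 = 0\<close>. In the second case \<open>d\<^sup>2 x * d\<^sup>2 y = 0\<close>, and centrality of \<open>Z\<close> makes \<open>d\<^sup>2\<close> vanish on commutators.\<close>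
lemma unit_central_of_second_difference:
  assumes u: "unit h"
    and z: "\<And>p q x. let w = (h * (h * (p * q - q * p) - (p * q - q * p) * h) - (h * (p * q - q * p) - (p * q - q * p) * h) * h) * iv h * iv h
       in w * x - x * w \<in> M"
  shows "h * x - x * h \<in> M"
proof -
  define d where "d = (\<lambda>x. h * x - x * h)"
  have prod: "d (x * y) = d x * y + x * d y" for x y by (simp add: d_def algebra_simps)
  have add: "d (x + y) = d x + d y" "d (x - y) = d x - d y" for x y by (simp_all add: d_def algebra_simps)
  have dh: "d h = 0" by (simp add: d_def)
  define Z where "Z = (\<lambda>c. d (d c) * iv h * iv h)"
  have zc: "Z (p * q - q * p) * x - x * Z (p * q - q * p) \<in> M" for p q x
    using z[of p q x] by (simp add: Z_def d_def Let_def)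
  have ddZ: "d (d c) = Z c * h * h" for c using u by (simp add: Z_def mult.assoc iv_simps)
  \<comment> \<open>The elements d a are themselves commutators, and d (h * a) = h * d a.\<close>
  have Zh: "Z (d (h * a)) = h * Z (d a)" for a by (simp add: Z_def prod dh mult.assoc)
  have 1: "Z (d a) * x - x * Z (d a) \<in> M" for a x using zc[of h a x] by (simp add: d_def)
  have 2: "d x * Z (d a) \<in> M" for x a
  proof -
    have "h * Z (d a) * x - x * (h * Z (d a)) \<in> M" using 1[of "h * a" x] unfolding Zh .
    then have "(h * Z (d a) * x - x * (h * Z (d a))) - h * (Z (d a) * x - x * Z (d a)) \<in> M" by (rule M_diff[OF _ M_left[OF 1]])
    moreover have "(h * y * x - x * (h * y)) - h * (y * x - x * y) = d x * y" for y by (simp add: d_def algebra_simps)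
    ultimately show ?thesis by simp
  qed
  have 3: "d x * s * Z (d a) \<in> M" for x s a
  proof -
    have "d x * s * y = d (x * s) * y - x * (d s * y)" for y by (simp add: prod algebra_simps)
    then show ?thesis using 2 by (simp only: M_diff M_left)
  qed
  show ?thesis
  proof (cases "\<forall>x. d x \<in> M")
    case True then show ?thesis by (simp add: d_def)
  next
    case False
    then have "Z (d a) \<in> M" for a using M_prime[OF 3] by blast
    then have t: "d (d (d a)) \<in> M" for a using ddZ M_right by metis
    have sq: "d (d x) * d (d y) \<in> M" for x y
    proof -
      let ?A = "d (d x) * d (d y)"
      have "?A + ?A + ?A = d (d (d (x * d y))) - d (d (d x)) * d y - x * d (d (d (d y))) - (d x * d (d (d y)) + d x * d (d (d y)) + d x * d (d (d y)))"
        by (simp add: prod add algebra_simps)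
      also have "\<dots> \<in> M" by (intro M_diff M_left M_right M_add t)
      finally have "(1/3) *\<^sub>R (?A + ?A + ?A) \<in> M" by (rule M_scale)
      moreover have "(1/3) *\<^sub>R (z + z + z) = z" for z :: 'a
        by (simp add: scaleR_add_right scaleR_left_distrib[symmetric])
      ultimately show ?thesis by metis
    qed
    have 4: "d (d x) * s * Z (p * q - q * p) \<in> M" for x s p q
    proof -
      let ?z = "Z (p * q - q * p)"
      have "d (d x) * ?z * s \<in> M" unfolding Z_def using sq M_right by (metis mult.assoc)
      then have "d (d x) * ?z * s - d (d x) * (?z * s - s * ?z) \<in> M" by (rule M_diff[OF _ M_left[OF zc]])
      then show ?thesis by (simp add: algebra_simps)
    qed
    show ?thesis
    proof (cases "\<forall>x. d (d x) \<in> M")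
      case True then show ?thesis using ad_square_zero[of h x] by (simp add: d_def)
    next
      case False
      then have "Z (p * q - q * p) \<in> M" for p q using M_prime[OF 4] by blast
      then have "d (d (p * q - q * p)) \<in> M" for p q using ddZ M_right by metis
      then show ?thesis using ad_square_zero_on_commutators[of h x] t by (simp add: d_def)
    qed
  qed
qed

end

section \<open>Invariant subgroups modulo maximal ideals\<close>

text \<open>The first-order term of \<open>D\<close> in a form without remainder.\<close>
lemma D_expand: assumes "unit (1 + b * s)" shows "D s b = 1 + (s * b - b * s) * iv (1 + b * s)"
proof -
  have "D s b = ((1 + b * s) + (s * b - b * s)) * iv (1 + b * s)" unfolding D_def by simp
  then show ?thesis using iv_right[OF assms] by (simp only: distrib_right)
qed

lemma unit_D_small: fixes s b :: "'a::{real_normed_algebra_1,banach}"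
  assumes "norm s * norm b \<le> 1/2" shows "unit (1 + s * b)" "unit (D s b)" "iv (D s b) = D b s"
proof -
  show "unit (1 + s * b)" by (rule norm_iv(1)[OF order_trans[OF norm_mult_ineq assms]])
  then show "unit (D s b)" "iv (D s b) = D b s" by (simp_all add: unit_D iv_D)
qed

text \<open>The derivative of conjugation by \<open>D p (t *\<^sub>R q)\<close> at \<open>t = 0\<close> is the bracket with \<open>p * q - q * p\<close>.\<close>
lemma conj_derivative: fixes p q z :: "'a::{real_normed_algebra_1,banach}"
  assumes c: "\<And>n::nat. 0 < c n" "\<And>n. c n * (norm p * norm q) \<le> 1/2" "c \<longlonglongrightarrow> 0"
  defines "F \<equiv> \<lambda>n. D p (c n *\<^sub>R q) * z * iv (D p (c n *\<^sub>R q))"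
  shows "(\<lambda>n. inverse (c n) *\<^sub>R (F n - z)) \<longlonglongrightarrow> (p * q - q * p) * z - z * (p * q - q * p)"
    and "F \<longlonglongrightarrow> z"
proof -
  define u where "u = p * q - q * p"
  define v where "v = (\<lambda>n. iv (1 + c n *\<^sub>R (q * p)))"
  define w where "w = (\<lambda>n. (1 + c n *\<^sub>R (q * p)) * iv (1 + c n *\<^sub>R (p * q)))"
  have n1: "norm (c n *\<^sub>R (q * p)) \<le> 1/2" for n
  proof -
    have "norm (c n *\<^sub>R (q * p)) \<le> c n * (norm q * norm p)"
      using c(1)[of n] norm_mult_ineq[of q p] by (simp add: mult_left_mono)
    then show ?thesis using c(2)[of n] by (simp add: mult_ac)
  qed
  have n2: "norm (c n *\<^sub>R (p * q)) \<le> 1/2" for n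
  proof -
    have "norm (c n *\<^sub>R (p * q)) \<le> c n * (norm p * norm q)"
      using c(1)[of n] norm_mult_ineq[of p q] by (simp add: mult_left_mono)
    then show ?thesis using c(2)[of n] by simp
  qed
  have l: "(\<lambda>n. c n *\<^sub>R y) \<longlonglongrightarrow> 0" for y :: 'a using tendsto_scaleR[OF c(3) tendsto_const[of y]] by simp
  have v1: "v \<longlonglongrightarrow> 1" unfolding v_def using tendsto_iv[OF n1 l] by (simp add: iv_one)
  have w1: "w \<longlonglongrightarrow> 1" unfolding w_def
    using tendsto_mult[OF tendsto_add[OF tendsto_const l] tendsto_iv[OF n2 l], of 1] by (simp add: iv_one)
  have eq: "F n = z + c n *\<^sub>R ((u * v n * z - z * (u * v n)) * w n)" for n
  proof -
    let ?b = "c n *\<^sub>R q" and ?x = "c n *\<^sub>R (u * v n)"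
    have nn: "norm p * norm ?b \<le> 1/2" using c(1)[of n] c(2)[of n] by (simp add: mult_ac)
    have ub: "unit (1 + ?b * p)" using norm_iv(1)[OF n1[of n]] by simp
    have D1: "D p ?b = 1 + ?x" unfolding D_expand[OF ub] by (simp add: u_def v_def algebra_simps scaleR_diff_right)
    have D2: "iv (D p ?b) = w n" unfolding unit_D_small(3)[OF nn] by (simp add: w_def D_def)
    have "(1 + ?x) * w n = 1" using iv_right[OF unit_D_small(2)[OF nn]] unfolding D1[symmetric] D2 .
    then have zz: "z * (1 + ?x) * w n = z" by (simp add: mult.assoc)
    have "F n = (1 + ?x) * z * w n" unfolding F_def D2 by (simp only: D1)
    also have "\<dots> = z * (1 + ?x) * w n + (?x * z - z * ?x) * w n" by (simp add: algebra_simps)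
    also have "\<dots> = z + c n *\<^sub>R ((u * v n * z - z * (u * v n)) * w n)" unfolding zz by (simp add: algebra_simps scaleR_diff_right)
    finally show ?thesis .
  qed
  have L: "(\<lambda>n. (u * v n * z - z * (u * v n)) * w n) \<longlonglongrightarrow> (u * 1 * z - z * (u * 1)) * 1"
    by (intro tendsto_intros v1 w1)
  have "inverse (c n) *\<^sub>R (F n - z) = (u * v n * z - z * (u * v n)) * w n" for n
    using c(1)[of n] by (simp add: eq)
  then show "(\<lambda>n. inverse (c n) *\<^sub>R (F n - z)) \<longlonglongrightarrow> (p * q - q * p) * z - z * (p * q - q * p)"
    using L by (simp add: u_def)
  have "(\<lambda>n. z + c n *\<^sub>R ((u * v n * z - z * (u * v n)) * w n)) \<longlonglongrightarrow> z + 0 *\<^sub>R ((u * 1 * z - z * (u * 1)) * 1)"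
    by (intro tendsto_add tendsto_const tendsto_scaleR c(3) L)
  moreover have "(\<lambda>n. z + c n *\<^sub>R ((u * v n * z - z * (u * v n)) * w n)) = F" using eq by (intro ext) simp
  ultimately show "F \<longlonglongrightarrow> z" by simp
qed

lemma small_sequence: assumes "0 < r" "0 \<le> e"
  obtains c :: "nat \<Rightarrow> real" where "\<And>n. 0 < c n" "\<And>n. c n * e \<le> r" "c \<longlonglongrightarrow> 0"
proof
  let ?c = "\<lambda>n. r / (e + 1) * inverse (real (Suc n))"
  show "0 < ?c n" for n using assms by simp
  have "r / (e + 1) * e \<le> r" using assms by (simp add: field_simps)
  moreover have "?c n * e \<le> r / (e + 1) * e" for n
    using assms by (intro mult_right_mono mult_left_le) (auto simp: inverse_le_1_iff)
  ultimately show "?c n * e \<le> r" for n using order_trans by blast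
  show "?c \<longlonglongrightarrow> 0" using tendsto_mult_right_zero[OF LIMSEQ_inverse_real_of_nat] .
qed

definition (in invariant_subgroup) group_commutators :: "'a set" where "group_commutators = {h * k * iv h * iv k | h k. h \<in> H \<and> k \<in> H}"

locale invariant_mod_maximal = maximal_ideal M + invariant_subgroup H for M H :: "'a::{real_normed_algebra_1,banach} set"
begin

text \<open>The commutant of the group commutators of \<open>H\<close> modulo \<open>M\<close>.\<close>
definition commutant :: "'a set" where "commutant = {z. \<forall>c\<in>group_commutators. z * c - c * z \<in> M}"

definition bicommutant :: "'a set" where "bicommutant = {b. \<forall>z\<in>commutant. b * z - z * b \<in> M}"

lemma group_commutators_D: assumes c: "c \<in> group_commutators" and n: "norm s * norm b \<le> rho" shows "D s b * c * iv (D s b) \<in> group_commutators"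
proof -
  obtain h k where h: "h \<in> H" "k \<in> H" "c = h * k * iv h * iv k" using c unfolding group_commutators_def by blast
  define n where "n = D s b"
  have un: "unit n" unfolding n_def by (rule unit_D_small) (use n in \<open>simp add: rho_def\<close>)
  have hk: "n * h * iv n \<in> H" "n * k * iv n \<in> H" unfolding n_def by (intro H_D h n)+
  have "n * c * iv n = (n * h * iv n) * (n * k * iv n) * iv (n * h * iv n) * iv (n * k * iv n)"
    using un H_unit[OF h(1)] H_unit[OF h(2)] by (simp add: h(3) iv_mult unit_mult unit_iv iv_iv mult.assoc iv_simps)
  then show ?thesis unfolding n_def[symmetric] group_commutators_def using hk by blast
qed

lemma commutant_conj:
  assumes S: "\<And>c. c \<in> S \<Longrightarrow> iv n * c * n \<in> S" and n: "unit n" and z: "\<forall>c\<in>S. z * c - c * z \<in> M"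
  shows "\<forall>c\<in>S. n * z * iv n * c - c * (n * z * iv n) \<in> M"
proof
  fix c assume "c \<in> S"
  then have "n * (z * (iv n * c * n) - (iv n * c * n) * z) * iv n \<in> M"
    by (intro M_right[OF M_left] z[rule_format] S)
  moreover have "n * (z * (iv n * c * n) - (iv n * c * n) * z) * iv n = n * z * iv n * c - c * (n * z * iv n)"
    using n by (simp add: right_diff_distrib left_diff_distrib mult.assoc iv_simps)
  ultimately show "n * z * iv n * c - c * (n * z * iv n) \<in> M" by simp
qed

lemma iv_D_conj: fixes s b c :: 'a assumes n: "norm s * norm b \<le> rho"
  and S: "\<And>s b. norm s * norm b \<le> rho \<Longrightarrow> D s b * c * iv (D s b) \<in> S"
  shows "iv (D s b) * c * D s b \<in> S"
proof -
  have n': "norm b * norm s \<le> rho" using n by (simp add: mult.commute)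
  have h: "norm s * norm b \<le> 1/2" "norm b * norm s \<le> 1/2" using n n' by (auto simp: rho_def)
  show ?thesis using S[OF n'] unfolding unit_D_small(3)[OF h(1)] unit_D_small(3)[OF h(2)] .
qed

lemma commutant_D: assumes "z \<in> commutant" "norm s * norm b \<le> rho" shows "D s b * z * iv (D s b) \<in> commutant"
proof -
  have u: "unit (D s b)" by (rule unit_D_small) (use assms in \<open>simp add: rho_def\<close>)
  show ?thesis unfolding commutant_def mem_Collect_eq
    by (rule commutant_conj[OF _ u]) (use assms iv_D_conj[OF assms(2) group_commutators_D] in \<open>auto simp: commutant_def\<close>)
qed

lemma bicommutant_D: assumes "z \<in> bicommutant" "norm s * norm b \<le> rho" shows "D s b * z * iv (D s b) \<in> bicommutant"
proof -
  have u: "unit (D s b)" by (rule unit_D_small) (use assms in \<open>simp add: rho_def\<close>)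
  show ?thesis unfolding bicommutant_def mem_Collect_eq
    by (rule commutant_conj[OF _ u]) (use assms iv_D_conj[OF assms(2) commutant_D] in \<open>auto simp: bicommutant_def\<close>)
qed

lemma commutant_limit:
  assumes f: "\<And>n. f n * z - z * f n \<in> M" "f \<longlonglongrightarrow> l" shows "l * z - z * l \<in> M"
proof -
  have "(\<lambda>n. f n * z - z * f n) \<longlonglongrightarrow> l * z - z * l" by (intro tendsto_intros f(2))
  then show ?thesis by (rule closed_sequentially[OF M_closed f(1)])
qed

lemma commutant_scale_diff: assumes "f * z - z * f \<in> M" "g * z - z * g \<in> M"
  shows "(c *\<^sub>R (f - g)) * z - z * (c *\<^sub>R (f - g)) \<in> M"
proof -
  have "(c *\<^sub>R (f - g)) * z - z * (c *\<^sub>R (f - g)) = c *\<^sub>R ((f * z - z * f) - (g * z - z * g))"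
    by (simp add: algebra_simps scaleR_diff_right)
  then show ?thesis using assms by (simp only: M_diff M_scale)
qed

lemma bicommutant_bracket: assumes b: "b \<in> bicommutant" shows "b * (p * q - q * p) - (p * q - q * p) * b \<in> bicommutant"
proof -
  obtain c :: "nat \<Rightarrow> real" where c: "\<And>n. 0 < c n" "\<And>n. c n * (norm p * norm q) \<le> rho" "c \<longlonglongrightarrow> 0"
    using small_sequence[OF rho_pos, of "norm p * norm q"] by (metis mult_nonneg_nonneg norm_ge_zero)
  have c2: "c n * (norm p * norm q) \<le> 1/2" for n using c(2)[of n] by (simp add: rho_def)
  have F: "D p (c n *\<^sub>R q) * b * iv (D p (c n *\<^sub>R q)) \<in> bicommutant" for n
    by (rule bicommutant_D[OF b]) (use c(1)[of n] c(2)[of n] in \<open>simp add: mult_ac\<close>)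
  note lim = conj_derivative(1)[OF c(1) c2 c(3), of b]
  let ?u = "p * q - q * p"
  have u: "(?u * b - b * ?u) * z - z * (?u * b - b * ?u) \<in> M" if z: "z \<in> commutant" for z
    by (rule commutant_limit[OF commutant_scale_diff lim]) (use F b z in \<open>simp_all add: bicommutant_def\<close>)
  have "(b * ?u - ?u * b) * z - z * (b * ?u - ?u * b) \<in> M" if z: "z \<in> commutant" for z
  proof -
    have "(b * ?u - ?u * b) * z - z * (b * ?u - ?u * b) = - ((?u * b - b * ?u) * z - z * (?u * b - b * ?u))"
      by (simp add: algebra_simps)
    then show ?thesis using M_minus[OF u[OF z]] by (simp only:)
  qed
  then show ?thesis unfolding bicommutant_def by blast
qed

text \<open>The bicommutant of a commutative set is commutative. It is invariant under conjugation by \<open>D s b\<close>, and differentiation makes it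
  stable under brackets with commutators.\<close>
lemma commutators_central:
  assumes t: "\<And>w x. w \<in> group_commutators \<Longrightarrow> x \<in> group_commutators \<Longrightarrow> w * x - x * w \<in> M" and c: "c \<in> group_commutators"
  shows "c * x - x * c \<in> M"
proof (rule commutative_invariant_central[of bicommutant])
  have CZ: "group_commutators \<subseteq> commutant" unfolding commutant_def using t by blast
  have sym: "a * b - b * a \<in> M \<Longrightarrow> b * a - a * b \<in> M" for a b using M_minus[of "a * b - b * a"] by simp
  then show "c \<in> bicommutant" unfolding bicommutant_def using c unfolding commutant_def by blast
  have "bicommutant \<subseteq> commutant"
  proof
    fix b assume "b \<in> bicommutant" then show "b \<in> commutant" using CZ unfolding commutant_def bicommutant_def by blast
  qed
  then show "a * b - b * a \<in> M" if "a \<in> bicommutant" "b \<in> bicommutant" for a b using that unfolding bicommutant_def by blast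
  show "b * (p * q - q * p) - (p * q - q * p) * b \<in> bicommutant" if "b \<in> bicommutant" for b p q by (rule bicommutant_bracket[OF that])
qed

text \<open>For \<open>k = (D p (t *\<^sub>R q), h) \<in> H\<close> the commutators \<open>(h, k)\<close> are central modulo \<open>M\<close>, and their derivative at \<open>t = 0\<close> is the second difference
  required by \<open>unit_central_of_second_difference\<close>.\<close>
lemma subgroup_central:
  assumes t: "\<And>w x. w \<in> group_commutators \<Longrightarrow> x \<in> group_commutators \<Longrightarrow> w * x - x * w \<in> M" and h: "h \<in> H"
  shows "h * x - x * h \<in> M"
proof (rule unit_central_of_second_difference[OF H_unit[OF h]])
  fix p q x :: 'a
  obtain c :: "nat \<Rightarrow> real" where c: "\<And>n. 0 < c n" "\<And>n. c n * (norm p * norm q) \<le> rho" "c \<longlonglongrightarrow> 0"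
    using small_sequence[OF rho_pos, of "norm p * norm q"] by (metis mult_nonneg_nonneg norm_ge_zero)
  have c2: "c n * (norm p * norm q) \<le> 1/2" for n using c(2)[of n] by (simp add: rho_def)
  define F where "F = (\<lambda>n. D p (c n *\<^sub>R q) * h * iv (D p (c n *\<^sub>R q)))"
  define u where "u = p * q - q * p"
  have FH: "F n \<in> H" for n unfolding F_def
    by (rule H_D[OF h]) (use c(1)[of n] c(2)[of n] in \<open>simp add: mult_ac\<close>)
  have lim: "(\<lambda>n. inverse (c n) *\<^sub>R (F n - h)) \<longlonglongrightarrow> u * h - h * u"
    unfolding F_def u_def by (intro conj_derivative c c2)
  have uh: "unit h" by (rule H_unit[OF h])
  define k where "k = (\<lambda>n. F n * iv h)"
  have kH: "k n \<in> H" for n unfolding k_def by (intro H_mult FH H_iv h)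
  have uk: "unit (k n)" for n by (rule H_unit[OF kH])
  have ik: "(\<lambda>n. iv (k n)) \<longlonglongrightarrow> 1"
  proof -
    have "iv (k n) = h * (D p (c n *\<^sub>R q) * iv h * iv (D p (c n *\<^sub>R q)))" for n
    proof -
      have "unit (D p (c n *\<^sub>R q))" by (rule unit_D_small) (use c(1)[of n] c2[of n] in \<open>simp add: mult_ac\<close>)
      then show ?thesis using uh by (simp add: k_def F_def iv_mult unit_mult unit_iv iv_iv mult.assoc)
    qed
    moreover have "(\<lambda>n. h * (D p (c n *\<^sub>R q) * iv h * iv (D p (c n *\<^sub>R q)))) \<longlonglongrightarrow> h * iv h"
      by (intro tendsto_mult tendsto_const conj_derivative(2) c c2)
    ultimately show ?thesis by (simp add: iv_right[OF uh])
  qed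
  define g where "g = (\<lambda>n. h * k n * iv h * iv (k n))"
  have gC: "g n \<in> group_commutators" for n unfolding g_def group_commutators_def using h kH by blast
  have gx: "g n * x - x * g n \<in> M" for n by (rule commutators_central[OF t gC])
  have eq: "inverse (c n) *\<^sub>R (g n - 1) =
    (h * (inverse (c n) *\<^sub>R (F n - h)) - (inverse (c n) *\<^sub>R (F n - h)) * h) * iv h * iv h * iv (k n)" for n
  proof -
    have "g n - 1 = (h * k n - k n * h) * iv h * iv (k n)"
      unfolding g_def using uh uk[of n] by (simp add: left_diff_distrib mult.assoc iv_simps)
    also have "h * k n - k n * h = (h * (F n - h) - (F n - h) * h) * iv h"
      unfolding k_def using uh by (simp add: left_diff_distrib right_diff_distrib mult.assoc iv_simps)
    finally show ?thesis by (simp add: scaleR_diff_right left_diff_distrib right_diff_distrib)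
  qed
  let ?l = "(h * (u * h - h * u) - (u * h - h * u) * h) * iv h * iv h"
  have "(\<lambda>n. inverse (c n) *\<^sub>R (g n - 1)) \<longlonglongrightarrow> ?l * 1"
    unfolding eq by (intro tendsto_mult tendsto_diff tendsto_const lim ik)
  then have gl: "(\<lambda>n. inverse (c n) *\<^sub>R (g n - 1)) \<longlonglongrightarrow> ?l" by simp
  have "?l * x - x * ?l \<in> M"
    by (rule commutant_limit[OF commutant_scale_diff gl]) (use gx M_zero in auto)
  from M_minus[OF this] show "let w = (h * (h * (p * q - q * p) - (p * q - q * p) * h) - (h * (p * q - q * p) - (p * q - q * p) * h) * h) * iv h * iv h
       in w * x - x * w \<in> M" unfolding Let_def u_def by (simp add: algebra_simps)
qed

lemma prime_word:
  assumes "\<And>b g p b'. t * b * t * g * t * p * t * b' * t \<in> M" shows "t \<in> M"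
proof -
  have "t * b * t * g * t * p * t \<in> M \<or> t \<in> M" for b g p by (rule M_prime) (rule assms)
  then have "t * b * t * g * t \<in> M \<or> t \<in> M" for b g using M_prime[of "t * b * t * g * t" t] by blast
  then have "t * b * t \<in> M \<or> t \<in> M" for b using M_prime[of "t * b * t" t] by blast
  then show ?thesis using M_prime[of t t] by blast
qed

end

text \<open>The sums of words form an ideal. If it were proper, a maximal ideal containing it would contain the bracket of any two group
  commutators of \<open>H\<close>, by primeness, and \<open>H\<close> would be central modulo it.\<close>
theorem (in invariant_subgroup) unit_is_sum_of_words:
  assumes full: "\<And>M. is_maximal_ideal M \<Longrightarrow> \<exists>h\<in>H. \<exists>a. h * a - a * h \<notin> M"
  shows "\<exists>zs. set zs \<subseteq> {\<alpha> * (t * b * t * g * t * p * t * b' * t) * \<beta> | \<alpha> t b g p b' \<beta>. \<exists>w\<in>group_commutators. \<exists>x\<in>group_commutators. t = w * x - x * w} \<and> sum_list zs = (1::'a)"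
proof (rule ccontr)
  let ?S = "{\<alpha> * (t * b * t * g * t * p * t * b' * t) * \<beta> | \<alpha> t b g p b' \<beta> :: 'a. \<exists>w\<in>group_commutators. \<exists>x\<in>group_commutators. t = w * x - x * w}"
  define I where "I = {sum_list zs | zs. set zs \<subseteq> ?S}"
  assume "\<not> ?thesis"
  then have I1: "1 \<notin> I" unfolding I_def by auto
  have "two_sided_ideal I" unfolding two_sided_ideal_def
  proof (intro conjI ballI allI)
    show "0 \<in> I" unfolding I_def by (intro CollectI exI[of _ "[]"]) simp
    fix x assume "x \<in> I"
    then obtain zs where zs: "set zs \<subseteq> ?S" "x = sum_list zs" unfolding I_def by blast
    show "x + y \<in> I" if "y \<in> I" for y
    proof -
      obtain ys where ys: "set ys \<subseteq> ?S" "y = sum_list ys" using \<open>y \<in> I\<close> unfolding I_def by blast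
      show ?thesis unfolding I_def by (intro CollectI exI[of _ "zs @ ys"]) (use zs ys in simp)
    qed
    fix a
    have Sl: "a * s \<in> ?S" "s * a \<in> ?S" if s: "s \<in> ?S" for s
    proof -
      obtain \<alpha> t b g p b' \<beta> where e: "s = \<alpha> * (t * b * t * g * t * p * t * b' * t) * \<beta>" "\<exists>w\<in>group_commutators. \<exists>x\<in>group_commutators. t = w * x - x * w" using s by blast
      have "a * s = (a * \<alpha>) * (t * b * t * g * t * p * t * b' * t) * \<beta>" "s * a = \<alpha> * (t * b * t * g * t * p * t * b' * t) * (\<beta> * a)"
        unfolding e(1) by (simp_all only: mult.assoc)
      then show "a * s \<in> ?S" "s * a \<in> ?S" using e(2) by blast+
    qed
    have "a * x = sum_list (map ((*) a) zs)" "x * a = sum_list (map (\<lambda>z. z * a) zs)"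
      unfolding zs(2) by (induction zs) (auto simp: algebra_simps)
    moreover have "set (map ((*) a) zs) \<subseteq> ?S" "set (map (\<lambda>z. z * a) zs) \<subseteq> ?S"
      using Sl subsetD[OF zs(1)] unfolding set_map image_subset_iff by (intro ballI; simp only:)+
    ultimately show "a * x \<in> I" "x * a \<in> I" unfolding I_def by blast+
  qed
  then obtain M where max: "is_maximal_ideal M" and IM: "I \<subseteq> M" using exists_maximal_ideal I1 by metis
  then interpret invariant_mod_maximal M H using max by unfold_locales
  have "w * x - x * w \<in> M" if wx: "w \<in> group_commutators" "x \<in> group_commutators" for w x
  proof (rule prime_word)
    fix b g p b'
    define t where "t = w * x - x * w"
    have "1 * (t * b * t * g * t * p * t * b' * t) * 1 \<in> ?S" using wx unfolding t_def by blast
    then have "sum_list [1 * (t * b * t * g * t * p * t * b' * t) * 1] \<in> I" unfolding I_def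
      by (intro CollectI exI[of _ "[1 * (t * b * t * g * t * p * t * b' * t) * 1]"]) simp
    then have "t * b * t * g * t * p * t * b' * t \<in> M" using IM by auto
    then show "(w * x - x * w) * b * (w * x - x * w) * g * (w * x - x * w) * p * (w * x - x * w) * b' * (w * x - x * w) \<in> M"
      unfolding t_def .
  qed
  from subgroup_central[OF this] show False using full[OF max] by blast
qed

section \<open>Small products of commutators\<close>

text \<open>The condition that \<open>H\<close> is not central modulo any maximal ideal expresses that \<open>[H, A]\<close> generates \<open>A\<close> as a closed ideal.\<close>
locale full_subgroup = invariant_subgroup H for H :: "'a::{real_normed_algebra_1,banach} set" +
  assumes full: "is_maximal_ideal M \<Longrightarrow> \<exists>h\<in>H. \<exists>a. h * a - a * h \<notin> M"
begin

lemma subgroup_gauge_WG: "\<forall>s\<in>S. norm s \<le> 1 \<Longrightarrow> subgroup_gauge (WG S) H"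
  by (intro subgroup_gauge.intro gauge_WG invariant_subgroup_axioms)

text \<open>For each word finitely many elements have to be of finite gauge in order to put all its multiples into \<open>X\<close>. The set \<open>F\<close> is chosen before
  the letters, which are then taken to be the elements of all these sets.\<close>
lemma word_multiples_in_X:
  assumes w: "w \<in> group_commutators" and x: "x \<in> group_commutators"
    and t: "t = w * x - x * w"
  shows "\<exists>F. finite F \<and> (\<forall>S. (\<forall>s\<in>S. norm s \<le> 1) \<longrightarrow> (\<forall>e\<in>F. gauge.fin (WG S) e) \<longrightarrow>
    (\<forall>a. gauge.fin (WG S) a \<longrightarrow> a * (\<alpha> * (t * b * t * g * t * p * t * b' * t) * \<beta>) \<in> subgroup_gauge.X (WG S) H))"
proof -
  obtain h k where hk: "h \<in> H" "k \<in> H" "w = h * k * iv h * iv k" using w unfolding group_commutators_def by blast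
  obtain h' k' where hk': "h' \<in> H" "k' \<in> H" "x = h' * k' * iv h' * iv k'" using x unfolding group_commutators_def by blast
  show ?thesis
  proof (intro exI[of _ "{\<alpha>, b, g, p, b', \<beta>, h, iv h, k, iv k, h', iv h', k', iv k'}"] conjI allI impI)
    fix S :: "'a set" and a
    assume S: "\<forall>s\<in>S. norm s \<le> 1" and F: "\<forall>e\<in>{\<alpha>, b, g, p, b', \<beta>, h, iv h, k, iv k, h', iv h', k', iv k'}. gauge.fin (WG S) e"
      and a: "gauge.fin (WG S) a"
    interpret subgroup_gauge "WG S" H by (rule subgroup_gauge_WG[OF S])
    have "w \<in> X" "x \<in> X" unfolding hk(3) hk'(3) by (rule X_commutator; use hk hk' F in simp)+
    then have "(a * \<alpha>) * (t * b * t * g * t * p * t * b' * t) * \<beta> \<in> X"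
      by (rule X_word[OF _ _ t]) (use F a in \<open>auto intro: fin_mult\<close>)
    then show "a * (\<alpha> * (t * b * t * g * t * p * t * b' * t) * \<beta>) \<in> X" by (simp only: mult.assoc)
  qed simp
qed

text \<open>The letters are scaled versions of the prescribed elements and of the elements needed for the words that sum to \<open>1\<close>. Then
  \<open>a = a * 1\<close> is a sum of elements of \<open>X\<close> for every \<open>a\<close> of finite gauge; in particular all letters are reachable and the Newton iteration applies.\<close>
theorem small_products_in_subgroup:
  fixes ts :: "'a list"
  shows "\<exists>S. (\<forall>s\<in>S. norm s \<le> 1) \<and> (\<forall>t\<in>set ts. gauge.fin (WG S) t) \<and>
    (\<exists>\<epsilon>>0. \<forall>g l. g 0 = 1 \<longrightarrow> (\<forall>n::nat. unit (g n)) \<longrightarrow> (\<forall>n. gauge.W (WG S) (\<epsilon> / 2^n) (iv (g n) * g (Suc n))) \<longrightarrow> g \<longlonglongrightarrow> l \<longrightarrow> l \<in> H)"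
proof -
  obtain zs where zs: "set zs \<subseteq> {\<alpha> * (t * b * t * g * t * p * t * b' * t) * \<beta> | \<alpha> t b g p b' \<beta>.
      \<exists>w\<in>group_commutators. \<exists>x\<in>group_commutators. t = w * x - x * w}"
    "sum_list zs = (1::'a)"
    using unit_is_sum_of_words[OF full] by blast
  have "\<exists>F. finite F \<and> (\<forall>S. (\<forall>s\<in>S. norm s \<le> 1) \<longrightarrow> (\<forall>e\<in>F. gauge.fin (WG S) e) \<longrightarrow>
    (\<forall>a. gauge.fin (WG S) a \<longrightarrow> a * z \<in> subgroup_gauge.X (WG S) H))" if z: "z \<in> set zs" for z
  proof -
    obtain \<alpha> t b g p b' \<beta> w x where e: "z = \<alpha> * (t * b * t * g * t * p * t * b' * t) * \<beta>"
      "w \<in> group_commutators" "x \<in> group_commutators" "t = w * x - x * w"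
      using subsetD[OF zs(1) z] by blast
    show ?thesis unfolding e(1) by (rule word_multiples_in_X[OF e(2-4)])
  qed
  then have "\<forall>z\<in>set zs. \<exists>F. finite F \<and> (\<forall>S. (\<forall>s\<in>S. norm s \<le> 1) \<longrightarrow> (\<forall>e\<in>F. gauge.fin (WG S) e) \<longrightarrow>
    (\<forall>a. gauge.fin (WG S) a \<longrightarrow> a * z \<in> subgroup_gauge.X (WG S) H))" by (intro ballI)
  from bchoice[OF this] obtain F where F: "\<forall>z\<in>set zs. finite (F z) \<and> (\<forall>S. (\<forall>s\<in>S. norm s \<le> 1) \<longrightarrow> (\<forall>e\<in>F z. gauge.fin (WG S) e) \<longrightarrow>
    (\<forall>a. gauge.fin (WG S) a \<longrightarrow> a * z \<in> subgroup_gauge.X (WG S) H))" by (rule exE)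
  have "finite (set ts \<union> (\<Union>z\<in>set zs. F z))" using F by simp
  then obtain es where es: "set es = set ts \<union> (\<Union>z\<in>set zs. F z)" using finite_list by blast
  define xs where "xs = map (\<lambda>e. inverse (norm e + 1) *\<^sub>R e) es"
  have nx: "\<forall>x\<in>set xs. norm x \<le> 1"
  proof
    fix x assume "x \<in> set xs"
    then obtain e where x: "x = inverse (norm e + 1) *\<^sub>R e" unfolding xs_def by auto
    have "0 < norm e + 1" using norm_ge_zero[of e] by linarith
    then show "norm x \<le> 1" unfolding x by (simp add: divide_simps)
  qed
  interpret letter_subgroup xs H
    by (intro letter_subgroup.intro letter_gauge.intro subgroup_gauge_WG nx)
  have fe: "fin e" if e: "e \<in> set es" for e
  proof -
    have "inverse (norm e + 1) *\<^sub>R e \<in> set xs" using e unfolding xs_def by simp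
    then have "fin (inverse (norm e + 1) *\<^sub>R e)" using letter_G unfolding fin_def by blast
    then have "fin ((norm e + 1) *\<^sub>R (inverse (norm e + 1) *\<^sub>R e))" by (rule fin_scale)
    moreover have "norm e + 1 \<noteq> 0" using norm_ge_zero[of e] by linarith
    ultimately show ?thesis by simp
  qed
  have z: "a * z \<in> X" if "z \<in> set zs" "fin a" for z a
    using F that nx fe es by blast
  have "a * sum_list ys \<in> X" if "ys \<noteq> []" "set ys \<subseteq> set zs" "fin a" for ys a using that
  proof (induction ys rule: list_nonempty_induct)
    case (single x) then show ?case using z by simp
  next
    case (cons x ys)
    then show ?case using z by (auto simp: distrib_left intro: X_add)
  qed
  from this[of zs] have "a \<in> X" if "fin a" for a using zs(2) that by (cases zs) auto
  moreover have "fin x" if "x \<in> set xs" for x using letter_G[OF that] unfolding fin_def by blast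
  ultimately have "set xs \<subseteq> X" by blast
  from convergent_products_in_subgroup[OF this] show ?thesis
    by (intro exI[of _ "set xs"] conjI) (use nx fe es in auto)
qed

end

section \<open>All commutators with the identity component\<close>

definition comm :: "'a::ring_1 \<Rightarrow> 'a \<Rightarrow> 'a" where "comm g k = g * k * iv g * iv k"

text \<open>For arbitrary \<open>k\<close> the commutator \<open>(1 + q, k)\<close> is a value of \<open>D\<close> with one small argument.\<close>
lemma comm_eq_D: assumes k: "unit k" and u: "unit (1 + q)" shows "comm (1 + q) k = D (q * iv k) k"
proof -
  have "1 + k * (q * iv k) = k * (1 + q) * iv k" using conj_one_plus[OF k, of q] by (simp add: mult.assoc)
  then show ?thesis using k u
    by (simp add: comm_def D_def iv_mult unit_mult unit_iv iv_iv mult.assoc iv_simps)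
qed

lemma comm_mult_left: assumes "unit g" "unit a" "unit k"
  shows "comm (g * a) k = comm (g * a * iv g) (g * k * iv g) * comm g k"
  using assms by (simp add: comm_def iv_mult unit_mult unit_iv iv_iv mult.assoc iv_simps)

context full_subgroup begin

text \<open>With \<open>q * iv k\<close> and \<open>k\<close> among the elements of finite gauge, \<open>D (t *\<^sub>R q * iv k) k\<close> has weight of order \<open>t\<close>. It is viewed as an infinite product whose first factor is
  the only nontrivial one.\<close>
lemma line_commutators_small:
  fixes q k :: 'a
  assumes k: "unit k"
  shows "\<exists>\<delta>>0. \<forall>t. \<bar>t\<bar> < \<delta> \<longrightarrow> comm (1 + t *\<^sub>R q) k \<in> H"
proof -
  obtain S \<epsilon> where S: "\<forall>s\<in>S. norm s \<le> 1" "\<forall>t\<in>set [q * iv k, k, q]. gauge.fin (WG S) t" "0 < \<epsilon>"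
    and new: "\<And>g l. g 0 = 1 \<Longrightarrow> (\<forall>n::nat. unit (g n)) \<Longrightarrow> (\<forall>n. gauge.W (WG S) (\<epsilon> / 2^n) (iv (g n) * g (Suc n))) \<Longrightarrow> g \<longlonglongrightarrow> l \<Longrightarrow> l \<in> H"
    using small_products_in_subgroup[of "[q * iv k, k, q]"] by auto
  interpret subgroup_gauge "WG S" H by (rule subgroup_gauge_WG[OF S(1)])
  obtain r where r: "0 < r" "q * iv k \<in> WG S r" using S(2) fin_pos[of "q * iv k"] by auto
  obtain s where s: "0 < s" "k \<in> WG S s" using S(2) fin_pos[of k] by auto
  define \<delta> where "\<delta> = min (min (\<epsilon> / (5 * (r * s))) (rho / (r * s))) (1 / (2 * (norm q + 1)))"
  have d0: "0 < \<delta>" unfolding \<delta>_def using r s S(3) rho_pos by (simp add: add_nonneg_pos)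
  have "comm (1 + t *\<^sub>R q) k \<in> H" if t: "\<bar>t\<bar> < \<delta>" for t
  proof -
    have t1: "\<bar>t\<bar> * (r * s) \<le> \<epsilon> / 5" "\<bar>t\<bar> * (r * s) \<le> rho"
      using t r s by (auto simp: \<delta>_def field_simps)
    have "\<bar>t\<bar> * (norm q + 1) \<le> 1/2"
      using t norm_ge_zero[of q] by (auto simp: \<delta>_def field_simps)
    then have "norm (t *\<^sub>R q) \<le> 1/2" using abs_ge_zero[of t] by (simp add: algebra_simps)
    then have u: "unit (1 + t *\<^sub>R q)" by (rule norm_iv)
    define w where "w = comm (1 + t *\<^sub>R q) k"
    have m: "t *\<^sub>R q * iv k \<in> WG S (\<bar>t\<bar> * r)" using G_scale[OF r(2), of t] by simp
    have "W (5 * (\<bar>t\<bar> * r * s)) w" unfolding w_def comm_eq_D[OF k u]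
      by (rule D_W[OF m s(2)]) (use t1(2) in \<open>simp add: mult.assoc\<close>)
    moreover have "5 * (\<bar>t\<bar> * r * s) \<le> \<epsilon>" using t1(1) by (simp add: mult.assoc)
    ultimately have w: "W \<epsilon> w" using W_mono by blast
    then have uw: "unit w" by (rule W_unit)
    show ?thesis unfolding w_def[symmetric]
    proof (rule new[of "\<lambda>n. if n = 0 then 1 else w"])
      show "\<forall>n. unit (if n = 0 then 1 else w)" using uw unit_one by simp
      show "\<forall>n::nat. W (\<epsilon> / 2^n) (iv (if n = 0 then 1 else w) * (if Suc n = 0 then 1 else w))"
        using w uw S(3) by (simp add: iv_one iv_left W_one)
      \<comment> \<open>The sequence is constant from index 1 on.\<close>
      show "(\<lambda>n. if n = 0 then 1 else w) \<longlonglongrightarrow> w"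
        by (rule LIMSEQ_offset[of _ 1]) simp
    qed simp
  qed
  then show ?thesis using d0 by blast
qed

text \<open>As \<open>(g * a, k)\<close> is the product of \<open>(g * a * iv g, g * k * iv g)\<close> and \<open>(g, k)\<close>, membership propagates from \<open>g\<close> to \<open>g * a\<close>.\<close>
lemma H_comm_step:
  assumes a: "comm (g * a * iv g) (g * k * iv g) \<in> H" and u: "unit g" "unit a" "unit k"
  shows "comm g k \<in> H \<longleftrightarrow> comm (g * a) k \<in> H"
proof
  assume "comm g k \<in> H" then show "comm (g * a) k \<in> H" unfolding comm_mult_left[OF u] using a H_mult by blast
next
  assume "comm (g * a) k \<in> H"
  then have "iv (comm (g * a * iv g) (g * k * iv g)) * comm (g * a) k \<in> H" using a by (intro H_mult H_iv)
  moreover have "iv (comm (g * a * iv g) (g * k * iv g)) * comm (g * a) k = comm g k"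
    unfolding comm_mult_left[OF u] by (rule iv_left'[OF H_unit[OF a]])
  ultimately show "comm g k \<in> H" by simp
qed

text \<open>The bound on \<open>t\<close> in the preceding lemma depends on \<open>q\<close> and \<open>k\<close>, so it gives no neighbourhood of \<open>1\<close>. Along the segment from \<open>1\<close> to \<open>1 + q\<close> it shows
  that membership of \<open>(1 + t *\<^sub>R q, k)\<close> is locally constant in \<open>t\<close>, which suffices.\<close>
lemma near_one_commutators:
  fixes q k :: 'a
  assumes q: "norm q < 1" and k: "unit k"
  shows "comm (1 + q) k \<in> H"
proof -
  define g where "g = (\<lambda>t. 1 + t *\<^sub>R q)"
  have ug: "unit (g t)" if "t \<in> {0..1}" for t
  proof -
    have "norm (t *\<^sub>R q) \<le> norm q" using that by (simp add: mult_left_le_one_le)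
    then have "norm (t *\<^sub>R q) < 1" using q by linarith
    then show ?thesis unfolding g_def using neumann[OF order_refl] unitI by metis
  qed
  have "comm (g 0) k \<in> H \<longleftrightarrow> comm (g 1) k \<in> H"
  proof (rule connected_equivalence_relation[of "{0..1::real}" 0 1 "\<lambda>s t. comm (g s) k \<in> H \<longleftrightarrow> comm (g t) k \<in> H"])
    fix t :: real assume t: "t \<in> {0..1}"
    let ?g = "g t"
    obtain \<delta> where d: "0 < \<delta>" "\<And>s. \<bar>s\<bar> < \<delta> \<Longrightarrow> comm (1 + s *\<^sub>R (q * iv ?g)) (?g * k * iv ?g) \<in> H"
      using line_commutators_small[of "?g * k * iv ?g" "q * iv ?g"] ug[OF t] k unit_mult unit_iv by metis
    show "\<exists>T. openin (top_of_set {0..1}) T \<and> t \<in> T \<and> (\<forall>x\<in>T. (comm ?g k \<in> H) = (comm (g x) k \<in> H))"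
    proof (intro exI[of _ "{0..1} \<inter> ball t \<delta>"] conjI ballI)
      show "openin (top_of_set {0..1}) ({0..1} \<inter> ball t \<delta>)" by (rule openin_open_Int) simp
      show "t \<in> {0..1} \<inter> ball t \<delta>" using t d by simp
      fix x assume x: "x \<in> {0..1} \<inter> ball t \<delta>"
      have ugx: "unit (g x)" "unit ?g" using ug x t by auto
      define a where "a = iv ?g * g x"
      have ua: "unit a" unfolding a_def using ugx by (simp add: unit_mult unit_iv)
      have ga: "?g * a = g x" unfolding a_def using ugx by (simp add: iv_simps)
      have "?g * a * iv ?g = 1 + (x - t) *\<^sub>R (q * iv ?g)"
      proof -
        have "g x = ?g + (x - t) *\<^sub>R q" by (simp add: g_def algebra_simps)
        then have "g x * iv ?g = ?g * iv ?g + (x - t) *\<^sub>R (q * iv ?g)" by (simp add: distrib_right)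
        then show ?thesis unfolding ga iv_right[OF ugx(2)] .
      qed
      moreover have "\<bar>x - t\<bar> < \<delta>" using x by (simp add: dist_real_def abs_minus_commute)
      ultimately have "comm (?g * a * iv ?g) (?g * k * iv ?g) \<in> H" using d(2) by simp
      from H_comm_step[OF this ugx(2) ua k] show "(comm ?g k \<in> H) = (comm (g x) k \<in> H)" unfolding ga .
    qed
  qed auto
  moreover have "comm (g 0) k = 1" using k by (simp add: g_def comm_def iv_one iv_simps)
  ultimately show ?thesis using H_one by (simp add: g_def)
qed

text \<open>Now there is a whole neighbourhood of \<open>1\<close>, and membership of \<open>(g, k)\<close> is locally constant in \<open>g\<close>.\<close>
lemma connected_commutators:
  fixes k :: 'a
  assumes C: "connected C" "1 \<in> C" "\<And>x. x \<in> C \<Longrightarrow> unit x" and g: "g \<in> C" and k: "unit k"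
  shows "comm g k \<in> H"
proof -
  have "comm 1 k \<in> H \<longleftrightarrow> comm g k \<in> H"
  proof (rule connected_equivalence_relation[OF C(1,2) g, of "\<lambda>s t. comm s k \<in> H \<longleftrightarrow> comm t k \<in> H"])
    fix x assume x: "x \<in> C"
    have ux: "unit x" by (rule C(3)[OF x])
    show "\<exists>T. openin (top_of_set C) T \<and> x \<in> T \<and> (\<forall>y\<in>T. (comm x k \<in> H) = (comm y k \<in> H))"
    proof (intro exI[of _ "C \<inter> ball x (1 / (norm (iv x) + 1))"] conjI ballI)
      show "openin (top_of_set C) (C \<inter> ball x (1 / (norm (iv x) + 1)))" by (rule openin_open_Int) simp
      have pos: "0 < norm (iv x) + 1" using norm_ge_zero[of "iv x"] by linarith
      then show "x \<in> C \<inter> ball x (1 / (norm (iv x) + 1))" using x by simp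
      fix y assume y: "y \<in> C \<inter> ball x (1 / (norm (iv x) + 1))"
      have uy: "unit y" using C(3) y by blast
      define a where "a = iv x * y"
      have ua: "unit a" unfolding a_def using ux uy by (simp add: unit_mult unit_iv)
      have xa: "x * a = y" unfolding a_def using ux by (simp add: iv_simps)
      have "x * a * iv x = 1 + (y - x) * iv x" unfolding xa using ux by (simp add: left_diff_distrib iv_simps)
      moreover have nl: "norm ((y - x) * iv x) < 1"
      proof -
        have "norm ((y - x) * iv x) \<le> norm (y - x) * norm (iv x)" by (rule norm_mult_ineq)
        also have "\<dots> \<le> norm (y - x) * (norm (iv x) + 1)" by (intro mult_left_mono) auto
        also have "\<dots> < 1" using y pos by (simp add: dist_norm norm_minus_commute field_simps)
        finally show ?thesis .
      qed
      ultimately have "comm (x * a * iv x) (x * k * iv x) \<in> H"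
        using near_one_commutators[OF nl, of "x * k * iv x"] k ux by (simp add: unit_mult unit_iv)
      from H_comm_step[OF this ux ua k] show "(comm x k \<in> H) = (comm y k \<in> H)" unfolding xa .
    qed
  qed auto
  moreover have "comm 1 k = 1" using k by (simp add: comm_def iv_one iv_simps)
  ultimately show ?thesis using H_one by simp
qed

end

section \<open>The Trotter product\<close>

lemma unit_exp: "unit (exp (x::'a::{real_normed_algebra_1,banach}))" and iv_exp: "iv (exp x) = exp (- x)"
proof -
  have "exp x * exp (- x) = 1" "exp (- x) * exp x = 1"
    using exp_minus_inverse[of x] exp_minus_inverse[of "- x"] by simp_all
  then show "unit (exp x)" "iv (exp x) = exp (- x)" by (auto intro: unitI iv_unique)
qed

lemma exp_power_scaleR: "exp (x::'a::{real_normed_algebra_1,banach}) ^ n = exp (real n *\<^sub>R x)"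
proof (induction n)
  case (Suc n)
  have "exp (x + real n *\<^sub>R x) = exp x * exp (real n *\<^sub>R x)" by (rule exp_add_commuting) simp
  then show ?case using Suc by (simp add: scaleR_left_distrib)
qed simp

lemma exp_WG:
  assumes S: "\<forall>s\<in>S. norm s \<le> 1" and a: "(a::'a::{real_normed_algebra_1,banach}) \<in> WG S r"
  shows "exp a - 1 \<in> WG S (exp r - 1)"
proof -
  interpret gauge "WG S" by (rule gauge_WG[OF S])
  have pw: "a ^ n \<in> WG S (r ^ n)" for n by (induction n) (auto intro: G_one G_mult a)
  have t: "a ^ Suc n /\<^sub>R fact (Suc n) \<in> WG S (r ^ Suc n /\<^sub>R fact (Suc n))" for n
    using G_scale[OF pw[of "Suc n"], of "inverse (fact (Suc n))"] by (simp del: power_Suc fact_Suc)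
  have hs: "((\<lambda>n. x ^ Suc n /\<^sub>R fact (Suc n)) has_sum (exp x - 1)) UNIV"
    for x :: "'b::{real_normed_algebra_1,banach}"
  proof (rule norm_summable_imp_has_sum)
    show "summable (\<lambda>n. norm (x ^ Suc n /\<^sub>R fact (Suc n)))"
      using summable_norm_exp[of x] by (subst summable_Suc_iff)
    show "(\<lambda>n. x ^ Suc n /\<^sub>R fact (Suc n)) sums (exp x - 1)"
      using exp_converges[of x] by (subst sums_Suc_iff) simp
  qed
  have "exp a - 1 \<in> WG S (infsum (\<lambda>n. r ^ Suc n /\<^sub>R fact (Suc n)) UNIV)"
    by (rule WG_infsum[OF S t has_sum_imp_summable[OF hs] hs])
  then show ?thesis unfolding infsumI[OF hs] .
qed

context gauge begin

lemma exp_gauge_mult: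
  assumes "x - 1 \<in> G (exp u - 1)" "y - 1 \<in> G (exp v - 1)"
  shows "x * y - 1 \<in> G (exp (u + v) - 1)"
proof -
  have "(x - 1) * (y - 1) + (x - 1) + (y - 1) \<in> G ((exp u - 1) * (exp v - 1) + (exp u - 1) + (exp v - 1))"
    by (intro G_add G_mult assms)
  then show ?thesis by (simp add: algebra_simps exp_add)
qed

lemma exp_gauge_power:
  assumes "x - 1 \<in> G (exp u - 1)" shows "x ^ n - 1 \<in> G (exp (real n * u) - 1)"
proof (induction n)
  case 0 show ?case using G_zero by simp
next
  case (Suc n)
  have "x * x ^ n - 1 \<in> G (exp (u + real n * u) - 1)" by (rule exp_gauge_mult[OF assms Suc.IH])
  then show ?case by (simp add: algebra_simps)
qed

text \<open>\<open>(P * w)^N\<close> is \<open>P^N\<close> times the product of the conjugates of \<open>w\<close> by powers of \<open>P\<close>.\<close>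
lemma W_power_quotient:
  assumes w: "W e w" "4 * e \<le> kap" and P: "unit P" and j: "\<And>j. j < N \<Longrightarrow> P ^ j - 1 \<in> G p" and p: "2 * p \<le> kap"
  shows "unit (P ^ N) \<and> W (2 * real N * e) (iv (P ^ N) * (P * w) ^ N)"
  using j
proof (induction N)
  case 0 show ?case using W_one by (simp add: unit_one iv_one)
next
  case (Suc N)
  then have IH: "unit (P ^ N)" "W (2 * real N * e) (iv (P ^ N) * (P * w) ^ N)" by auto
  have c: "W (2 * e) (iv (P ^ N) * w * P ^ N)" by (rule W_conj'[OF Suc.prems[of N] p w]) simp
  have "iv (P ^ Suc N) * (P * w) ^ Suc N = (iv (P ^ N) * w * P ^ N) * (iv (P ^ N) * (P * w) ^ N)"
    using P IH(1) by (simp add: iv_mult mult.assoc iv_simps)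
  moreover have "W (2 * e + 2 * real N * e) ((iv (P ^ N) * w * P ^ N) * (iv (P ^ N) * (P * w) ^ N))"
    by (rule W_mult[OF IH(2) c])
  ultimately show ?case using P IH(1) by (simp add: unit_mult algebra_simps)
qed

end

lemma power_diff_norm:
  fixes x y :: "'a::real_normed_algebra_1"
  assumes "norm x \<le> m" "norm y \<le> m" "1 \<le> m"
  shows "norm (x ^ N - y ^ N) \<le> real N * m ^ N * norm (x - y)"
proof (induction N)
  case (Suc N)
  have yN: "norm (y ^ N) \<le> m ^ N" using norm_power_ineq[of y N] power_mono[OF assms(2), of N] by simp
  have m0: "0 \<le> m" using assms by simp
  have "x ^ Suc N - y ^ Suc N = x * (x ^ N - y ^ N) + (x - y) * y ^ N" by (simp add: algebra_simps)
  also have "norm \<dots> \<le> norm x * norm (x ^ N - y ^ N) + norm (x - y) * norm (y ^ N)"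
    by (intro norm_triangle_mono norm_mult_ineq)
  also have "\<dots> \<le> m * (real N * m ^ N * norm (x - y)) + norm (x - y) * (m * m ^ N)"
  proof (intro add_mono mult_mono assms Suc.IH)
    have "1 * m ^ N \<le> m * m ^ N" using assms m0 by (intro mult_right_mono) auto
    then show "norm (y ^ N) \<le> m * m ^ N" using yN by simp
  qed (use m0 in auto)
  finally show ?case by (simp add: algebra_simps)
qed simp

text \<open>Both sides are \<open>2^n\<close>-th powers of elements whose difference is \<open>o((1/2)^n)\<close>, because \<open>exp (s *\<^sub>R a) * exp (s *\<^sub>R b)\<close> and \<open>exp (s *\<^sub>R (a + b))\<close> have
  the same derivative at \<open>s = 0\<close>.\<close>
lemma trotter_limit:
  fixes a b :: "'a::{real_normed_algebra_1,banach}"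
  shows "(\<lambda>n. (exp ((1/2)^n *\<^sub>R a) * exp ((1/2)^n *\<^sub>R b)) ^ (2^n)) \<longlonglongrightarrow> exp (a + b)"
proof -
  define F where "F = (\<lambda>s. exp (s *\<^sub>R a) * exp (s *\<^sub>R b) - exp (s *\<^sub>R (a + b)))"
  have "(F has_vector_derivative (exp (0 *\<^sub>R a) * (exp (0 *\<^sub>R b) * b) + (exp (0 *\<^sub>R a) * a) * exp (0 *\<^sub>R b)) - exp (0 *\<^sub>R (a + b)) * (a + b)) (at 0)"
    unfolding F_def
    by (intro has_vector_derivative_diff has_vector_derivative_mult exp_scaleR_has_vector_derivative_right)
  then have "(F has_derivative (\<lambda>x. 0)) (at 0)" by (simp add: has_vector_derivative_def)
  then have "((\<lambda>s. norm (F s - F 0 - 0) / norm (s - 0)) \<longlongrightarrow> 0) (at 0)" unfolding has_derivative_iff_norm by simp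
  then have "(\<lambda>n. norm (F ((1/2)^n)) / (1/2)^n) \<longlonglongrightarrow> 0"
    unfolding tendsto_at_iff_sequentially
    by (elim allE[of _ "\<lambda>n. (1/2)^n"] impE) (auto simp: F_def comp_def intro: LIMSEQ_power_zero)
  then have lim: "(\<lambda>n. exp (norm a + norm b) * (norm (F ((1/2)^n)) / (1/2)^n)) \<longlonglongrightarrow> 0"
    by (rule tendsto_mult_right_zero)
  have "norm ((exp ((1/2)^n *\<^sub>R a) * exp ((1/2)^n *\<^sub>R b)) ^ (2^n) - exp (a + b)) \<le> exp (norm a + norm b) * (norm (F ((1/2)^n)) / (1/2)^n)" for n
  proof -
    let ?s = "(1/2)^n :: real" and ?m = "exp ((1/2)^n * (norm a + norm b))"
    have n1: "norm (exp (?s *\<^sub>R a) * exp (?s *\<^sub>R b)) \<le> ?m"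
    proof -
      have "norm (exp (?s *\<^sub>R a) * exp (?s *\<^sub>R b)) \<le> exp (norm (?s *\<^sub>R a)) * exp (norm (?s *\<^sub>R b))"
        by (intro order_trans[OF norm_mult_ineq] mult_mono norm_exp) auto
      then show ?thesis by (simp add: distrib_left exp_add)
    qed
    have n2: "norm (exp (?s *\<^sub>R (a + b))) \<le> ?m"
    proof -
      have "norm (?s *\<^sub>R (a + b)) \<le> ?s * (norm a + norm b)" using norm_triangle_ineq[of a b] by (simp add: mult_left_mono)
      then show ?thesis using norm_exp[of "?s *\<^sub>R (a + b)"] by (meson exp_le_cancel_iff order_trans)
    qed
    have e: "exp (?s *\<^sub>R (a + b)) ^ (2^n) = exp (a + b)"
    proof -
      have "exp (?s *\<^sub>R (a + b)) ^ (2^n) = exp (real (2^n) *\<^sub>R (?s *\<^sub>R (a + b)))"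
        by (rule exp_power_scaleR)
      then show ?thesis by (simp add: power_divide)
    qed
    have m: "?m ^ (2^n) = exp (norm a + norm b)"
    proof -
      have "?m ^ (2^n) = exp (real (2^n) * (?s * (norm a + norm b)))" using exp_of_nat_mult[of "2^n" "?s * (norm a + norm b)"] by simp
      then show ?thesis by (simp add: power_divide)
    qed
    have "norm ((exp (?s *\<^sub>R a) * exp (?s *\<^sub>R b)) ^ (2^n) - exp (?s *\<^sub>R (a + b)) ^ (2^n)) \<le>
      real (2^n) * ?m ^ (2^n) * norm (exp (?s *\<^sub>R a) * exp (?s *\<^sub>R b) - exp (?s *\<^sub>R (a + b)))"
      by (rule power_diff_norm[OF n1 n2]) simp
    then show ?thesis unfolding e m F_def by (simp add: power_divide mult_ac)
  qed
  then have "(\<lambda>n. (exp ((1/2)^n *\<^sub>R a) * exp ((1/2)^n *\<^sub>R b)) ^ (2^n) - exp (a + b)) \<longlonglongrightarrow> 0"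
    by (intro Lim_null_comparison[OF always_eventually lim] allI)
  then show ?thesis by (rule LIM_zero_cancel)
qed

context full_subgroup begin

text \<open>Let \<open>h n\<close> be the \<open>n\<close>-th dyadic Trotter product. With \<open>A\<close>, \<open>B\<close> the factors at level \<open>n + 1\<close>, the products \<open>h n\<close> and \<open>h (n + 1)\<close> are the \<open>2^n\<close>-th
  powers of \<open>A A B B\<close> and of \<open>A B A B\<close>. These two differ by a conjugate of a commutator of \<open>A\<close> and \<open>B\<close>, of weight of order \<open>4^-n\<close>, so consecutive Trotter products differ by
  weight of order \<open>2^-n\<close> and form a convergent infinite product of commutators.\<close>
lemma small_exp_sum_in_subgroup:
  fixes a b :: 'a
  shows "\<exists>\<delta>>0. \<forall>t. 0 < t \<longrightarrow> t < \<delta> \<longrightarrow> iv (exp (t *\<^sub>R a) * exp (t *\<^sub>R b)) * exp (t *\<^sub>R (a + b)) \<in> H"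
proof -
  obtain S \<epsilon> where S: "\<forall>s\<in>S. norm s \<le> 1" "\<forall>t\<in>set [a, b]. gauge.fin (WG S) t" "0 < \<epsilon>"
    and new: "\<And>g l. g 0 = 1 \<Longrightarrow> (\<forall>n::nat. unit (g n)) \<Longrightarrow> (\<forall>n. gauge.W (WG S) (\<epsilon> / 2^n) (iv (g n) * g (Suc n))) \<Longrightarrow> g \<longlonglongrightarrow> l \<Longrightarrow> l \<in> H"
    using small_products_in_subgroup[of "[a, b]"] by auto
  interpret subgroup_gauge "WG S" H by (rule subgroup_gauge_WG[OF S(1)])
  obtain R where R: "1 \<le> R" "\<forall>x\<in>{a, b}. x \<in> WG S R" using fin_bound[of "{a, b}"] S(2) by auto
  define \<delta> where "\<delta> = min (kap / 8) (\<epsilon> / 4) / R"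
  have d0: "0 < \<delta>" unfolding \<delta>_def using R(1) S(3) kap_pos by simp
  have "iv (exp (t *\<^sub>R a) * exp (t *\<^sub>R b)) * exp (t *\<^sub>R (a + b)) \<in> H" if t: "0 < t" "t < \<delta>" for t
  proof -
    define r where "r = t * R"
    have "t * R < \<delta> * R" using t R by (intro mult_strict_right_mono) auto
    then have r: "0 < r" "8 * r \<le> kap" "4 * r \<le> \<epsilon>" unfolding r_def \<delta>_def using t R by auto
    have r1: "r \<le> 1" using r(2) by (simp add: kap_def)
    have expb: "exp x - 1 \<le> 2 * x" if "0 \<le> x" "x \<le> 1" for x :: real
    proof -
      have "x * x \<le> 1 * x" using that by (intro mult_right_mono) auto
      then show ?thesis using exp_bound[OF that] by (simp add: power2_eq_square)
    qed
    define A where "A = (\<lambda>n. exp (((1/2)^n * t) *\<^sub>R a))"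
    define B where "B = (\<lambda>n. exp (((1/2)^n * t) *\<^sub>R b))"
    have g: "exp (((1/2)^n * s) *\<^sub>R c) - 1 \<in> WG S (exp ((1/2)^n * r) - 1)" if "c \<in> {a, b}" "\<bar>s\<bar> = t" for n s c
    proof -
      have "((1/2)^n * s) *\<^sub>R c \<in> WG S (\<bar>(1/2)^n * s\<bar> * R)" by (rule G_scale) (use R that in blast)
      from exp_WG[OF S(1) this] show ?thesis using that(2) by (simp add: abs_mult r_def mult.assoc)
    qed
    have sq: "A n = A (Suc n) * A (Suc n)" "B n = B (Suc n) * B (Suc n)" for n
    proof -
      have e: "exp (x *\<^sub>R c) = exp ((x / 2) *\<^sub>R c) * exp ((x / 2) *\<^sub>R c)" for x :: real and c :: 'a
        using exp_add_commuting[of "(x / 2) *\<^sub>R c" "(x / 2) *\<^sub>R c"] by (simp flip: scaleR_add_left)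
      show "A n = A (Suc n) * A (Suc n)" "B n = B (Suc n) * B (Suc n)"
        using e[of "(1/2)^n * t"] unfolding A_def B_def by simp_all
    qed
    have uA: "unit (A n)" "unit (B n)" for n unfolding A_def B_def by (rule unit_exp)+
    define w where "w = (\<lambda>n. iv (B n) * (iv (B n) * iv (A n) * B n * A n) * B n)"
    have step: "A (Suc n) * B (Suc n) * (A (Suc n) * B (Suc n)) = A n * B n * w (Suc n)" for n
      unfolding sq[of n] w_def using uA[of "Suc n"] by (simp add: mult.assoc iv_simps)
    have small: "exp ((1/2)^n * r) - 1 \<le> 2 * ((1/2)^n * r)" "2 * ((1/2)^n * r) \<le> kap / 4" for n
    proof -
      have le: "(1/2)^n * r \<le> 1 * r" using r by (intro mult_right_mono) (auto simp: power_le_one)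
      have "0 \<le> (1/2)^n * r" using r by simp
      then show "exp ((1/2)^n * r) - 1 \<le> 2 * ((1/2)^n * r)" by (rule expb) (use le r1 in linarith)
      show "2 * ((1/2)^n * r) \<le> kap / 4" using le r by linarith
    qed
    have Ww: "W (8 * ((1/2)^n * r) * ((1/2)^n * r)) (w n)" for n
    proof -
      let ?x = "(1/2)^n * r"
      have Am: "iv (A n) - 1 \<in> WG S (2 * ?x)" "iv (B n) - 1 \<in> WG S (2 * ?x)"
        using g[of a "- t" n] g[of b "- t" n] t G_mono[OF _ small(1)] by (auto simp: A_def B_def iv_exp)
      have Bp: "B n - 1 \<in> WG S (2 * ?x)" using g[of b t n] t G_mono[OF _ small(1)] by (auto simp: B_def)
      have x4: "2 * ?x \<le> kap / 4" by (rule small(2))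
      have "W (2 * ?x * (2 * ?x)) (K (iv (B n) - 1) (iv (A n) - 1))"
        by (rule W_K[OF Am(2,1)]) (use x4 kap_pos in auto)
      then have k: "W (2 * ?x * (2 * ?x)) (iv (B n) * iv (A n) * B n * A n)"
        using uA[of n] by (simp add: K_def iv_iv)
      have "(2 * ?x) * (2 * ?x) \<le> (kap / 4) * 1" using x4 r(1) by (intro mult_mono) (auto simp: kap_def)
      then have "4 * (2 * ?x * (2 * ?x)) \<le> kap" by linarith
      from W_conj'[OF Bp _ k this] x4 kap_pos show ?thesis unfolding w_def by (simp add: mult_ac)
    qed
    define h where "h = (\<lambda>n. (A n * B n) ^ (2^n))"
    have q: "unit (h n) \<and> W (\<epsilon> / 2^n) (iv (h n) * h (Suc n))" for n
    proof -
      let ?x = "(1/2)^Suc n * r"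
      have AB: "A n * B n - 1 \<in> WG S (exp ((1/2)^n * r + (1/2)^n * r) - 1)"
        unfolding A_def B_def using t by (intro exp_gauge_mult g) auto
      have Pj: "(A n * B n) ^ j - 1 \<in> WG S (4 * r)" if "j < 2^n" for j
      proof -
        have "real j \<le> 2^n" using that by (metis less_imp_le of_nat_le_iff of_nat_numeral of_nat_power)
        then have "real j * ((1/2)^n * r + (1/2)^n * r) \<le> 2^n * ((1/2)^n * r + (1/2)^n * r)"
          using r by (intro mult_right_mono) auto
        also have "\<dots> = 2 * r" by (simp add: power_divide)
        finally have "exp (real j * ((1/2)^n * r + (1/2)^n * r)) - 1 \<le> exp (2 * r) - 1" by simp
        also have "\<dots> \<le> 4 * r" using expb[of "2 * r"] r by (simp add: kap_def)
        finally show ?thesis using G_mono[OF exp_gauge_power[OF AB, of j]] by blast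
      qed
      have xr: "8 * ?x * ?x = 2 * ((1/2)^n * (1/2)^n) * (r * r)" by (simp add: algebra_simps)
      have e4: "4 * (8 * ?x * ?x) \<le> kap"
      proof -
        have "(2 * ?x) * (2 * ?x) \<le> (kap / 4) * (1/8)" using small(2)[of "Suc n"] r(1) by (intro mult_mono) (auto simp: kap_def)
        moreover have "4 * (8 * x * x) \<le> kap" if "(2 * x) * (2 * x) \<le> (kap / 4) * (1/8)" for x
          using that kap_pos by linarith
        ultimately show ?thesis by blast
      qed
      have *: "unit ((A n * B n) ^ (2^n)) \<and> W (2 * real (2^n) * (8 * ?x * ?x)) (iv ((A n * B n) ^ (2^n)) * (A n * B n * w (Suc n)) ^ (2^n))"
        by (rule W_power_quotient[OF Ww e4 unit_mult[OF uA] Pj]) (use r in auto)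
      have "2 * real (2^n) * (8 * ?x * ?x) = 4 * (r * r) / 2^n" unfolding xr by (simp add: power_divide)
      also have "\<dots> \<le> \<epsilon> / 2^n"
      proof -
        have "r * r \<le> 1 * r" using r r1 by (intro mult_right_mono) auto
        then have "4 * (r * r) \<le> \<epsilon>" using r by linarith
        then show ?thesis by (intro divide_right_mono) auto
      qed
      finally have "W (\<epsilon> / 2^n) (iv ((A n * B n) ^ (2^n)) * (A n * B n * w (Suc n)) ^ (2^n))" using * W_mono by blast
      moreover have "(A n * B n * w (Suc n)) ^ (2^n) = h (Suc n)"
        unfolding h_def step[symmetric] by (simp add: power_mult power2_eq_square flip: power_mult)
          (simp add: power_mult power2_eq_square)
      ultimately show ?thesis using * unfolding h_def by simp
    qed
    have lim: "h \<longlonglongrightarrow> exp (t *\<^sub>R a + t *\<^sub>R b)"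
      using trotter_limit[of "t *\<^sub>R a" "t *\<^sub>R b"] unfolding h_def A_def B_def by simp
    have "iv (h 0) * exp (t *\<^sub>R a + t *\<^sub>R b) \<in> H"
    proof (rule new[of "\<lambda>n. iv (h 0) * h n"])
      show "iv (h 0) * h 0 = 1" using q by (simp add: iv_left)
      show "\<forall>n. unit (iv (h 0) * h n)" using q by (simp add: unit_mult unit_iv)
      show "\<forall>n. W (\<epsilon> / 2^n) (iv (iv (h 0) * h n) * (iv (h 0) * h (Suc n)))"
      proof
        fix n
        have "iv (iv (h 0) * h n) * (iv (h 0) * h (Suc n)) = iv (h n) * h (Suc n)"
          using q[of 0] q[of n] by (simp add: iv_mult unit_iv iv_iv mult.assoc iv_simps)
        then show "W (\<epsilon> / 2^n) (iv (iv (h 0) * h n) * (iv (h 0) * h (Suc n)))" using q[of n] by simp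
      qed
      show "(\<lambda>n. iv (h 0) * h n) \<longlonglongrightarrow> iv (h 0) * exp (t *\<^sub>R a + t *\<^sub>R b)" by (intro tendsto_intros lim)
    qed
    then show ?thesis by (simp add: h_def A_def B_def scaleR_add_right)
  qed
  then show ?thesis using d0 by blast
qed

end

section \<open>Exponentials\<close>

lemma exp_conj: fixes u x :: "'a::{real_normed_algebra_1,banach}"
  assumes u: "unit u" shows "exp (u * x * iv u) = u * exp x * iv u"
proof -
  have p: "(u * x * iv u) ^ n = u * x ^ n * iv u" for n
    by (induction n) (use u in \<open>simp_all add: iv_simps mult.assoc\<close>)
  have "(\<lambda>n. u * (x ^ n /\<^sub>R fact n) * iv u) sums (u * exp x * iv u)"
    by (intro sums_mult sums_mult2 exp_converges)
  then have "(\<lambda>n. (u * x * iv u) ^ n /\<^sub>R fact n) sums (u * exp x * iv u)" by (simp add: p)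
  then show ?thesis using exp_converges sums_unique2 by blast
qed

text \<open>The power series of the remainder starts at order two, and the difference of the \<open>n\<close>-th powers is estimated by telescoping.\<close>
lemma exp_remainder_lipschitz:
  fixes b c :: "'a::{real_normed_algebra_1,banach}"
  assumes b: "norm b \<le> 1/4" and c: "norm c \<le> 1/4"
  shows "norm ((exp b - 1 - b) - (exp c - 1 - c)) \<le> 1/2 * norm (b - c)"
proof -
  have pd: "norm (b ^ n - c ^ n) \<le> real n * (1/4) ^ (n - 1) * norm (b - c)" for n
  proof (induction n)
    case (Suc n)
    have "norm (b ^ Suc n - c ^ Suc n) = norm (b * (b ^ n - c ^ n) + (b - c) * c ^ n)" by (simp add: algebra_simps)
    also have "\<dots> \<le> norm b * norm (b ^ n - c ^ n) + norm (b - c) * norm (c ^ n)"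
      by (intro norm_triangle_mono norm_mult_ineq)
    also have "\<dots> \<le> (1/4) * (real n * (1/4) ^ (n - 1) * norm (b - c)) + norm (b - c) * (1/4) ^ n"
      using norm_power_ineq[of c n] power_mono[OF c, of n] by (intro add_mono mult_mono b Suc.IH) auto
    also have "\<dots> = real (Suc n) * (1/4) ^ (Suc n - 1) * norm (b - c)"
      by (cases n) (auto simp: algebra_simps)
    finally show ?case .
  qed simp
  let ?f = "\<lambda>n. b ^ Suc (Suc n) /\<^sub>R fact (Suc (Suc n)) - c ^ Suc (Suc n) /\<^sub>R fact (Suc (Suc n))"
  have s: "(\<lambda>n. x ^ Suc (Suc n) /\<^sub>R fact (Suc (Suc n))) sums (exp x - 1 - x)" for x :: "'a"
  proof -
    have "(\<lambda>n. x ^ Suc n /\<^sub>R fact (Suc n)) sums (exp x - 1)"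
      using exp_converges[of x] by (subst sums_Suc_iff) simp
    then show ?thesis by (subst sums_Suc_iff) simp
  qed
  have fs: "?f sums ((exp b - 1 - b) - (exp c - 1 - c))" by (intro sums_diff s)
  have le: "norm (?f n) \<le> (1/4) ^ Suc n * norm (b - c)" for n
  proof -
    let ?m = "Suc (Suc n)"
    have "?f n = (b ^ ?m - c ^ ?m) /\<^sub>R fact ?m" by (simp only: scaleR_diff_right)
    then have "norm (?f n) = norm (b ^ ?m - c ^ ?m) / fact ?m" by (simp add: divide_inverse_commute del: fact_Suc power_Suc)
    also have "\<dots> \<le> (real ?m * (1/4) ^ (?m - 1) * norm (b - c)) / fact ?m" by (intro divide_right_mono pd) simp
    also have "\<dots> \<le> (fact ?m * (1/4) ^ (?m - 1) * norm (b - c)) / fact ?m"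
    proof (intro divide_right_mono mult_right_mono)
      have "real ?m \<le> real (fact ?m)" by (simp only: of_nat_le_iff fact_ge_self)
      then show "real ?m \<le> fact ?m" by (simp del: fact_Suc)
    qed auto
    also have "\<dots> = (1/4) ^ Suc n * norm (b - c)" by (simp del: fact_Suc)
    finally show ?thesis .
  qed
  have gs: "(\<lambda>n. (1/4) ^ Suc n * norm (b - c)) sums (1/3 * norm (b - c))"
    using sums_mult2[OF sums_mult[OF geometric_sums[of "1/4::real"], of "1/4"], of "norm (b - c)"] by simp
  have "norm (suminf ?f) \<le> 1/3 * norm (b - c)"
    using norm_suminf_le[OF le sums_summable[OF gs]] unfolding sums_unique[OF gs, symmetric] .
  then have "norm ((exp b - 1 - b) - (exp c - 1 - c)) \<le> 1/3 * norm (b - c)" unfolding sums_unique[OF fs, symmetric] .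
  then show ?thesis using norm_ge_zero[of "b - c"] by linarith
qed

text \<open>\<open>b\<close> is the fixed point of the contraction \<open>b \<mapsto> x - (exp b - 1 - b)\<close>.\<close>
lemma near_one_exp:
  fixes x :: "'a::{real_normed_algebra_1,banach}"
  assumes x: "norm x \<le> 1/8" obtains b where "exp b = 1 + x"
proof -
  let ?f = "\<lambda>b. x - (exp b - 1 - b)"
  have "\<exists>!b. b \<in> cball 0 (1/4) \<and> ?f b = b"
  proof (rule Banach_fix)
    show "complete (cball (0::'a) (1/4))" by (simp add: complete_eq_closed)
    show "cball (0::'a) (1/4) \<noteq> {}" by simp
    show "0 \<le> (1/2::real)" "(1/2::real) < 1" by auto
    show "?f ` cball 0 (1/4) \<subseteq> cball 0 (1/4)"
    proof
      fix y assume "y \<in> ?f ` cball 0 (1/4)"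
      then obtain b where b: "norm b \<le> 1/4" "y = ?f b" by auto
      have "norm (exp b - 1 - b) \<le> 1/2 * norm b" using exp_remainder_lipschitz[OF b(1), of 0] by simp
      then have "norm y \<le> 1/8 + 1/2 * (1/4)" unfolding b(2) using x b(1) norm_triangle_ineq4[of x "exp b - 1 - b"] by linarith
      then show "y \<in> cball 0 (1/4)" by simp
    qed
    show "dist (?f b) (?f c) \<le> 1/2 * dist b c" if "b \<in> cball 0 (1/4)" "c \<in> cball 0 (1/4)" for b c
    proof -
      have "dist (?f b) (?f c) = norm ((exp b - 1 - b) - (exp c - 1 - c))"
        unfolding dist_norm by (subst norm_minus_commute) (simp add: algebra_simps)
      then show ?thesis using exp_remainder_lipschitz[of b c] that by (simp add: dist_norm)
    qed
  qed
  then obtain b where "?f b = b" by blast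
  then have "exp b = 1 + x" by (simp add: algebra_simps)
  then show ?thesis using that by blast
qed

text \<open>The set of products of exponentials is stable under passing to nearby units, by \<open>near_one_exp\<close>.\<close>
lemma connected_products_of_exponentials:
  fixes C :: "'a::{real_normed_algebra_1,banach} set"
  assumes C: "connected C" "1 \<in> C" "\<And>x. x \<in> C \<Longrightarrow> unit x" and g: "g \<in> C"
  shows "\<exists>bs. g = prod_list (map exp bs)"
proof -
  let ?P = "\<lambda>g. \<exists>bs :: 'a list. g = prod_list (map exp bs)"
  have ext: "?P (x * exp b)" if P: "?P x" for x b
  proof -
    obtain bs where "x = prod_list (map exp bs)" using P by (rule exE)
    then have "x * exp b = prod_list (map exp (bs @ [b]))" by simp
    then show ?thesis by blast
  qed
  have "?P 1 \<longleftrightarrow> ?P g"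
  proof (rule connected_equivalence_relation[OF C(1,2) g, of "\<lambda>s t. ?P s \<longleftrightarrow> ?P t"])
    fix x assume x: "x \<in> C"
    have ux: "unit x" by (rule C(3)[OF x])
    have pos: "0 < norm (iv x) + 1" using norm_ge_zero[of "iv x"] by linarith
    show "\<exists>T. openin (top_of_set C) T \<and> x \<in> T \<and> (\<forall>y\<in>T. ?P x \<longleftrightarrow> ?P y)"
    proof (intro exI[of _ "C \<inter> ball x (1/8 / (norm (iv x) + 1))"] conjI ballI)
      show "openin (top_of_set C) (C \<inter> ball x (1/8 / (norm (iv x) + 1)))" by (rule openin_open_Int) simp
      show "x \<in> C \<inter> ball x (1/8 / (norm (iv x) + 1))" using x pos by simp
      fix y assume y: "y \<in> C \<inter> ball x (1/8 / (norm (iv x) + 1))"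
      have "norm (iv x * (y - x)) \<le> norm (iv x) * norm (y - x)" by (rule norm_mult_ineq)
      also have "\<dots> \<le> (norm (iv x) + 1) * norm (y - x)" by (intro mult_right_mono) auto
      also have "\<dots> \<le> 1/8" using y pos by (simp add: dist_norm norm_minus_commute field_simps)
      finally obtain b where b: "exp b = 1 + iv x * (y - x)" using near_one_exp by blast
      have y: "y = x * exp b" unfolding b using ux by (simp add: right_diff_distrib distrib_left iv_simps)
      then have "x = y * exp (- b)" using iv_right'[OF unit_exp, of b] by (simp add: mult.assoc iv_right[OF unit_exp] flip: iv_exp)
      then show "?P x \<longleftrightarrow> ?P y" using ext y by metis
    qed
  qed auto
  moreover have "?P 1" by (rule exI[of _ "[]"]) simp
  ultimately show ?thesis by blast
qed

abbreviation unit_component :: "'a::{real_normed_algebra_1,banach} set" where "unit_component \<equiv> connected_component_set (Collect unit) 1"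

lemma unit_component: "connected unit_component" "1 \<in> unit_component" "x \<in> unit_component \<Longrightarrow> unit x"
  using connected_component_subset[of "Collect unit" 1] by (auto simp: connected_component_refl unit_one)

lemma path_in_unit_component: fixes f :: "real \<Rightarrow> 'a::{real_normed_algebra_1,banach}"
  assumes "continuous_on {0..1} f" "\<And>t. t \<in> {0..1} \<Longrightarrow> unit (f t)" "f 0 = 1"
  shows "f 1 \<in> unit_component"
proof -
  have "connected (f ` {0..1})" by (intro connected_continuous_image assms) simp
  moreover have "1 \<in> f ` {0..1}" using assms(3) by force
  ultimately have "f ` {0..1} \<subseteq> unit_component" using assms(2) by (intro connected_component_maximal) auto
  then show ?thesis by (rule subsetD) (rule imageI, simp)
qed

lemma exp_unit_component: "exp x \<in> unit_component"
proof -
  have "exp (1 *\<^sub>R x) \<in> unit_component"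
  proof (rule path_in_unit_component[of "\<lambda>t. exp (t *\<^sub>R x)"])
    show "continuous_on {0..1} (\<lambda>t. exp (t *\<^sub>R x))"
      unfolding continuous_on_eq_continuous_within
      by (intro ballI has_vector_derivative_continuous[OF exp_scaleR_has_vector_derivative_right])
  qed (simp_all add: unit_exp)
  then show ?thesis by simp
qed

lemma one_plus_unit_component: assumes "norm x < 1" shows "1 + x \<in> unit_component"
proof -
  have "1 + 1 *\<^sub>R x \<in> unit_component"
  proof (rule path_in_unit_component[of "\<lambda>t. 1 + t *\<^sub>R x"])
    fix t :: real assume "t \<in> {0..1}"
    then have "norm (t *\<^sub>R x) \<le> norm x" by (simp add: mult_left_le_one_le)
    then have "norm (t *\<^sub>R x) < 1" using assms by linarith
    then show "unit (1 + t *\<^sub>R x)" using neumann[OF order_refl] unitI by metis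
  qed (auto intro!: continuous_intros)
  then show ?thesis by simp
qed

context full_subgroup begin

lemma comm_in_H: "g \<in> unit_component \<Longrightarrow> unit k \<Longrightarrow> comm g k \<in> H"
  by (rule connected_commutators[OF unit_component])

lemma H_left_cancel: assumes c: "c \<in> H" shows "c * v \<in> H \<longleftrightarrow> v \<in> H"
proof
  assume "c * v \<in> H"
  then have "iv c * (c * v) \<in> H" by (rule H_mult[OF H_iv[OF c]])
  then show "v \<in> H" using iv_left'[OF H_unit[OF c]] by simp
qed (rule H_mult[OF c])

lemma H_normal: assumes "g \<in> unit_component" "h \<in> H" shows "g * h * iv g \<in> H"
proof -
  have "comm g h * h = g * h * iv g" unfolding comm_def using H_unit[OF assms(2)] by (simp add: mult.assoc iv_simps)
  then show ?thesis using H_mult[OF comm_in_H[OF assms(1) H_unit[OF assms(2)]] assms(2)] by simp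
qed

text \<open>The quotient by \<open>H\<close> is commutative.\<close>
lemma H_swap:
  assumes x: "x \<in> unit_component" and y: "y \<in> unit_component" and z: "unit z"
  shows "x * y * z * w \<in> H \<longleftrightarrow> x * z * y * w \<in> H"
proof -
  have c: "x * comm y z * iv x \<in> H" by (rule H_normal[OF x comm_in_H[OF y z]])
  have "x * y * z * w = (x * comm y z * iv x) * (x * z * y * w)"
    unfolding comm_def using unit_component(3)[OF x] unit_component(3)[OF y] z by (simp add: mult.assoc iv_simps)
  then show ?thesis using H_left_cancel[OF c] by simp
qed

text \<open>For small multiples this is \<open>small_exp_sum_in_subgroup\<close>; since the quotient by \<open>H\<close> is commutative, powers of the relation can be collected.\<close>
lemma exp_sum_in_H: "exp a * exp b * exp (- (a + b)) \<in> H"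
proof -
  obtain \<delta> where d: "0 < \<delta>" "\<And>t. 0 < t \<Longrightarrow> t < \<delta> \<Longrightarrow> iv (exp (t *\<^sub>R a) * exp (t *\<^sub>R b)) * exp (t *\<^sub>R (a + b)) \<in> H"
    using small_exp_sum_in_subgroup by metis
  obtain n where n: "inverse (real (Suc n)) < \<delta>" using reals_Archimedean[OF d(1)] by blast
  define t where "t = inverse (real (Suc n))"
  define a' b' where "a' = t *\<^sub>R a" "b' = t *\<^sub>R b"
  have "iv (exp a' * exp b') * exp (a' + b') \<in> H"
    using d(2)[of t] n by (simp add: a'_b'_def t_def scaleR_add_right)
  then have "iv (iv (exp a' * exp b') * exp (a' + b')) \<in> H" by (rule H_iv)
  then have "exp (a' + b') * iv (iv (exp a' * exp b') * exp (a' + b')) * iv (exp (a' + b')) \<in> H" by (rule H_normal[OF exp_unit_component])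
  moreover have "z * iv (iv (x * y) * z) * iv z = x * y * iv z" if "unit x" "unit y" "unit z" for x y z :: 'a
    using that by (simp add: iv_mult unit_mult unit_iv iv_iv mult.assoc iv_simps)
  ultimately have u: "exp a' * exp b' * exp (- (a' + b')) \<in> H"
    unfolding iv_exp[of "a' + b'", symmetric] by (metis unit_exp)
  have "exp (real m *\<^sub>R a') * exp (real m *\<^sub>R b') * exp (- (real m *\<^sub>R (a' + b'))) \<in> H" for m
  proof (induction m)
    case 0 show ?case by (simp add: H_one)
  next
    case (Suc m)
    have e: "exp (real (Suc m) *\<^sub>R c) = exp (real m *\<^sub>R c) * exp c" for c :: 'a
      using exp_add_commuting[of "real m *\<^sub>R c" c] by (simp add: scaleR_left_distrib add.commute)
    have e': "exp (- (real (Suc m) *\<^sub>R c)) = exp (- c) * exp (- (real m *\<^sub>R c))" for c :: 'a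
      using exp_add_commuting[of "- c" "- (real m *\<^sub>R c)"] by (simp add: scaleR_left_distrib)
    let ?X = "exp (real m *\<^sub>R a')" and ?Y = "exp (real m *\<^sub>R b')" and ?Z = "exp (- (real m *\<^sub>R (a' + b')))"
    let ?u = "exp a' * exp b' * exp (- (a' + b'))"
    have "?X * (?Y * ?u * iv ?Y) * iv ?X \<in> H" by (intro H_normal exp_unit_component u)
    then have "(?X * (?Y * ?u * iv ?Y) * iv ?X) * (?X * ?Y * ?Z) \<in> H" by (rule H_mult[OF _ Suc.IH])
    then have "?X * ?Y * exp a' * (exp b' * exp (- (a' + b')) * ?Z) \<in> H"
      by (simp add: mult.assoc iv_simps unit_exp)
    then have "?X * exp a' * ?Y * (exp b' * exp (- (a' + b')) * ?Z) \<in> H"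
      using H_swap[OF exp_unit_component exp_unit_component unit_exp] by blast
    then show ?case unfolding e e' by (simp add: mult.assoc)
  qed
  from this[of "Suc n"] show ?thesis
    by (simp add: a'_b'_def t_def flip: scaleR_add_right)
qed

lemma exp_exp_in_H_iff: "exp a * exp b * g \<in> H \<longleftrightarrow> exp (a + b) * g \<in> H"
proof -
  have "exp a * exp b * g = (exp a * exp b * exp (- (a + b))) * (exp (a + b) * g)"
    using iv_left'[OF unit_exp[of "a + b"], of g] unfolding iv_exp by (simp add: mult.assoc)
  then show ?thesis using H_left_cancel[OF exp_sum_in_H] by metis
qed

text \<open>Modulo \<open>H\<close> a product of exponentials depends only on the sum of the exponents.\<close>
lemma exp_prod_in_H_iff: "prod_list (map exp bs) \<in> H \<longleftrightarrow> exp (sum_list bs) \<in> H"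
proof -
  have "exp x * prod_list (map exp bs) \<in> H \<longleftrightarrow> exp (x + sum_list bs) \<in> H" for x
  proof (induction bs arbitrary: x)
    case (Cons b bs)
    have "exp x * prod_list (map exp (b # bs)) = exp x * exp b * prod_list (map exp bs)" by (simp add: mult.assoc)
    then show ?case using exp_exp_in_H_iff Cons.IH[of "x + b"] by (simp add: add.assoc)
  qed simp
  from this[of 0] show ?thesis by simp
qed

text \<open>After rescaling, \<open>u = 1 + q\<close> is a unit near \<open>1\<close> with \<open>[a, b] = [u, c]\<close>. As \<open>u * c\<close> is the conjugate of \<open>c * u\<close> by \<open>u\<close>, the element
  \<open>exp (u * c) * exp (- (c * u))\<close> is the commutator of \<open>u\<close> and \<open>exp (c * u)\<close>.\<close>
lemma exp_bracket_in_H: "exp (a * b - b * a) \<in> H"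
proof -
  define l where "l = norm a + 1"
  have l: "0 < l" unfolding l_def using norm_ge_zero[of a] by linarith
  \<comment> \<open>The scalar l makes the norm of q smaller than 1, and is compensated in c.\<close>
  define q c where "q = inverse l *\<^sub>R a" and "c = l *\<^sub>R b"
  have "norm q = norm a / l" unfolding q_def using l by (simp add: divide_inverse_commute)
  also have "\<dots> < 1" using l by (simp add: l_def)
  finally have q: "norm q < 1" .
  define u where "u = 1 + q"
  have uu: "unit u" unfolding u_def by (rule unit_component(3)[OF one_plus_unit_component[OF q]])
  have "u * (c * u) * iv u = u * c" using uu by (simp add: mult.assoc iv_simps)
  then have "exp (u * c) = u * exp (c * u) * iv u" using exp_conj[OF uu, of "c * u"] by simp
  then have "exp (u * c) * exp (- (c * u)) * 1 = comm u (exp (c * u))" by (simp add: comm_def iv_exp)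
  then have "exp (u * c) * exp (- (c * u)) * 1 \<in> H" using near_one_commutators[OF q unit_exp] unfolding u_def by metis
  then have "exp (u * c + - (c * u)) * 1 \<in> H" unfolding exp_exp_in_H_iff .
  moreover have "u * c + - (c * u) = a * b - b * a" using l by (simp add: u_def q_def c_def algebra_simps)
  ultimately show ?thesis by simp
qed

end

section \<open>The unit group of a C*-algebra\<close>

lemma carrier_unit_group: "carrier unit_group = Collect unit"
  and mult_unit_group: "mult unit_group = (*)" and one_unit_group: "one unit_group = 1"
  by (auto simp: unit_group_def units_of_def Units_def unit_def)

lemma group_unit_group: "group (unit_group :: 'a::unital_cstar_algebra monoid)"
proof -
  have "monoid \<lparr>carrier = UNIV, mult = (*), one = 1 :: 'a\<rparr>" by unfold_locales (auto simp: mult.assoc)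
  then show ?thesis unfolding unit_group_def by (rule monoid.units_group)
qed

lemma inv_unit_group: "unit k \<Longrightarrow> inv\<^bsub>unit_group\<^esub> k = iv k"
  by (rule group.inv_equality[OF group_unit_group])
     (simp_all add: carrier_unit_group mult_unit_group one_unit_group iv_left unit_iv)

lemma identity_component_eq: "identity_component = unit_component"
  by (simp add: identity_component_def carrier_unit_group)

lemma comm_in_derived: assumes "g \<in> unit_component" "k \<in> unit_component"
  shows "g * k * iv g * iv k \<in> derived unit_group identity_component"
proof -
  have "g * k * iv g * iv k \<in> derived_set unit_group identity_component"
    unfolding identity_component_eq mult_unit_group
    by (rule UN_I[OF assms(1)], rule UN_I[OF assms(2)]) (simp only: inv_unit_group unit_component(3) assms singleton_iff)
  then show ?thesis unfolding derived_def by (rule generate.incl)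
qed

text \<open>For the norm gauge, elements of finite weight are products of commutators of elements near \<open>1\<close>.\<close>
lemma W_in_derived: assumes "gauge.W norm_gauge e (g :: 'a::unital_cstar_algebra)"
  shows "g \<in> derived unit_group identity_component"
proof -
  interpret gauge "norm_gauge :: real \<Rightarrow> 'a set" by (rule gauge_norm_balls)
  from assms show ?thesis
  proof (induction rule: W.induct)
    case (W_one e) show ?case using generate.one[of unit_group] unfolding derived_def one_unit_group .
  next
    case (W_step e g P p Q q)
    have "norm P < 1" "norm Q < 1" using W_step.hyps by (auto simp: norm_gauge_def kap_def)
    then have "K P Q \<in> derived unit_group identity_component" unfolding K_def by (intro comm_in_derived one_plus_unit_component)
    then show ?case using W_step.IH generate.eng[of g unit_group _ "K P Q"] unfolding derived_def mult_unit_group by blast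
  qed
qed

lemma D_in_derived: assumes "norm s * norm b \<le> rho" shows "D s b \<in> derived unit_group identity_component"
  by (rule W_in_derived, rule gauge.D_W[OF gauge_norm_balls _ _ assms]) (simp_all add: norm_gauge_def)

text \<open>Complex scalars act through multiplication by \<open>scaleC c 1\<close>, so every ideal of the ring is a complex subspace.\<close>
lemma maximal_ideal_closed:
  assumes "is_maximal_ideal (M :: 'a::unital_cstar_algebra set)" shows "closed_two_sided_ideal M"
proof -
  interpret maximal_ideal M by (rule maximal_ideal.intro[OF assms])
  have "scaleC c x \<in> M" if "x \<in> M" for c x using M_left[OF that, of "scaleC c 1"] by (simp add: mult_scaleC_left)
  then show ?thesis unfolding closed_two_sided_ideal_def cvs.subspace_def
    using M_closed M_zero M_add M_left M_right by blast
qed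

theorem theorem1p2:
  fixes H :: "'a::unital_cstar_algebra set"
  assumes "subgroup H unit_group"
    and "H \<subseteq> identity_component"
    and "normalized_by H (derived unit_group identity_component)"
    and "closed_two_sided_ideal hull (commutator_span H UNIV) = UNIV"
  shows "derived unit_group identity_component \<subseteq> H \<and>
    (\<exists>L :: 'a set. add_subgroup L \<and> commutator_span UNIV UNIV \<subseteq> L \<and>
      H = {prod_list (map exp bs) | bs :: 'a list. sum_list bs \<in> L})"
proof -
  interpret full_subgroup H
  proof
    show u: "h \<in> H \<Longrightarrow> unit h" for h using subgroup.subset[OF assms(1)] by (auto simp: carrier_unit_group)
    show "1 \<in> H" using subgroup.one_closed[OF assms(1)] by (simp add: one_unit_group)
    show "h * k \<in> H" if "h \<in> H" "k \<in> H" for h k using subgroup.m_closed[OF assms(1) that] by (simp add: mult_unit_group)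
    show "iv h \<in> H" if "h \<in> H" for h using subgroup.m_inv_closed[OF assms(1) that] by (simp add: inv_unit_group u[OF that])
    show "D s b * h * iv (D s b) \<in> H" if h: "h \<in> H" and n: "norm s * norm b \<le> rho" for h s b
    proof -
      have u: "unit (D s b)" by (rule unit_D_small) (use n in \<open>simp add: rho_def\<close>)
      have "(\<lambda>h. D s b * h * inv\<^bsub>unit_group\<^esub> (D s b)) ` H = H"
        using assms(3) D_in_derived[OF n] unfolding normalized_by_def by blast
      then show ?thesis using h unfolding inv_unit_group[OF u] by blast
    qed
    show "\<exists>h\<in>H. \<exists>a. h * a - a * h \<notin> M" if M: "is_maximal_ideal M" for M
    proof (rule ccontr)
      assume "\<not> ?thesis"
      then have "{x * y - y * x | x y. x \<in> H \<and> y \<in> UNIV} \<subseteq> M" by auto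
      moreover have id: "closed_two_sided_ideal M" by (rule maximal_ideal_closed[OF M])
      ultimately have "commutator_span H UNIV \<subseteq> M"
        unfolding commutator_span_def closed_two_sided_ideal_def by (intro cvs.span_minimal) auto
      then have "closed_two_sided_ideal hull (commutator_span H UNIV) \<subseteq> M" using id by (rule hull_minimal)
      then have "1 \<in> M" using assms(4) by auto
      then show False using M unfolding is_maximal_ideal_def by simp
    qed
  qed
  have GH: "derived unit_group identity_component \<subseteq> H"
    unfolding derived_def
  proof (rule group.generate_subgroup_incl[OF group_unit_group _ assms(1)])
    show "derived_set unit_group identity_component \<subseteq> H"
      unfolding identity_component_eq mult_unit_group
      by (intro UN_least) (simp only: inv_unit_group unit_component(3) comm_in_H insert_subset empty_subsetI simp_thms flip: comm_def)
  qed
  define L where "L = {c. exp c \<in> H}"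
  have add: "x + y \<in> L" if "x \<in> L" "y \<in> L" for x y
    using H_mult[of "exp x" "exp y"] exp_exp_in_H_iff[of x y 1] that by (simp add: L_def)
  have neg: "- x \<in> L" if "x \<in> L" for x using H_iv[of "exp x"] that by (simp add: L_def iv_exp)
  have L: "add_subgroup L" unfolding add_subgroup_def using add neg H_one by (auto simp: L_def)
  have "commutator_span UNIV UNIV \<subseteq> L"
  proof
    fix z :: 'a assume "z \<in> commutator_span UNIV UNIV"
    then show "z \<in> L" unfolding commutator_span_def
    proof (induction rule: cvs.span_induct_alt)
      case base show ?case using H_one by (simp add: L_def)
    next
      case (step c x y)
      then obtain a b where "x = a * b - b * a" by blast
      then have "scaleC c x = scaleC c a * b - b * scaleC c a"
        by (simp add: mult_scaleC_left mult_scaleC_right cvs.scale_right_diff_distrib)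
      then have "scaleC c x \<in> L" using exp_bracket_in_H by (simp add: L_def)
      then show ?case using add step by blast
    qed
  qed
  moreover have "H = {prod_list (map exp bs) | bs :: 'a list. sum_list bs \<in> L}"
  proof (intro equalityI subsetI)
    fix h assume h: "h \<in> H"
    then have "h \<in> unit_component" using assms(2) unfolding identity_component_eq by blast
    then obtain bs where bs: "h = prod_list (map exp bs)" using connected_products_of_exponentials[OF unit_component] by blast
    then show "h \<in> {prod_list (map exp bs) | bs :: 'a list. sum_list bs \<in> L}" using h exp_prod_in_H_iff[of bs] by (auto simp: L_def)
  next
    fix h assume "h \<in> {prod_list (map exp bs) | bs :: 'a list. sum_list bs \<in> L}"
    then show "h \<in> H" using exp_prod_in_H_iff by (auto simp: L_def)
  qed
  ultimately show ?thesis using GH L by blast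
qed

end
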